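(* Let $X(t)=\mathcal{S}(t)X_0+\int_0^t\mathcal{S}(t-s)\mathcal{Y}^{1/2}(s)\,dB(s)$, $t\ge 0$, and for fixed $\Delta t>0$ define the adjusted return $R(t,\Delta t)=X(t+\Delta t)-\mathcal{S}(\Delta t)X(t)$. Let $\mathcal{F}^{\mathcal{Y}}$ be the $\sigma$-algebra generated by the paths of $\mathcal{Y}$. Then $R(t,\Delta t)\,|\,\mathcal{F}^{\mathcal{Y}}$ (that is, $R(t,\Delta t)$ conditioned on $\mathcal{F}^{\mathcal{Y}}$) is a mean zero $H$-valued Gaussian random variable, with covariance operator $$ \mathcal{Q}_{R(t,\Delta t)|\mathcal{Y}}:=\int_t^{t+\Delta t}\mathcal{S}(t+\Delta t-s)\mathcal{Y}^{1/2}(s)\mathcal{Q}\mathcal{Y}^{1/2}(s)\mathcal{S}^*(t+\Delta t-s)\,ds. $$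
   Context: $H$ is a separable Hilbert space with inner product $(\cdot,\cdot)_H$, and $\mathcal{H}=L_{\mathrm{HS}}(H)$ is the Hilbert space of Hilbert-Schmidt operators on $H$. $\mathcal{H}_+$ is the convex cone of non-negative definite operators in $\mathcal{H}$. Volatility: $\mathbb{C}\in L(\mathcal{H})$ is a bounded linear operator on $\mathcal{H}$ and $\mathbb{S}(t)=\exp(t\mathbb{C})$. It is assumed that $(\mathbb{C}\mathcal{T})^*=\mathbb{C}\mathcal{T}^*$ for every $\mathcal{T}\in\mathcal{H}$ and that $\mathbb{C}(\mathcal{H}_+)\subset\mathcal{H}_+$ (or that $\mathbb{S}(t)(\mathcal{H}_+)\subset\mathcal{H}_+$ for all $t\ge0$). $\mathcal{L}$ is a square-integrable $\mathcal{H}$-valued Lévy process with non-decreasing paths, meaning that $\mathcal{L}(t)$ is self-adjoint and $t\mapsto(\mathcal{L}(t)f,f)_H$ is non-decreasing in $t\ge 0$ for every $f\in H$, a.s. $\mathcal{Y}_0\in\mathcal{H}$ is self-adjoint and non-negative definite, and $\mathcal{Y}(t)=\mathbb{S}(t)\mathcal{Y}_0+\int_0^t\mathbb{S}(t-s)\,d\mathcal{L}(s)$ is the mild solution of $d\mathcal{Y}(t)=\mathbb{C}\mathcal{Y}(t)\,dt+d\mathcal{L}(t)$, $\mathcal{Y}(0)=\mathcal{Y}_0$; it is self-adjoint and non-negative definite, and $\mathcal{Y}^{1/2}(t)$ is its square root. Process $X$: $B$ is an $H$-valued Wiener process with covariance operator $\mathcal{Q}$ (self-adjoint, non-negative definite,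 trace class on $H$). $\mathcal{A}$ is a densely defined, possibly unbounded, linear operator on $H$ generating a $C_0$-semigroup $\mathcal{S}$ on $H$, with adjoint $\mathcal{S}^*$; $X_0\in H$. The process $X$ is the mild solution of $dX(t)=\mathcal{A}X(t)\,dt+\mathcal{Y}^{1/2}(t)\,dB(t)$, $X(0)=X_0$. *)

theory Defs
  imports "HOL-Probability.Probability"
begin

section \<open>Orthonormal bases of separable Hilbert spaces\<close>

text \<open>A separable real Hilbert space is a type of sort
  \<open>{real_inner, banach, second_countable_topology}\<close>.\<close>

definition is_onb :: "'a::real_inner set \<Rightarrow> bool" where
  "is_onb E \<longleftrightarrow> countable E \<and> pairwise orthogonal E \<and> (\<forall>e\<in>E. norm e = 1) \<and> closure (span E) = UNIV"

text \<open>Gram-Schmidt without normalisation; linearly dependent entries give \<open>0\<close>.\<close>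

function gso :: "(nat \<Rightarrow> 'a::real_inner) \<Rightarrow> nat \<Rightarrow> 'a" where
  "gso d n = d n - (\<Sum>i\<in>{..<n}. ((d n \<bullet> gso d i) / (gso d i \<bullet> gso d i)) *\<^sub>R gso d i)"
  by pat_completeness auto
termination by (relation "inv_image less_than snd") auto

declare gso.simps [simp del]

lemma gso_orthogonal_less: "j < n \<Longrightarrow> gso d n \<bullet> gso d j = 0"
proof (induction n arbitrary: j rule: less_induct)
  case (less n)
  have orth: "gso d i \<bullet> gso d j = 0" if "i < n" "i \<noteq> j" for i
    using that less.IH[of i j] less.IH[of j i] less.prems
    by (cases "i < j") (auto simp: inner_commute[of "gso d i" "gso d j"])
  have "gso d n \<bullet> gso d j = d n \<bullet> gso d j
      - (\<Sum>i\<in>{..<n}. ((d n \<bullet> gso d i) / (gso d i \<bullet> gso d i)) * (gso d i \<bullet> gso d j))"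
    by (subst gso.simps) (simp add: inner_diff_left inner_sum_left)
  also have "(\<Sum>i\<in>{..<n}. ((d n \<bullet> gso d i) / (gso d i \<bullet> gso d i)) * (gso d i \<bullet> gso d j))
      = (\<Sum>i\<in>{j}. ((d n \<bullet> gso d i) / (gso d i \<bullet> gso d i)) * (gso d i \<bullet> gso d j))"
    using less.prems orth by (intro sum.mono_neutral_right) auto
  also have "\<dots> = d n \<bullet> gso d j" by (cases "gso d j = 0") auto
  finally show ?case by simp
qed

lemma is_onb_exists: "\<exists>E::'a::{real_inner,second_countable_topology} set. is_onb E"
proof -
  obtain D :: "'a set" where D: "countable D" "\<And>X. open X \<Longrightarrow> X \<noteq> {} \<Longrightarrow> \<exists>d\<in>D. d \<in> X"
    using countable_dense_setE by blast
  have "D \<noteq> {}" using D(2)[of UNIV] by auto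
  define d where "d = from_nat_into D"
  have rd: "range d = D" unfolding d_def using range_from_nat_into[OF \<open>D \<noteq> {}\<close> D(1)] .
  define E where "E = (\<lambda>n. gso d n /\<^sub>R norm (gso d n)) ` {n. gso d n \<noteq> 0}"
  have gE: "gso d n \<in> span E" for n
  proof (cases "gso d n = 0")
    case False
    then have "gso d n /\<^sub>R norm (gso d n) \<in> span E" by (auto simp: E_def intro!: span_base)
    from span_scale[OF this, of "norm (gso d n)"] False show ?thesis by simp
  qed (simp add: span_zero)
  have "d n \<in> span E" for n
  proof -
    have "d n = gso d n + (\<Sum>i\<in>{..<n}. ((d n \<bullet> gso d i) / (gso d i \<bullet> gso d i)) *\<^sub>R gso d i)"
      by (subst (1) gso.simps) simp
    moreover have "\<dots> \<in> span E" by (intro span_add span_sum span_scale gE)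
    ultimately show ?thesis by simp
  qed
  then have "D \<subseteq> span E" using rd by auto
  moreover have "closure D = UNIV"
  proof -
    have "- closure D = {}"
      using D(2)[of "- closure D"] closure_subset[of D] by (auto simp: open_Compl)
    then show ?thesis by blast
  qed
  ultimately have "closure (span E) = UNIV" using closure_mono by blast
  moreover have "gso d m \<bullet> gso d n = 0" if "m \<noteq> n" for m n
    using gso_orthogonal_less[of m n d] gso_orthogonal_less[of n m d] that
    by (cases "m < n") (auto simp: inner_commute[of "gso d m" "gso d n"])
  then have "pairwise orthogonal E"
    unfolding E_def by (intro pairwise_imageI) (auto simp: orthogonal_def)
  ultimately have "is_onb E" unfolding is_onb_def by (auto simp: E_def)
  then show ?thesis ..
qed

text \<open>Hilbert-Schmidt norms and inner products do not depend on the orthonormal basis, so an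
  arbitrary one is fixed.\<close>

definition hilbert_basis :: "'a::{real_inner,second_countable_topology} set" where
  "hilbert_basis = (SOME E. is_onb E)"

lemma is_onb_hilbert_basis: "is_onb hilbert_basis"
  unfolding hilbert_basis_def using is_onb_exists by (rule someI_ex)

lemma norm_hilbert_basis: "e \<in> hilbert_basis \<Longrightarrow> norm e = 1"
  and inner_hilbert_basis: "e \<in> hilbert_basis \<Longrightarrow> f \<in> hilbert_basis \<Longrightarrow> e \<noteq> f \<Longrightarrow> e \<bullet> f = 0"
  and countable_hilbert_basis: "countable hilbert_basis"
  using is_onb_hilbert_basis unfolding is_onb_def pairwise_def orthogonal_def by auto

section \<open>Bounded operators on Hilbert spaces\<close>

text \<open>On Hilbert spaces \<^const>\<open>adjoint\<close> of a bounded operator is again bounded, and a self-adjoint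
  non-negative definite operator has exactly one root as in \<open>sqrt_op\<close>.\<close>

definition adj_op :: "('a::real_inner \<Rightarrow>\<^sub>L 'b::real_inner) \<Rightarrow> ('b \<Rightarrow>\<^sub>L 'a)" where
  "adj_op A = Blinfun (adjoint (blinfun_apply A))"

definition self_adjoint :: "('a::real_inner \<Rightarrow>\<^sub>L 'a) \<Rightarrow> bool" where
  "self_adjoint A \<longleftrightarrow> (\<forall>x y. A x \<bullet> y = x \<bullet> A y)"

definition nonneg_definite :: "('a::real_inner \<Rightarrow>\<^sub>L 'a) \<Rightarrow> bool" where
  "nonneg_definite A \<longleftrightarrow> (\<forall>x. 0 \<le> A x \<bullet> x)"

definition trace_class_nonneg :: "('a::{real_inner,second_countable_topology} \<Rightarrow>\<^sub>L 'a) \<Rightarrow> bool" where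
  "trace_class_nonneg A \<longleftrightarrow> self_adjoint A \<and> nonneg_definite A \<and>
     (\<lambda>e. A e \<bullet> e) summable_on hilbert_basis"

definition sqrt_op :: "('a::real_inner \<Rightarrow>\<^sub>L 'a) \<Rightarrow> ('a \<Rightarrow>\<^sub>L 'a)" where
  "sqrt_op A = (THE R. self_adjoint R \<and> nonneg_definite R \<and> R o\<^sub>L R = A)"

definition exp_op :: "('a::real_normed_vector \<Rightarrow>\<^sub>L 'a) \<Rightarrow> ('a \<Rightarrow>\<^sub>L 'a)" where
  "exp_op A = (\<Sum>n. (((o\<^sub>L) A ^^ n) id_blinfun) /\<^sub>R fact n)"

definition hs_norm_sq :: "('a::{real_inner,second_countable_topology} \<Rightarrow>\<^sub>L 'b::real_inner) \<Rightarrow> ennreal" where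
  "hs_norm_sq A = (\<Sum>\<^sub>\<infinity>e\<in>hilbert_basis. ennreal ((norm (A e))\<^sup>2))"

section \<open>The Hilbert space of Hilbert-Schmidt operators\<close>

definition hilbert_schmidt :: "('a::{real_inner,second_countable_topology} \<Rightarrow>\<^sub>L 'b::real_inner) \<Rightarrow> bool" where
  "hilbert_schmidt A \<longleftrightarrow> (\<lambda>e. (norm (A e))\<^sup>2) summable_on hilbert_basis"

lemma hilbert_schmidt_zero: "hilbert_schmidt 0"
  by (simp add: hilbert_schmidt_def)

lemma hilbert_schmidt_add:
  assumes "hilbert_schmidt A" "hilbert_schmidt B" shows "hilbert_schmidt (A + B)"
  unfolding hilbert_schmidt_def
proof (rule summable_on_comparison_test)
  show "(\<lambda>e. 2 * (norm (A e))\<^sup>2 + 2 * (norm (B e))\<^sup>2) summable_on hilbert_basis"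
    using assms unfolding hilbert_schmidt_def
    by (intro summable_on_add summable_on_cmult_right)
  fix e :: 'a
  have "(norm (A e + B e))\<^sup>2 \<le> (norm (A e) + norm (B e))\<^sup>2"
    by (intro power_mono norm_triangle_ineq) auto
  also have "\<dots> \<le> 2 * (norm (A e))\<^sup>2 + 2 * (norm (B e))\<^sup>2"
    using sum_squares_bound[of "norm (A e)" "norm (B e)"] by (simp add: power2_sum)
  finally show "(norm ((A + B) e))\<^sup>2 \<le> 2 * (norm (A e))\<^sup>2 + 2 * (norm (B e))\<^sup>2"
    by (simp add: blinfun.bilinear_simps)
qed auto

lemma hilbert_schmidt_scaleR:
  assumes "hilbert_schmidt A" shows "hilbert_schmidt (c *\<^sub>R A)"
  using assms unfolding hilbert_schmidt_def
  by (auto simp: blinfun.bilinear_simps power_mult_distrib intro!: summable_on_cmult_right)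

lemma hilbert_schmidt_uminus: "hilbert_schmidt A \<Longrightarrow> hilbert_schmidt (- A)"
  using hilbert_schmidt_scaleR[of A "-1"] by simp

lemma hilbert_schmidt_diff:
  "hilbert_schmidt A \<Longrightarrow> hilbert_schmidt B \<Longrightarrow> hilbert_schmidt (A - B)"
  using hilbert_schmidt_add[of A "-B"] hilbert_schmidt_uminus[of B] by simp

lemma hilbert_schmidt_inner_summable:
  assumes "hilbert_schmidt A" "hilbert_schmidt B"
  shows "(\<lambda>e. A e \<bullet> B e) summable_on hilbert_basis"
proof (rule abs_summable_summable, rule summable_on_comparison_test)
  show "(\<lambda>e. (norm (A e))\<^sup>2 + (norm (B e))\<^sup>2) summable_on hilbert_basis"
    using assms unfolding hilbert_schmidt_def by (intro summable_on_add)
  fix e :: 'a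
  have "\<bar>A e \<bullet> B e\<bar> \<le> norm (A e) * norm (B e)" by (rule Cauchy_Schwarz_ineq2)
  also have "\<dots> \<le> (norm (A e))\<^sup>2 + (norm (B e))\<^sup>2"
    using sum_squares_bound[of "norm (A e)" "norm (B e)"]
      mult_nonneg_nonneg[OF norm_ge_zero[of "A e"] norm_ge_zero[of "B e"]]
    by linarith
  finally show "norm (A e \<bullet> B e) \<le> (norm (A e))\<^sup>2 + (norm (B e))\<^sup>2" by simp
qed auto

lemma norm_hilbert_schmidt_bound:
  fixes A :: "'a::{real_inner,second_countable_topology} \<Rightarrow>\<^sub>L 'b::real_inner"
  assumes "hilbert_schmidt A"
  shows "norm A \<le> sqrt (\<Sum>\<^sub>\<infinity>e\<in>hilbert_basis. (norm (A e))\<^sup>2)" (is "_ \<le> ?K")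
proof (rule norm_blinfun_bound)
  show "0 \<le> ?K" by (simp add: infsum_nonneg)
  fix x :: 'a
  have "span hilbert_basis \<subseteq> {x. norm (A x) \<le> ?K * norm x}"
  proof
    fix x :: 'a assume "x \<in> span hilbert_basis"
    then obtain F u where F: "finite F" "F \<subseteq> hilbert_basis" and x: "x = (\<Sum>e\<in>F. u e *\<^sub>R e)"
      unfolding span_explicit by auto
    have "x \<bullet> x = (\<Sum>e\<in>F. \<Sum>f\<in>F. u e * u f * (f \<bullet> e))"
      unfolding x by (simp add: inner_sum_left inner_sum_right sum_distrib_left mult.assoc)
    also have "\<dots> = (\<Sum>e\<in>F. (u e)\<^sup>2)"
    proof (rule sum.cong[OF refl])
      fix e assume e: "e \<in> F"
      have "(\<Sum>f\<in>F. u e * u f * (f \<bullet> e)) = (\<Sum>f\<in>{e}. u e * u f * (f \<bullet> e))"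
        using e F inner_hilbert_basis by (intro sum.mono_neutral_right) auto
      also have "\<dots> = (u e)\<^sup>2"
        using e F norm_hilbert_basis[of e] by (auto simp: dot_square_norm power2_eq_square)
      finally show "(\<Sum>f\<in>F. u e * u f * (f \<bullet> e)) = (u e)\<^sup>2" .
    qed
    finally have nx: "norm x = L2_set u F" by (simp add: norm_eq_sqrt_inner L2_set_def)
    have "norm (A x) \<le> (\<Sum>e\<in>F. \<bar>u e\<bar> * \<bar>norm (A e)\<bar>)"
      unfolding x by (auto simp: blinfun.sum_right blinfun.scaleR_right intro!: sum_norm_le)
    also have "\<dots> \<le> L2_set u F * L2_set (\<lambda>e. norm (A e)) F"
      by (rule L2_set_mult_ineq)
    also have "\<dots> \<le> L2_set u F * ?K"
    proof (intro mult_left_mono)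
      show "L2_set (\<lambda>e. norm (A e)) F \<le> ?K"
        unfolding L2_set_def using assms F unfolding hilbert_schmidt_def
        by (auto intro!: finite_sum_le_infsum)
    qed auto
    finally show "x \<in> {x. norm (A x) \<le> ?K * norm x}" using nx by (simp add: mult.commute)
  qed
  then have "closure (span hilbert_basis) \<subseteq> {x. norm (A x) \<le> ?K * norm x}"
    by (rule closure_minimal) (intro closed_Collect_le continuous_intros)
  then show "norm (A x) \<le> ?K * norm x"
    using is_onb_hilbert_basis unfolding is_onb_def by auto
qed

typedef (overloaded) 'a hs_op =
  "{A :: 'a::{real_inner,banach,second_countable_topology} \<Rightarrow>\<^sub>L 'a. hilbert_schmidt A}"
  morphisms op_of_hs hs_of_op
  using hilbert_schmidt_zero by blast

setup_lifting type_definition_hs_op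

instantiation hs_op :: ("{real_inner,banach,second_countable_topology}") real_vector
begin

lift_definition zero_hs_op :: "'a hs_op" is 0 by (rule hilbert_schmidt_zero)
lift_definition plus_hs_op :: "'a hs_op \<Rightarrow> 'a hs_op \<Rightarrow> 'a hs_op" is "(+)" by (rule hilbert_schmidt_add)
lift_definition minus_hs_op :: "'a hs_op \<Rightarrow> 'a hs_op \<Rightarrow> 'a hs_op" is "(-)" by (rule hilbert_schmidt_diff)
lift_definition uminus_hs_op :: "'a hs_op \<Rightarrow> 'a hs_op" is uminus by (rule hilbert_schmidt_uminus)
lift_definition scaleR_hs_op :: "real \<Rightarrow> 'a hs_op \<Rightarrow> 'a hs_op" is scaleR by (rule hilbert_schmidt_scaleR)

instance
  by standard (transfer; simp add: algebra_simps)+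

end

instantiation hs_op :: ("{real_inner,banach,second_countable_topology}") real_inner
begin

lift_definition inner_hs_op :: "'a hs_op \<Rightarrow> 'a hs_op \<Rightarrow> real"
  is "\<lambda>(A :: 'a \<Rightarrow>\<^sub>L 'a) (B :: 'a \<Rightarrow>\<^sub>L 'a). \<Sum>\<^sub>\<infinity>e\<in>hilbert_basis. A e \<bullet> B e" .

definition norm_hs_op :: "'a hs_op \<Rightarrow> real" where "norm_hs_op A = sqrt (A \<bullet> A)"
definition dist_hs_op :: "'a hs_op \<Rightarrow> 'a hs_op \<Rightarrow> real" where "dist_hs_op A B = norm (A - B)"
definition sgn_hs_op :: "'a hs_op \<Rightarrow> 'a hs_op" where "sgn_hs_op A = A /\<^sub>R norm A"
definition uniformity_hs_op :: "('a hs_op \<times> 'a hs_op) filter" where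
  "uniformity_hs_op = (INF e\<in>{0<..}. principal {(x, y). dist x y < e})"
definition open_hs_op :: "'a hs_op set \<Rightarrow> bool" where
  "open_hs_op U \<longleftrightarrow> (\<forall>x\<in>U. \<forall>\<^sub>F (x', y) in uniformity. x' = x \<longrightarrow> y \<in> U)"

instance
proof
  fix A B C :: "'a hs_op" and r :: real
  show "A \<bullet> B = B \<bullet> A" by transfer (simp add: inner_commute)
  show "(A + B) \<bullet> C = A \<bullet> C + B \<bullet> C"
    by transfer (simp add: blinfun.bilinear_simps inner_add_left infsum_add
        hilbert_schmidt_inner_summable)
  show "r *\<^sub>R A \<bullet> B = r * (A \<bullet> B)"
    by transfer (simp add: blinfun.bilinear_simps infsum_cmult_right')
  show "0 \<le> A \<bullet> A" by transfer (simp add: infsum_nonneg)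
  show "A \<bullet> A = 0 \<longleftrightarrow> A = 0"
  proof transfer
    fix A :: "'a \<Rightarrow>\<^sub>L 'a" assume "hilbert_schmidt A"
    from norm_hilbert_schmidt_bound[OF this]
    show "((\<Sum>\<^sub>\<infinity>e\<in>hilbert_basis. A e \<bullet> A e) = 0) = (A = 0)"
      by (auto simp: dot_square_norm)
  qed
qed (fact norm_hs_op_def dist_hs_op_def sgn_hs_op_def uniformity_hs_op_def open_hs_op_def)+

end

lemma hilbert_schmidt_op_of_hs: "hilbert_schmidt (op_of_hs A)"
  using op_of_hs by auto

lemma norm_hs_op_eq: "norm A = sqrt (\<Sum>\<^sub>\<infinity>e\<in>hilbert_basis. (norm (op_of_hs A e))\<^sup>2)"
  unfolding norm_hs_op_def by transfer (simp add: dot_square_norm)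

lemma norm_op_of_hs_le: "norm (op_of_hs A) \<le> norm A"
  unfolding norm_hs_op_eq by (rule norm_hilbert_schmidt_bound[OF hilbert_schmidt_op_of_hs])

instance hs_op :: ("{real_inner,banach,second_countable_topology}") banach
proof
  fix X :: "nat \<Rightarrow> 'a hs_op" assume X: "Cauchy X"
  define Y where "Y = (\<lambda>n. op_of_hs (X n))"
  have dY: "norm (Y m - Y n) \<le> norm (X m - X n)" for m n
    using norm_op_of_hs_le[of "X m - X n"] by (simp add: Y_def minus_hs_op.rep_eq)
  have "Cauchy Y"
    using X dY unfolding Cauchy_def dist_norm by (meson le_less_trans)
  then obtain A where A: "Y \<longlonglongrightarrow> A" using Cauchy_convergent_iff convergent_def by blast
  have fin: "(\<Sum>e\<in>F. (norm ((Y n - A) e))\<^sup>2) \<le> \<epsilon>\<^sup>2"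
    if N: "\<And>m. m \<ge> N \<Longrightarrow> norm (X n - X m) \<le> \<epsilon>" and F: "finite F" "F \<subseteq> hilbert_basis" for F n N \<epsilon>
  proof (rule tendsto_upperbound)
    show "(\<lambda>m. \<Sum>e\<in>F. (norm ((Y n - Y m) e))\<^sup>2) \<longlonglongrightarrow> (\<Sum>e\<in>F. (norm ((Y n - A) e))\<^sup>2)"
      by (intro tendsto_intros A)
    show "\<forall>\<^sub>F m in sequentially. (\<Sum>e\<in>F. (norm ((Y n - Y m) e))\<^sup>2) \<le> \<epsilon>\<^sup>2"
      using eventually_ge_at_top[of N]
    proof eventually_elim
      case (elim m)
      have "(\<Sum>e\<in>F. (norm ((Y n - Y m) e))\<^sup>2) \<le> (\<Sum>\<^sub>\<infinity>e\<in>hilbert_basis. (norm (op_of_hs (X n - X m) e))\<^sup>2)"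
        using F hilbert_schmidt_op_of_hs[of "X n - X m"]
        by (auto simp: Y_def minus_hs_op.rep_eq hilbert_schmidt_def intro!: finite_sum_le_infsum)
      also have "\<dots> = (norm (X n - X m))\<^sup>2"
        by (simp add: norm_hs_op_eq infsum_nonneg)
      also have "\<dots> \<le> \<epsilon>\<^sup>2" using N[OF elim] by (intro power_mono) auto
      finally show ?case .
    qed
  qed simp
  have HS: "hilbert_schmidt (Y n - A)" if "\<And>m. m \<ge> N \<Longrightarrow> norm (X n - X m) \<le> \<epsilon>" for n N \<epsilon>
    unfolding hilbert_schmidt_def using fin[OF that]
    by (intro nonneg_bdd_above_summable_on) (auto intro!: bdd_aboveI2)
  obtain N0 where N0: "\<And>m n. m \<ge> N0 \<Longrightarrow> n \<ge> N0 \<Longrightarrow> norm (X m - X n) < 1"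
    using X[unfolded Cauchy_def dist_norm] by (metis zero_less_one)
  have "hilbert_schmidt (Y N0 - A)"
    by (rule HS[of N0 _ 1]) (simp add: N0 less_imp_le)
  moreover have "hilbert_schmidt (Y N0)" by (simp add: Y_def hilbert_schmidt_op_of_hs)
  ultimately have "hilbert_schmidt (Y N0 - (Y N0 - A))" by (rule hilbert_schmidt_diff[rotated])
  then have A_HS: "hilbert_schmidt A" by simp
  have "X \<longlonglongrightarrow> hs_of_op A"
  proof (rule LIMSEQ_I)
    fix r :: real assume "r > 0"
    then obtain N where N: "\<And>m n. m \<ge> N \<Longrightarrow> n \<ge> N \<Longrightarrow> norm (X m - X n) < r/2"
      using X[unfolded Cauchy_def dist_norm] by (metis half_gt_zero)
    have "norm (X n - hs_of_op A) < r" if n: "n \<ge> N" for n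
    proof -
      have b: "\<And>m. m \<ge> N \<Longrightarrow> norm (X n - X m) \<le> r/2" using N n by (simp add: less_imp_le)
      have "(\<Sum>\<^sub>\<infinity>e\<in>hilbert_basis. (norm ((Y n - A) e))\<^sup>2) \<le> (r/2)\<^sup>2"
        using HS[OF b] fin[OF b] unfolding hilbert_schmidt_def by (intro infsum_le_finite_sums) auto
      then have "sqrt (\<Sum>\<^sub>\<infinity>e\<in>hilbert_basis. (norm ((Y n - A) e))\<^sup>2) \<le> r/2"
        using \<open>r > 0\<close> by (intro real_le_lsqrt) (auto simp: infsum_nonneg)
      then have "norm (X n - hs_of_op A) \<le> r/2"
        by (simp add: norm_hs_op_eq minus_hs_op.rep_eq Y_def hs_of_op_inverse A_HS)
      then show ?thesis using \<open>r > 0\<close> by simp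
    qed
    then show "\<exists>N. \<forall>n\<ge>N. norm (X n - hs_of_op A) < r" by blast
  qed
  then show "convergent X" by (auto simp: convergent_def)
qed

lift_definition rank1_hs :: "'a::{real_inner,banach,second_countable_topology} \<Rightarrow> 'a \<Rightarrow> 'a hs_op"
  is "\<lambda>y e. if e \<in> hilbert_basis then blinfun_scaleR_left y o\<^sub>L blinfun_inner_left e else 0"
proof -
  fix y e :: 'a
  have *: "hilbert_schmidt (blinfun_scaleR_left y o\<^sub>L blinfun_inner_left e)" if e: "e \<in> hilbert_basis"
  proof -
    have "(norm ((blinfun_scaleR_left y o\<^sub>L blinfun_inner_left e) f))\<^sup>2 = 0"
      if "f \<in> hilbert_basis - {e}" for f
      using that e inner_hilbert_basis[of f e] by (auto simp: inner_commute)
    then show ?thesis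
      unfolding hilbert_schmidt_def
      using e by (subst summable_on_cong_neutral[where T = "{e}"]) auto
  qed
  show "hilbert_schmidt (if e \<in> hilbert_basis then blinfun_scaleR_left y o\<^sub>L blinfun_inner_left e else 0)"
    using * by (simp add: hilbert_schmidt_zero)
qed

lemma rank1_hs_apply:
  assumes "e \<in> hilbert_basis" "f \<in> hilbert_basis"
  shows "op_of_hs (rank1_hs y e) f = (if f = e then y else 0)"
  using assms inner_hilbert_basis[of e f] norm_hilbert_basis[of e]
  by (auto simp: rank1_hs.rep_eq dot_square_norm inner_commute)

lemma op_of_hs_sum: "op_of_hs (sum f F) = (\<Sum>x\<in>F. op_of_hs (f x))"
  by (induction F rule: infinite_finite_induct) (auto simp: zero_hs_op.rep_eq plus_hs_op.rep_eq)

lemma hs_op_separable: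
  "\<exists>D :: 'a::{real_inner,banach,second_countable_topology} hs_op set.
     countable D \<and> (\<forall>A. \<forall>r>0. \<exists>d\<in>D. norm (A - d) < r)"
proof -
  obtain D' :: "'a set" where D': "countable D'" "\<And>X. open X \<Longrightarrow> X \<noteq> {} \<Longrightarrow> \<exists>d\<in>D'. d \<in> X"
    using countable_dense_setE by blast
  define D :: "'a hs_op set" where
    "D = (\<lambda>xs. \<Sum>(y, e)\<leftarrow>xs. rank1_hs y e) ` lists (D' \<times> hilbert_basis)"
  have "countable D"
    unfolding D_def using D'(1) countable_hilbert_basis by blast
  moreover have "\<exists>d\<in>D. norm (A - d) < r" if "r > 0" for A :: "'a hs_op" and r :: real
  proof -
    let ?f = "\<lambda>e. (norm (op_of_hs A e))\<^sup>2"
    have sA: "?f summable_on hilbert_basis"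
      using hilbert_schmidt_op_of_hs[of A] by (simp add: hilbert_schmidt_def)
    obtain F where F: "finite F" "F \<subseteq> hilbert_basis"
      and dF: "dist (sum ?f F) (infsum ?f hilbert_basis) \<le> r\<^sup>2 / 4"
      using infsum_finite_approximation[OF sA, of "r\<^sup>2 / 4"] \<open>r > 0\<close> by auto
    define \<delta> where "\<delta> = r / (2 * sqrt (real (card F) + 1))"
    have "\<delta> > 0" using \<open>r > 0\<close> by (simp add: \<delta>_def add_nonneg_pos)
    have "\<exists>y\<in>D'. norm (op_of_hs A e - y) < \<delta>" for e
      using D'(2)[of "ball (op_of_hs A e) \<delta>"] \<open>\<delta> > 0\<close> by (auto simp: dist_norm)
    then obtain y where y: "\<And>e. y e \<in> D'" "\<And>e. norm (op_of_hs A e - y e) < \<delta>" by metis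
    obtain es where es: "set es = F" "distinct es" using F(1) finite_distinct_list by blast
    define d where "d = (\<Sum>e\<in>F. rank1_hs (y e) e)"
    have "d = (\<Sum>(y, e)\<leftarrow>map (\<lambda>e. (y e, e)) es. rank1_hs y e)"
      unfolding d_def using es by (simp add: sum_list_distinct_conv_sum_set o_def)
    moreover have "map (\<lambda>e. (y e, e)) es \<in> lists (D' \<times> hilbert_basis)"
      using y F es by auto
    ultimately have "d \<in> D" unfolding D_def by blast
    have dap: "op_of_hs d f = (if f \<in> F then y f else 0)" if "f \<in> hilbert_basis" for f
    proof -
      have "op_of_hs d f = (\<Sum>e\<in>F. op_of_hs (rank1_hs (y e) e) f)"
        by (simp add: d_def op_of_hs_sum blinfun.sum_left)
      also have "\<dots> = (\<Sum>e\<in>F. if f = e then y e else 0)"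
        using F(2) that by (intro sum.cong refl rank1_hs_apply) auto
      also have "\<dots> = (if f \<in> F then y f else 0)"
        using F(1) by (simp add: sum.delta')
      finally show ?thesis .
    qed
    let ?g = "\<lambda>e. (norm (op_of_hs (A - d) e))\<^sup>2"
    have sg: "?g summable_on hilbert_basis"
      using hilbert_schmidt_op_of_hs[of "A - d"] by (simp add: hilbert_schmidt_def)
    have "infsum ?g hilbert_basis = infsum ?g F + infsum ?g (hilbert_basis - F)"
      using F sg infsum_Un_disjoint[of ?g F "hilbert_basis - F"]
      by (simp add: Un_absorb1 summable_on_subset_banach[OF sg])
    also have "infsum ?g (hilbert_basis - F) = infsum ?f (hilbert_basis - F)"
      by (intro infsum_cong) (auto simp: minus_hs_op.rep_eq blinfun.bilinear_simps dap)
    also have "\<dots> = infsum ?f hilbert_basis - sum ?f F"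
      using infsum_Diff[OF sA, of F] F by (simp add: summable_on_finite)
    also have "\<dots> \<le> r\<^sup>2 / 4" using dF by (auto simp only: dist_real_def abs_le_iff)
    also have "infsum ?g F \<le> real (card F) * \<delta>\<^sup>2"
    proof -
      have "sum ?g F \<le> (\<Sum>e\<in>F. \<delta>\<^sup>2)"
        using y(2) F(2) \<open>\<delta> > 0\<close>
        by (intro sum_mono power_mono)
          (auto simp: minus_hs_op.rep_eq blinfun.bilinear_simps dap subset_iff less_imp_le)
      then show ?thesis using F by simp
    qed
    also have "real (card F) * \<delta>\<^sup>2 \<le> r\<^sup>2 / 4"
    proof -
      have "\<delta>\<^sup>2 = r\<^sup>2 / (4 * (real (card F) + 1))"
        unfolding \<delta>_def by (simp add: power_divide power_mult_distrib)
      then have "4 * \<delta>\<^sup>2 + real (card F) * (4 * \<delta>\<^sup>2) = r\<^sup>2" by (simp add: field_simps)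
      then show ?thesis using zero_le_power2[of \<delta>] by linarith
    qed
    finally have "infsum ?g hilbert_basis \<le> r\<^sup>2 / 2" by simp
    also have "\<dots> < r\<^sup>2" using \<open>r > 0\<close> by simp
    finally have "norm (A - d) < r"
      unfolding norm_hs_op_eq using \<open>r > 0\<close> by (intro real_less_lsqrt) (auto simp: infsum_nonneg)
    with \<open>d \<in> D\<close> show ?thesis by blast
  qed
  ultimately show ?thesis by blast
qed

instance hs_op :: ("{real_inner,banach,second_countable_topology}") second_countable_topology
proof
  obtain D :: "'a hs_op set" where D: "countable D" "\<And>A r. r > 0 \<Longrightarrow> \<exists>d\<in>D. norm (A - d) < r"
    using hs_op_separable by blast
  define B where "B = (\<lambda>(d, n). ball d (1 / real (Suc n))) ` (D \<times> UNIV)"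
  have "countable B" unfolding B_def using D(1) by blast
  moreover have "topological_basis B"
  proof (rule topological_basisI)
    fix U and A :: "'a hs_op" assume "open U" "A \<in> U"
    then obtain r where r: "r > 0" "ball A r \<subseteq> U" using open_contains_ball by blast
    obtain n where n: "1 / real (Suc n) < r / 2" using r nat_approx_posE[of "r/2"] by auto
    obtain d where d: "d \<in> D" "dist A d < 1 / real (Suc n)"
      using D(2)[of "1 / real (Suc n)" A] by (auto simp: dist_norm)
    have "ball d (1 / real (Suc n)) \<subseteq> ball A r"
    proof
      fix x assume "x \<in> ball d (1 / real (Suc n))"
      then have "dist d x < 1 / real (Suc n)" by simp
      then have "dist A x < r" using d(2) n dist_triangle[of A x d] by linarith
      then show "x \<in> ball A r" by simp
    qed
    then have "A \<in> ball d (1 / real (Suc n)) \<and> ball d (1 / real (Suc n)) \<subseteq> U"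
      using d(2) r by (auto simp: dist_commute)
    moreover have "ball d (1 / real (Suc n)) \<in> B" using d(1) by (force simp: B_def)
    ultimately show "\<exists>V\<in>B. A \<in> V \<and> V \<subseteq> U" by blast
  qed (auto simp: B_def)
  ultimately show "\<exists>B::'a hs_op set set. countable B \<and> open = generate_topology B"
    using topological_basis_imp_subbasis by blast
qed

text \<open>The adjoint of a Hilbert-Schmidt operator is Hilbert-Schmidt, so no junk value of
  \<^const>\<open>hs_of_op\<close> enters below.\<close>

definition hs_adjoint :: "'a::{real_inner,banach,second_countable_topology} hs_op \<Rightarrow> 'a hs_op" where
  "hs_adjoint T = hs_of_op (adj_op (op_of_hs T))"

text \<open>Over the reals, non-negative definiteness does not entail self-adjointness. For an operator
  commuting with \<^const>\<open>hs_adjoint\<close>, preserving this cone is equivalent to preserving its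
  self-adjoint part.\<close>

definition hs_cone :: "'a::{real_inner,banach,second_countable_topology} hs_op set" where
  "hs_cone = {T. nonneg_definite (op_of_hs T)}"

section \<open>Semigroups and generators\<close>

definition c0_semigroup :: "(real \<Rightarrow> 'a::real_normed_vector \<Rightarrow>\<^sub>L 'a) \<Rightarrow> bool" where
  "c0_semigroup S \<longleftrightarrow> S 0 = id_blinfun \<and>
     (\<forall>s\<ge>0. \<forall>t\<ge>0. S (s + t) = S s o\<^sub>L S t) \<and>
     (\<forall>x. ((\<lambda>t. S t x) \<longlongrightarrow> x) (at_right 0))"

definition densely_defined_operator :: "'a::real_normed_vector set \<Rightarrow> ('a \<Rightarrow> 'a) \<Rightarrow> bool" where
  "densely_defined_operator D A \<longleftrightarrow> subspace D \<and> closure D = UNIV \<and>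
     (\<forall>x\<in>D. \<forall>y\<in>D. A (x + y) = A x + A y) \<and> (\<forall>c. \<forall>x\<in>D. A (c *\<^sub>R x) = c *\<^sub>R A x)"

definition generates :: "'a::real_normed_vector set \<Rightarrow> ('a \<Rightarrow> 'a) \<Rightarrow> (real \<Rightarrow> 'a \<Rightarrow>\<^sub>L 'a) \<Rightarrow> bool" where
  "generates D A S \<longleftrightarrow>
     D = {x. \<exists>y. ((\<lambda>h. (S h x - x) /\<^sub>R h) \<longlongrightarrow> y) (at_right 0)} \<and>
     (\<forall>x\<in>D. ((\<lambda>h. (S h x - x) /\<^sub>R h) \<longlongrightarrow> A x) (at_right 0))"

section \<open>Gaussian measures on Hilbert spaces\<close>

definition gaussian_real :: "real measure \<Rightarrow> bool" where
  "gaussian_real \<nu> \<longleftrightarrow>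
     (\<exists>m \<sigma>. 0 < \<sigma> \<and> \<nu> = density lborel (\<lambda>x. ennreal (normal_density m \<sigma> x))) \<or> (\<exists>m. \<nu> = return borel m)"

definition gaussian_measure :: "'a::{real_inner,second_countable_topology} measure \<Rightarrow> bool" where
  "gaussian_measure \<mu> \<longleftrightarrow> prob_space \<mu> \<and> sets \<mu> = sets borel \<and>
     (\<forall>h. gaussian_real (distr \<mu> borel (\<lambda>x. x \<bullet> h)))"

definition has_mean :: "'a::real_inner measure \<Rightarrow> 'a \<Rightarrow> bool" where
  "has_mean \<mu> m \<longleftrightarrow> (\<forall>h. integrable \<mu> (\<lambda>x. x \<bullet> h) \<and> (\<integral>x. x \<bullet> h \<partial>\<mu>) = m \<bullet> h)"

definition has_covariance :: "'a::real_inner measure \<Rightarrow> ('a \<Rightarrow>\<^sub>L 'a) \<Rightarrow> bool" where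
  "has_covariance \<mu> Q \<longleftrightarrow> (\<exists>m. has_mean \<mu> m \<and>
     (\<forall>h k. integrable \<mu> (\<lambda>x. ((x - m) \<bullet> h) * ((x - m) \<bullet> k)) \<and>
            (\<integral>x. ((x - m) \<bullet> h) * ((x - m) \<bullet> k) \<partial>\<mu>) = Q h \<bullet> k))"

definition covariance_operator :: "'a::real_inner measure \<Rightarrow> ('a \<Rightarrow>\<^sub>L 'a)" where
  "covariance_operator \<mu> = (THE Q. has_covariance \<mu> Q)"

section \<open>Wiener and Levy processes\<close>

text \<open>Time runs through \<open>[0,\<infinity>)\<close>; the values of filtrations and processes at negative times are
  irrelevant.\<close>

definition filtered_prob_space :: "'w measure \<Rightarrow> (real \<Rightarrow> 'w measure) \<Rightarrow> bool" where
  "filtered_prob_space M F \<longleftrightarrow> prob_space M \<and> filtration (space M) F \<and> (\<forall>t. subalgebra M (F t))"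

definition adapted :: "(real \<Rightarrow> 'w measure) \<Rightarrow> (real \<Rightarrow> 'w \<Rightarrow> 'a::topological_space) \<Rightarrow> bool" where
  "adapted F Z \<longleftrightarrow> (\<forall>t\<ge>0. Z t \<in> borel_measurable (F t))"

definition indep_increments ::
  "'w measure \<Rightarrow> (real \<Rightarrow> 'w measure) \<Rightarrow> (real \<Rightarrow> 'w \<Rightarrow> 'a::real_normed_vector) \<Rightarrow> bool" where
  "indep_increments M F Z \<longleftrightarrow> (\<forall>s t. 0 \<le> s \<and> s \<le> t \<longrightarrow>
     prob_space.indep_set M (sets (vimage_algebra (space M) (\<lambda>\<omega>. Z t \<omega> - Z s \<omega>) borel)) (sets (F s)))"

definition wiener_process ::
  "'w measure \<Rightarrow> (real \<Rightarrow> 'w measure) \<Rightarrow> ('a::{real_inner,banach,second_countable_topology} \<Rightarrow>\<^sub>L 'a)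
     \<Rightarrow> (real \<Rightarrow> 'w \<Rightarrow> 'a) \<Rightarrow> bool" where
  "wiener_process M F Q B \<longleftrightarrow>
     (AE \<omega> in M. B 0 \<omega> = 0) \<and> adapted F B \<and> indep_increments M F B \<and>
     (\<forall>s t. 0 \<le> s \<and> s \<le> t \<longrightarrow>
        gaussian_measure (distr M borel (\<lambda>\<omega>. B t \<omega> - B s \<omega>)) \<and>
        has_mean (distr M borel (\<lambda>\<omega>. B t \<omega> - B s \<omega>)) 0 \<and>
        has_covariance (distr M borel (\<lambda>\<omega>. B t \<omega> - B s \<omega>)) ((t - s) *\<^sub>R Q)) \<and>
     (AE \<omega> in M. continuous_on {0..} (\<lambda>t. B t \<omega>))"

text \<open>As usual for Hilbert space valued processes, a Levy process is only required to be
  stochastically continuous; no cadlag version is chosen.\<close>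

definition levy_process ::
  "'w measure \<Rightarrow> (real \<Rightarrow> 'w measure) \<Rightarrow> (real \<Rightarrow> 'w \<Rightarrow> 'a::{real_inner,banach,second_countable_topology}) \<Rightarrow> bool" where
  "levy_process M F L \<longleftrightarrow>
     (AE \<omega> in M. L 0 \<omega> = 0) \<and> adapted F L \<and> indep_increments M F L \<and>
     (\<forall>s t. 0 \<le> s \<and> s \<le> t \<longrightarrow>
        distr M borel (\<lambda>\<omega>. L t \<omega> - L s \<omega>) = distr M borel (L (t - s))) \<and>
     (\<forall>t\<ge>0. \<forall>\<epsilon>>0.
        ((\<lambda>s. measure M {\<omega>\<in>space M. \<epsilon> < norm (L s \<omega> - L t \<omega>)}) \<longlongrightarrow> 0) (at t within {0..}))"

definition square_integrable_process :: "'w measure \<Rightarrow> (real \<Rightarrow> 'w \<Rightarrow> 'a::real_normed_vector) \<Rightarrow> bool" where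
  "square_integrable_process M Z \<longleftrightarrow> (\<forall>t\<ge>0. integrable M (\<lambda>\<omega>. (norm (Z t \<omega>))\<^sup>2))"

definition nondecreasing_paths ::
  "'w measure \<Rightarrow> (real \<Rightarrow> 'w \<Rightarrow> 'a::{real_inner,banach,second_countable_topology} hs_op) \<Rightarrow> bool" where
  "nondecreasing_paths M L \<longleftrightarrow> (AE \<omega> in M.
     (\<forall>t\<ge>0. self_adjoint (op_of_hs (L t \<omega>))) \<and>
     (\<forall>f. mono_on {0..} (\<lambda>t. op_of_hs (L t \<omega>) f \<bullet> f)))"

section \<open>Stochastic integrals\<close>

text \<open>Elementary processes on \<open>(0,T]\<close>: finitely many operator values, constant on the intervals
  of the partition \<open>0 = \<tau>\<^sub>0 \<le> \<dots> \<le> \<tau>\<^sub>n = T\<close>, with \<open>\<Phi>\<^sub>i\<close> known at time \<open>\<tau>\<^sub>i\<close>.\<close>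

definition elementary_process ::
  "(real \<Rightarrow> 'w measure) \<Rightarrow> real \<Rightarrow> nat \<Rightarrow> (nat \<Rightarrow> real)
     \<Rightarrow> (nat \<Rightarrow> 'w \<Rightarrow> 'a::real_normed_vector \<Rightarrow>\<^sub>L 'b::real_normed_vector) \<Rightarrow> bool" where
  "elementary_process F T n \<tau> \<Phi> \<longleftrightarrow> \<tau> 0 = 0 \<and> \<tau> n = T \<and>
     (\<forall>i<n. \<tau> i \<le> \<tau> (Suc i) \<and> simple_function (F (\<tau> i)) (\<Phi> i))"

definition elementary_value ::
  "nat \<Rightarrow> (nat \<Rightarrow> real) \<Rightarrow> (nat \<Rightarrow> 'w \<Rightarrow> 'a::real_normed_vector \<Rightarrow>\<^sub>L 'b::real_normed_vector)
     \<Rightarrow> real \<Rightarrow> 'w \<Rightarrow> 'a \<Rightarrow>\<^sub>L 'b" where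
  "elementary_value n \<tau> \<Phi> s \<omega> = (\<Sum>i<n. (indicator {\<tau> i<..\<tau> (Suc i)} s :: real) *\<^sub>R \<Phi> i \<omega>)"

definition elementary_integral ::
  "(real \<Rightarrow> 'w \<Rightarrow> 'a::real_normed_vector) \<Rightarrow> nat \<Rightarrow> (nat \<Rightarrow> real)
     \<Rightarrow> (nat \<Rightarrow> 'w \<Rightarrow> 'a \<Rightarrow>\<^sub>L 'b::real_normed_vector) \<Rightarrow> 'w \<Rightarrow> 'b" where
  "elementary_integral Z n \<tau> \<Phi> \<omega> = (\<Sum>i<n. \<Phi> i \<omega> (Z (\<tau> (Suc i)) \<omega> - Z (\<tau> i) \<omega>))"

text \<open>\<open>I\<close> is a version of the Ito integral of \<open>\<Psi>\<close> over \<open>[0,T]\<close> with respect to \<open>Z\<close>, a centred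
  square integrable process with stationary independent increments such that \<open>Z(1)\<close> has
  covariance operator \<open>Q\<close>: the isometric extension of the elementary integral from the seminorm
  \<open>(E \<integral>\<^sub>0\<^sup>T \<parallel>\<Psi>(s) Q\<^sup>1\<^sup>/\<^sup>2\<parallel>\<^sup>2\<^sub>H\<^sub>S ds)\<^sup>1\<^sup>/\<^sup>2\<close> to \<open>L\<^sup>2\<close> of the probability space.\<close>

definition has_ito_integral ::
  "'w measure \<Rightarrow> (real \<Rightarrow> 'w measure) \<Rightarrow> (real \<Rightarrow> 'w \<Rightarrow> 'a::{real_inner,banach,second_countable_topology})
     \<Rightarrow> ('a \<Rightarrow>\<^sub>L 'a) \<Rightarrow> real \<Rightarrow> (real \<Rightarrow> 'w \<Rightarrow> 'a \<Rightarrow>\<^sub>L 'b::{real_inner,banach,second_countable_topology})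
     \<Rightarrow> ('w \<Rightarrow> 'b) \<Rightarrow> bool" where
  "has_ito_integral M F Z Q T \<Psi> I \<longleftrightarrow>
     I \<in> borel_measurable M \<and>
     (\<forall>x. (\<lambda>(s, \<omega>). \<Psi> s \<omega> x) \<in> borel_measurable (restrict_space borel {0..T} \<Otimes>\<^sub>M M)) \<and>
     (\<exists>n \<tau> \<Phi>. (\<forall>k. elementary_process F T (n k) (\<tau> k) (\<Phi> k)) \<and>
        ((\<lambda>k. \<integral>\<^sup>+\<omega>. (\<integral>\<^sup>+s\<in>{0..T}.
            hs_norm_sq ((elementary_value (n k) (\<tau> k) (\<Phi> k) s \<omega> - \<Psi> s \<omega>) o\<^sub>L sqrt_op Q) \<partial>lborel) \<partial>M)
          \<longlonglongrightarrow> 0) \<and>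
        ((\<lambda>k. \<integral>\<^sup>+\<omega>. ennreal ((norm (elementary_integral Z (n k) (\<tau> k) (\<Phi> k) \<omega> - I \<omega>))\<^sup>2) \<partial>M)
          \<longlonglongrightarrow> 0))"

text \<open>For a square integrable Levy process \<open>L\<close> with mean \<open>t m\<close>, the integral is the Ito integral
  with respect to the martingale \<open>L(t) - t m\<close> plus the drift integral.\<close>

definition has_levy_integral ::
  "'w measure \<Rightarrow> (real \<Rightarrow> 'w measure) \<Rightarrow> (real \<Rightarrow> 'w \<Rightarrow> 'a::{real_inner,banach,second_countable_topology})
     \<Rightarrow> real \<Rightarrow> (real \<Rightarrow> 'w \<Rightarrow> 'a \<Rightarrow>\<^sub>L 'b::{real_inner,banach,second_countable_topology})
     \<Rightarrow> ('w \<Rightarrow> 'b) \<Rightarrow> bool" where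
  "has_levy_integral M F L T \<Psi> I \<longleftrightarrow>
     (let m = (\<integral>\<omega>. L 1 \<omega> \<partial>M); Q = covariance_operator (distr M borel (L 1)) in
      \<exists>J. has_ito_integral M F (\<lambda>t \<omega>. L t \<omega> - t *\<^sub>R m) Q T \<Psi> J \<and>
        (AE \<omega> in M. I \<omega> = J \<omega> + (LINT s:{0..T}|lborel. \<Psi> s \<omega> m)))"

section \<open>Conditional distributions\<close>

definition path_algebra :: "'w measure \<Rightarrow> (real \<Rightarrow> 'w \<Rightarrow> 'a::topological_space) \<Rightarrow> 'w measure" where
  "path_algebra M Y =
     vimage_algebra (space M) (\<lambda>\<omega>. \<lambda>t\<in>{0..}. Y t \<omega>) (\<Pi>\<^sub>M t\<in>{0..}. borel)"

definition regular_cond_distr ::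
  "'w measure \<Rightarrow> 'w measure \<Rightarrow> ('w \<Rightarrow> 'a::topological_space) \<Rightarrow> ('w \<Rightarrow> 'a measure) \<Rightarrow> bool" where
  "regular_cond_distr M G R \<kappa> \<longleftrightarrow>
     subalgebra M G \<and> R \<in> borel_measurable M \<and> \<kappa> \<in> G \<rightarrow>\<^sub>M prob_algebra borel \<and>
     (\<forall>C\<in>sets borel. AE \<omega> in M. real_cond_exp M G (\<lambda>\<omega>. indicator C (R \<omega>)) \<omega> = measure (\<kappa> \<omega>) C)"

end

theory Submission
  imports Defs
begin

text \<open>The driving noises are automatically independent: \<open>B\<close> and \<open>L\<close> have independent increments
  with respect to the same filtration, \<open>B\<close> is continuous and \<open>L\<close> is non-decreasing, so the bracket of
  the martingales generated by bounded functions of their increments vanishes. Riemann sums show that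
  \<open>Y(s)\<close> is non-negative definite and, up to null sets, a function of \<open>L\<close>. Hence \<open>B\<close> is still a
  Wiener process for the filtration enlarged by the \<open>\<sigma>\<close>-algebra \<open>G\<close> of the paths of \<open>Y\<close>.

  By the semigroup law, \<open>R\<close> is the Ito integral of \<open>\<Psi>(s) = S(t + \<Delta> - s) Y\<^sup>1\<^sup>/\<^sup>2(s)\<close> over \<open>(t, t + \<Delta>]\<close>.
  Replacing the coefficients of approximating step processes by their conditional expectations given
  \<open>G\<close> is an \<open>L\<^sup>2\<close>-contraction that fixes \<open>\<Psi>\<close>, so the coefficients may be taken \<open>G\<close>-measurable. By
  independence, \<open>R\<close> is then a limit of functions \<open>J\<^sub>k(\<omega>, \<omega>')\<close> on the diagonal of a product space: the
  coefficients depend on \<open>\<omega>\<close>, the increments of \<open>B\<close> on \<open>\<omega>'\<close>. For fixed \<open>\<omega>\<close> these are centred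
  Gaussian variables with variance given by the Ito isometry, and their limit has the conditional
  law of \<open>R\<close>.\<close>

section \<open>Orthonormal expansions\<close>

text \<open>What shapes the independence proof is that \<open>L\<close> has no path regularity and
  is only Hilbert-Schmidt: the norms of its positive increments over a partition need not have
  bounded sums, as rank-one pieces in orthogonal directions show. Quadratic forms
  \<open>op_of_hs P e \<bullet> e\<close> telescope, and they dominate all matrix coefficients of a
  positive \<open>P\<close>. Hence \<open>L\<close> is tested by functions of finitely many matrix
  coefficients; these still generate the Borel sets. The space of bounded operators is not separable
  in general, so integrands are measured through \<open>\<Psi> s \<omega> x\<close> with
  \<open>x\<close> fixed, and Hilbert-Schmidt norms are treated as countable sums of squared matrix
  coefficients. Tonelli's theorem then reduces isometries and conditional expectations to scalar
  ones. Conditioning on \<open>G\<close> is compatible with adaptedness because \<open>G\<close>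
  enters the filtration at time 0: a \<open>G\<close>-measurable coefficient is admissible on every
  interval. Positivity of \<open>Y s\<close> and its dependence on \<open>L\<close> alone hold only
  almost surely for each fixed \<open>s\<close>. This causes the null closures and the exchange of
  null sets in time and in \<open>\<omega>\<close>.\<close>

lemma hilbert_basis_self: "e \<in> hilbert_basis \<Longrightarrow> e \<bullet> e = 1"
  using norm_hilbert_basis[of e] by (simp add: dot_square_norm)

lemma inner_hilbert_basis_eq:
  "e \<in> hilbert_basis \<Longrightarrow> f \<in> hilbert_basis \<Longrightarrow> e \<bullet> f = (if e = f then 1 else 0)"
  using inner_hilbert_basis hilbert_basis_self by auto

text \<open>The residual \<open>x - p\<close> is orthogonal to the span of \<open>F\<close>, so
  Pythagoras applies to \<open>(x - p) + (p - s)\<close>: the Fourier partial sum is the best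
  approximation from that span.\<close>

lemma norm_diff_projection_le:
  fixes x :: "'a::{real_inner,second_countable_topology}"
  assumes F: "finite F" "F \<subseteq> hilbert_basis"
  shows "norm (x - (\<Sum>e\<in>F. (x \<bullet> e) *\<^sub>R e)) \<le> norm (x - (\<Sum>e\<in>F. u e *\<^sub>R e))"
proof -
  define p where "p = (\<Sum>e\<in>F. (x \<bullet> e) *\<^sub>R e)"
  define s where "s = (\<Sum>e\<in>F. u e *\<^sub>R e)"
  have *: "(x - p) \<bullet> e = 0" if "e \<in> F" for e
  proof -
    have "p \<bullet> e = (\<Sum>f\<in>F. (x \<bullet> f) * (f \<bullet> e))" by (simp add: p_def inner_sum_left)
    also have "\<dots> = (\<Sum>f\<in>F. if f = e then x \<bullet> f else 0)"
      using that F by (intro sum.cong) (auto simp: inner_hilbert_basis_eq subset_iff)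
    also have "\<dots> = x \<bullet> e" using that F by simp
    finally show ?thesis by (simp add: inner_diff_left)
  qed
  have "(x - p) \<bullet> (p - s) = 0"
  proof -
    have "p - s = (\<Sum>e\<in>F. (x \<bullet> e - u e) *\<^sub>R e)"
      by (simp add: p_def s_def scaleR_diff_left sum_subtractf)
    then show ?thesis by (simp add: inner_sum_right *)
  qed
  then have "(norm (x - s))\<^sup>2 = (norm (x - p))\<^sup>2 + (norm (p - s))\<^sup>2"
    using dot_norm[of "x - p" "p - s"] by simp
  then have "(norm (x - p))\<^sup>2 \<le> (norm (x - s))\<^sup>2" by simp
  then show ?thesis unfolding p_def s_def by (simp add: power2_le_iff_abs_le)
qed

text \<open>Density of the span supplies one good combination over some finite \<open>F\<close>.
  Padded with zeros it is a competitor over every larger \<open>G\<close>, where best approximation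
  does the rest; density thus becomes convergence along the net of finite subsets.\<close>

lemma hilbert_basis_expansion:
  fixes x :: "'a::{real_inner,second_countable_topology}"
  shows "((\<lambda>e. (x \<bullet> e) *\<^sub>R e) has_sum x) hilbert_basis"
  unfolding has_sum_def
proof (rule tendstoI)
  fix \<epsilon> :: real assume "\<epsilon> > 0"
  have "x \<in> closure (span hilbert_basis)" using is_onb_hilbert_basis by (auto simp: is_onb_def)
  then obtain s where s: "s \<in> span hilbert_basis" "dist s x < \<epsilon>"
    using \<open>\<epsilon> > 0\<close> by (auto simp: closure_approachable)
  then obtain F u where F: "finite F" "F \<subseteq> hilbert_basis" and su: "s = (\<Sum>e\<in>F. u e *\<^sub>R e)"
    unfolding span_explicit by auto
  show "\<forall>\<^sub>F G in finite_subsets_at_top hilbert_basis. dist (\<Sum>e\<in>G. (x \<bullet> e) *\<^sub>R e) x < \<epsilon>"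
    unfolding eventually_finite_subsets_at_top
  proof (intro exI[of _ F] conjI F allI impI)
    fix G assume G: "finite G \<and> F \<subseteq> G \<and> G \<subseteq> hilbert_basis"
    have "s = (\<Sum>e\<in>G. (if e \<in> F then u e else 0) *\<^sub>R e)"
      unfolding su using G by (intro sum.mono_neutral_cong_left) auto
    then have "norm (x - (\<Sum>e\<in>G. (x \<bullet> e) *\<^sub>R e)) \<le> norm (x - s)"
      using norm_diff_projection_le[of G x "\<lambda>e. if e \<in> F then u e else 0"] G by auto
    then show "dist (\<Sum>e\<in>G. (x \<bullet> e) *\<^sub>R e) x < \<epsilon>"
      using s(2) by (simp add: dist_norm norm_minus_commute)
  qed
qed

lemma parseval_inner:
  fixes x y :: "'a::{real_inner,second_countable_topology}"
  shows "((\<lambda>e. (x \<bullet> e) * (y \<bullet> e)) has_sum (x \<bullet> y)) hilbert_basis"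
  using has_sum_bounded_linear[OF bounded_linear_inner_left hilbert_basis_expansion[of x], of y]
  by (simp add: o_def inner_commute)

lemma parseval_norm:
  fixes x :: "'a::{real_inner,second_countable_topology}"
  shows "((\<lambda>e. (x \<bullet> e)\<^sup>2) has_sum (norm x)\<^sup>2) hilbert_basis"
  using parseval_inner[of x x] by (simp add: power2_eq_square dot_square_norm)

section \<open>The Riesz representation and adjoints\<close>

text \<open>The completeness step behind the Riesz theorem. Squared norms of finite sums are sums of
  \<open>(a e)\<^sup>2\<close>, so tails beyond well-chosen finite sets are small. The net is
  reduced to the increasing sequence \<open>H n\<close> to make sequential completeness
  applicable.\<close>

lemma orthogonal_series_summable:
  fixes a :: "'a::{real_inner,banach,second_countable_topology} \<Rightarrow> real"
  assumes "(\<lambda>e. (a e)\<^sup>2) summable_on hilbert_basis"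
  shows "\<exists>y. ((\<lambda>e. a e *\<^sub>R e) has_sum y) hilbert_basis"
proof -
  have norm_sum: "(norm (\<Sum>e\<in>F. a e *\<^sub>R e))\<^sup>2 = (\<Sum>e\<in>F. (a e)\<^sup>2)"
    if F: "finite F" "F \<subseteq> hilbert_basis" for F :: "'a set"
  proof -
    have "(norm (\<Sum>e\<in>F. a e *\<^sub>R e))\<^sup>2 = (\<Sum>e\<in>F. \<Sum>f\<in>F. a e * a f * (e \<bullet> f))"
      by (simp add: power2_norm_eq_inner inner_sum_left inner_sum_right sum_distrib_left mult_ac inner_commute)
    also have "\<dots> = (\<Sum>e\<in>F. \<Sum>f\<in>F. if e = f then a e * a f else 0)"
      using F by (intro sum.cong) (auto simp: inner_hilbert_basis_eq subset_iff)
    finally show ?thesis using F by (simp add: power2_eq_square)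
  qed
  let ?S = "infsum (\<lambda>e. (a e)\<^sup>2) hilbert_basis"
  \<comment> \<open>The tolerance is the square of half of \<open>1 / Suc n\<close>; in
    \<open>tail2\<close> two such errors, one from \<open>G\<close> and one from \<open>s n\<close>,
    add up to \<open>1 / Suc n\<close>.\<close>
  have "\<exists>F. finite F \<and> F \<subseteq> hilbert_basis \<and> dist (\<Sum>e\<in>F. (a e)\<^sup>2) ?S \<le> 1 / 4 / (real (Suc n))\<^sup>2" for n
    using infsum_finite_approximation[OF assms, of "1 / 4 / (real (Suc n))\<^sup>2"] by auto
  then obtain F where F: "\<And>n. finite (F n)" "\<And>n. F n \<subseteq> hilbert_basis"
    "\<And>n. dist (\<Sum>e\<in>F n. (a e)\<^sup>2) ?S \<le> 1 / 4 / (real (Suc n))\<^sup>2" by metis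
  have tail: "norm ((\<Sum>e\<in>G. a e *\<^sub>R e) - (\<Sum>e\<in>F n. a e *\<^sub>R e)) \<le> 1 / real (Suc n) / 2"
    if G: "finite G" "G \<subseteq> hilbert_basis" "F n \<subseteq> G" for G n
  proof -
    have "(norm ((\<Sum>e\<in>G. a e *\<^sub>R e) - (\<Sum>e\<in>F n. a e *\<^sub>R e)))\<^sup>2 = (\<Sum>e\<in>G - F n. (a e)\<^sup>2)"
      using norm_sum[of "G - F n"] G F(1)[of n] by (simp add: sum_diff) blast
    also have "\<dots> = (\<Sum>e\<in>G. (a e)\<^sup>2) - (\<Sum>e\<in>F n. (a e)\<^sup>2)"
      using G F(1)[of n] by (simp add: sum_diff)
    also have "\<dots> \<le> 1 / 4 / (real (Suc n))\<^sup>2"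
      using F(3)[of n] finite_sum_le_infsum[OF assms G(1,2)] by (simp add: dist_real_def)
    also have "\<dots> = (1 / real (Suc n) / 2)\<^sup>2" by (simp add: power2_eq_square algebra_simps)
    finally show ?thesis by (rule power2_le_imp_le) simp
  qed
  define H where "H n = (\<Union>i\<le>n. F i)" for n
  have H: "finite (H n)" "H n \<subseteq> hilbert_basis" "F n \<subseteq> H n" for n
    using F by (auto simp: H_def)
  have HH: "H m \<subseteq> H n" if "m \<le> n" for m n using that by (auto simp: H_def intro: order_trans)
  define s where "s n = (\<Sum>e\<in>H n. a e *\<^sub>R e)" for n
  have tail2: "norm ((\<Sum>e\<in>G. a e *\<^sub>R e) - s n) \<le> 1 / real (Suc n)"
    if G: "finite G" "G \<subseteq> hilbert_basis" "F n \<subseteq> G" for G n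
  proof -
    let ?x = "\<Sum>e\<in>G. a e *\<^sub>R e" and ?z = "\<Sum>e\<in>F n. a e *\<^sub>R e"
    have "norm (?x - s n) = norm ((?x - ?z) - (s n - ?z))" by simp
    also have "\<dots> \<le> norm (?x - ?z) + norm (s n - ?z)" by (rule norm_triangle_ineq4)
    also have "\<dots> \<le> 1 / real (Suc n) / 2 + 1 / real (Suc n) / 2"
      unfolding s_def by (intro add_mono tail G H)
    also have "\<dots> = 1 / real (Suc n)" by (rule field_sum_of_halves)
    finally show ?thesis .
  qed
  have "Cauchy s"
  proof (rule metric_CauchyI)
    fix r :: real assume "r > 0"
    then obtain N where N: "1 / real (Suc N) < r / 2" using nat_approx_posE[of "r/2"] by auto
    have "dist (s m) (s N) < r / 2" if "m \<ge> N" for m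
    proof -
      have "norm (s m - s N) \<le> 1 / real (Suc N)"
        unfolding s_def[of m] using that by (intro tail2 H order_trans[OF H(3) HH])
      with N show ?thesis by (simp add: dist_norm)
    qed
    then have "dist (s m) (s n) < r" if "m \<ge> N" "n \<ge> N" for m n
      using that dist_triangle_half_l by blast
    then show "\<exists>M. \<forall>m\<ge>M. \<forall>n\<ge>M. dist (s m) (s n) < r" by blast
  qed
  then obtain y where y: "s \<longlonglongrightarrow> y" using Cauchy_convergent_iff convergent_def by blast
  have "((\<lambda>e. a e *\<^sub>R e) has_sum y) hilbert_basis"
    unfolding has_sum_def
  proof (rule tendstoI)
    fix r :: real assume "r > 0"
    obtain N1 where N1: "\<And>n. n \<ge> N1 \<Longrightarrow> dist (s n) y < r / 2"
      using y \<open>r > 0\<close> unfolding lim_sequentially by (meson half_gt_zero)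
    obtain N2 where N2: "1 / real (Suc N2) < r / 2" using nat_approx_posE[of "r/2"] \<open>r > 0\<close> by auto
    define n where "n = max N1 N2"
    have n: "1 / real (Suc n) < r / 2"
      using N2 by (rule le_less_trans[rotated]) (auto simp: n_def intro!: divide_left_mono)
    show "\<forall>\<^sub>F G in finite_subsets_at_top hilbert_basis. dist (\<Sum>e\<in>G. a e *\<^sub>R e) y < r"
      unfolding eventually_finite_subsets_at_top
    proof (intro exI[of _ "F n"] conjI F allI impI)
      fix G assume G: "finite G \<and> F n \<subseteq> G \<and> G \<subseteq> hilbert_basis"
      have "dist (\<Sum>e\<in>G. a e *\<^sub>R e) (s n) < r / 2"
        using tail2[of G n] G n by (simp add: dist_norm)
      moreover have "dist (s n) y < r / 2" using N1 by (simp add: n_def)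
      ultimately show "dist (\<Sum>e\<in>G. a e *\<^sub>R e) y < r"
        using dist_triangle[of "\<Sum>e\<in>G. a e *\<^sub>R e" y "s n"] by linarith
    qed
  qed
  then show ?thesis ..
qed

text \<open>The representing vector must have the coordinates \<open>f e\<close>. Testing
  \<open>f\<close> on the partial sum \<open>z\<close> gives \<open>norm z ^ 2 = f z\<close> and
  hence \<open>norm z \<le> K\<close>, which is square summability.\<close>

lemma riesz_representation:
  fixes f :: "'a::{real_inner,banach,second_countable_topology} \<Rightarrow> real"
  assumes "bounded_linear f"
  obtains y where "\<And>x. f x = x \<bullet> y"
proof -
  interpret bounded_linear f by fact
  obtain K where K: "K \<ge> 0" "\<And>x. norm (f x) \<le> norm x * K" using nonneg_bounded by auto
  have "(\<Sum>e\<in>F. (f e)\<^sup>2) \<le> K\<^sup>2" if F: "finite F" "F \<subseteq> hilbert_basis" for F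
  proof -
    define z where "z = (\<Sum>e\<in>F. f e *\<^sub>R e)"
    let ?S = "\<Sum>e\<in>F. (f e)\<^sup>2"
    have fz: "f z = ?S" by (simp add: z_def sum scaleR power2_eq_square)
    have "z \<bullet> z = (\<Sum>e\<in>F. \<Sum>g\<in>F. f e * f g * (e \<bullet> g))"
      by (simp add: z_def inner_sum_left inner_sum_right sum_distrib_left mult_ac inner_commute)
    also have "\<dots> = (\<Sum>e\<in>F. \<Sum>g\<in>F. if e = g then f e * f g else 0)"
      using F by (intro sum.cong) (auto simp: inner_hilbert_basis_eq subset_iff)
    finally have nz: "(norm z)\<^sup>2 = ?S" using F by (simp add: dot_square_norm power2_eq_square)
    have "(norm z)\<^sup>2 \<le> norm z * K" using K(2)[of z] fz nz by (simp add: sum_nonneg)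
    then have "norm z \<le> K" using K(1)
      by (cases "norm z = 0") (auto simp: power2_eq_square mult_le_cancel_left)
    then show ?thesis using nz by (metis norm_ge_zero power_mono)
  qed
  then have "(\<lambda>e. (f e)\<^sup>2) summable_on hilbert_basis"
    by (intro nonneg_bdd_above_summable_on) (auto intro!: bdd_aboveI2)
  then obtain y where y: "((\<lambda>e. f e *\<^sub>R e) has_sum y) hilbert_basis"
    using orthogonal_series_summable by blast
  have "f x = x \<bullet> y" for x
  proof -
    have "((\<lambda>e. (x \<bullet> e) * f e) has_sum f x) hilbert_basis"
      using has_sum_bounded_linear[OF assms hilbert_basis_expansion[of x]] by (simp add: o_def scaleR)
    moreover have "((\<lambda>e. (x \<bullet> e) * f e) has_sum (x \<bullet> y)) hilbert_basis"
      using has_sum_bounded_linear[OF bounded_linear_inner_right y, of x]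
      by (simp add: o_def mult.commute)
    ultimately show ?thesis by (rule has_sum_unique)
  qed
  then show ?thesis using that by blast
qed

text \<open>\<open>adjoint\<close> is a choice of a transposed map, and \<open>Blinfun\<close> is
  meaningful for bounded linear maps only. Riesz gives existence of the transpose; the transposition
  identity itself then gives linearity and the norm bound. Later facts on \<open>adj_op\<close> rest
  on this lemma.\<close>

lemma inner_adj_op:
  fixes A :: "'a::{real_inner,banach,second_countable_topology} \<Rightarrow>\<^sub>L 'b::real_inner"
  shows "A x \<bullet> y = x \<bullet> adj_op A y"
proof -
  have "\<exists>z. \<forall>x. A x \<bullet> y = x \<bullet> z" for y
  proof -
    have "bounded_linear (\<lambda>x. A x \<bullet> y)"
      by (rule bounded_linear_compose[OF bounded_linear_inner_left blinfun.bounded_linear_right])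
    from riesz_representation[OF this] obtain z where "\<And>x. A x \<bullet> y = x \<bullet> z" by blast
    then show ?thesis by blast
  qed
  then obtain g where g: "\<And>x y. A x \<bullet> y = x \<bullet> g y" by metis
  have ad: "x \<bullet> adjoint (blinfun_apply A) y = A x \<bullet> y" for x y
  proof -
    have "\<exists>f'. \<forall>x y. A x \<bullet> y = x \<bullet> f' y" using g by blast
    then have "\<forall>x y. A x \<bullet> y = x \<bullet> adjoint (blinfun_apply A) y"
      unfolding adjoint_def by (rule someI_ex)
    then show ?thesis by simp
  qed
  have "bounded_linear (adjoint (blinfun_apply A))"
  proof (rule bounded_linear_intro[of _ "norm A"])
    show "adjoint (blinfun_apply A) (x + y) = adjoint (blinfun_apply A) x + adjoint (blinfun_apply A) y" for x y
      by (rule vector_eq_ldot[THEN iffD1]) (simp add: ad inner_add_right)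
    show "adjoint (blinfun_apply A) (r *\<^sub>R x) = r *\<^sub>R adjoint (blinfun_apply A) x" for r x
      by (rule vector_eq_ldot[THEN iffD1]) (simp add: ad)
    show "norm (adjoint (blinfun_apply A) x) \<le> norm x * norm A" for x
    proof -
      let ?z = "adjoint (blinfun_apply A) x"
      have "norm ?z * norm ?z = A ?z \<bullet> x" using ad[of ?z x] by (simp add: dot_square_norm power2_eq_square)
      also have "\<dots> \<le> norm (A ?z) * norm x" by (rule norm_cauchy_schwarz)
      also have "\<dots> \<le> (norm A * norm ?z) * norm x" by (intro mult_right_mono norm_blinfun) auto
      finally have "norm ?z * norm ?z \<le> norm ?z * (norm x * norm A)" by (simp add: mult_ac)
      then show ?thesis by (cases "norm ?z = 0") (auto simp: mult_le_cancel_left)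
    qed
  qed
  then show ?thesis by (simp add: adj_op_def bounded_linear_Blinfun_apply ad)
qed


lemma inner_adj_op': 
  fixes A :: "'a::{real_inner,banach,second_countable_topology} \<Rightarrow>\<^sub>L 'b::real_inner"
  shows "adj_op A y \<bullet> x = y \<bullet> A x"
  using inner_adj_op[of A x y] by (simp add: inner_commute)

lemma adj_op_eqI:
  fixes A :: "'a::{real_inner,banach,second_countable_topology} \<Rightarrow>\<^sub>L 'b::real_inner"
  assumes "\<And>x y. A x \<bullet> y = x \<bullet> blinfun_apply B y" shows "adj_op A = B"
  by (rule blinfun_eqI, rule vector_eq_ldot[THEN iffD1]) (simp add: assms inner_adj_op[symmetric])

lemma adj_op_compose:
  fixes A :: "'a::{real_inner,banach,second_countable_topology} \<Rightarrow>\<^sub>L 'b::{real_inner,banach,second_countable_topology}"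
    and B :: "'c::{real_inner,banach,second_countable_topology} \<Rightarrow>\<^sub>L 'a"
  shows "adj_op (A o\<^sub>L B) = adj_op B o\<^sub>L adj_op A"
  by (rule adj_op_eqI) (simp add: inner_adj_op)

lemma adj_op_add:
  fixes A B :: "'a::{real_inner,banach,second_countable_topology} \<Rightarrow>\<^sub>L 'b::real_inner"
  shows "adj_op (A + B) = adj_op A + adj_op B"
  by (rule adj_op_eqI) (simp add: inner_adj_op blinfun.bilinear_simps inner_add_left inner_add_right)

lemma adj_op_diff:
  fixes A B :: "'a::{real_inner,banach,second_countable_topology} \<Rightarrow>\<^sub>L 'b::real_inner"
  shows "adj_op (A - B) = adj_op A - adj_op B"
  by (rule adj_op_eqI) (simp add: inner_adj_op blinfun.bilinear_simps inner_diff_left inner_diff_right)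

lemma adj_op_scaleR:
  fixes A :: "'a::{real_inner,banach,second_countable_topology} \<Rightarrow>\<^sub>L 'b::real_inner"
  shows "adj_op (c *\<^sub>R A) = c *\<^sub>R adj_op A"
  by (rule adj_op_eqI) (simp add: inner_adj_op blinfun.bilinear_simps)

lemma adj_op_zero:
  "adj_op (0 :: 'a::{real_inner,banach,second_countable_topology} \<Rightarrow>\<^sub>L 'b::real_inner) = 0"
  by (rule adj_op_eqI) simp

lemma norm_adj_op_le:
  fixes A :: "'a::{real_inner,banach,second_countable_topology} \<Rightarrow>\<^sub>L 'b::real_inner"
  shows "norm (adj_op A) \<le> norm A"
proof (rule norm_blinfun_bound)
  fix y
  let ?z = "adj_op A y"
  have "norm ?z * norm ?z = A ?z \<bullet> y" using inner_adj_op[of A ?z y] by (simp add: dot_square_norm power2_eq_square)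
  also have "\<dots> \<le> norm (A ?z) * norm y" by (rule norm_cauchy_schwarz)
  also have "\<dots> \<le> (norm A * norm ?z) * norm y" by (intro mult_right_mono norm_blinfun) auto
  finally have "norm ?z * norm ?z \<le> norm ?z * (norm A * norm y)" by (simp add: mult_ac)
  then show "norm ?z \<le> norm A * norm y" by (cases "norm ?z = 0") (auto simp: mult_le_cancel_left)
qed simp

lemma self_adjoint_adj_op:
  "self_adjoint (A :: 'a::{real_inner,banach,second_countable_topology} \<Rightarrow>\<^sub>L 'a) \<longleftrightarrow> adj_op A = A"
  using adj_op_eqI[of A A] inner_adj_op[of A] by (auto simp: self_adjoint_def)

section \<open>Square roots of non-negative operators\<close>

text \<open>The form at \<open>x + r y\<close> is a non-negative quadratic polynomial in
  \<open>r\<close>; its minimiser gives the inequality. If the form vanishes at \<open>y\<close>,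
  the polynomial is affine and its slope must be 0.\<close>

lemma nonneg_definite_Cauchy_Schwarz:
  assumes "self_adjoint A" "nonneg_definite A"
  shows "(A x \<bullet> y)\<^sup>2 \<le> (A x \<bullet> x) * (A y \<bullet> y)"
proof -
  have q: "0 \<le> A x \<bullet> x + 2 * r * (A x \<bullet> y) + r\<^sup>2 * (A y \<bullet> y)" for r
  proof -
    have "A y \<bullet> x = A x \<bullet> y" using assms(1) by (metis inner_commute self_adjoint_def)
    then have "A (x + r *\<^sub>R y) \<bullet> (x + r *\<^sub>R y) = A x \<bullet> x + 2 * r * (A x \<bullet> y) + r\<^sup>2 * (A y \<bullet> y)"
      by (simp add: blinfun.bilinear_simps inner_add_left inner_add_right algebra_simps power2_eq_square)
    then show ?thesis using assms(2) by (metis nonneg_definite_def)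
  qed
  show ?thesis
  proof (cases "A y \<bullet> y = 0")
    case True
    have "A x \<bullet> y = 0"
    proof (rule ccontr)
      assume "A x \<bullet> y \<noteq> 0"
      then show False using q[of "- (A x \<bullet> x + 1) / (2 * (A x \<bullet> y))"] True by (simp add: field_simps)
    qed
    then show ?thesis using True by simp
  next
    case False
    then have pos: "A y \<bullet> y > 0" using assms(2) by (simp add: less_le nonneg_definite_def)
    from q[of "- (A x \<bullet> y) / (A y \<bullet> y)"] pos
    have "0 \<le> A x \<bullet> x - (A x \<bullet> y)\<^sup>2 / (A y \<bullet> y)"
      by (simp add: power2_eq_square field_simps)
    then show ?thesis using pos by (simp add: field_simps)
  qed
qed

lemma nonneg_definite_kernel:
  assumes "self_adjoint A" "nonneg_definite A" "A x \<bullet> x = 0"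
  shows "A x = 0"
  using nonneg_definite_Cauchy_Schwarz[OF assms(1,2), of x "A x"] assms(3) by simp

text \<open>Cauchy-Schwarz for the form, at \<open>x\<close> and \<open>A x\<close>, bounds
  \<open>norm (A x) ^ 4\<close> by \<open>norm x ^ 2 * norm (A x) ^ 2\<close>. A bound on the
  quadratic form thus becomes one on the operator norm.\<close>

lemma norm_nonneg_definite_le:
  assumes A: "self_adjoint A" "nonneg_definite A" and b: "\<And>x. A x \<bullet> x \<le> x \<bullet> x"
  shows "norm A \<le> 1"
proof (rule norm_blinfun_bound)
  fix x
  have "((norm (A x))\<^sup>2)\<^sup>2 \<le> (A x \<bullet> x) * (A (A x) \<bullet> A x)"
    using nonneg_definite_Cauchy_Schwarz[OF A, of x "A x"] by (simp add: dot_square_norm)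
  also have "\<dots> \<le> (norm x)\<^sup>2 * (norm (A x))\<^sup>2"
    using b[of x] b[of "A x"] A(2) by (intro mult_mono) (auto simp: dot_square_norm nonneg_definite_def)
  finally have "(norm (A x))\<^sup>2 * (norm (A x))\<^sup>2 \<le> (norm x)\<^sup>2 * (norm (A x))\<^sup>2"
    by (simp add: power2_eq_square)
  then have "(norm (A x))\<^sup>2 \<le> (norm x)\<^sup>2" if "A x \<noteq> 0"
    by (rule mult_right_le_imp_le) (use that in simp)
  then have "norm (A x) \<le> norm x"
    by (cases "A x = 0") (auto intro: power2_le_imp_le)
  then show "norm (A x) \<le> 1 * norm x" by simp
qed simp

text \<open>The iterates increase to \<open>Y\<close> with \<open>2 Y = T + Y\<^sup>2\<close>, that is \<open>(1 - Y)\<^sup>2 = 1 - T\<close>. Their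
  coefficients as polynomials in \<open>T\<close> are non-negative, so for \<open>\<parallel>T\<parallel> \<le> 1\<close> the scalar iteration
  started with \<open>T = 1\<close> is a majorant and convergence holds in operator norm.\<close>

primrec root_iter :: "('a::real_normed_vector \<Rightarrow>\<^sub>L 'a) \<Rightarrow> nat \<Rightarrow> 'a \<Rightarrow>\<^sub>L 'a" where
  "root_iter T 0 = 0"
| "root_iter T (Suc n) = (1/2) *\<^sub>R (T + (root_iter T n o\<^sub>L root_iter T n))"

primrec root_majorant :: "nat \<Rightarrow> real" where
  "root_majorant 0 = 0"
| "root_majorant (Suc n) = (1 + (root_majorant n)\<^sup>2) / 2"

lemma root_majorant_bounds: "0 \<le> root_majorant n" "root_majorant n \<le> 1"
proof (induction n)
  case (Suc n)
  { case 1 show ?case by simp }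
  { case 2 show ?case using Suc power_le_one[of "root_majorant n" 2] by simp }
qed auto

text \<open>Both bounds follow the scalar recursion. The differences use
  \<open>Y Y - X X = Y (Y - X) + (Y - X) X\<close>, which holds without commutation.\<close>

lemma root_iter_majorized:
  assumes "norm T \<le> 1"
  shows "norm (root_iter T n) \<le> root_majorant n"
    and "norm (root_iter T (Suc n) - root_iter T n) \<le> root_majorant (Suc n) - root_majorant n"
proof -
  have A: "norm (root_iter T n) \<le> root_majorant n" for n
  proof (induction n)
    case (Suc n)
    have "norm (T + (root_iter T n o\<^sub>L root_iter T n)) \<le> norm T + norm (root_iter T n) * norm (root_iter T n)"
      by (rule order_trans[OF norm_triangle_ineq add_left_mono[OF norm_blinfun_compose]])
    also have "\<dots> \<le> 1 + (root_majorant n)\<^sup>2"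
      unfolding power2_eq_square using assms Suc by (intro add_mono mult_mono) (auto intro: order_trans[OF norm_ge_zero])
    finally show ?case by simp
  qed simp
  show "norm (root_iter T n) \<le> root_majorant n" by (rule A)
  show "norm (root_iter T (Suc n) - root_iter T n) \<le> root_majorant (Suc n) - root_majorant n"
  proof (induction n)
    case 0 then show ?case using assms by simp
  next
    case (Suc n)
    let ?Y = "root_iter T (Suc n)" and ?X = "root_iter T n"
    let ?y = "root_majorant (Suc n)" and ?x = "root_majorant n"
    have "root_iter T (Suc (Suc n)) - ?Y = (1/2) *\<^sub>R ((?Y o\<^sub>L (?Y - ?X)) + ((?Y - ?X) o\<^sub>L ?X))"
      by (subst root_iter.simps(2), subst (3) root_iter.simps(2))
        (auto intro!: blinfun_eqI simp del: root_iter.simps simp: blinfun.bilinear_simps algebra_simps)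
    also have "norm \<dots> \<le> (norm ?Y * norm (?Y - ?X) + norm (?Y - ?X) * norm ?X) / 2"
      by (simp del: root_iter.simps) (rule order_trans[OF norm_triangle_ineq add_mono[OF norm_blinfun_compose norm_blinfun_compose]])
    also have "\<dots> \<le> (?y * (?y - ?x) + (?y - ?x) * ?x) / 2"
      by (intro divide_right_mono add_mono mult_mono A Suc order_trans[OF norm_ge_zero Suc])
        (auto simp del: root_majorant.simps root_iter.simps simp: root_majorant_bounds)
    also have "\<dots> = root_majorant (Suc (Suc n)) - ?y"
      by (subst (2) root_majorant.simps(2), subst (5) root_majorant.simps(2)) (simp add: field_simps power2_eq_square)
    finally show ?case .
  qed
qed

lemma root_iter_diff_le:
  assumes "norm T \<le> 1" "m \<le> n"
  shows "norm (root_iter T n - root_iter T m) \<le> root_majorant n - root_majorant m"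
  using assms(2)
proof (induction n rule: dec_induct)
  case (step n)
  have "root_iter T (Suc n) - root_iter T m = (root_iter T (Suc n) - root_iter T n) + (root_iter T n - root_iter T m)"
    by simp
  also have "norm \<dots> \<le> (root_majorant (Suc n) - root_majorant n) + (root_majorant n - root_majorant m)"
    by (intro norm_triangle_mono root_iter_majorized step assms)
  finally show ?case by simp
qed simp

definition root_limit :: "('a::banach \<Rightarrow>\<^sub>L 'a) \<Rightarrow> 'a \<Rightarrow>\<^sub>L 'a" where
  "root_limit T = lim (root_iter T)"

lemma root_iter_tendsto:
  fixes T :: "'a::banach \<Rightarrow>\<^sub>L 'a"
  assumes "norm T \<le> 1"
  shows "root_iter T \<longlonglongrightarrow> root_limit T"
proof -
  \<comment> \<open>For the zero operator the difference bound has a non-negative left side; this is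
    monotonicity of the majorant.\<close>
  have le: "root_majorant m \<le> root_majorant n" if "m \<le> n" for m n
    using order_trans[OF norm_ge_zero root_iter_diff_le[of "0 :: 'a \<Rightarrow>\<^sub>L 'a", OF _ that]] by simp
  then have "mono root_majorant" by (rule monoI)
  then have "Cauchy root_majorant"
    by (intro convergent_Cauchy Bseq_mono_convergent[OF BseqI'[of _ 1]]) (auto simp: root_majorant_bounds abs_le_iff incseq_def
        intro: order_trans[OF _ root_majorant_bounds(1)])
  have "Cauchy (root_iter T)"
  proof (rule metric_CauchyI)
    fix r :: real assume "r > 0"
    then obtain N where N: "\<And>m n. m \<ge> N \<Longrightarrow> n \<ge> N \<Longrightarrow> dist (root_majorant m) (root_majorant n) < r"
      using \<open>Cauchy root_majorant\<close> unfolding Cauchy_def by blast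
    have "dist (root_iter T m) (root_iter T n) \<le> dist (root_majorant m) (root_majorant n)" for m n
      using root_iter_diff_le[OF assms, of m n] root_iter_diff_le[OF assms, of n m] le[of m n] le[of n m]
      by (cases "m \<le> n") (auto simp: dist_norm norm_minus_commute)
    then show "\<exists>M. \<forall>m\<ge>M. \<forall>n\<ge>M. dist (root_iter T m) (root_iter T n) < r"
      using N by (meson le_less_trans)
  qed
  then show ?thesis unfolding root_limit_def
    by (simp add: Cauchy_convergent_iff convergent_LIMSEQ_iff)
qed

lemma root_limit_fixed_point:
  assumes "norm T \<le> 1"
  shows "2 *\<^sub>R root_limit T = T + (root_limit T o\<^sub>L root_limit T)"
proof -
  have "(\<lambda>n. root_iter T (Suc n)) \<longlonglongrightarrow> (1/2) *\<^sub>R (T + (root_limit T o\<^sub>L root_limit T))"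
    unfolding root_iter.simps by (intro tendsto_intros root_iter_tendsto assms bounded_bilinear.tendsto[OF bounded_bilinear_blinfun_compose])
  moreover have "(\<lambda>n. root_iter T (Suc n)) \<longlonglongrightarrow> root_limit T"
    by (rule LIMSEQ_Suc[OF root_iter_tendsto[OF assms]])
  ultimately have "root_limit T = (1/2) *\<^sub>R (T + (root_limit T o\<^sub>L root_limit T))"
    using LIMSEQ_unique by blast
  then have "2 *\<^sub>R root_limit T = 2 *\<^sub>R ((1/2) *\<^sub>R (T + (root_limit T o\<^sub>L root_limit T)))" by (rule arg_cong)
  then show ?thesis by simp
qed

lemma root_limit_norm_le: "norm T \<le> 1 \<Longrightarrow> norm (root_limit T) \<le> 1"
  by (rule tendsto_upperbound[OF tendsto_norm[OF root_iter_tendsto]])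
    (auto intro!: always_eventually intro: order_trans[OF root_iter_majorized(1) root_majorant_bounds(2)])

lemma root_limit_self_adjoint:
  fixes T :: "'a::{real_inner,banach} \<Rightarrow>\<^sub>L 'a"
  assumes "norm T \<le> 1" "self_adjoint T" shows "self_adjoint (root_limit T)"
proof -
  have *: "root_iter T n x \<bullet> y = x \<bullet> root_iter T n y" for n x y
  proof (induction n arbitrary: x y)
    case (Suc n)
    then show ?case using assms(2)
      by (simp add: blinfun.bilinear_simps inner_add_left inner_add_right self_adjoint_def)
  qed simp
  have "(\<lambda>n. root_iter T n x \<bullet> y) \<longlonglongrightarrow> root_limit T x \<bullet> y" "(\<lambda>n. x \<bullet> root_iter T n y) \<longlonglongrightarrow> x \<bullet> root_limit T y" for x y
    by (intro tendsto_intros root_iter_tendsto assms)+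
  then show ?thesis unfolding self_adjoint_def * by (blast intro: LIMSEQ_unique)
qed

lemma root_limit_commute:
  fixes T :: "'a::banach \<Rightarrow>\<^sub>L 'a"
  assumes "norm T \<le> 1" "T o\<^sub>L B = B o\<^sub>L T" shows "root_limit T o\<^sub>L B = B o\<^sub>L root_limit T"
proof -
  have *: "root_iter T n (B x) = B (root_iter T n x)" for n x
  proof (induction n arbitrary: x)
    case (Suc n)
    have "T (B x) = B (T x)" using assms(2) by (metis blinfun_apply_blinfun_compose)
    with Suc show ?case by (simp add: blinfun.bilinear_simps)
  qed simp
  have "(\<lambda>n. root_iter T n (B x)) \<longlonglongrightarrow> root_limit T (B x)" "(\<lambda>n. B (root_iter T n x)) \<longlonglongrightarrow> B (root_limit T x)" for x
    by (intro tendsto_intros root_iter_tendsto assms)+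
  then have "root_limit T (B x) = B (root_limit T x)" for x unfolding * by (blast intro: LIMSEQ_unique)
  then show ?thesis by (intro blinfun_eqI) simp
qed

text \<open>The divisor \<open>1 + norm A\<close> is positive also for \<open>A = 0\<close> and
  depends continuously on \<open>A\<close>. For self-adjoint non-negative \<open>A\<close> the
  result lies between 0 and the identity as a form, so the root iteration applies to it.\<close>

definition op_scale :: "('a::real_normed_vector \<Rightarrow>\<^sub>L 'a) \<Rightarrow> 'a \<Rightarrow>\<^sub>L 'a" where
  "op_scale A = id_blinfun - A /\<^sub>R (1 + norm A)"

definition pos_root :: "('a::banach \<Rightarrow>\<^sub>L 'a) \<Rightarrow> 'a \<Rightarrow>\<^sub>L 'a" where
  "pos_root A = sqrt (1 + norm A) *\<^sub>R (id_blinfun - root_limit (op_scale A))"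

lemma norm_op_scale_le:
  assumes "self_adjoint A" "nonneg_definite A"
  shows "self_adjoint (op_scale A)" "norm (op_scale A) \<le> 1"
proof -
  show sa: "self_adjoint (op_scale A)"
    using assms(1) by (simp add: self_adjoint_def op_scale_def blinfun.bilinear_simps inner_diff_left inner_diff_right)
  have "A x \<bullet> x \<le> (1 + norm A) * (x \<bullet> x)" for x
  proof -
    have "A x \<bullet> x \<le> norm (A x) * norm x" by (rule norm_cauchy_schwarz)
    also have "\<dots> \<le> (norm A * norm x) * norm x" by (intro mult_right_mono norm_blinfun) auto
    also have "\<dots> = norm A * (x \<bullet> x)" by (simp add: dot_square_norm power2_eq_square)
    finally show ?thesis by (simp add: algebra_simps add_increasing)
  qed
  moreover have "1 + norm A > 0" by (simp add: add_pos_nonneg)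
  ultimately show "norm (op_scale A) \<le> 1"
    using assms(2)
    by (intro norm_nonneg_definite_le sa)
      (auto simp: nonneg_definite_def op_scale_def blinfun.bilinear_simps inner_diff_left field_simps)
qed

lemma pos_root_props:
  fixes A :: "'a::{real_inner,banach} \<Rightarrow>\<^sub>L 'a"
  assumes A: "self_adjoint A" "nonneg_definite A"
  shows "self_adjoint (pos_root A)" "nonneg_definite (pos_root A)" "pos_root A o\<^sub>L pos_root A = A"
    and "\<And>B. A o\<^sub>L B = B o\<^sub>L A \<Longrightarrow> pos_root A o\<^sub>L B = B o\<^sub>L pos_root A"
proof -
  note T = norm_op_scale_le[OF A]
  let ?Y = "root_limit (op_scale A)"
  have c: "1 + norm A > 0" by (simp add: add_pos_nonneg)
  show "self_adjoint (pos_root A)"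
    using root_limit_self_adjoint[OF T(2,1)]
    by (simp add: self_adjoint_def pos_root_def blinfun.bilinear_simps inner_diff_left inner_diff_right)
  show "nonneg_definite (pos_root A)"
    unfolding nonneg_definite_def
  proof
    fix x
    have "?Y x \<bullet> x \<le> norm (?Y x) * norm x" by (rule norm_cauchy_schwarz)
    also have "\<dots> \<le> (1 * norm x) * norm x"
      by (intro mult_right_mono order_trans[OF norm_blinfun] root_limit_norm_le T) auto
    finally have "?Y x \<bullet> x \<le> x \<bullet> x" by (simp add: dot_square_norm power2_eq_square)
    then show "0 \<le> pos_root A x \<bullet> x"
      using c by (auto simp: pos_root_def blinfun.bilinear_simps inner_diff_left)
  qed
  have fp: "2 *\<^sub>R ?Y x = op_scale A x + ?Y (?Y x)" for x
    using arg_cong[OF root_limit_fixed_point[OF T(2)], of "\<lambda>B. B x"] by (simp add: blinfun.bilinear_simps)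
  show "pos_root A o\<^sub>L pos_root A = A"
  proof (rule blinfun_eqI)
    fix x
    have "(pos_root A o\<^sub>L pos_root A) x = (1 + norm A) *\<^sub>R (x - 2 *\<^sub>R ?Y x + ?Y (?Y x))"
      using c by (simp add: pos_root_def blinfun.bilinear_simps algebra_simps scaleR_2)
    also have "\<dots> = (1 + norm A) *\<^sub>R (x - op_scale A x)" by (simp add: fp)
    also have "\<dots> = A x" using c by (simp add: op_scale_def blinfun.bilinear_simps)
    finally show "(pos_root A o\<^sub>L pos_root A) x = A x" .
  qed
  fix B assume AB: "A o\<^sub>L B = B o\<^sub>L A"
  have "A (B x) = B (A x)" for x using AB by (metis blinfun_apply_blinfun_compose)
  then have "op_scale A o\<^sub>L B = B o\<^sub>L op_scale A"
    by (intro blinfun_eqI) (simp add: op_scale_def blinfun.bilinear_simps)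
  from root_limit_commute[OF T(2) this]
  have "?Y (B x) = B (?Y x)" for x by (metis blinfun_apply_blinfun_compose)
  then show "pos_root A o\<^sub>L B = B o\<^sub>L pos_root A"
    by (intro blinfun_eqI) (simp add: pos_root_def blinfun.bilinear_simps)
qed

text \<open>A competitor \<open>R\<close> commutes with \<open>A\<close>, hence with the root
  \<open>P\<close>. For \<open>d = R - P\<close> this gives
  \<open>(R + P) d = R R - P P = 0\<close>; both non-negative forms then vanish on the range of
  \<open>d\<close>, so \<open>R d = P d = 0\<close> and \<open>d d = 0\<close>. As \<open>d\<close>
  is self-adjoint, \<open>d = 0\<close>.\<close>

lemma pos_root_unique:
  fixes A R :: "'a::{real_inner,banach} \<Rightarrow>\<^sub>L 'a"
  assumes A: "self_adjoint A" "nonneg_definite A"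
    and R: "self_adjoint R" "nonneg_definite R" "R o\<^sub>L R = A"
  shows "R = pos_root A"
proof (rule blinfun_eqI)
  fix x
  let ?P = "pos_root A"
  note P = pos_root_props[OF A]
  have "A o\<^sub>L R = R o\<^sub>L A" unfolding R(3)[symmetric] by (intro blinfun_eqI) simp
  then have com: "?P (R x) = R (?P x)" for x using P(4) by (metis blinfun_apply_blinfun_compose)
  have sq: "R (R x) = ?P (?P x)" for x using R(3) P(3) by (metis blinfun_apply_blinfun_compose)
  define d where "d x = R x - ?P x" for x
  have d_sa: "d x \<bullet> y = x \<bullet> d y" for x y
    using R(1) P(1) by (simp add: d_def inner_diff_left inner_diff_right self_adjoint_def)
  have "R (d x) + ?P (d x) = 0" for x by (simp add: d_def blinfun.bilinear_simps com sq)
  then have "R (d x) \<bullet> d x + ?P (d x) \<bullet> d x = 0" for x by (metis inner_add_left inner_zero_left)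
  then have "R (d x) \<bullet> d x = 0 \<and> ?P (d x) \<bullet> d x = 0" for x
    using R(2) P(2) unfolding nonneg_definite_def by (metis add_nonneg_eq_0_iff)
  then have "R (d x) = 0" "?P (d x) = 0" for x
    using nonneg_definite_kernel[OF R(1,2)] nonneg_definite_kernel[OF P(1,2)] by blast+
  then have "d (d x) = 0" for x by (simp add: d_def[of "d x"])
  then have "d x \<bullet> d x = 0" using d_sa[of "d x" x] by (metis inner_zero_left)
  then show "R x = ?P x" by (simp add: d_def)
qed

lemma sqrt_op_eq_pos_root:
  fixes A :: "'a::{real_inner,banach} \<Rightarrow>\<^sub>L 'a"
  assumes A: "self_adjoint A" "nonneg_definite A"
  shows "sqrt_op A = pos_root A"
  unfolding sqrt_op_def
proof (rule the_equality)
  show "self_adjoint (pos_root A) \<and> nonneg_definite (pos_root A) \<and> pos_root A o\<^sub>L pos_root A = A"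
    using pos_root_props(1-3)[OF A] by blast
  show "R = pos_root A" if "self_adjoint R \<and> nonneg_definite R \<and> R o\<^sub>L R = A" for R
    using that pos_root_unique[OF A] by blast
qed

lemma sqrt_op_props:
  fixes A :: "'a::{real_inner,banach} \<Rightarrow>\<^sub>L 'a"
  assumes A: "self_adjoint A" "nonneg_definite A"
  shows "self_adjoint (sqrt_op A)" "nonneg_definite (sqrt_op A)" "sqrt_op A o\<^sub>L sqrt_op A = A"
  using pos_root_props(1-3)[OF A] by (simp_all only: sqrt_op_eq_pos_root[OF A])

lemma continuous_on_inner_apply:
  "continuous_on UNIV (\<lambda>A :: 'a::real_inner \<Rightarrow>\<^sub>L 'b::real_inner. A x \<bullet> y)"
  "continuous_on UNIV (\<lambda>A :: 'a::real_inner \<Rightarrow>\<^sub>L 'b::real_inner. y \<bullet> A x)"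
  by (intro continuous_on_inner blinfun.continuous_on continuous_on_id continuous_on_const)+

lemma closed_nonneg_self_adjoint:
  "closed {A :: 'a::real_inner \<Rightarrow>\<^sub>L 'a. self_adjoint A \<and> nonneg_definite A}"
proof -
  have "closed {A :: 'a \<Rightarrow>\<^sub>L 'a. A x \<bullet> y = x \<bullet> A y}" for x y
    by (rule closed_Collect_eq[OF continuous_on_inner_apply])
  moreover have "closed {A :: 'a \<Rightarrow>\<^sub>L 'a. 0 \<le> A x \<bullet> x}" for x
    by (rule closed_Collect_le[OF continuous_on_const continuous_on_inner_apply(1)])
  ultimately show ?thesis
    unfolding self_adjoint_def nonneg_definite_def
    by (intro closed_Collect_conj closed_Collect_all) auto
qed

text \<open>Off the cone of self-adjoint non-negative operators \<^const>\<open>sqrt_op\<close> is the constant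
  \<open>THE R. False\<close>, hence measurable there too.\<close>

lemma measurable_sqrt_op [measurable]:
  "(sqrt_op :: ('a::{real_inner,banach} \<Rightarrow>\<^sub>L 'a) \<Rightarrow> _) \<in> borel_measurable borel"
proof -
  define P :: "('a \<Rightarrow>\<^sub>L 'a) set" where "P = {A. self_adjoint A \<and> nonneg_definite A}"
  define J :: "'a \<Rightarrow>\<^sub>L 'a" where "J = (THE R. False)"
  have "closed P"
    unfolding P_def by (rule closed_nonneg_self_adjoint)
  then have [measurable]: "P \<in> sets borel" by simp
  have J: "sqrt_op A = J" if "A \<notin> P" for A
  proof -
    \<comment> \<open>The square of a self-adjoint operator is self-adjoint and non-negative, so
      outside \<open>P\<close> no candidate root exists and \<open>THE\<close> is applied to the
      empty predicate.\<close>
    have "R o\<^sub>L R \<noteq> A" if "self_adjoint R" for R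
    proof
      assume "R o\<^sub>L R = A"
      then have "A x \<bullet> y = R x \<bullet> R y" "x \<bullet> A y = R x \<bullet> R y" for x y
        using that by (auto simp: self_adjoint_def)
      then have "A \<in> P" by (auto simp: P_def self_adjoint_def nonneg_definite_def)
      with \<open>A \<notin> P\<close> show False ..
    qed
    then have "(\<lambda>R. self_adjoint R \<and> nonneg_definite R \<and> R o\<^sub>L R = A) = (\<lambda>_. False)" by blast
    then show ?thesis by (simp add: sqrt_op_def J_def)
  qed
  \<comment> \<open>Each \<open>G n\<close> is given by a continuous formula on the closed set
    \<open>P\<close> and is constant off it, hence Borel; so is the pointwise limit.\<close>
  define G where "G n A = (if A \<in> P then sqrt (1 + norm A) *\<^sub>R (id_blinfun - root_iter (op_scale A) n) else J)"
    for n A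
  have ci: "continuous_on UNIV (\<lambda>A :: 'a \<Rightarrow>\<^sub>L 'a. root_iter (op_scale A) n)" for n
  proof (induction n)
    case (Suc n)
    have "continuous_on UNIV (\<lambda>A :: 'a \<Rightarrow>\<^sub>L 'a. op_scale A)"
      unfolding op_scale_def
      by (intro continuous_intros) (simp add: add_nonneg_eq_0_iff)
    then show ?case unfolding root_iter.simps
      by (intro continuous_intros bounded_bilinear.continuous_on[OF bounded_bilinear_blinfun_compose] Suc)
  qed simp
  have "G n \<in> borel_measurable borel" for n
    unfolding G_def
    by (intro measurable_If borel_measurable_continuous_onI continuous_intros ci) auto
  then show ?thesis
  proof (rule borel_measurable_LIMSEQ_metric)
    fix A :: "'a \<Rightarrow>\<^sub>L 'a"
    show "(\<lambda>n. G n A) \<longlonglongrightarrow> sqrt_op A"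
    proof (cases "A \<in> P")
      case True
      then have "sqrt_op A = pos_root A" "norm (op_scale A) \<le> 1"
        by (auto simp: P_def sqrt_op_eq_pos_root norm_op_scale_le)
      then show ?thesis using True by (auto simp: G_def pos_root_def intro!: tendsto_intros root_iter_tendsto)
    next
      case False then show ?thesis by (simp add: G_def J)
    qed
  qed
qed

section \<open>Hilbert-Schmidt norms\<close>

abbreviation basis_space :: "'a::{real_inner,second_countable_topology} measure" where
  "basis_space \<equiv> count_space hilbert_basis"

lemma sum_le_nn_integral_count_space:
  fixes f :: "'a \<Rightarrow> ennreal"
  assumes "finite F" "F \<subseteq> A"
  shows "sum f F \<le> (\<integral>\<^sup>+x. f x \<partial>count_space A)"
proof -
  have "sum f F = (\<Sum>x\<in>F. f x * indicator F x)" by (intro sum.cong) auto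
  also have "\<dots> = (\<integral>\<^sup>+x. f x * indicator F x \<partial>count_space A)"
    using assms by (subst nn_integral_count_space'[of F A]) auto
  also have "\<dots> \<le> (\<integral>\<^sup>+x. f x \<partial>count_space A)"
    by (intro nn_integral_mono) (auto split: split_indicator)
  finally show ?thesis .
qed

text \<open>Sums in \<open>ennreal\<close> become integrals over a counting measure, so that
  Tonelli, monotonicity and measurability of integrals are available for Hilbert-Schmidt norms.
  Countability reduces finite subsets to initial segments of an enumeration.\<close>

lemma nn_integral_count_space_eq_infsum:
  fixes f :: "'a \<Rightarrow> ennreal"
  assumes "countable A"
  shows "(\<integral>\<^sup>+x. f x \<partial>count_space A) = infsum f A"
proof -
  have "infsum f A = (SUP F\<in>{F. finite F \<and> F \<subseteq> A}. sum f F)"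
    by (rule nonneg_infsum_complete) simp
  also have "\<dots> = (\<integral>\<^sup>+x. f x \<partial>count_space A)"
  proof (rule antisym)
    show "(SUP F\<in>{F. finite F \<and> F \<subseteq> A}. sum f F) \<le> (\<integral>\<^sup>+x. f x \<partial>count_space A)"
      by (rule SUP_least) (auto intro: sum_le_nn_integral_count_space)
    show "(\<integral>\<^sup>+x. f x \<partial>count_space A) \<le> (SUP F\<in>{F. finite F \<and> F \<subseteq> A}. sum f F)"
    proof (cases "finite A")
      case True
      then show ?thesis by (subst nn_integral_count_space_finite) (auto intro!: SUP_upper)
    next
      case False
      have bij: "bij_betw (from_nat_into A) UNIV A" using assms False by (rule bij_betw_from_nat_into)
      have "(\<integral>\<^sup>+x. f x \<partial>count_space A) = (\<Sum>i. f (from_nat_into A i))"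
        by (simp add: nn_integral_bij_count_space[OF bij, symmetric] nn_integral_count_space_nat)
      also have "\<dots> = (SUP n. \<Sum>i<n. f (from_nat_into A i))" by (rule suminf_eq_SUP) 
      also have "\<dots> \<le> (SUP F\<in>{F. finite F \<and> F \<subseteq> A}. sum f F)"
      proof (rule SUP_least)
        fix n
        have "(\<Sum>i<n. f (from_nat_into A i)) = sum f (from_nat_into A ` {..<n})"
          using bij by (subst sum.reindex) (auto simp: bij_betw_def inj_on_def)
        also have "\<dots> \<le> (SUP F\<in>{F. finite F \<and> F \<subseteq> A}. sum f F)"
          using bij by (intro SUP_upper) (auto simp: bij_betw_def)
        finally show "(\<Sum>i<n. f (from_nat_into A i)) \<le> (SUP F\<in>{F. finite F \<and> F \<subseteq> A}. sum f F)" .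
      qed
      finally show ?thesis .
    qed
  qed
  finally show ?thesis by simp
qed

lemma hs_norm_sq_nn_integral: "hs_norm_sq A = (\<integral>\<^sup>+e. ennreal ((norm (A e))\<^sup>2) \<partial>basis_space)"
  unfolding hs_norm_sq_def by (rule nn_integral_count_space_eq_infsum[OF countable_hilbert_basis, symmetric])

lemma ennreal_has_sum_basis:
  fixes f :: "'a::{real_inner,second_countable_topology} \<Rightarrow> real"
  assumes "\<And>e. e \<in> hilbert_basis \<Longrightarrow> 0 \<le> f e" "(f has_sum s) hilbert_basis"
  shows "(\<integral>\<^sup>+e. ennreal (f e) \<partial>basis_space) = ennreal s"
proof -
  have s: "f summable_on hilbert_basis" "infsum f hilbert_basis = s"
    using assms(2) by (auto simp: has_sum_iff)
  have "(\<integral>\<^sup>+e. ennreal (f e) \<partial>basis_space) = (SUP F\<in>{F. finite F \<and> F \<subseteq> hilbert_basis}. \<Sum>e\<in>F. ennreal (f e))"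
    by (simp add: nn_integral_count_space_eq_infsum[OF countable_hilbert_basis] nonneg_infsum_complete)
  also have "\<dots> = (SUP F\<in>{F. finite F \<and> F \<subseteq> hilbert_basis}. ennreal (sum f F))"
    using assms(1) by (intro SUP_cong refl sum_ennreal) (auto simp: subset_iff)
  also have "\<dots> = ennreal s"
    using infsum_nonneg_is_SUPREMUM_ennreal[OF s(1) assms(1)] s(2) by simp
  finally show ?thesis .
qed

lemma parseval_nn_integral:
  "(\<integral>\<^sup>+e. ennreal ((x \<bullet> e)\<^sup>2) \<partial>basis_space) = ennreal ((norm x)\<^sup>2)"
  by (rule ennreal_has_sum_basis[OF _ parseval_norm]) simp

lemma nn_integral_basis_swap:
  assumes "\<And>e. e \<in> hilbert_basis \<Longrightarrow> f e \<in> borel_measurable M"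
  shows "(\<integral>\<^sup>+x. \<integral>\<^sup>+e. f e x \<partial>basis_space \<partial>M) = (\<integral>\<^sup>+e. \<integral>\<^sup>+x. f e x \<partial>M \<partial>basis_space)"
  using countable_hilbert_basis assms by (rule nn_integral_count_space_nn_integral)

text \<open>The sum of all squared matrix coefficients is symmetric in domain and codomain; this is
  what makes the norm invariant under adjoints.\<close>

lemma hs_norm_sq_double:
  fixes A :: "'a::{real_inner,second_countable_topology} \<Rightarrow>\<^sub>L 'b::{real_inner,second_countable_topology}"
  shows "hs_norm_sq A = (\<integral>\<^sup>+e. \<integral>\<^sup>+f. ennreal ((A e \<bullet> f)\<^sup>2) \<partial>basis_space \<partial>basis_space)"
  by (simp add: hs_norm_sq_nn_integral parseval_nn_integral)

lemma hs_norm_sq_adj_op: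
  fixes A :: "'a::{real_inner,banach,second_countable_topology} \<Rightarrow>\<^sub>L 'b::{real_inner,second_countable_topology}"
  shows "hs_norm_sq (adj_op A) = hs_norm_sq A"
proof -
  have "adj_op A x \<bullet> y = A y \<bullet> x" for x y by (metis inner_adj_op' inner_commute)
  then show ?thesis unfolding hs_norm_sq_double by (subst nn_integral_basis_swap) simp_all
qed

lemma hs_norm_sq_compose_left:
  "hs_norm_sq (B o\<^sub>L A) \<le> ennreal ((norm B)\<^sup>2) * hs_norm_sq A"
proof -
  have "hs_norm_sq (B o\<^sub>L A) \<le> (\<integral>\<^sup>+e. ennreal ((norm B)\<^sup>2) * ennreal ((norm (A e))\<^sup>2) \<partial>basis_space)"
    unfolding hs_norm_sq_nn_integral
    by (intro nn_integral_mono)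
      (auto simp: ennreal_mult[symmetric] power_mult_distrib[symmetric] intro!: ennreal_leI power_mono norm_blinfun)
  then show ?thesis by (simp add: nn_integral_cmult hs_norm_sq_nn_integral)
qed

lemma hs_norm_sq_compose_right:
  fixes A :: "'a::{real_inner,banach,second_countable_topology} \<Rightarrow>\<^sub>L 'b::{real_inner,banach,second_countable_topology}"
    and B :: "'c::{real_inner,banach,second_countable_topology} \<Rightarrow>\<^sub>L 'a"
  shows "hs_norm_sq (A o\<^sub>L B) \<le> ennreal ((norm B)\<^sup>2) * hs_norm_sq A"
proof -
  have "hs_norm_sq (A o\<^sub>L B) = hs_norm_sq (adj_op B o\<^sub>L adj_op A)"
    by (simp add: adj_op_compose[symmetric] hs_norm_sq_adj_op)
  also have "\<dots> \<le> ennreal ((norm (adj_op B))\<^sup>2) * hs_norm_sq (adj_op A)" by (rule hs_norm_sq_compose_left)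
  also have "\<dots> \<le> ennreal ((norm B)\<^sup>2) * hs_norm_sq A"
    by (auto simp: hs_norm_sq_adj_op intro!: mult_right_mono ennreal_leI power_mono norm_adj_op_le)
  finally show ?thesis .
qed

lemma norm_sq_add_le: "(norm (x + y))\<^sup>2 \<le> 2 * (norm x)\<^sup>2 + 2 * (norm (y::'a::real_normed_vector))\<^sup>2"
proof -
  have "(norm (x + y))\<^sup>2 \<le> (norm x + norm y)\<^sup>2" by (intro power_mono norm_triangle_ineq) auto
  also have "\<dots> \<le> 2 * (norm x)\<^sup>2 + 2 * (norm y)\<^sup>2"
    using sum_squares_bound[of "norm x" "norm y"] by (simp add: power2_sum)
  finally show ?thesis .
qed

lemma ennreal_norm_sq_add_le:
  "ennreal ((norm (x + y))\<^sup>2) \<le> 2 * ennreal ((norm x)\<^sup>2) + 2 * ennreal ((norm (y::'a::real_normed_vector))\<^sup>2)"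
proof -
  have "ennreal ((norm (x + y))\<^sup>2) \<le> ennreal (2 * (norm x)\<^sup>2 + 2 * (norm y)\<^sup>2)"
    by (intro ennreal_leI norm_sq_add_le)
  then show ?thesis by (simp add: ennreal_mult)
qed

lemma hs_norm_sq_add_le: "hs_norm_sq (A + B) \<le> 2 * hs_norm_sq A + 2 * hs_norm_sq B"
proof -
  have "hs_norm_sq (A + B) \<le>
      (\<integral>\<^sup>+e. 2 * ennreal ((norm (A e))\<^sup>2) + 2 * ennreal ((norm (B e))\<^sup>2) \<partial>basis_space)"
    unfolding hs_norm_sq_nn_integral
    by (intro nn_integral_mono) (simp add: blinfun.bilinear_simps ennreal_norm_sq_add_le)
  then show ?thesis by (simp add: nn_integral_add nn_integral_cmult hs_norm_sq_nn_integral)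
qed

lemma hs_norm_sq_uminus: "hs_norm_sq (- A) = hs_norm_sq A"
  by (simp add: hs_norm_sq_nn_integral blinfun.bilinear_simps)

lemma hilbert_schmidt_iff: "hilbert_schmidt A \<longleftrightarrow> hs_norm_sq A < \<top>"
proof
  assume "hilbert_schmidt A"
  then have "((\<lambda>e. (norm (A e))\<^sup>2) has_sum (\<Sum>\<^sub>\<infinity>e\<in>hilbert_basis. (norm (A e))\<^sup>2)) hilbert_basis"
    by (simp add: hilbert_schmidt_def)
  from ennreal_has_sum_basis[OF _ this] show "hs_norm_sq A < \<top>"
    by (simp add: hs_norm_sq_nn_integral)
next
  assume fin: "hs_norm_sq A < \<top>"
  define K where "K = enn2real (hs_norm_sq A)"
  have "(\<Sum>e\<in>F. (norm (A e))\<^sup>2) \<le> K" if F: "finite F" "F \<subseteq> hilbert_basis" for F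
  proof -
    have "ennreal (\<Sum>e\<in>F. (norm (A e))\<^sup>2) \<le> hs_norm_sq A"
      unfolding hs_norm_sq_nn_integral using sum_le_nn_integral_count_space[OF F, of "\<lambda>e. ennreal ((norm (A e))\<^sup>2)"]
      by (simp add: sum_ennreal)
    also have "\<dots> = ennreal K" using fin by (simp add: K_def)
    finally show ?thesis by (simp add: ennreal_le_iff K_def)
  qed
  then show "hilbert_schmidt A"
    unfolding hilbert_schmidt_def by (intro nonneg_bdd_above_summable_on) (auto intro!: bdd_aboveI2)
qed

text \<open>Parseval expands the left side into the sum of \<open>(y \<bullet> A e)\<^sup>2\<close>,
  and Cauchy-Schwarz applies termwise. The bound transfers Hilbert-Schmidt convergence to the
  vectors \<open>sqrt_op Q (adj_op (\<Psi> s \<omega>) h)\<close> that determine the conditional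
  variances.\<close>

lemma norm_adj_op_apply_le_hs:
  fixes A :: "'a::{real_inner,banach,second_countable_topology} \<Rightarrow>\<^sub>L 'b::{real_inner,second_countable_topology}"
  shows "ennreal ((norm (adj_op A y))\<^sup>2) \<le> ennreal ((norm y)\<^sup>2) * hs_norm_sq A"
proof -
  have "ennreal ((norm (adj_op A y))\<^sup>2) = (\<integral>\<^sup>+e. ennreal ((y \<bullet> A e)\<^sup>2) \<partial>basis_space)"
    by (simp add: parseval_nn_integral[symmetric] inner_adj_op')
  also have "\<dots> \<le> (\<integral>\<^sup>+e. ennreal ((norm y)\<^sup>2) * ennreal ((norm (A e))\<^sup>2) \<partial>basis_space)"
    by (intro nn_integral_mono)
      (auto simp: ennreal_mult[symmetric] power_mult_distrib[symmetric] abs_le_square_iff[symmetric] Cauchy_Schwarz_ineq2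
        intro!: ennreal_leI)
  finally show ?thesis by (simp add: nn_integral_cmult hs_norm_sq_nn_integral)
qed

lemma norm_hs_op_eq_hs_norm_sq: "ennreal ((norm T)\<^sup>2) = hs_norm_sq (op_of_hs T)"
proof -
  have "((\<lambda>e. (norm (op_of_hs T e))\<^sup>2) has_sum (\<Sum>\<^sub>\<infinity>e\<in>hilbert_basis. (norm (op_of_hs T e))\<^sup>2)) hilbert_basis"
    using hilbert_schmidt_op_of_hs[of T] by (simp add: hilbert_schmidt_def)
  from ennreal_has_sum_basis[OF _ this] show ?thesis
    by (simp add: norm_hs_op_eq hs_norm_sq_nn_integral infsum_nonneg)
qed

context
  fixes Q :: "'a::{real_inner,banach,second_countable_topology} \<Rightarrow>\<^sub>L 'a"
  assumes Q: "trace_class_nonneg Q"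
begin

lemma trace_class_sqrt:
  "self_adjoint (sqrt_op Q)" "sqrt_op Q o\<^sub>L sqrt_op Q = Q"
  using Q by (auto simp: trace_class_nonneg_def sqrt_op_props)

lemma trace_class_inner: "Q x \<bullet> y = sqrt_op Q x \<bullet> sqrt_op Q y"
proof -
  have "Q x \<bullet> y = sqrt_op Q (sqrt_op Q x) \<bullet> y" using trace_class_sqrt(2) by (metis blinfun_apply_blinfun_compose)
  also have "\<dots> = sqrt_op Q x \<bullet> sqrt_op Q y" using trace_class_sqrt(1) unfolding self_adjoint_def by blast
  finally show ?thesis .
qed

lemma hs_norm_sq_sqrt_finite: "hs_norm_sq (sqrt_op Q) < \<top>"
proof -
  have "((\<lambda>e. Q e \<bullet> e) has_sum (\<Sum>\<^sub>\<infinity>e\<in>hilbert_basis. Q e \<bullet> e)) hilbert_basis"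
    using Q by (simp add: trace_class_nonneg_def)
  then have "((\<lambda>e. (norm (sqrt_op Q e))\<^sup>2) has_sum (\<Sum>\<^sub>\<infinity>e\<in>hilbert_basis. Q e \<bullet> e)) hilbert_basis"
    by (simp add: trace_class_inner dot_square_norm)
  from ennreal_has_sum_basis[OF _ this] show ?thesis by (simp add: hs_norm_sq_nn_integral)
qed

lemma adj_op_sqrt_trace_class: "adj_op (sqrt_op Q) = sqrt_op Q"
  using trace_class_sqrt(1) by (simp add: self_adjoint_adj_op)

text \<open>Passing to the adjoint gives the trace of
  \<open>A o\<^sub>L Q o\<^sub>L adj_op A\<close> over a basis of the codomain. In this form the
  norm is a sum of the scalar variances that occur in the bilinear isometry.\<close>

lemma hs_norm_sq_compose_sqrt:
  fixes A :: "'a \<Rightarrow>\<^sub>L 'b::{real_inner,banach,second_countable_topology}"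
  shows "hs_norm_sq (A o\<^sub>L sqrt_op Q) = (\<integral>\<^sup>+f. ennreal (Q (adj_op A f) \<bullet> adj_op A f) \<partial>basis_space)"
proof -
  have "hs_norm_sq (A o\<^sub>L sqrt_op Q) = hs_norm_sq (sqrt_op Q o\<^sub>L adj_op A)"
    using hs_norm_sq_adj_op[of "A o\<^sub>L sqrt_op Q"] by (simp add: adj_op_compose adj_op_sqrt_trace_class)
  then show ?thesis by (simp add: hs_norm_sq_nn_integral trace_class_inner dot_square_norm)
qed

lemma hs_norm_sq_compose_sqrt_finite:
  fixes A :: "'a \<Rightarrow>\<^sub>L 'b::{real_inner,banach,second_countable_topology}"
  shows "hs_norm_sq (A o\<^sub>L sqrt_op Q) < \<top>"
  by (rule le_less_trans[OF hs_norm_sq_compose_left]) (simp add: ennreal_mult_less_top hs_norm_sq_sqrt_finite)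

end

section \<open>Measurability by coordinates\<close>

lemma borel_measurable_nn_integral_basis:
  assumes "\<And>e. e \<in> hilbert_basis \<Longrightarrow> f e \<in> borel_measurable M"
  shows "(\<lambda>x. \<integral>\<^sup>+e. f e x \<partial>basis_space) \<in> borel_measurable M"
proof -
  interpret sigma_finite_measure basis_space
    by (rule sigma_finite_measure_count_space_countable[OF countable_hilbert_basis])
  have "(\<lambda>(e, x). f e x) \<in> borel_measurable (basis_space \<Otimes>\<^sub>M M)"
    using assms by (intro measurable_pair_measure_countable1 countable_hilbert_basis) auto
  then have "(\<lambda>(x, e). f e x) \<in> borel_measurable (M \<Otimes>\<^sub>M basis_space)"
    by (subst measurable_pair_swap_iff) (simp add: case_prod_beta)
  then show ?thesis by (rule borel_measurable_nn_integral)
qed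

text \<open>The sum is a limit along all finite subsets. Countability of the basis yields the
  cofinal sequence \<open>B n\<close>, and limits of sequences preserve measurability.\<close>

lemma measurable_has_sum_basis:
  fixes s :: "'w \<Rightarrow> 'b::{real_normed_vector,second_countable_topology}"
    and f :: "'c::{real_inner,second_countable_topology} \<Rightarrow> 'w \<Rightarrow> 'b"
  assumes f: "\<And>e. e \<in> hilbert_basis \<Longrightarrow> f e \<in> borel_measurable M"
    and s: "\<And>w. w \<in> space M \<Longrightarrow> ((\<lambda>e. f e w) has_sum s w) hilbert_basis"
  shows "s \<in> borel_measurable M"
proof -
  define B where "B n = {e \<in> (hilbert_basis :: 'c set). to_nat_on hilbert_basis e < n}" for n
  have inj: "inj_on (to_nat_on hilbert_basis) hilbert_basis"
    using countable_hilbert_basis by (rule inj_on_to_nat_on)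
  have finB: "finite (B n)" for n
  proof (rule finite_imageD)
    show "finite (to_nat_on hilbert_basis ` B n)"
      by (rule finite_subset[of _ "{..<n}"]) (auto simp: B_def)
    show "inj_on (to_nat_on hilbert_basis) (B n)" using inj by (rule inj_on_subset) (auto simp: B_def)
  qed
  have "filterlim B (finite_subsets_at_top hilbert_basis) sequentially"
    unfolding filterlim_finite_subsets_at_top
  proof (intro allI impI)
    fix X :: "'c set" assume X: "finite X \<and> X \<subseteq> hilbert_basis"
    obtain N where N: "to_nat_on hilbert_basis ` X \<subseteq> {..<N}"
      using X finite_nat_iff_bounded[of "to_nat_on hilbert_basis ` X"] by auto
    show "\<forall>\<^sub>F n in sequentially. finite (B n) \<and> X \<subseteq> B n \<and> B n \<subseteq> hilbert_basis"
      using eventually_ge_at_top[of N]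
      by eventually_elim (use X N finB in \<open>auto simp: B_def\<close>)
  qed
  then have lim: "(\<lambda>n. \<Sum>e\<in>B n. f e w) \<longlonglongrightarrow> s w" if "w \<in> space M" for w
    using s[OF that] unfolding has_sum_def by (rule filterlim_compose[rotated])
  show ?thesis
  proof (rule borel_measurable_LIMSEQ_metric[OF _ lim])
    show "(\<lambda>w. \<Sum>e\<in>B n. f e w) \<in> borel_measurable M" for n
      by (rule borel_measurable_sum) (auto simp: B_def f)
  qed
qed

lemma measurable_basis_coordinates:
  fixes X :: "'w \<Rightarrow> 'a::{real_inner,second_countable_topology}"
  assumes "\<And>e. e \<in> hilbert_basis \<Longrightarrow> (\<lambda>w. X w \<bullet> e) \<in> borel_measurable M"
  shows "X \<in> borel_measurable M"
  by (rule measurable_has_sum_basis[OF _ hilbert_basis_expansion]) (auto intro!: assms borel_measurable_scaleR)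

text \<open>Inner products with a fixed \<open>b\<close> are determined by matrix coefficients:
  Parseval expands each \<open>op_of_hs (X w) e \<bullet> op_of_hs b e\<close>, and the results are
  summed over \<open>e\<close>. This is what makes sets of matrix coefficients generate the Borel
  algebra.\<close>

lemma measurable_hs_coordinates:
  fixes X :: "'w \<Rightarrow> 'a::{real_inner,banach,second_countable_topology} hs_op"
  assumes "\<And>e f. e \<in> hilbert_basis \<Longrightarrow> f \<in> hilbert_basis \<Longrightarrow> (\<lambda>w. op_of_hs (X w) e \<bullet> f) \<in> borel_measurable M"
  shows "X \<in> borel_measurable M"
proof (rule measurable_basis_coordinates)
  fix b :: "'a hs_op"
  have 1: "(\<lambda>w. op_of_hs (X w) e \<bullet> op_of_hs b e) \<in> borel_measurable M" if "e \<in> hilbert_basis" for e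
    by (rule measurable_has_sum_basis[OF _ parseval_inner]) (auto intro!: assms that borel_measurable_times)
  have "((\<lambda>e. op_of_hs (X w) e \<bullet> op_of_hs b e) has_sum (X w \<bullet> b)) hilbert_basis" for w
    using hilbert_schmidt_inner_summable[OF hilbert_schmidt_op_of_hs hilbert_schmidt_op_of_hs, of "X w" b]
    by (simp add: inner_hs_op.rep_eq)
  with 1 show "(\<lambda>w. X w \<bullet> b) \<in> borel_measurable M" by (rule measurable_has_sum_basis)
qed

text \<open>Measurability vector by vector suffices, because the norm evaluates the operator only at
  the countably many vectors \<open>R e\<close>.\<close>

lemma measurable_hs_norm_sq_compose:
  fixes \<Psi> :: "'w \<Rightarrow> 'a::{real_inner,second_countable_topology} \<Rightarrow>\<^sub>L 'b::{real_inner,second_countable_topology}"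
  assumes "\<And>x. (\<lambda>w. \<Psi> w x) \<in> borel_measurable M"
  shows "(\<lambda>w. hs_norm_sq (\<Psi> w o\<^sub>L R)) \<in> borel_measurable M"
  unfolding hs_norm_sq_nn_integral
  using assms by (intro borel_measurable_nn_integral_basis) simp

section \<open>Operator exponentials on the positive cone\<close>

abbreviation op_power :: "('a::real_normed_vector \<Rightarrow>\<^sub>L 'a) \<Rightarrow> nat \<Rightarrow> 'a \<Rightarrow>\<^sub>L 'a" where
  "op_power A n \<equiv> ((o\<^sub>L) A ^^ n) id_blinfun"

lemma norm_compose_funpow_le: "norm (op_power A n) \<le> norm A ^ n"
proof (induction n)
  case 0 show ?case using norm_blinfun_id_le by simp
next
  case (Suc n)
  have "norm (A o\<^sub>L op_power A n) \<le> norm A * norm (op_power A n)"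
    by (rule norm_blinfun_compose)
  also have "\<dots> \<le> norm A * norm A ^ n" by (intro mult_left_mono Suc) simp
  finally show ?case by simp
qed

lemma summable_norm_power_fact: "summable (\<lambda>n. (r::real) ^ n /\<^sub>R fact n)"
  using sums_summable[OF exp_converges[of r]] by simp

lemma exp_op_sums:
  fixes A :: "'a::banach \<Rightarrow>\<^sub>L 'a"
  shows "(\<lambda>n. (op_power A n) /\<^sub>R fact n) sums exp_op A"
  unfolding exp_op_def
proof (rule summable_sums, rule summable_comparison_test[OF _ summable_norm_power_fact[of "norm A"]], intro exI allI impI)
  fix n
  show "norm ((op_power A n) /\<^sub>R fact n) \<le> norm A ^ n /\<^sub>R fact n"
    using norm_compose_funpow_le[of n A] by (auto intro!: mult_left_mono)
qed

lemma exp_op_apply_sums: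
  fixes A :: "'a::banach \<Rightarrow>\<^sub>L 'a"
  shows "(\<lambda>n. ((blinfun_apply A ^^ n) x) /\<^sub>R fact n) sums exp_op A x"
proof -
  have "(op_power A n) x = (blinfun_apply A ^^ n) x" for n
    by (induction n) auto
  then show ?thesis
    using bounded_linear.sums[OF blinfun.bounded_linear_left exp_op_sums[of A], of x] by (simp add: blinfun.bilinear_simps)
qed

lemma funpow_scaleR_blinfun:
  "op_power (s *\<^sub>R C) n = s ^ n *\<^sub>R op_power C n"
  by (induction n) (auto intro!: blinfun_eqI simp: blinfun.bilinear_simps)

lemma continuous_on_exp_op:
  fixes C :: "'a::banach \<Rightarrow>\<^sub>L 'a"
  shows "continuous_on {0..K} (\<lambda>s. exp_op (s *\<^sub>R C))"
proof -
  define f where "f n s = (op_power (s *\<^sub>R C) n) /\<^sub>R fact n" for n s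
  have "uniform_limit {0..K} (\<lambda>n s. \<Sum>i<n. f i s) (\<lambda>s. \<Sum>i. f i s) sequentially"
  proof (rule Weierstrass_m_test[OF _ summable_norm_power_fact[of "K * norm C"]])
    fix n s assume s: "s \<in> {0..K}"
    have "norm (f n s) \<le> (norm (s *\<^sub>R C)) ^ n /\<^sub>R fact n"
      unfolding f_def using norm_compose_funpow_le[of n "s *\<^sub>R C"] by (auto intro!: mult_left_mono)
    also have "\<dots> \<le> (K * norm C) ^ n /\<^sub>R fact n"
      using s by (intro scaleR_left_mono power_mono) (auto intro!: mult_right_mono)
    finally show "norm (f n s) \<le> (K * norm C) ^ n /\<^sub>R fact n" .
  qed
  moreover have "continuous_on {0..K} (\<lambda>s. \<Sum>i<n. f i s)" for n
    unfolding f_def funpow_scaleR_blinfun by (intro continuous_intros)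
  ultimately have "continuous_on {0..K} (\<lambda>s. \<Sum>i. f i s)"
    by (intro uniform_limit_theorem[where F = sequentially]) auto
  then show ?thesis by (simp add: f_def exp_op_def)
qed

lemma bounded_linear_op_of_hs: "bounded_linear op_of_hs"
  by (rule bounded_linear_intro[of _ 1])
    (auto simp: plus_hs_op.rep_eq scaleR_hs_op.rep_eq norm_op_of_hs_le)

lemma bounded_linear_hs_inner: "bounded_linear (\<lambda>T. op_of_hs T x \<bullet> y)"
  by (rule bounded_linear_compose[OF bounded_linear_inner_left
        bounded_linear_compose[OF blinfun.bounded_linear_left bounded_linear_op_of_hs]])

text \<open>The self-adjoint part of \<open>hs_cone\<close>. Over the reals this is the cone on
  which the quadratic form controls the operator and \<open>sqrt_op\<close> is a true root.\<close>

definition pos_cone :: "'a::{real_inner,banach,second_countable_topology} hs_op set" where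
  "pos_cone = {T. self_adjoint (op_of_hs T) \<and> nonneg_definite (op_of_hs T)}"

lemma closed_pos_cone: "closed pos_cone"
  using continuous_closed_vimage[OF closed_nonneg_self_adjoint] linear_continuous_at[OF bounded_linear_op_of_hs]
  by (auto simp: pos_cone_def vimage_def)

lemma pos_cone_add: "S \<in> pos_cone \<Longrightarrow> T \<in> pos_cone \<Longrightarrow> S + T \<in> pos_cone"
  by (auto simp: pos_cone_def self_adjoint_def nonneg_definite_def plus_hs_op.rep_eq blinfun.bilinear_simps
      inner_add_left inner_add_right)

lemma zero_pos_cone: "0 \<in> pos_cone"
  by (auto simp: pos_cone_def self_adjoint_def nonneg_definite_def zero_hs_op.rep_eq)

lemma pos_cone_sum: "(\<And>i. i \<in> I \<Longrightarrow> T i \<in> pos_cone) \<Longrightarrow> sum T I \<in> pos_cone"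
  by (induction I rule: infinite_finite_induct) (auto simp: zero_pos_cone pos_cone_add)

lemma op_of_hs_adjoint: "op_of_hs (hs_adjoint T) = adj_op (op_of_hs T)"
  unfolding hs_adjoint_def
  by (rule hs_of_op_inverse) (use hilbert_schmidt_op_of_hs[of T] in \<open>simp add: hilbert_schmidt_iff hs_norm_sq_adj_op\<close>)

lemma bounded_linear_hs_adjoint: "bounded_linear hs_adjoint"
proof (rule bounded_linear_intro[of _ 1])
  show "hs_adjoint (S + T) = hs_adjoint S + hs_adjoint T" for S T :: "'a hs_op"
    by (simp add: op_of_hs_inject[symmetric] op_of_hs_adjoint plus_hs_op.rep_eq adj_op_add)
  show "hs_adjoint (c *\<^sub>R T) = c *\<^sub>R hs_adjoint T" for c and T :: "'a hs_op"
    by (simp add: op_of_hs_inject[symmetric] op_of_hs_adjoint scaleR_hs_op.rep_eq adj_op_scaleR)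
  show "norm (hs_adjoint T) \<le> norm T * 1" for T :: "'a hs_op"
  proof -
    have "ennreal ((norm (hs_adjoint T))\<^sup>2) = ennreal ((norm T)\<^sup>2)"
      by (simp add: norm_hs_op_eq_hs_norm_sq op_of_hs_adjoint hs_norm_sq_adj_op)
    then show ?thesis by simp
  qed
qed

lemma hs_adjoint_eq_iff: "hs_adjoint T = T \<longleftrightarrow> self_adjoint (op_of_hs T)"
  by (simp add: op_of_hs_inject[symmetric] op_of_hs_adjoint self_adjoint_adj_op)

text \<open>Self-adjointness follows termwise, since powers of \<open>C\<close> commute with the
  adjoint. If \<open>C\<close> preserves the cone, positivity follows termwise as well; otherwise
  the second alternative in \<open>cone\<close> is the claim itself.\<close>

lemma exp_op_pos_cone:
  fixes C :: "'a::{real_inner,banach,second_countable_topology} hs_op \<Rightarrow>\<^sub>L 'a hs_op"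
  assumes adj: "\<And>T. hs_adjoint (C T) = C (hs_adjoint T)"
    and cone: "(\<forall>T\<in>hs_cone. C T \<in> hs_cone) \<or> (\<forall>s\<ge>0. \<forall>T\<in>hs_cone. exp_op (s *\<^sub>R C) T \<in> hs_cone)"
    and s: "s \<ge> 0" and T: "T \<in> pos_cone"
  shows "exp_op (s *\<^sub>R C) T \<in> pos_cone"
proof -
  have adj': "hs_adjoint ((blinfun_apply (s *\<^sub>R C) ^^ n) T) = (blinfun_apply (s *\<^sub>R C) ^^ n) T" for n
  proof (induction n)
    case 0 then show ?case using T by (simp add: hs_adjoint_eq_iff pos_cone_def)
  next
    case (Suc n)
    have "hs_adjoint (blinfun_apply (s *\<^sub>R C) S) = blinfun_apply (s *\<^sub>R C) (hs_adjoint S)" for S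
      by (simp add: blinfun.scaleR_left linear_scale[OF bounded_linear.linear[OF bounded_linear_hs_adjoint]] adj)
    with Suc show ?case by (simp only: funpow.simps o_apply)
  qed
  have "(\<lambda>n. hs_adjoint (((blinfun_apply (s *\<^sub>R C) ^^ n) T) /\<^sub>R fact n)) sums hs_adjoint (exp_op (s *\<^sub>R C) T)"
    by (rule bounded_linear.sums[OF bounded_linear_hs_adjoint exp_op_apply_sums])
  then have "(\<lambda>n. ((blinfun_apply (s *\<^sub>R C) ^^ n) T) /\<^sub>R fact n) sums hs_adjoint (exp_op (s *\<^sub>R C) T)"
    by (simp only: linear_scale[OF bounded_linear.linear[OF bounded_linear_hs_adjoint]] adj')
  then have sa: "hs_adjoint (exp_op (s *\<^sub>R C) T) = exp_op (s *\<^sub>R C) T"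
    using exp_op_apply_sums sums_unique2 by blast
  have Tc: "T \<in> hs_cone" using T by (simp add: pos_cone_def hs_cone_def)
  have "exp_op (s *\<^sub>R C) T \<in> hs_cone"
  proof (cases "\<forall>T\<in>hs_cone. C T \<in> hs_cone")
    case True
    have step: "blinfun_apply (s *\<^sub>R C) S \<in> hs_cone" if "S \<in> hs_cone" for S
    proof -
      have "C S \<in> hs_cone" using True that by blast
      then show ?thesis using s
        by (simp add: hs_cone_def nonneg_definite_def blinfun.bilinear_simps scaleR_hs_op.rep_eq)
    qed
    have pw: "(blinfun_apply (s *\<^sub>R C) ^^ n) T \<in> hs_cone" for n
    proof (induction n)
      case (Suc n)
      show ?case by (simp only: funpow.simps o_apply) (rule step[OF Suc])
    qed (simp add: Tc)
    have "0 \<le> op_of_hs (exp_op (s *\<^sub>R C) T) x \<bullet> x" for x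
    proof (rule sums_le[OF _ sums_zero])
      show "(\<lambda>n. op_of_hs (((blinfun_apply (s *\<^sub>R C) ^^ n) T) /\<^sub>R fact n) x \<bullet> x) sums (op_of_hs (exp_op (s *\<^sub>R C) T) x \<bullet> x)"
        by (rule bounded_linear.sums[OF bounded_linear_hs_inner exp_op_apply_sums])
      show "0 \<le> op_of_hs (((blinfun_apply (s *\<^sub>R C) ^^ n) T) /\<^sub>R fact n) x \<bullet> x" for n
        using pw[of n] by (simp add: hs_cone_def nonneg_definite_def blinfun.bilinear_simps scaleR_hs_op.rep_eq)
    qed
    then show ?thesis by (simp add: hs_cone_def nonneg_definite_def)
  next
    case False
    with cone s Tc show ?thesis by blast
  qed
  then show ?thesis using sa by (simp add: pos_cone_def hs_cone_def hs_adjoint_eq_iff)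
qed

section \<open>Independence and product laws\<close>

lemma integrable_bounded_mult:
  fixes X D :: "'w \<Rightarrow> real"
  assumes "integrable M X" "D \<in> borel_measurable M" "\<And>\<omega>. \<bar>D \<omega>\<bar> \<le> c"
  shows "integrable M (\<lambda>\<omega>. D \<omega> * X \<omega>)"
proof (rule Bochner_Integration.integrable_bound)
  show "integrable M (\<lambda>\<omega>. c * X \<omega>)" using assms(1) by simp
  show "AE \<omega> in M. norm (D \<omega> * X \<omega>) \<le> norm (c * X \<omega>)"
  proof (rule AE_I2)
    fix \<omega>
    have "\<bar>D \<omega>\<bar> * \<bar>X \<omega>\<bar> \<le> \<bar>c\<bar> * \<bar>X \<omega>\<bar>"
      by (intro mult_right_mono order_trans[OF assms(3) abs_ge_self]) auto
    then show "norm (D \<omega> * X \<omega>) \<le> norm (c * X \<omega>)" by (simp add: abs_mult)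
  qed
qed (use assms in auto)

text \<open>Independence of \<open>U\<close> from the whole algebra \<open>N\<close> is packed into
  one joint law: the identity into \<open>N\<close> serves as a random variable that carries all of
  \<open>N\<close>. Rectangles determine the product measure.\<close>

lemma (in prob_space) indep_pair_distr:
  assumes N: "subalgebra M N" and U: "U \<in> M \<rightarrow>\<^sub>M K"
    and ind: "indep_set (sets (vimage_algebra (space M) U K)) (sets N)"
  shows "distr M (N \<Otimes>\<^sub>M K) (\<lambda>\<omega>. (\<omega>, U \<omega>)) = distr M N (\<lambda>\<omega>. \<omega>) \<Otimes>\<^sub>M distr M K U"
proof (rule pair_measure_eqI[symmetric])
  have id: "(\<lambda>\<omega>. \<omega>) \<in> M \<rightarrow>\<^sub>M N"
    using N by (auto simp: subalgebra_def measurable_def)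
  interpret N: prob_space "distr M N (\<lambda>\<omega>. \<omega>)" by (rule prob_space_distr[OF id])
  interpret K: prob_space "distr M K U" by (rule prob_space_distr[OF U])
  show "sigma_finite_measure (distr M N (\<lambda>\<omega>. \<omega>))" "sigma_finite_measure (distr M K U)" by unfold_locales
  show "sets (distr M N (\<lambda>\<omega>. \<omega>) \<Otimes>\<^sub>M distr M K U) = sets (distr M (N \<Otimes>\<^sub>M K) (\<lambda>\<omega>. (\<omega>, U \<omega>)))"
    by (simp cong: sets_pair_measure_cong)
  fix A C assume "A \<in> sets (distr M N (\<lambda>\<omega>. \<omega>))" "C \<in> sets (distr M K U)"
  then have A: "A \<in> sets N" and C: "C \<in> sets K" by auto
  have AM: "A \<in> sets M" using A N by (auto simp: subalgebra_def)
  have sp: "space N = space M" using N by (simp add: subalgebra_def)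
  have "U -` C \<inter> space M \<in> sets (vimage_algebra (space M) U K)" using C by (rule in_vimage_algebra)
  from indep_setD[OF ind this A]
  have "prob ((U -` C \<inter> space M) \<inter> A) = prob (U -` C \<inter> space M) * prob A" .
  moreover have "(\<lambda>\<omega>. (\<omega>, U \<omega>)) -` (A \<times> C) \<inter> space M = (U -` C \<inter> space M) \<inter> A"
    using sets.sets_into_space[OF AM] by auto
  moreover have "(\<lambda>\<omega>. \<omega>) -` A \<inter> space M = A" using sets.sets_into_space[OF AM] by auto
  moreover have "(\<lambda>\<omega>. (\<omega>, U \<omega>)) \<in> M \<rightarrow>\<^sub>M N \<Otimes>\<^sub>M K" using id U by simp
  ultimately show "emeasure (distr M N (\<lambda>\<omega>. \<omega>)) A * emeasure (distr M K U) C =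
      emeasure (distr M (N \<Otimes>\<^sub>M K) (\<lambda>\<omega>. (\<omega>, U \<omega>))) (A \<times> C)"
    using A C id U by (simp add: emeasure_distr emeasure_eq_measure ennreal_mult[symmetric] mult.commute)
qed

text \<open>Fubini for that product law: \<open>U\<close> may be replaced by an independent copy
  while the dependence on \<open>N\<close> is frozen. This produces conditional expectations in
  explicit form.\<close>

lemma (in prob_space) indep_freeze:
  fixes h :: "'a \<Rightarrow> 'b \<Rightarrow> real"
  assumes N: "subalgebra M N" and U: "U \<in> M \<rightarrow>\<^sub>M K"
    and ind: "indep_set (sets (vimage_algebra (space M) U K)) (sets N)"
    and h: "case_prod h \<in> borel_measurable (N \<Otimes>\<^sub>M K)" and bd: "\<And>\<omega> u. \<bar>h \<omega> u\<bar> \<le> c"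
  shows "(\<integral>\<omega>. h \<omega> (U \<omega>) \<partial>M) = (\<integral>\<omega>. (\<integral>\<omega>'. h \<omega> (U \<omega>') \<partial>M) \<partial>M)"
proof -
  have id: "(\<lambda>\<omega>. \<omega>) \<in> M \<rightarrow>\<^sub>M N"
    using N by (auto simp: subalgebra_def measurable_def)
  interpret N: prob_space "distr M N (\<lambda>\<omega>. \<omega>)" by (rule prob_space_distr[OF id])
  interpret K: prob_space "distr M K U" by (rule prob_space_distr[OF U])
  interpret P: pair_prob_space "distr M N (\<lambda>\<omega>. \<omega>)" "distr M K U" ..
  have m: "(\<lambda>\<omega>. (\<omega>, U \<omega>)) \<in> M \<rightarrow>\<^sub>M N \<Otimes>\<^sub>M K" using id U by simp
  have h': "case_prod h \<in> borel_measurable (distr M N (\<lambda>\<omega>. \<omega>) \<Otimes>\<^sub>M distr M K U)"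
    using h by (simp cong: measurable_cong_sets)
  have "integrable (distr M N (\<lambda>\<omega>. \<omega>) \<Otimes>\<^sub>M distr M K U) (case_prod h)"
    by (rule P.integrable_const_bound[OF _ h', of c]) (auto simp: bd)
  from P.integral_fst'[OF this]
  have "(\<integral>\<omega>. (\<integral>u. h \<omega> u \<partial>distr M K U) \<partial>distr M N (\<lambda>\<omega>. \<omega>)) = integral\<^sup>L (distr M (N \<Otimes>\<^sub>M K) (\<lambda>\<omega>. (\<omega>, U \<omega>))) (case_prod h)"
    by (simp add: indep_pair_distr[OF N U ind])
  also have "\<dots> = (\<integral>\<omega>. h \<omega> (U \<omega>) \<partial>M)" by (subst integral_distr[OF m h]) simp
  also have "(\<integral>\<omega>. (\<integral>u. h \<omega> u \<partial>distr M K U) \<partial>distr M N (\<lambda>\<omega>. \<omega>)) = (\<integral>\<omega>. (\<integral>u. h \<omega> u \<partial>distr M K U) \<partial>M)"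
  proof (rule integral_distr[OF id])
    have "(\<lambda>\<omega>. \<integral>u. h \<omega> u \<partial>distr M K U) \<in> borel_measurable (distr M N (\<lambda>\<omega>. \<omega>))"
      using h' by (rule K.borel_measurable_lebesgue_integral)
    then show "(\<lambda>\<omega>. \<integral>u. h \<omega> u \<partial>distr M K U) \<in> borel_measurable N" by simp
  qed
  also have "\<dots> = (\<integral>\<omega>. (\<integral>\<omega>'. h \<omega> (U \<omega>') \<partial>M) \<partial>M)"
  proof (rule Bochner_Integration.integral_cong[OF refl])
    fix \<omega> assume "\<omega> \<in> space M"
    then have "\<omega> \<in> space N" using N by (simp add: subalgebra_def)
    from measurable_Pair2[OF h this] have "h \<omega> \<in> borel_measurable K" by simp
    then show "(\<integral>u. h \<omega> u \<partial>distr M K U) = (\<integral>\<omega>'. h \<omega> (U \<omega>') \<partial>M)" by (rule integral_distr[OF U])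
  qed
  finally show ?thesis by simp
qed

section \<open>A Wiener process and a non-decreasing process with independent increments\<close>

text \<open>Both processes have increments independent of the past of one common filtration.
  Independence of \<open>B\<close> and \<open>L\<close> from each other is what the locale
  derives.\<close>

locale wiener_increasing = prob_space M
  for M :: "'w measure" +
  fixes F :: "real \<Rightarrow> 'w measure"
    and B :: "real \<Rightarrow> 'w \<Rightarrow> 'b::{real_normed_vector,second_countable_topology}"
    and L :: "real \<Rightarrow> 'w \<Rightarrow> 'h::{real_inner,banach,second_countable_topology} hs_op"
  assumes F_filtration: "filtration (space M) F" and F_subalg: "\<And>t. subalgebra M (F t)"
    and B_adapted: "adapted F B" and B_indep: "indep_increments M F B"
    and B_cont: "AE \<omega> in M. continuous_on {0..} (\<lambda>t. B t \<omega>)"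
    and L_adapted: "adapted F L" and L_indep: "indep_increments M F L"
    and L_mono: "AE \<omega> in M. \<forall>s t. 0 \<le> s \<longrightarrow> s \<le> t \<longrightarrow> L t \<omega> - L s \<omega> \<in> pos_cone"
    and L_int: "\<And>t. 0 \<le> t \<Longrightarrow> integrable M (L t)"
begin

lemma F_mono: "s \<le> t \<Longrightarrow> sets (F s) \<subseteq> sets (F t)"
  using F_filtration by (simp add: filtration_def)

lemma F_space: "space (F t) = space M"
  using F_subalg by (simp add: subalgebra_def)

lemma F_lift: "s \<le> t \<Longrightarrow> f \<in> F s \<rightarrow>\<^sub>M K \<Longrightarrow> f \<in> F t \<rightarrow>\<^sub>M K"
  using F_mono[of s t] F_space by (auto simp: measurable_def)

lemma F_lift_M: "f \<in> F s \<rightarrow>\<^sub>M K \<Longrightarrow> f \<in> M \<rightarrow>\<^sub>M K"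
  using measurable_from_subalg[OF F_subalg] .

lemma B_F: "0 \<le> s \<Longrightarrow> s \<le> t \<Longrightarrow> B s \<in> borel_measurable (F t)"
  using B_adapted F_lift unfolding adapted_def by blast

lemma L_F: "0 \<le> s \<Longrightarrow> s \<le> t \<Longrightarrow> L s \<in> borel_measurable (F t)"
  using L_adapted F_lift unfolding adapted_def by blast

lemma B_M: "0 \<le> s \<Longrightarrow> B s \<in> borel_measurable M"
  using B_F F_lift_M by blast

lemma L_M: "0 \<le> s \<Longrightarrow> L s \<in> borel_measurable M"
  using L_F F_lift_M by blast

lemma B_ind: "0 \<le> s \<Longrightarrow> s \<le> t \<Longrightarrow>
    indep_set (sets (vimage_algebra (space M) (\<lambda>\<omega>. B t \<omega> - B s \<omega>) borel)) (sets (F s))"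
  using B_indep by (simp add: indep_increments_def)

lemma L_ind: "0 \<le> s \<Longrightarrow> s \<le> t \<Longrightarrow>
    indep_set (sets (vimage_algebra (space M) (\<lambda>\<omega>. L t \<omega> - L s \<omega>) borel)) (sets (F s))"
  using L_indep by (simp add: indep_increments_def)

text \<open>The tower property at \<open>r\<close>: the part of the increment up to \<open>r\<close>
  is frozen, the rest is averaged over an independent copy. The inner integral is a version of the
  conditional expectation that is defined for every \<open>\<omega>\<close>.\<close>

lemma freeze_increment:
  fixes Z :: "real \<Rightarrow> 'w \<Rightarrow> 'c::{real_normed_vector,second_countable_topology}" and f :: "'c \<Rightarrow> real"
  assumes Z: "\<And>s t. 0 \<le> s \<Longrightarrow> s \<le> t \<Longrightarrow> Z s \<in> borel_measurable (F t)"
    and ind: "\<And>s t. 0 \<le> s \<Longrightarrow> s \<le> t \<Longrightarrow>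
      indep_set (sets (vimage_algebra (space M) (\<lambda>\<omega>. Z t \<omega> - Z s \<omega>) borel)) (sets (F s))"
    and f: "f \<in> borel_measurable borel" "\<And>x. 0 \<le> f x" "\<And>x. f x \<le> 1"
    and W: "W \<in> borel_measurable (F r)" "\<And>\<omega>. 0 \<le> W \<omega>" "\<And>\<omega>. W \<omega> \<le> 1"
    and s: "0 \<le> s" "s \<le> r" "r \<le> t"
  shows "(\<integral>\<omega>. W \<omega> * f (Z t \<omega> - Z s \<omega>) \<partial>M) =
    (\<integral>\<omega>. W \<omega> * (\<integral>\<omega>'. f (Z r \<omega> - Z s \<omega> + (Z t \<omega>' - Z r \<omega>')) \<partial>M) \<partial>M)"
proof -
  have [measurable]: "Z s \<in> borel_measurable (F r)" "Z r \<in> borel_measurable (F r)"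
    using Z[of s r] Z[of r r] s by auto
  have ZM: "Z t \<in> borel_measurable M" "Z r \<in> borel_measurable M"
    using F_lift_M[OF Z[of t t]] F_lift_M[OF Z[of r t]] s by auto
  note [measurable] = W(1) f(1)
  define h where "h \<omega> u = W \<omega> * f (Z r \<omega> - Z s \<omega> + u)" for \<omega> u
  have "(\<integral>\<omega>. h \<omega> (Z t \<omega> - Z r \<omega>) \<partial>M) = (\<integral>\<omega>. (\<integral>\<omega>'. h \<omega> (Z t \<omega>' - Z r \<omega>') \<partial>M) \<partial>M)"
  proof (rule indep_freeze[OF F_subalg _ ind])
    show "case_prod h \<in> borel_measurable (F r \<Otimes>\<^sub>M borel)" unfolding h_def by measurable
    show "\<bar>h \<omega> u\<bar> \<le> 1" for \<omega> u
      unfolding h_def using W(2,3)[of \<omega>] f(2,3)[of "Z r \<omega> - Z s \<omega> + u"]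
      by (simp add: abs_mult mult_le_one)
  qed (use s ZM in auto)
  then show ?thesis by (simp add: h_def)
qed

text \<open>The core estimate. Both factors are replaced by their conditional expectations
  \<open>fB\<close>, \<open>gL\<close>, which are martingales; only the bracket of their increments over a fine
  partition survives, and it vanishes in the limit because one martingale is uniformly small on
  small intervals while the variation of the other one is dominated by the telescoping sums
  of the non-decreasing process \<open>\<kappa> \<circ> L\<close>.\<close>

context
  fixes f :: "'b \<Rightarrow> real" and g :: "'h hs_op \<Rightarrow> real" and \<kappa> :: "'h hs_op \<Rightarrow> real" and K s t :: real and A :: "'w set"
  assumes f: "f \<in> borel_measurable borel" "\<And>x. 0 \<le> f x" "\<And>x. f x \<le> 1"
    and f_lip: "\<And>x y. \<bar>f x - f y\<bar> \<le> K * norm (x - y)" and K: "0 \<le> K"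
    and g: "g \<in> borel_measurable borel" "\<And>x. 0 \<le> g x" "\<And>x. g x \<le> 1"
    and \<kappa>: "bounded_linear \<kappa>" "\<And>P. P \<in> pos_cone \<Longrightarrow> 0 \<le> \<kappa> P"
    and g_lip: "\<And>T P. P \<in> pos_cone \<Longrightarrow> \<bar>g (T + P) - g T\<bar> \<le> \<kappa> P"
    and st: "0 \<le> s" "s \<le> t" and A: "A \<in> sets (F s)"
begin

text \<open>Concrete versions of the conditional expectations of \<open>f (B t - B s)\<close> and
  \<open>g (L t - L s)\<close> given \<open>F r\<close>, so that their increments in
  \<open>r\<close> can be estimated path by path.\<close>

definition fB where "fB r \<omega> = (\<integral>\<omega>'. f (B r \<omega> - B s \<omega> + (B t \<omega>' - B r \<omega>')) \<partial>M)"
definition gL where "gL r \<omega> = (\<integral>\<omega>'. g (L r \<omega> - L s \<omega> + (L t \<omega>' - L r \<omega>')) \<partial>M)"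

lemma meas_cond:
  fixes Z :: "real \<Rightarrow> 'w \<Rightarrow> 'c::{real_normed_vector,second_countable_topology}" and k :: "'c \<Rightarrow> real"
  assumes [measurable]: "k \<in> borel_measurable borel" and Z: "\<And>s t. 0 \<le> s \<Longrightarrow> s \<le> t \<Longrightarrow> Z s \<in> borel_measurable (F t)"
    and k: "\<And>x. 0 \<le> k x" "\<And>x. k x \<le> 1" and r: "s \<le> r" "r \<le> t"
  shows "(\<lambda>\<omega>. \<integral>\<omega>'. k (Z r \<omega> - Z s \<omega> + (Z t \<omega>' - Z r \<omega>')) \<partial>M) \<in> borel_measurable (F r)"
    and "0 \<le> (\<integral>\<omega>'. k (Z r \<omega> - Z s \<omega> + (Z t \<omega>' - Z r \<omega>')) \<partial>M)"
    and "(\<integral>\<omega>'. k (Z r \<omega> - Z s \<omega> + (Z t \<omega>' - Z r \<omega>')) \<partial>M) \<le> 1"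
    and "integrable M (\<lambda>\<omega>'. k (x + (Z t \<omega>' - Z r \<omega>')))"
proof -
  have [measurable]: "Z s \<in> borel_measurable (F r)" "Z r \<in> borel_measurable (F r)"
    using Z[of s r] Z[of r r] st r by auto
  have [measurable]: "Z t \<in> borel_measurable M" "Z r \<in> borel_measurable M"
    using F_lift_M[OF Z[of t t]] F_lift_M[OF Z[of r t]] st r by auto
  show "(\<lambda>\<omega>. \<integral>\<omega>'. k (Z r \<omega> - Z s \<omega> + (Z t \<omega>' - Z r \<omega>')) \<partial>M) \<in> borel_measurable (F r)"
    by measurable
  show int: "integrable M (\<lambda>\<omega>'. k (x + (Z t \<omega>' - Z r \<omega>')))" for x
    by (rule integrable_const_bound[of _ 1]) (auto simp: k)
  show "0 \<le> (\<integral>\<omega>'. k (Z r \<omega> - Z s \<omega> + (Z t \<omega>' - Z r \<omega>')) \<partial>M)" by (simp add: k)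
  show "(\<integral>\<omega>'. k (Z r \<omega> - Z s \<omega> + (Z t \<omega>' - Z r \<omega>')) \<partial>M) \<le> 1"
    using integral_mono[OF int integrable_const, of _ 1] by (simp add: k prob_space)
qed

lemma fB_props:
  assumes "s \<le> r" "r \<le> t"
  shows "fB r \<in> borel_measurable (F r)" "0 \<le> fB r \<omega>" "fB r \<omega> \<le> 1" "fB r \<in> borel_measurable M"
proof -
  note m = meas_cond(1-3)[where k = f and Z = B and r = r, OF f(1) B_F f(2,3) assms]
  show "fB r \<in> borel_measurable (F r)" unfolding fB_def[abs_def] by (rule m(1))
  then show "fB r \<in> borel_measurable M" by (rule F_lift_M)
  show "0 \<le> fB r \<omega>" unfolding fB_def by (rule m(2))
  show "fB r \<omega> \<le> 1" unfolding fB_def by (rule m(3))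
qed

lemma gL_props:
  assumes "s \<le> r" "r \<le> t"
  shows "gL r \<in> borel_measurable (F r)" "0 \<le> gL r \<omega>" "gL r \<omega> \<le> 1" "gL r \<in> borel_measurable M"
proof -
  note m = meas_cond(1-3)[where k = g and Z = L and r = r, OF g(1) L_F g(2,3) assms]
  show "gL r \<in> borel_measurable (F r)" unfolding gL_def[abs_def] by (rule m(1))
  then show "gL r \<in> borel_measurable M" by (rule F_lift_M)
  show "0 \<le> gL r \<omega>" unfolding gL_def by (rule m(2))
  show "gL r \<omega> \<le> 1" unfolding gL_def by (rule m(3))
qed

text \<open>Both sides equal the integral of \<open>W\<close> times \<open>f (B t - B s)\<close>, by
  the tower property at \<open>r'\<close> and at \<open>r\<close>.\<close>

lemma fB_martingale:
  assumes r: "s \<le> r" "r \<le> r'" "r' \<le> t"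
    and W: "W \<in> borel_measurable (F r)" "\<And>\<omega>. 0 \<le> W \<omega>" "\<And>\<omega>. W \<omega> \<le> 1"
  shows "(\<integral>\<omega>. W \<omega> * fB r' \<omega> \<partial>M) = (\<integral>\<omega>. W \<omega> * fB r \<omega> \<partial>M)"
  using freeze_increment[OF B_F B_ind f F_lift[OF r(2) W(1)] W(2,3), of s t]
    freeze_increment[OF B_F B_ind f W, of s t] r st by (simp add: fB_def)

lemma gL_martingale:
  assumes r: "s \<le> r" "r \<le> r'" "r' \<le> t"
    and W: "W \<in> borel_measurable (F r)" "\<And>\<omega>. 0 \<le> W \<omega>" "\<And>\<omega>. W \<omega> \<le> 1"
  shows "(\<integral>\<omega>. W \<omega> * gL r' \<omega> \<partial>M) = (\<integral>\<omega>. W \<omega> * gL r \<omega> \<partial>M)"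
  using freeze_increment[OF L_F L_ind g F_lift[OF r(2) W(1)] W(2,3), of s t]
    freeze_increment[OF L_F L_ind g W, of s t] r st by (simp add: gL_def)

text \<open>Moduli for one interval. Since \<open>f\<close> has values in [0, 1], truncation at 1
  keeps \<open>dB\<close> a valid modulus, and it makes dominated convergence available.
  \<open>dL\<close> is additive over adjacent intervals because \<open>\<kappa>\<close> is
  linear.\<close>

definition dB where "dB r r' \<omega> = min 1 (K * norm (B r' \<omega> - B r \<omega>))"
definition dL where "dL r r' \<omega> = \<kappa> (L r' \<omega> - L r \<omega>)"

lemma dB_props:
  assumes "s \<le> r" "r \<le> r'"
  shows "dB r r' \<in> borel_measurable M" "0 \<le> dB r r' \<omega>" "dB r r' \<omega> \<le> 1" "integrable M (dB r r')"
proof -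
  have [measurable]: "B r \<in> borel_measurable M" "B r' \<in> borel_measurable M" using assms st B_M by auto
  show m: "dB r r' \<in> borel_measurable M" unfolding dB_def[abs_def] by measurable
  show "0 \<le> dB r r' \<omega>" "dB r r' \<omega> \<le> 1" using K by (auto simp: dB_def)
  show "integrable M (dB r r')"
    by (rule integrable_const_bound[OF _ m, of 1]) (use K in \<open>auto simp: dB_def\<close>)
qed

lemma dL_props:
  assumes "s \<le> r" "r \<le> r'"
  shows "integrable M (dL r r')" "AE \<omega> in M. 0 \<le> dL r r' \<omega>"
proof -
  show "integrable M (dL r r')"
    unfolding dL_def[abs_def] using assms st
    by (intro integrable_bounded_linear[OF \<kappa>(1)] Bochner_Integration.integrable_diff L_int) auto
  show "AE \<omega> in M. 0 \<le> dL r r' \<omega>"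
    using L_mono by eventually_elim (use assms st \<kappa>(2) in \<open>auto simp: dL_def\<close>)
qed

lemma fB_increment:
  assumes r: "s \<le> r" "r \<le> r'" "r' \<le> t"
  shows "\<bar>fB r' \<omega> - fB r \<omega>\<bar> \<le> dB r r' \<omega> + (\<integral>\<omega>'. dB r r' \<omega>' \<partial>M)"
proof -
  have r': "s \<le> r'" "r \<le> t" using r by auto
  have lip: "\<bar>f x - f y\<bar> \<le> min 1 (K * norm (x - y))" for x y
    using f_lip[of x y] f(2,3)[of x] f(2,3)[of y] by (auto simp: abs_le_iff)
  note i = meas_cond(4)[where k = f and Z = B, OF f(1) B_F f(2,3) r'(1) r(3)]
    meas_cond(4)[where k = f and Z = B, OF f(1) B_F f(2,3) r(1) r'(2)]
  have "fB r' \<omega> - fB r \<omega> = (\<integral>\<omega>'. f (B r' \<omega> - B s \<omega> + (B t \<omega>' - B r' \<omega>')) -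
      f (B r \<omega> - B s \<omega> + (B t \<omega>' - B r \<omega>')) \<partial>M)"
    unfolding fB_def by (intro Bochner_Integration.integral_diff[symmetric] i)
  also have "\<bar>\<dots>\<bar> \<le> (\<integral>\<omega>'. \<bar>f (B r' \<omega> - B s \<omega> + (B t \<omega>' - B r' \<omega>')) -
      f (B r \<omega> - B s \<omega> + (B t \<omega>' - B r \<omega>'))\<bar> \<partial>M)" by (rule integral_abs_bound)
  also have "\<dots> \<le> (\<integral>\<omega>'. dB r r' \<omega> + dB r r' \<omega>' \<partial>M)"
  proof (rule integral_mono)
    fix \<omega>'
    let ?u = "B r' \<omega> - B s \<omega> + (B t \<omega>' - B r' \<omega>')" and ?v = "B r \<omega> - B s \<omega> + (B t \<omega>' - B r' \<omega>')"
      and ?w = "B r \<omega> - B s \<omega> + (B t \<omega>' - B r \<omega>')"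
    have "\<bar>f ?u - f ?v\<bar> \<le> dB r r' \<omega>" using lip[of ?u ?v] by (simp add: dB_def)
    moreover have "\<bar>f ?v - f ?w\<bar> \<le> dB r r' \<omega>'" using lip[of ?v ?w] by (simp add: dB_def norm_minus_commute)
    ultimately show "\<bar>f ?u - f ?w\<bar> \<le> dB r r' \<omega> + dB r r' \<omega>'" by simp
  next
    show "integrable M (\<lambda>\<omega>'. dB r r' \<omega> + dB r r' \<omega>')"
      by (rule Bochner_Integration.integrable_add[OF integrable_const dB_props(4)[OF r(1,2)]])
  qed (rule integrable_abs[OF Bochner_Integration.integrable_diff[OF i]])
  also have "\<dots> = dB r r' \<omega> + (\<integral>\<omega>'. dB r r' \<omega>' \<partial>M)"
    using dB_props(4)[OF r(1,2)] by (simp add: prob_space)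
  finally show ?thesis .
qed

text \<open>The same splitting, with \<open>?v\<close> chosen so that both outer arguments are
  \<open>?v\<close> plus an element of the positive cone; \<open>g_lip\<close> controls
  perturbations of this kind.\<close>

lemma gL_increment:
  assumes r: "s \<le> r" "r \<le> r'" "r' \<le> t"
  shows "AE \<omega> in M. \<bar>gL r' \<omega> - gL r \<omega>\<bar> \<le> dL r r' \<omega> + (\<integral>\<omega>'. dL r r' \<omega>' \<partial>M)"
proof -
  have r': "s \<le> r'" "r \<le> t" using r by auto
  note i = meas_cond(4)[where k = g and Z = L, OF g(1) L_F g(2,3) r'(1) r(3)]
    meas_cond(4)[where k = g and Z = L, OF g(1) L_F g(2,3) r(1) r'(2)]
  have pos: "AE \<omega> in M. L r' \<omega> - L r \<omega> \<in> pos_cone"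
    using L_mono by eventually_elim (use r st in auto)
  from pos show ?thesis
  proof eventually_elim
    fix \<omega> assume P: "L r' \<omega> - L r \<omega> \<in> pos_cone"
    have "gL r' \<omega> - gL r \<omega> = (\<integral>\<omega>'. g (L r' \<omega> - L s \<omega> + (L t \<omega>' - L r' \<omega>')) -
        g (L r \<omega> - L s \<omega> + (L t \<omega>' - L r \<omega>')) \<partial>M)"
      unfolding gL_def by (intro Bochner_Integration.integral_diff[symmetric] i)
    also have "\<bar>\<dots>\<bar> \<le> (\<integral>\<omega>'. \<bar>g (L r' \<omega> - L s \<omega> + (L t \<omega>' - L r' \<omega>')) -
        g (L r \<omega> - L s \<omega> + (L t \<omega>' - L r \<omega>'))\<bar> \<partial>M)" by (rule integral_abs_bound)
    also have "\<dots> \<le> (\<integral>\<omega>'. dL r r' \<omega> + dL r r' \<omega>' \<partial>M)"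
    proof (rule integral_mono_AE)
      show "AE \<omega>' in M. \<bar>g (L r' \<omega> - L s \<omega> + (L t \<omega>' - L r' \<omega>')) -
        g (L r \<omega> - L s \<omega> + (L t \<omega>' - L r \<omega>'))\<bar> \<le> dL r r' \<omega> + dL r r' \<omega>'"
        using pos
      proof eventually_elim
        fix \<omega>' assume P': "L r' \<omega>' - L r \<omega>' \<in> pos_cone"
        let ?v = "L r \<omega> - L s \<omega> + (L t \<omega>' - L r' \<omega>')"
        have "\<bar>g (?v + (L r' \<omega> - L r \<omega>)) - g ?v\<bar> \<le> dL r r' \<omega>" unfolding dL_def by (rule g_lip[OF P])
        moreover have "\<bar>g (?v + (L r' \<omega>' - L r \<omega>')) - g ?v\<bar> \<le> dL r r' \<omega>'" unfolding dL_def by (rule g_lip[OF P'])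
        moreover have "?v + (L r' \<omega> - L r \<omega>) = L r' \<omega> - L s \<omega> + (L t \<omega>' - L r' \<omega>')"
          "?v + (L r' \<omega>' - L r \<omega>') = L r \<omega> - L s \<omega> + (L t \<omega>' - L r \<omega>')" by simp_all
        ultimately show "\<bar>g (L r' \<omega> - L s \<omega> + (L t \<omega>' - L r' \<omega>')) -
          g (L r \<omega> - L s \<omega> + (L t \<omega>' - L r \<omega>'))\<bar> \<le> dL r r' \<omega> + dL r r' \<omega>'" by simp
      qed
    next
      show "integrable M (\<lambda>\<omega>'. dL r r' \<omega> + dL r r' \<omega>')"
        by (rule Bochner_Integration.integrable_add[OF integrable_const dL_props(1)[OF r(1,2)]])
    qed (rule integrable_abs[OF Bochner_Integration.integrable_diff[OF i]])
    also have "\<dots> = dL r r' \<omega> + (\<integral>\<omega>'. dL r r' \<omega>' \<partial>M)"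
      using dL_props(1)[OF r(1,2)] by (simp add: prob_space)
    finally show "\<bar>gL r' \<omega> - gL r \<omega>\<bar> \<le> dL r r' \<omega> + (\<integral>\<omega>'. dL r r' \<omega>' \<partial>M)" .
  qed
qed

text \<open>Interpolates between the two sides of the product formula: at \<open>r = t\<close> it is
  the joint expectation, at \<open>r = s\<close> the product of the separate ones.\<close>

definition prodE where "prodE r = (\<integral>\<omega>. indicator A \<omega> * fB r \<omega> * gL r \<omega> \<partial>M)"

lemma A_M: "A \<in> sets M" using A F_subalg[of s] by (auto simp: subalgebra_def)

lemma bounded_integrable:
  fixes h :: "'w \<Rightarrow> real"
  shows "h \<in> borel_measurable M \<Longrightarrow> (\<And>\<omega>. 0 \<le> h \<omega>) \<Longrightarrow> (\<And>\<omega>. h \<omega> \<le> 1) \<Longrightarrow> integrable M h"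
  by (rule integrable_const_bound[of _ 1]) auto

text \<open>By the martingale properties the two mixed expectations reduce to the one at
  \<open>r\<close>, so the increment of \<open>prodE\<close> is the expectation of the product of
  both increments. The majorant \<open>D\<close> is left free so that one function can serve all
  intervals of a partition.\<close>

lemma prodE_increment:
  assumes r: "s \<le> r" "r \<le> r'" "r' \<le> t"
    and D: "D \<in> borel_measurable M" "\<And>\<omega>. 0 \<le> D \<omega>" "\<And>\<omega>. D \<omega> \<le> 1" and dD: "\<And>\<omega>. dB r r' \<omega> \<le> D \<omega>"
  shows "\<bar>prodE r' - prodE r\<bar> \<le>
    (\<integral>\<omega>. (D \<omega> + (\<integral>\<omega>'. D \<omega>' \<partial>M)) * (dL r r' \<omega> + (\<integral>\<omega>'. dL r r' \<omega>' \<partial>M)) \<partial>M)"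
proof -
  have r': "s \<le> r'" "r \<le> t" using r by auto
  note p = fB_props[OF r(1) r'(2)] fB_props[OF r'(1) r(3)] gL_props[OF r(1) r'(2)] gL_props[OF r'(1) r(3)]
  have AF: "A \<in> sets (F r)" using A F_mono[OF r(1)] by auto
  note [measurable] = A_M
  let ?i = "indicator A :: 'w \<Rightarrow> real"
  have i01: "0 \<le> ?i \<omega>" "?i \<omega> \<le> 1" for \<omega> by (auto simp: indicator_def)
  have int: "integrable M (\<lambda>\<omega>. ?i \<omega> * x \<omega> * y \<omega>)"
    if "x \<in> borel_measurable M" "y \<in> borel_measurable M" "\<And>\<omega>. 0 \<le> x \<omega>" "\<And>\<omega>. x \<omega> \<le> 1" "\<And>\<omega>. 0 \<le> y \<omega>" "\<And>\<omega>. y \<omega> \<le> 1" for x y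
    using that i01 by (intro bounded_integrable) (auto intro!: mult_le_one mult_nonneg_nonneg)
  \<comment> \<open>The weight, \<open>indicator A\<close> times \<open>fB r\<close>, is known at
    time \<open>r\<close>, so the martingale property of \<open>gL\<close> applies to it; the next
    step exchanges the roles.\<close>
  have 1: "(\<integral>\<omega>. ?i \<omega> * fB r \<omega> * gL r' \<omega> \<partial>M) = (\<integral>\<omega>. ?i \<omega> * fB r \<omega> * gL r \<omega> \<partial>M)"
    using p i01 AF by (intro gL_martingale r) (auto intro!: mult_le_one mult_nonneg_nonneg)
  have "(\<integral>\<omega>. (?i \<omega> * gL r \<omega>) * fB r' \<omega> \<partial>M) = (\<integral>\<omega>. (?i \<omega> * gL r \<omega>) * fB r \<omega> \<partial>M)"
    using p i01 AF by (intro fB_martingale r) (auto intro!: mult_le_one mult_nonneg_nonneg)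
  then have 2: "(\<integral>\<omega>. ?i \<omega> * fB r' \<omega> * gL r \<omega> \<partial>M) = (\<integral>\<omega>. ?i \<omega> * fB r \<omega> * gL r \<omega> \<partial>M)"
    by (simp add: mult_ac)
  note ints = int[OF p(8) p(16) p(6,7) p(14,15)] int[OF p(8) p(12) p(6,7) p(10,11)]
     int[OF p(4) p(16) p(2,3) p(14,15)] int[OF p(4) p(12) p(2,3) p(10,11)]
  have "prodE r' - prodE r = (\<integral>\<omega>. ?i \<omega> * fB r' \<omega> * gL r' \<omega> \<partial>M) - (\<integral>\<omega>. ?i \<omega> * fB r' \<omega> * gL r \<omega> \<partial>M)
      - (\<integral>\<omega>. ?i \<omega> * fB r \<omega> * gL r' \<omega> \<partial>M) + (\<integral>\<omega>. ?i \<omega> * fB r \<omega> * gL r \<omega> \<partial>M)"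
    unfolding prodE_def 1 2 by simp
  also have "\<dots> = (\<integral>\<omega>. ?i \<omega> * (fB r' \<omega> - fB r \<omega>) * (gL r' \<omega> - gL r \<omega>) \<partial>M)"
    using ints by (simp add: algebra_simps)
  finally have "\<bar>prodE r' - prodE r\<bar> \<le> (\<integral>\<omega>. \<bar>?i \<omega> * (fB r' \<omega> - fB r \<omega>) * (gL r' \<omega> - gL r \<omega>)\<bar> \<partial>M)"
    by (simp only: integral_abs_bound)
  also have "\<dots> \<le> (\<integral>\<omega>. (D \<omega> + (\<integral>\<omega>'. D \<omega>' \<partial>M)) * (dL r r' \<omega> + (\<integral>\<omega>'. dL r r' \<omega>' \<partial>M)) \<partial>M)"
  proof (rule integral_mono_AE)
    have "integrable M (\<lambda>\<omega>. ?i \<omega> * fB r' \<omega> * gL r' \<omega> - ?i \<omega> * fB r' \<omega> * gL r \<omega> - ?i \<omega> * fB r \<omega> * gL r' \<omega> + ?i \<omega> * fB r \<omega> * gL r \<omega>)"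
      by (rule Bochner_Integration.integrable_add[OF Bochner_Integration.integrable_diff[OF Bochner_Integration.integrable_diff[OF ints(1,2)] ints(3)] ints(4)])
    moreover have "?i \<omega> * (fB r' \<omega> - fB r \<omega>) * (gL r' \<omega> - gL r \<omega>) =
        ?i \<omega> * fB r' \<omega> * gL r' \<omega> - ?i \<omega> * fB r' \<omega> * gL r \<omega> - ?i \<omega> * fB r \<omega> * gL r' \<omega> + ?i \<omega> * fB r \<omega> * gL r \<omega>" for \<omega>
      by (simp add: algebra_simps)
    ultimately show "integrable M (\<lambda>\<omega>. \<bar>?i \<omega> * (fB r' \<omega> - fB r \<omega>) * (gL r' \<omega> - gL r \<omega>)\<bar>)"
      by (simp only: integrable_abs)
    have Di: "integrable M D" using D by (intro bounded_integrable)
    show "integrable M (\<lambda>\<omega>. (D \<omega> + (\<integral>\<omega>'. D \<omega>' \<partial>M)) * (dL r r' \<omega> + (\<integral>\<omega>'. dL r r' \<omega>' \<partial>M)))"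
    proof (rule integrable_bounded_mult)
      have "\<bar>(\<integral>\<omega>'. D \<omega>' \<partial>M)\<bar> \<le> 1"
        using integral_mono[OF Di integrable_const, of 1] D by (simp add: prob_space)
      then show "\<bar>D \<omega> + (\<integral>\<omega>'. D \<omega>' \<partial>M)\<bar> \<le> 2" for \<omega> using D(2,3)[of \<omega>] by linarith
    qed (use D dL_props(1)[OF r(1,2)] in auto)
    have ED: "(\<integral>\<omega>'. dB r r' \<omega>' \<partial>M) \<le> (\<integral>\<omega>'. D \<omega>' \<partial>M)"
      by (intro integral_mono dB_props r Di dD)
    show "AE \<omega> in M. \<bar>?i \<omega> * (fB r' \<omega> - fB r \<omega>) * (gL r' \<omega> - gL r \<omega>)\<bar> \<le>
        (D \<omega> + (\<integral>\<omega>'. D \<omega>' \<partial>M)) * (dL r r' \<omega> + (\<integral>\<omega>'. dL r r' \<omega>' \<partial>M))"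
      using gL_increment[OF r]
    proof eventually_elim
      fix \<omega> assume gi: "\<bar>gL r' \<omega> - gL r \<omega>\<bar> \<le> dL r r' \<omega> + (\<integral>\<omega>'. dL r r' \<omega>' \<partial>M)"
      have fi: "\<bar>fB r' \<omega> - fB r \<omega>\<bar> \<le> D \<omega> + (\<integral>\<omega>'. D \<omega>' \<partial>M)"
        using fB_increment[OF r, of \<omega>] dD[of \<omega>] ED by linarith
      have "\<bar>?i \<omega> * (fB r' \<omega> - fB r \<omega>) * (gL r' \<omega> - gL r \<omega>)\<bar> \<le> \<bar>fB r' \<omega> - fB r \<omega>\<bar> * \<bar>gL r' \<omega> - gL r \<omega>\<bar>"
        by (simp add: abs_mult indicator_def)
      also have "\<dots> \<le> (D \<omega> + (\<integral>\<omega>'. D \<omega>' \<partial>M)) * (dL r r' \<omega> + (\<integral>\<omega>'. dL r r' \<omega>' \<partial>M))"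
        by (intro mult_mono gi fi order_trans[OF abs_ge_zero fi]) auto
      finally show "\<bar>?i \<omega> * (fB r' \<omega> - fB r \<omega>) * (gL r' \<omega> - gL r \<omega>)\<bar> \<le>
        (D \<omega> + (\<integral>\<omega>'. D \<omega>' \<partial>M)) * (dL r r' \<omega> + (\<integral>\<omega>'. dL r r' \<omega>' \<partial>M))" .
    qed
  qed
  finally show ?thesis .
qed

text \<open>Refining the partition does not accumulate errors: the largest modulus
  \<open>D n\<close> of \<open>B\<close> is factored out, the moduli of \<open>L\<close> telescope
  to \<open>dL s t\<close>, and \<open>D n\<close> tends to 0 by uniform continuity of almost every
  path of \<open>B\<close>.\<close>

lemma prodE_eq: "prodE t = prodE s"
proof (cases "s = t")
  case False
  with st have "s < t" by simp
  define \<rho> where "\<rho> n k = s + (t - s) * (real k / real (Suc n))" for n k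
  define D where "D n \<omega> = Max ((\<lambda>k. dB (\<rho> n k) (\<rho> n (Suc k)) \<omega>) ` {..n})" for n \<omega>
  define X where "X \<omega> = dL s t \<omega> + (\<integral>\<omega>'. dL s t \<omega>' \<partial>M)" for \<omega>
  have \<rho>0: "\<rho> n 0 = s" for n by (simp add: \<rho>_def)
  have \<rho>n: "\<rho> n (Suc n) = t" for n
  proof -
    have "real (Suc n) / real (Suc n) = 1" by simp
    then show ?thesis unfolding \<rho>_def by (simp only: mult_1_right)
  qed
  have mono: "\<rho> n k \<le> \<rho> n l" if "k \<le> l" for n k l
    using that \<open>s < t\<close> by (auto simp: \<rho>_def intro!: divide_right_mono)
  have step: "\<rho> n (Suc k) - \<rho> n k = (t - s) / real (Suc n)" for n k
  proof -
    have "(t - s) * (real (Suc k) / real (Suc n)) - (t - s) * (real k / real (Suc n)) =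
        (t - s) * ((real (Suc k) - real k) / real (Suc n))"
      by (simp only: right_diff_distrib diff_divide_distrib)
    then show ?thesis by (simp add: \<rho>_def)
  qed
  have r: "s \<le> \<rho> n k" "\<rho> n k \<le> \<rho> n (Suc k)" "\<rho> n (Suc k) \<le> t" if "k \<le> n" for n k
    using mono[of 0 k n] mono[of k "Suc k" n] mono[of "Suc k" "Suc n" n] that by (auto simp: \<rho>0 \<rho>n)
  have Dm: "D n \<in> borel_measurable M" for n
    unfolding D_def[abs_def] by (intro borel_measurable_Max dB_props r) auto
  have dD: "dB (\<rho> n k) (\<rho> n (Suc k)) \<omega> \<le> D n \<omega>" if "k \<le> n" for n k \<omega>
    unfolding D_def using that by (intro Max_ge) auto
  have D0: "0 \<le> D n \<omega>" for n \<omega> using dB_props(2)[OF r(1,2), of 0 n \<omega>] dD[of 0 n \<omega>] by simp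
  have D1: "D n \<omega> \<le> 1" for n \<omega>
    unfolding D_def by (intro Max.boundedI) (auto intro: dB_props(3) r)
  have Xi: "integrable M X" unfolding X_def[abs_def]
    using dL_props(1)[of s t] st by (intro Bochner_Integration.integrable_add integrable_const) auto
  have Di: "integrable M (D n)" for n using Dm D0 D1 by (rule bounded_integrable)
  have DX: "integrable M (\<lambda>\<omega>. D n \<omega> * X \<omega>)" for n
    by (rule integrable_bounded_mult[OF Xi Dm, where c = 1]) (use D0 D1 in \<open>simp add: abs_le_iff order_trans[OF _ D0]\<close>)
  have bound: "\<bar>prodE t - prodE s\<bar> \<le> (\<integral>\<omega>. D n \<omega> * X \<omega> \<partial>M) + (\<integral>\<omega>. D n \<omega> \<partial>M) * (\<integral>\<omega>. X \<omega> \<partial>M)" for n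
  proof -
    let ?c = "\<integral>\<omega>. D n \<omega> \<partial>M"
    let ?l = "\<lambda>k. dL (\<rho> n k) (\<rho> n (Suc k))"
    have c: "\<bar>?c\<bar> \<le> 1" using integral_mono[OF Di integrable_const, of n 1] D0 D1 by (simp add: prob_space)
    have "prodE t - prodE s = (\<Sum>k<Suc n. prodE (\<rho> n (Suc k)) - prodE (\<rho> n k))"
      by (subst sum_lessThan_telescope) (simp add: \<rho>0 \<rho>n)
    then have "\<bar>prodE t - prodE s\<bar> \<le> (\<Sum>k<Suc n. \<bar>prodE (\<rho> n (Suc k)) - prodE (\<rho> n k)\<bar>)"
      by (metis sum_abs)
    also have "\<dots> \<le> (\<Sum>k<Suc n. \<integral>\<omega>. (D n \<omega> + ?c) * (?l k \<omega> + (\<integral>\<omega>'. ?l k \<omega>' \<partial>M)) \<partial>M)"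
      by (intro sum_mono prodE_increment r Dm D0 D1 dD) auto
    also have "\<dots> = (\<integral>\<omega>. (\<Sum>k<Suc n. (D n \<omega> + ?c) * (?l k \<omega> + (\<integral>\<omega>'. ?l k \<omega>' \<partial>M))) \<partial>M)"
    proof (rule Bochner_Integration.integral_sum[symmetric])
      fix k assume "k \<in> {..<Suc n}"
      then have li: "integrable M (?l k)" by (intro dL_props r) auto
      have bd: "\<bar>D n \<omega> + ?c\<bar> \<le> 2" for \<omega> using c D0[of n \<omega>] D1[of n \<omega>] by linarith
      show "integrable M (\<lambda>\<omega>. (D n \<omega> + ?c) * (?l k \<omega> + (\<integral>\<omega>'. ?l k \<omega>' \<partial>M)))"
        by (rule integrable_bounded_mult[OF _ _ bd]) (use li Dm in auto)
    qed
    also have "\<dots> = (\<integral>\<omega>. (D n \<omega> + ?c) * X \<omega> \<partial>M)"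
    proof (rule Bochner_Integration.integral_cong[OF refl])
      fix \<omega>
      have tel: "(\<Sum>k<Suc n. ?l k \<omega>') = dL s t \<omega>'" for \<omega>'
      proof -
        interpret \<kappa>: bounded_linear \<kappa> by (rule \<kappa>)
        have "(\<Sum>k<Suc n. ?l k \<omega>') = \<kappa> (\<Sum>k<Suc n. L (\<rho> n (Suc k)) \<omega>' - L (\<rho> n k) \<omega>')"
          by (simp only: dL_def \<kappa>.sum)
        also have "\<dots> = dL s t \<omega>'" by (subst sum_lessThan_telescope) (simp add: \<rho>0 \<rho>n dL_def)
        finally show ?thesis .
      qed
      have "(\<Sum>k<Suc n. \<integral>\<omega>'. ?l k \<omega>' \<partial>M) = (\<integral>\<omega>'. (\<Sum>k<Suc n. ?l k \<omega>') \<partial>M)"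
        by (rule Bochner_Integration.integral_sum[symmetric]) (auto intro!: dL_props r)
      also have "\<dots> = (\<integral>\<omega>'. dL s t \<omega>' \<partial>M)" by (simp only: tel)
      finally have tel2: "(\<Sum>k<Suc n. \<integral>\<omega>'. ?l k \<omega>' \<partial>M) = (\<integral>\<omega>'. dL s t \<omega>' \<partial>M)" .
      show "(\<Sum>k<Suc n. (D n \<omega> + ?c) * (?l k \<omega> + (\<integral>\<omega>'. ?l k \<omega>' \<partial>M))) = (D n \<omega> + ?c) * X \<omega>"
        by (simp only: sum_distrib_left[symmetric] sum.distrib tel tel2 X_def)
    qed
    also have "\<dots> = (\<integral>\<omega>. D n \<omega> * X \<omega> \<partial>M) + ?c * (\<integral>\<omega>. X \<omega> \<partial>M)"
      using DX[of n] Xi by (simp add: algebra_simps)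
    finally show ?thesis .
  qed
  have D_lim: "AE \<omega> in M. (\<lambda>n. D n \<omega>) \<longlonglongrightarrow> 0"
    using B_cont
  proof eventually_elim
    fix \<omega> assume "continuous_on {0..} (\<lambda>t. B t \<omega>)"
    then have "continuous_on {s..t} (\<lambda>t. B t \<omega>)" by (rule continuous_on_subset) (use st in auto)
    then have uc: "uniformly_continuous_on {s..t} (\<lambda>t. B t \<omega>)" by (rule compact_uniformly_continuous) simp
    show "(\<lambda>n. D n \<omega>) \<longlonglongrightarrow> 0"
    proof (rule LIMSEQ_I)
      fix \<epsilon> :: real assume "\<epsilon> > 0"
      \<comment> \<open>Division by \<open>K + 1\<close> admits \<open>K = 0\<close>; the factor 1/2
        restores strictness at the end.\<close>
      define \<eta> where "\<eta> = \<epsilon> / (K + 1) / 2"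
      have "\<eta> > 0" using \<open>\<epsilon> > 0\<close> K by (simp add: \<eta>_def)
      then obtain \<delta> where "\<delta> > 0" and \<delta>: "\<And>x y. x \<in> {s..t} \<Longrightarrow> y \<in> {s..t} \<Longrightarrow> dist y x < \<delta> \<Longrightarrow> dist (B y \<omega>) (B x \<omega>) < \<eta>"
        using uc unfolding uniformly_continuous_on_def by metis
      obtain N where N: "(t - s) / \<delta> < real N" using reals_Archimedean2 by blast
      have "norm (D n \<omega> - 0) < \<epsilon>" if n: "n \<ge> N" for n
      proof -
        have "dB (\<rho> n k) (\<rho> n (Suc k)) \<omega> \<le> K * \<eta>" if "k \<le> n" for k
        proof -
          have "(t - s) / real (Suc n) < \<delta>"
            using N n \<open>\<delta> > 0\<close> by (simp add: field_simps) (smt (verit) mult_left_mono of_nat_mono)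
          then have "dist (\<rho> n (Suc k)) (\<rho> n k) < \<delta>" using step[of n k] \<open>s < t\<close> by (simp add: dist_real_def)
          then have "dist (B (\<rho> n (Suc k)) \<omega>) (B (\<rho> n k) \<omega>) < \<eta>" using r[OF that] by (intro \<delta>) auto
          then show ?thesis using K by (auto simp: dB_def dist_norm intro!: mult_left_mono min.coboundedI2)
        qed
        then have "D n \<omega> \<le> K * \<eta>" unfolding D_def by (intro Max.boundedI) auto
        also have "\<dots> \<le> (K + 1) * \<eta>" using \<open>\<eta> > 0\<close> by (simp add: algebra_simps)
        also have "(K + 1) * \<eta> = \<epsilon> / 2"
        proof -
          have "K + 1 \<noteq> 0" using K by linarith
          then show ?thesis unfolding \<eta>_def by (metis nonzero_mult_div_cancel_left times_divide_eq_right)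
        qed
        also have "\<dots> < \<epsilon>" using \<open>\<epsilon> > 0\<close> by simp
        finally show ?thesis using D0[of n \<omega>] by simp
      qed
      then show "\<exists>no. \<forall>n\<ge>no. norm (D n \<omega> - 0) < \<epsilon>" by blast
    qed
  qed
  have l1: "(\<lambda>n. \<integral>\<omega>. D n \<omega> * X \<omega> \<partial>M) \<longlonglongrightarrow> (\<integral>\<omega>. 0 \<partial>M)"
  proof (rule integral_dominated_convergence[where w = "\<lambda>\<omega>. \<bar>X \<omega>\<bar>"])
    show "AE \<omega> in M. (\<lambda>n. D n \<omega> * X \<omega>) \<longlonglongrightarrow> 0"
      using D_lim by eventually_elim (auto intro!: tendsto_eq_intros)
    show "AE \<omega> in M. norm (D n \<omega> * X \<omega>) \<le> \<bar>X \<omega>\<bar>" for n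
      using D0 D1 by (intro AE_I2) (simp add: abs_mult mult_left_le_one_le)
  qed (use DX Xi in auto)
  have l2: "(\<lambda>n. \<integral>\<omega>. D n \<omega> \<partial>M) \<longlonglongrightarrow> (\<integral>\<omega>. 0 \<partial>M)"
    by (rule integral_dominated_convergence[where w = "\<lambda>_. 1"]) (use D_lim Dm D0 D1 in auto)
  have "(\<lambda>n. (\<integral>\<omega>. D n \<omega> * X \<omega> \<partial>M) + (\<integral>\<omega>. D n \<omega> \<partial>M) * (\<integral>\<omega>. X \<omega> \<partial>M)) \<longlonglongrightarrow> 0"
    using l1 l2 by (auto intro!: tendsto_eq_intros)
  then have "\<bar>prodE t - prodE s\<bar> \<le> 0" by (rule LIMSEQ_le_const) (use bound in auto)
  then show ?thesis by simp
qed simp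

text \<open>At \<open>r = t\<close> nothing is left to average; at \<open>r = s\<close> nothing is
  frozen, so both conditional expectations are constants.\<close>

lemma core_product:
  "(\<integral>\<omega>. indicator A \<omega> * f (B t \<omega> - B s \<omega>) * g (L t \<omega> - L s \<omega>) \<partial>M) =
    prob A * (\<integral>\<omega>. f (B t \<omega> - B s \<omega>) \<partial>M) * (\<integral>\<omega>. g (L t \<omega> - L s \<omega>) \<partial>M)"
proof -
  have "prodE t = (\<integral>\<omega>. indicator A \<omega> * f (B t \<omega> - B s \<omega>) * g (L t \<omega> - L s \<omega>) \<partial>M)"
    unfolding prodE_def fB_def gL_def by (simp add: prob_space)
  moreover have "prodE s = prob A * (\<integral>\<omega>. f (B t \<omega> - B s \<omega>) \<partial>M) * (\<integral>\<omega>. g (L t \<omega> - L s \<omega>) \<partial>M)"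
    unfolding prodE_def fB_def gL_def using A_M by simp
  ultimately show ?thesis using prodE_eq by simp
qed

end

end

section \<open>From Lipschitz test functions to events\<close>

lemma closed_indicator_approx:
  fixes C :: "'b::metric_space set"
  assumes "closed C" "C \<noteq> {}"
  defines "f \<equiv> \<lambda>n x. max 0 (1 - real n * infdist x C)"
  shows "f n \<in> borel_measurable borel" "0 \<le> f n x" "f n x \<le> 1" "\<bar>f n x - f n y\<bar> \<le> real n * dist x y"
    "(\<lambda>n. f n x) \<longlonglongrightarrow> indicator C x"
proof -
  show "f n \<in> borel_measurable borel"
    unfolding f_def by (intro borel_measurable_continuous_onI continuous_intros)
  show "0 \<le> f n x" "f n x \<le> 1" by (auto simp: f_def infdist_nonneg)
  have "\<bar>infdist x C - infdist y C\<bar> \<le> dist x y"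
    using infdist_triangle[of x C y] infdist_triangle[of y C x] by (simp add: dist_commute abs_le_iff)
  from mult_left_mono[OF this, of "real n"] have "\<bar>real n * infdist x C - real n * infdist y C\<bar> \<le> real n * dist x y"
    by (simp add: right_diff_distrib[symmetric] abs_mult)
  then show "\<bar>f n x - f n y\<bar> \<le> real n * dist x y"
    unfolding f_def by linarith
  show "(\<lambda>n. f n x) \<longlonglongrightarrow> indicator C x"
  proof (cases "x \<in> C")
    case True then show ?thesis by (simp add: f_def)
  next
    case False
    then have "infdist x C > 0"
      using assms in_closed_iff_infdist_zero[of C x] infdist_nonneg[of x C] by fastforce
    then obtain N where N: "1 / infdist x C < real N" using reals_Archimedean2 by blast
    have "f n x = 0" if "n \<ge> N" for n
    proof -
      have "1 < real N * infdist x C" using N \<open>infdist x C > 0\<close> by (simp add: field_simps)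
      also have "\<dots> \<le> real n * infdist x C" using that by (intro mult_right_mono) (auto simp: infdist_nonneg)
      finally show ?thesis by (simp add: f_def)
    qed
    then have "\<forall>\<^sub>F n in sequentially. f n x = indicator C x"
      using False by (auto simp: eventually_sequentially)
    then show ?thesis by (rule tendsto_eventually)
  qed
qed

text \<open>These sets are closed, stable under intersection and generate the Borel algebra.
  Distance functions are unsuitable on this side, since bounds by \<open>norm P\<close> do not
  telescope; bounds on coefficients are controlled by quadratic forms, which do.\<close>

definition cylinder :: "('h \<times> 'h \<times> real) set \<Rightarrow> 'h::{real_inner,banach,second_countable_topology} hs_op set" where
  "cylinder J = {T. \<forall>(e, f, c)\<in>J. op_of_hs T e \<bullet> f \<le> c}"

definition ramp :: "nat \<Rightarrow> real \<Rightarrow> real" where "ramp n x = max 0 (min 1 (1 - real n * x))"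

lemma ramp_bounds: "0 \<le> ramp n x" "ramp n x \<le> 1" by (auto simp: ramp_def)

lemma ramp_lipschitz: "\<bar>ramp n x - ramp n y\<bar> \<le> real n * \<bar>x - y\<bar>"
proof -
  have "\<bar>ramp n x - ramp n y\<bar> \<le> \<bar>real n * x - real n * y\<bar>" unfolding ramp_def by linarith
  also have "\<dots> = real n * \<bar>x - y\<bar>" by (simp add: right_diff_distrib[symmetric] abs_mult)
  finally show ?thesis .
qed

lemma ramp_tendsto: "(\<lambda>n. ramp n x) \<longlonglongrightarrow> (if x \<le> 0 then 1 else 0)"
proof (cases "x \<le> 0")
  case True
  then have "real n * x \<le> 0" for n by (simp add: mult_nonneg_nonpos)
  then have "ramp n x = 1" for n using True by (simp add: ramp_def)
  then show ?thesis using True by simp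
next
  case False
  then obtain N where N: "1 / x < real N" using reals_Archimedean2 by blast
  have "ramp n x = 0" if "n \<ge> N" for n
  proof -
    have "1 < real N * x" using N False by (simp add: field_simps)
    also have "\<dots> \<le> real n * x" using that False by (intro mult_right_mono) auto
    finally show ?thesis by (simp add: ramp_def)
  qed
  then have "\<forall>\<^sub>F n in sequentially. ramp n x = 0" by (auto simp: eventually_sequentially)
  then show ?thesis using False tendsto_eventually by force
qed

text \<open>Off-diagonal coefficients need not be monotone along the paths of \<open>L\<close>.
  Cauchy-Schwarz for the form dominates them by diagonal ones, which are.\<close>

lemma pos_cone_offdiag:
  assumes "P \<in> pos_cone"
  shows "\<bar>op_of_hs P e \<bullet> f\<bar> \<le> op_of_hs P e \<bullet> e + op_of_hs P f \<bullet> f"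
proof -
  let ?A = "op_of_hs P"
  have A: "self_adjoint ?A" "nonneg_definite ?A" using assms by (auto simp: pos_cone_def)
  have p: "0 \<le> ?A e \<bullet> e" "0 \<le> ?A f \<bullet> f" using A(2) by (auto simp: nonneg_definite_def)
  have "(?A e \<bullet> f)\<^sup>2 \<le> (?A e \<bullet> e) * (?A f \<bullet> f)" by (rule nonneg_definite_Cauchy_Schwarz[OF A])
  also have "\<dots> \<le> (?A e \<bullet> e + ?A f \<bullet> f)\<^sup>2" using p by (simp add: power2_sum add_increasing)
  finally show ?thesis using p by (simp add: abs_le_square_iff[symmetric])
qed

text \<open>\<open>\<kappa> n\<close> is the linear functional required by the core estimate. Each
  factor of \<open>g n\<close> is \<open>n\<close>-Lipschitz in one coefficient, and for factors in
  [0, 1] the increment of a product is at most the sum of the increments.\<close>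

lemma cylinder_approx:
  fixes J :: "('h::{real_inner,banach,second_countable_topology} \<times> 'h \<times> real) set"
  assumes "finite J"
  defines "g \<equiv> \<lambda>n T. \<Prod>(e, f, c)\<in>J. ramp n (op_of_hs T e \<bullet> f - c)"
    and "\<kappa> \<equiv> \<lambda>n P. \<Sum>(e, f, c)\<in>J. real n * (op_of_hs P e \<bullet> e + op_of_hs P f \<bullet> f)"
  shows "g n \<in> borel_measurable borel" "0 \<le> g n T" "g n T \<le> 1" "(\<lambda>n. g n T) \<longlonglongrightarrow> indicator (cylinder J) T"
    "bounded_linear (\<kappa> n)" "P \<in> pos_cone \<Longrightarrow> 0 \<le> \<kappa> n P" "P \<in> pos_cone \<Longrightarrow> \<bar>g n (T + P) - g n T\<bar> \<le> \<kappa> n P"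
proof -
  show "g n \<in> borel_measurable borel"
    unfolding g_def ramp_def case_prod_beta
    by (intro borel_measurable_continuous_onI continuous_intros
        linear_continuous_on[OF bounded_linear_hs_inner])
  show "0 \<le> g n T" "g n T \<le> 1"
    by (auto simp: g_def ramp_bounds intro!: prod_nonneg prod_le_1)
  have "(\<lambda>n. g n T) \<longlonglongrightarrow> (\<Prod>(e, f, c)\<in>J. if op_of_hs T e \<bullet> f - c \<le> 0 then 1 else 0)"
    unfolding g_def
  proof (rule tendsto_prod)
    fix j :: "'h \<times> 'h \<times> real"
    obtain e f c where "j = (e, f, c)" by (cases j)
    then show "(\<lambda>n. case j of (e, f, c) \<Rightarrow> ramp n (op_of_hs T e \<bullet> f - c)) \<longlonglongrightarrow>
        (case j of (e, f, c) \<Rightarrow> if op_of_hs T e \<bullet> f - c \<le> 0 then 1 else 0)"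
      using ramp_tendsto[of "op_of_hs T e \<bullet> f - c"] by simp
  qed
  also have "(\<Prod>(e, f, c)\<in>J. if op_of_hs T e \<bullet> f - c \<le> 0 then 1 else (0::real)) = indicator (cylinder J) T"
  proof (cases "T \<in> cylinder J")
    case True then show ?thesis by (auto simp: cylinder_def intro!: prod.neutral)
  next
    case False
    then obtain j where "j \<in> J" "\<not> (case j of (e, f, c) \<Rightarrow> op_of_hs T e \<bullet> f \<le> c)" by (auto simp: cylinder_def)
    then have "(\<Prod>(e, f, c)\<in>J. if op_of_hs T e \<bullet> f - c \<le> 0 then 1 else (0::real)) = 0"
      using assms(1) by (intro prod_zero bexI[of _ j]) (auto split: prod.splits)
    with False show ?thesis by simp
  qed
  finally show "(\<lambda>n. g n T) \<longlonglongrightarrow> indicator (cylinder J) T" .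
  show "bounded_linear (\<kappa> n)"
    unfolding \<kappa>_def case_prod_beta
    by (intro bounded_linear_sum bounded_linear_mult_const bounded_linear_const_mult bounded_linear_add bounded_linear_hs_inner)
  show "0 \<le> \<kappa> n P" if "P \<in> pos_cone"
    using that unfolding \<kappa>_def by (intro sum_nonneg) (auto simp: pos_cone_def nonneg_definite_def)
  show "\<bar>g n (T + P) - g n T\<bar> \<le> \<kappa> n P" if P: "P \<in> pos_cone"
  proof -
    have "norm (g n (T + P) - g n T) \<le> (\<Sum>j\<in>J. norm ((case j of (e, f, c) \<Rightarrow> ramp n (op_of_hs (T + P) e \<bullet> f - c)) -
        (case j of (e, f, c) \<Rightarrow> ramp n (op_of_hs T e \<bullet> f - c))))"
      unfolding g_def by (rule norm_prod_diff) (auto simp: ramp_bounds)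
    also have "\<dots> \<le> \<kappa> n P"
      unfolding \<kappa>_def
    proof (rule sum_mono)
      fix j assume "j \<in> J"
      obtain e f c where j: "j = (e, f, c)" by (cases j)
      have "\<bar>ramp n (op_of_hs (T + P) e \<bullet> f - c) - ramp n (op_of_hs T e \<bullet> f - c)\<bar> \<le> real n * \<bar>op_of_hs P e \<bullet> f\<bar>"
        using ramp_lipschitz[of n "op_of_hs (T + P) e \<bullet> f - c" "op_of_hs T e \<bullet> f - c"]
        by (simp add: plus_hs_op.rep_eq blinfun.bilinear_simps inner_add_left)
      also have "\<dots> \<le> real n * (op_of_hs P e \<bullet> e + op_of_hs P f \<bullet> f)"
        by (intro mult_left_mono pos_cone_offdiag P) auto
      finally show "norm ((case j of (e, f, c) \<Rightarrow> ramp n (op_of_hs (T + P) e \<bullet> f - c)) -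
        (case j of (e, f, c) \<Rightarrow> ramp n (op_of_hs T e \<bullet> f - c))) \<le>
        (case j of (e, f, c) \<Rightarrow> real n * (op_of_hs P e \<bullet> e + op_of_hs P f \<bullet> f))" by (simp add: j)
    qed
    finally show ?thesis by simp
  qed
qed

lemma cylinder_Int: "cylinder J \<inter> cylinder J' = cylinder (J \<union> J')"
  by (auto simp: cylinder_def ball_Un)

text \<open>Cylinders make every matrix coefficient measurable, and coefficients make the identity
  Borel measurable; conversely cylinders are closed.\<close>

lemma borel_hs_eq_sigma_cylinder:
  "sets (borel :: 'h::{real_inner,banach,second_countable_topology} hs_op measure) =
    sigma_sets UNIV {cylinder J |J. finite J}"
proof (rule antisym)
  let ?S = "sigma UNIV {cylinder J :: 'h hs_op set |J. finite J}"
  have s: "sets ?S = sigma_sets UNIV {cylinder J |J. finite J}" "space ?S = UNIV"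
    by (auto simp: sets_measure_of space_measure_of)
  have "(\<lambda>T :: 'h hs_op. T) \<in> borel_measurable ?S"
  proof (rule measurable_hs_coordinates)
    fix e f :: 'h
    show "(\<lambda>T. op_of_hs T e \<bullet> f) \<in> borel_measurable ?S"
    proof (rule borel_measurableI_le)
      fix y
      have "{T \<in> space ?S. op_of_hs T e \<bullet> f \<le> y} = cylinder {(e, f, y)}" by (auto simp: s cylinder_def)
      then show "{T \<in> space ?S. op_of_hs T e \<bullet> f \<le> y} \<in> sets ?S"
        by (simp only: s) (rule sigma_sets.Basic, auto)
    qed
  qed
  from measurable_sets[OF this] show "sets borel \<subseteq> sigma_sets UNIV {cylinder J :: 'h hs_op set |J. finite J}"
    by (auto simp: s)
  have "closed (cylinder J :: 'h hs_op set)" for J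
    unfolding cylinder_def case_prod_beta Ball_def
    by (intro closed_Collect_all closed_Collect_imp open_Collect_const closed_Collect_le continuous_on_const
        linear_continuous_on[OF bounded_linear_hs_inner])
  then show "sigma_sets UNIV {cylinder J :: 'h hs_op set |J. finite J} \<subseteq> sets borel"
    by (intro sets.sigma_sets_subset'[of _ borel, simplified]) auto
qed

text \<open>A finite set of times as a monotone sequence on all naturals; it is constant beyond the
  last time, which only creates trivial increments.\<close>

lemma finite_times_enumeration:
  fixes P :: "real set"
  assumes "finite P" "a \<in> P" "\<And>p. p \<in> P \<Longrightarrow> a \<le> p"
  obtains \<rho> :: "nat \<Rightarrow> real" and n where "mono \<rho>" "\<rho> 0 = a" "P = \<rho> ` {..n}"
proof -
  define xs where "xs = sorted_list_of_set P"
  have xs: "sorted xs" "set xs = P" using assms(1) by (auto simp: xs_def)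
  have ne: "xs \<noteq> []" using xs(2) assms(2) by auto
  then have lx: "length xs > 0" by simp
  define \<rho> where "\<rho> i = xs ! min i (length xs - 1)" for i
  have mi: "min i (length xs - 1) < length xs" for i using lx by linarith
  have "mono \<rho>" unfolding \<rho>_def using xs(1) lx by (intro monoI sorted_nth_mono mi) auto
  moreover have img: "P = \<rho> ` {..length xs - 1}"
  proof -
    have "\<rho> ` {..length xs - 1} = (\<lambda>i. xs ! i) ` {..<length xs}"
      using ne by (intro image_cong) (auto simp: \<rho>_def length_greater_0_conv[symmetric] simp del: length_greater_0_conv)
    then show ?thesis using xs(2) by (auto simp: in_set_conv_nth image_iff)
  qed
  moreover have "\<rho> 0 = a"
  proof (rule antisym)
    obtain i where "a = \<rho> i" using assms(2) img by auto
    then show "\<rho> 0 \<le> a" using \<open>mono \<rho>\<close> by (auto dest: monoD)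
    show "a \<le> \<rho> 0" using img by (intro assms(3)) auto
  qed
  ultimately show ?thesis using that by blast
qed

section \<open>Joint independence along a grid of times\<close>

context wiener_increasing
begin

lemma triple_basic:
  assumes st: "0 \<le> s" "s \<le> t" and A: "A \<in> sets (F s)" and C: "closed C" and J: "finite J"
  shows "prob (A \<inter> ((\<lambda>\<omega>. B t \<omega> - B s \<omega>) -` C \<inter> space M) \<inter> ((\<lambda>\<omega>. L t \<omega> - L s \<omega>) -` cylinder J \<inter> space M)) =
    prob A * prob ((\<lambda>\<omega>. B t \<omega> - B s \<omega>) -` C \<inter> space M) * prob ((\<lambda>\<omega>. L t \<omega> - L s \<omega>) -` cylinder J \<inter> space M)"
\<comment> \<open>\<open>infdist\<close> to the empty set is 0, so the approximations would be
  constantly 1; in that case both sides of the claim are 0 directly.\<close>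
proof (cases "C = {}")
  case False
  define b where "b \<omega> = B t \<omega> - B s \<omega>" for \<omega>
  define l where "l \<omega> = L t \<omega> - L s \<omega>" for \<omega>
  define f where "f n x = max 0 (1 - real n * infdist x C)" for n x
  define g where "g n T = (\<Prod>(e, f, c)\<in>J. ramp n (op_of_hs T e \<bullet> f - c))" for n T
  note f = closed_indicator_approx[OF C False, folded f_def]
  note g = cylinder_approx[OF J, folded g_def]
  have AM: "A \<in> sets M" using A F_subalg[of s] by (auto simp: subalgebra_def)
  have bM [measurable]: "b \<in> borel_measurable M" unfolding b_def[abs_def] using st B_M[of s] B_M[of t] by simp
  have lM [measurable]: "l \<in> borel_measurable M" unfolding l_def[abs_def] using st L_M[of s] L_M[of t] by simp
  have fM [measurable]: "(\<lambda>\<omega>. f n (b \<omega>)) \<in> borel_measurable M" for n using measurable_compose[OF bM f(1)] .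
  have gM [measurable]: "(\<lambda>\<omega>. g n (l \<omega>)) \<in> borel_measurable M" for n using measurable_compose[OF lM g(1)] .
  have CM: "C \<in> sets borel" using C by simp
  have JM: "cylinder J \<in> sets borel"
    unfolding borel_hs_eq_sigma_cylinder using J by (intro sigma_sets.Basic) auto
  note [measurable] = AM CM JM
  have eq: "(\<integral>\<omega>. indicator A \<omega> * f n (b \<omega>) * g n (l \<omega>) \<partial>M) = prob A * (\<integral>\<omega>. f n (b \<omega>) \<partial>M) * (\<integral>\<omega>. g n (l \<omega>) \<partial>M)" for n
    unfolding b_def l_def
    by (rule core_product[OF f(1-3) f(4)[unfolded dist_norm] of_nat_0_le_iff g(1-3) g(5,6) g(7) st A])
  have b1: "\<bar>indicator A \<omega> * f n (b \<omega>) * g n (l \<omega>)\<bar> \<le> 1" for n \<omega>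
    using f(2,3)[of n "b \<omega>"] g(2,3)[of n "l \<omega>"] by (auto simp: abs_mult indicator_def intro: mult_le_one)
  have l1: "(\<lambda>n. \<integral>\<omega>. indicator A \<omega> * f n (b \<omega>) * g n (l \<omega>) \<partial>M) \<longlonglongrightarrow>
      (\<integral>\<omega>. indicator A \<omega> * indicator C (b \<omega>) * indicator (cylinder J) (l \<omega>) \<partial>M)"
    by (rule integral_dominated_convergence[where w = "\<lambda>_. 1"])
      (use b1 in \<open>auto intro!: tendsto_intros f(5) g(4)\<close>)
  have l2: "(\<lambda>n. \<integral>\<omega>. f n (b \<omega>) \<partial>M) \<longlonglongrightarrow> (\<integral>\<omega>. indicator C (b \<omega>) \<partial>M)"
    by (rule integral_dominated_convergence[where w = "\<lambda>_. 1"]) (use f in auto)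
  have l3: "(\<lambda>n. \<integral>\<omega>. g n (l \<omega>) \<partial>M) \<longlonglongrightarrow> (\<integral>\<omega>. indicator (cylinder J) (l \<omega>) \<partial>M)"
    by (rule integral_dominated_convergence[where w = "\<lambda>_. 1"]) (use g in auto)
  have "(\<integral>\<omega>. indicator A \<omega> * indicator C (b \<omega>) * indicator (cylinder J) (l \<omega>) \<partial>M) =
      prob A * (\<integral>\<omega>. indicator C (b \<omega>) \<partial>M) * (\<integral>\<omega>. indicator (cylinder J) (l \<omega>) \<partial>M :: real)"
    using l1 unfolding eq by (rule LIMSEQ_unique) (intro tendsto_intros l2 l3)
  moreover have "(\<integral>\<omega>. indicator C (b \<omega>) \<partial>M :: real) = prob (b -` C \<inter> space M)"
  proof -
    have "(\<integral>\<omega>. indicator C (b \<omega>) \<partial>M :: real) = (\<integral>\<omega>. indicator (b -` C \<inter> space M) \<omega> \<partial>M)"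
      by (rule Bochner_Integration.integral_cong) (auto simp: indicator_def)
    then show ?thesis by simp
  qed
  moreover have "(\<integral>\<omega>. indicator (cylinder J) (l \<omega>) \<partial>M :: real) = prob (l -` cylinder J \<inter> space M)"
  proof -
    have "(\<integral>\<omega>. indicator (cylinder J) (l \<omega>) \<partial>M :: real) = (\<integral>\<omega>. indicator (l -` cylinder J \<inter> space M) \<omega> \<partial>M)"
      by (rule Bochner_Integration.integral_cong) (auto simp: indicator_def)
    then show ?thesis by simp
  qed
  moreover have "(\<integral>\<omega>. indicator A \<omega> * indicator C (b \<omega>) * indicator (cylinder J) (l \<omega>) \<partial>M :: real) =
      prob (A \<inter> (b -` C \<inter> space M) \<inter> (l -` cylinder J \<inter> space M))"
  proof -
    have "(\<integral>\<omega>. indicator A \<omega> * indicator C (b \<omega>) * indicator (cylinder J) (l \<omega>) \<partial>M :: real) =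
        (\<integral>\<omega>. indicator (A \<inter> (b -` C \<inter> space M) \<inter> (l -` cylinder J \<inter> space M)) \<omega> \<partial>M)"
      by (rule Bochner_Integration.integral_cong) (auto simp: indicator_def)
    moreover have "A \<inter> (b -` C \<inter> space M) \<inter> (l -` cylinder J \<inter> space M) \<inter> space M =
        A \<inter> (b -` C \<inter> space M) \<inter> (l -` cylinder J \<inter> space M)" by auto
    ultimately show ?thesis by simp
  qed
  ultimately show ?thesis by (simp add: b_def[abs_def] l_def[abs_def])
qed simp

text \<open>The product formula on three intersection-stable families, each containing the whole
  space, extends to the algebras they generate.\<close>

lemma triple_indep:
  assumes st: "0 \<le> s" "s \<le> t" and A: "A \<in> sets (F s)" and C: "C \<in> sets borel" and T: "T \<in> sets borel"
  shows "prob (A \<inter> ((\<lambda>\<omega>. B t \<omega> - B s \<omega>) -` C \<inter> space M) \<inter> ((\<lambda>\<omega>. L t \<omega> - L s \<omega>) -` T \<inter> space M)) =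
    prob A * prob ((\<lambda>\<omega>. B t \<omega> - B s \<omega>) -` C \<inter> space M) * prob ((\<lambda>\<omega>. L t \<omega> - L s \<omega>) -` T \<inter> space M)"
proof -
  let ?b = "\<lambda>\<omega>. B t \<omega> - B s \<omega>" and ?l = "\<lambda>\<omega>. L t \<omega> - L s \<omega>"
  let ?C = "{?b -` C \<inter> space M |C. closed C}" and ?L = "{?l -` T \<inter> space M |T. T \<in> {cylinder J |J. finite J}}"
  define E where "E i = (if i = 0 then sets (F s) else if i = Suc 0 then ?C else ?L)" for i
  have bM [measurable]: "?b \<in> borel_measurable M" using st B_M[of s] B_M[of t] by simp
  have lM [measurable]: "?l \<in> borel_measurable M" using st L_M[of s] L_M[of t] by simp
  have JM: "cylinder J \<in> sets borel" if "finite J" for J :: "('h \<times> 'h \<times> real) set"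
    unfolding borel_hs_eq_sigma_cylinder using that by (intro sigma_sets.Basic) auto
  have ev: "E i \<subseteq> events" for i
    using F_subalg[of s] JM by (auto simp: E_def subalgebra_def intro!: measurable_sets[OF bM] measurable_sets[OF lM])
  have c0: "cylinder ({} :: ('h \<times> 'h \<times> real) set) = UNIV" by (simp add: cylinder_def)
  have sp: "space M \<in> E i" for i
  proof -
    have "space M \<in> ?C" by (auto intro!: exI[of _ UNIV])
    moreover have "space M \<in> ?L"
    proof -
      have "space M = ?l -` cylinder {} \<inter> space M" using c0 by simp
      then show ?thesis by blast
    qed
    moreover have "space M \<in> sets (F s)" using F_space[of s] by (metis sets.top)
    ultimately show ?thesis by (simp add: E_def)
  qed
  have "indep_sets E {0, Suc 0, 2}"
  proof (subst indep_sets_finite)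
    show "\<forall>X\<in>Pi {0, Suc 0, 2} E. prob (\<Inter> (X ` {0, Suc 0, 2})) = (\<Prod>j\<in>{0, Suc 0, 2}. prob (X j))"
    proof
      fix X assume "X \<in> Pi {0, Suc 0, 2} E"
      then have "X 0 \<in> sets (F s)" "X (Suc 0) \<in> ?C" "X 2 \<in> ?L" by (auto simp: E_def Pi_iff)
      then obtain C' J where "X 0 \<in> sets (F s)" "X (Suc 0) = ?b -` C' \<inter> space M" "closed C'"
        "X 2 = ?l -` cylinder J \<inter> space M" "finite J" by blast
      with triple_basic[OF st, of "X 0" C' J]
      show "prob (\<Inter> (X ` {0, Suc 0, 2})) = (\<Prod>j\<in>{0, Suc 0, 2}. prob (X j))"
        by (simp add: Int_assoc mult.assoc)
    qed
  qed (use ev sp in auto)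
  moreover have "Int_stable (E i)" for i
  proof -
    have "Int_stable ?C"
    proof (rule Int_stableI)
      fix x y assume "x \<in> ?C" "y \<in> ?C"
      then obtain C1 C2 where "closed C1" "closed C2" "x = ?b -` C1 \<inter> space M" "y = ?b -` C2 \<inter> space M" by blast
      then show "x \<inter> y \<in> ?C" by (auto intro!: exI[of _ "C1 \<inter> C2"] closed_Int)
    qed
    moreover have "Int_stable ?L"
    proof (rule Int_stableI)
      fix x y assume "x \<in> ?L" "y \<in> ?L"
      then obtain J1 J2 where J: "finite J1" "finite J2" and xy: "x = ?l -` cylinder J1 \<inter> space M" "y = ?l -` cylinder J2 \<inter> space M" by blast
      have "x \<inter> y = ?l -` cylinder (J1 \<union> J2) \<inter> space M" unfolding xy cylinder_Int[symmetric] by auto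
      with J show "x \<inter> y \<in> ?L" by (metis (mono_tags, lifting) finite_UnI mem_Collect_eq)
    qed
    moreover have "Int_stable (sets (F s))" by (rule sets.Int_stable)
    ultimately show ?thesis by (simp add: E_def)
  qed
  ultimately have ind: "indep_sets (\<lambda>i. sigma_sets (space M) (E i)) {0, Suc 0, 2}"
    by (rule indep_sets_sigma)
  have bs: "?b -` C \<inter> space M \<in> sigma_sets (space M) (E (Suc 0))"
  proof -
    have "sigma_sets UNIV (Collect closed) = sets (borel :: 'b measure)"
      by (subst borel_eq_closed) (simp add: sets_measure_of)
    with sigma_sets_vimage_commute[of ?b "space M" UNIV "Collect closed"] C show ?thesis
      by (auto simp: E_def)
  qed
  have ls: "?l -` T \<inter> space M \<in> sigma_sets (space M) (E 2)"
    using sigma_sets_vimage_commute[of ?l "space M" UNIV "{cylinder J |J. finite J}"] T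
    by (auto simp: E_def borel_hs_eq_sigma_cylinder[symmetric])
  define X where "X i = (if i = 0 then A else if i = Suc 0 then ?b -` C \<inter> space M else ?l -` T \<inter> space M)" for i :: nat
  have "\<forall>i\<in>{0, Suc 0, 2}. X i \<in> sigma_sets (space M) (E i)"
    using A bs ls by (auto simp: X_def E_def intro: sigma_sets.Basic)
  from indep_setsD[OF ind _ _ _ this] show ?thesis by (simp add: X_def Int_ac mult_ac)
qed

text \<open>The past of the first grid time and the increments of both processes share one index
  type, so that a single independent family can afterwards be regrouped by a Boolean.\<close>

definition grid_alg :: "(nat \<Rightarrow> real) \<Rightarrow> (nat \<times> bool) option \<Rightarrow> 'w set set" where
  "grid_alg \<rho> i = (case i of None \<Rightarrow> sets (F (\<rho> 0))
    | Some (k, isB) \<Rightarrow> if isB then {(\<lambda>\<omega>. B (\<rho> (Suc k)) \<omega> - B (\<rho> k) \<omega>) -` C \<inter> space M |C. C \<in> sets borel}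
        else {(\<lambda>\<omega>. L (\<rho> (Suc k)) \<omega> - L (\<rho> k) \<omega>) -` T \<inter> space M |T. T \<in> sets borel})"

text \<open>Induction over the grid: everything from the first \<open>n\<close> intervals belongs to
  \<open>F (\<rho> n)\<close>, and the triple formula on the next interval splits off the increments
  of both processes at once.\<close>

lemma grid_alg_indep:
  assumes \<rho>: "mono \<rho>" "0 \<le> \<rho> 0"
  shows "indep_sets (grid_alg \<rho>) (insert None (Some ` ({..<n} \<times> UNIV)))"
proof -
  have \<rho>': "0 \<le> \<rho> k" "\<rho> k \<le> \<rho> (Suc k)" for k
    using monoD[OF \<rho>(1), of 0 k] monoD[OF \<rho>(1), of k "Suc k"] \<rho>(2) by auto
  have BF: "(\<lambda>\<omega>. B (\<rho> (Suc k)) \<omega> - B (\<rho> k) \<omega>) \<in> borel_measurable (F (\<rho> n))" if "k < n" for k n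
    using that monoD[OF \<rho>(1), of "Suc k" n] monoD[OF \<rho>(1), of "k" n] \<rho>' by (intro borel_measurable_diff B_F) auto
  have LF: "(\<lambda>\<omega>. L (\<rho> (Suc k)) \<omega> - L (\<rho> k) \<omega>) \<in> borel_measurable (F (\<rho> n))" if "k < n" for k n
    using that monoD[OF \<rho>(1), of "Suc k" n] monoD[OF \<rho>(1), of "k" n] \<rho>' by (intro borel_measurable_diff L_F) auto
  have inF: "grid_alg \<rho> i \<subseteq> sets (F (\<rho> n))" if "i \<in> insert None (Some ` ({..<n} \<times> UNIV))" for i n
  proof (cases i)
    case None
    then show ?thesis using F_mono[OF monoD[OF \<rho>(1), of 0 n]] by (auto simp: grid_alg_def)
  next
    case (Some kb)
    obtain k b where "kb = (k, b)" by (cases kb)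
    with Some that have kb: "i = Some (k, b)" "k < n" by auto
    have "(\<lambda>\<omega>. B (\<rho> (Suc k)) \<omega> - B (\<rho> k) \<omega>) -` C \<inter> space M \<in> sets (F (\<rho> n))" if "C \<in> sets borel" for C
      using measurable_sets[OF BF[OF kb(2)] that] by (simp add: F_space)
    moreover have "(\<lambda>\<omega>. L (\<rho> (Suc k)) \<omega> - L (\<rho> k) \<omega>) -` C \<inter> space M \<in> sets (F (\<rho> n))" if "C \<in> sets borel" for C
      using measurable_sets[OF LF[OF kb(2)] that] by (simp add: F_space)
    ultimately show ?thesis by (auto simp: grid_alg_def kb(1))
  qed
  have ev: "grid_alg \<rho> i \<subseteq> events" if "i \<in> insert None (Some ` ({..<n} \<times> UNIV))" for i n
    using inF[OF that] F_subalg by (auto simp: subalgebra_def)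
  have sp: "space M \<in> grid_alg \<rho> i" for i
    using sets.top[of "F (\<rho> 0)"]
    by (auto simp: grid_alg_def F_space split: option.split intro!: exI[of _ UNIV])
  have "prob (\<Inter>j\<in>insert None (Some ` ({..<n} \<times> UNIV)). X j) = (\<Prod>j\<in>insert None (Some ` ({..<n} \<times> UNIV)). prob (X j))"
    if "X \<in> Pi (insert None (Some ` ({..<n} \<times> UNIV))) (grid_alg \<rho>)" for X n
    using that
  proof (induction n)
    case (Suc n)
    let ?I = "insert None (Some ` ({..<n} \<times> (UNIV :: bool set)))"
    have I: "insert None (Some ` ({..<Suc n} \<times> (UNIV :: bool set))) = insert (Some (n, True)) (insert (Some (n, False)) ?I)"
      by (auto simp: less_Suc_eq image_iff)
    have XI: "X \<in> Pi ?I (grid_alg \<rho>)" using Suc.prems unfolding I by auto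
    have "X i \<in> sets (F (\<rho> n))" if "i \<in> ?I" for i using XI inF[OF that] that by (meson Pi_iff subsetD)
    then have AF: "(\<Inter>j\<in>?I. X j) \<in> sets (F (\<rho> n))" by (intro sets.finite_INT) auto
    obtain C T where C: "C \<in> sets borel" "X (Some (n, True)) = (\<lambda>\<omega>. B (\<rho> (Suc n)) \<omega> - B (\<rho> n) \<omega>) -` C \<inter> space M"
      and T: "T \<in> sets borel" "X (Some (n, False)) = (\<lambda>\<omega>. L (\<rho> (Suc n)) \<omega> - L (\<rho> n) \<omega>) -` T \<inter> space M"
      using Suc.prems unfolding I by (auto simp: grid_alg_def Pi_iff)
    have "prob (\<Inter>j\<in>insert (Some (n, True)) (insert (Some (n, False)) ?I). X j) =
        prob ((\<Inter>j\<in>?I. X j) \<inter> X (Some (n, True)) \<inter> X (Some (n, False)))"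
      by (rule arg_cong[of _ _ prob]) auto
    also have "\<dots> = prob (\<Inter>j\<in>?I. X j) * prob (X (Some (n, True))) * prob (X (Some (n, False)))"
      unfolding C(2) T(2) by (rule triple_indep[OF \<rho>' AF C(1) T(1)])
    also have "\<dots> = (\<Prod>j\<in>insert (Some (n, True)) (insert (Some (n, False)) ?I). prob (X j))"
      by (subst prod.insert, simp, force, subst prod.insert, simp, force) (simp only: Suc.IH[OF XI] mult_ac)
    finally show ?case unfolding I .
  qed simp
  then show ?thesis using ev sp by (subst indep_sets_finite) auto
qed


text \<open>For finitely many times a grid starting at \<open>a\<close> is used: \<open>L\<close>
  before \<open>a\<close> belongs to \<open>F a\<close>, \<open>L\<close> after \<open>a\<close> is
  \<open>L a\<close> plus grid increments, and the grid increments of \<open>B\<close> are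
  independent of all this. The algebras of finitely many times are directed, so their unions are
  intersection-stable generators.\<close>

theorem increments_indep_enlarged:
  assumes a: "0 \<le> a"
  shows "indep_set (sigma_sets (space M) (\<Union>r\<in>{a..}. {(\<lambda>\<omega>. B r \<omega> - B a \<omega>) -` T \<inter> space M |T. T \<in> sets borel}))
    (sigma_sets (space M) (sets (F a) \<union> (\<Union>r\<in>{0..}. {L r -` T \<inter> space M |T. T \<in> sets borel})))"
proof -
  define U where "U R = sigma_sets (space M) (\<Union>r\<in>R. {(\<lambda>\<omega>. B r \<omega> - B a \<omega>) -` T \<inter> space M |T. T \<in> sets borel})" for R
  define G where "G R = sigma_sets (space M) (sets (F a) \<union> (\<Union>r\<in>R. {L r -` T \<inter> space M |T. T \<in> sets borel}))" for R
  have LP: "{L r -` T \<inter> space M |T. T \<in> sets borel} \<subseteq> Pow (space M)" for r by auto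
  have GP: "sets (F a) \<union> (\<Union>r\<in>R. {L r -` T \<inter> space M |T. T \<in> sets borel}) \<subseteq> Pow (space M)" for R
    using LP sets.space_closed[of "F a"] F_space[of a] by auto
  have UP: "(\<Union>r\<in>R. {(\<lambda>\<omega>. B r \<omega> - B a \<omega>) -` T \<inter> space M |T. T \<in> sets borel}) \<subseteq> Pow (space M)" for R
    by auto
  have G_ind: "indep_set (U R') (G R)" if R: "finite R" "R \<subseteq> {0..}" "finite R'" "R' \<subseteq> {a..}" for R R'
  proof -
    \<comment> \<open>Only times from \<open>a\<close> on enter the grid; containing
      \<open>a\<close> itself makes it the first grid time.\<close>
    define P where "P = {a} \<union> R' \<union> {r \<in> R. a \<le> r}"
    obtain \<rho> :: "nat \<Rightarrow> real" and n :: nat where \<rho>: "mono \<rho>" "\<rho> 0 = a" and P: "P = \<rho> ` {..n}"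
      by (rule finite_times_enumeration[of P a]) (use R a in \<open>auto simp: P_def\<close>)
    \<comment> \<open>\<open>True\<close> collects the increments of \<open>B\<close>,
      \<open>False\<close> those of \<open>L\<close> together with the past of
      \<open>a\<close>.\<close>
    define I where "I isB = (if isB then Some ` ({..<n} \<times> {True}) else insert None (Some ` ({..<n} \<times> {False})))" for isB
    have IU: "(\<Union>isB\<in>UNIV. I isB) = insert None (Some ` ({..<n} \<times> UNIV))"
      by (auto simp: I_def UNIV_bool)
    have "indep_sets (\<lambda>j. sigma_sets (space M) (\<Union>i\<in>I j. grid_alg \<rho> i)) UNIV"
    proof (rule indep_sets_collect_sigma)
      show "indep_sets (grid_alg \<rho>) (\<Union>j\<in>UNIV. I j)"
        unfolding IU using \<rho> a by (intro grid_alg_indep) auto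
      show "disjoint_family_on I UNIV" by (auto simp: disjoint_family_on_def I_def)
      have st: "Int_stable {f -` T \<inter> space M |T. T \<in> sets N}" for f :: "'w \<Rightarrow> 'z" and N :: "'z measure"
      proof (rule Int_stableI)
        fix x y assume "x \<in> {f -` T \<inter> space M |T. T \<in> sets N}" "y \<in> {f -` T \<inter> space M |T. T \<in> sets N}"
        then obtain S T where "S \<in> sets N" "T \<in> sets N" "x = f -` S \<inter> space M" "y = f -` T \<inter> space M" by blast
        then show "x \<inter> y \<in> {f -` T \<inter> space M |T. T \<in> sets N}"
          by (auto intro!: exI[of _ "S \<inter> T"])
      qed
      show "Int_stable (grid_alg \<rho> i)" for i
        by (auto simp: grid_alg_def sets.Int_stable st split: option.split)
    qed
    moreover have "(\<lambda>j. sigma_sets (space M) (\<Union>i\<in>I j. grid_alg \<rho> i)) =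
        case_bool (sigma_sets (space M) (\<Union>i\<in>I True. grid_alg \<rho> i)) (sigma_sets (space M) (\<Union>i\<in>I False. grid_alg \<rho> i))"
      by (rule ext) (auto split: bool.split)
    ultimately have ind: "indep_set (sigma_sets (space M) (\<Union>i\<in>I True. grid_alg \<rho> i)) (sigma_sets (space M) (\<Union>i\<in>I False. grid_alg \<rho> i))"
      by (simp add: indep_set_def)
    define S1 where "S1 = sigma (space M) (\<Union>i\<in>I True. grid_alg \<rho> i)"
    define S0 where "S0 = sigma (space M) (\<Union>i\<in>I False. grid_alg \<rho> i)"
    have gP: "grid_alg \<rho> i \<subseteq> Pow (space M)" for i
      using sets.space_closed[of "F (\<rho> 0)"] F_space[of "\<rho> 0"] by (auto simp: grid_alg_def split: option.splits if_splits)
    have S: "sets S1 = sigma_sets (space M) (\<Union>i\<in>I True. grid_alg \<rho> i)" "space S1 = space M"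
      "sets S0 = sigma_sets (space M) (\<Union>i\<in>I False. grid_alg \<rho> i)" "space S0 = space M"
      unfolding S1_def S0_def using gP by (auto simp: sets_measure_of space_measure_of UN_subset_iff)
    have dB: "(\<lambda>\<omega>. B (\<rho> (Suc k)) \<omega> - B (\<rho> k) \<omega>) \<in> borel_measurable S1" if "k < n" for k
    proof (rule measurableI)
      fix C :: "'b set" assume "C \<in> sets borel"
      then have "(\<lambda>\<omega>. B (\<rho> (Suc k)) \<omega> - B (\<rho> k) \<omega>) -` C \<inter> space M \<in> grid_alg \<rho> (Some (k, True))"
        by (auto simp: grid_alg_def)
      then show "(\<lambda>\<omega>. B (\<rho> (Suc k)) \<omega> - B (\<rho> k) \<omega>) -` C \<inter> space S1 \<in> sets S1"
        unfolding S using that by (intro sigma_sets.Basic UN_I[of "Some (k, True)"]) (auto simp: I_def)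
    qed simp
    have dL: "(\<lambda>\<omega>. L (\<rho> (Suc k)) \<omega> - L (\<rho> k) \<omega>) \<in> borel_measurable S0" if "k < n" for k
    proof (rule measurableI)
      fix C :: "'h hs_op set" assume "C \<in> sets borel"
      then have "(\<lambda>\<omega>. L (\<rho> (Suc k)) \<omega> - L (\<rho> k) \<omega>) -` C \<inter> space M \<in> grid_alg \<rho> (Some (k, False))"
        by (auto simp: grid_alg_def)
      then show "(\<lambda>\<omega>. L (\<rho> (Suc k)) \<omega> - L (\<rho> k) \<omega>) -` C \<inter> space S0 \<in> sets S0"
        unfolding S using that by (intro sigma_sets.Basic UN_I[of "Some (k, False)"]) (auto simp: I_def)
    qed simp
    have FS0: "sets (F a) \<subseteq> sets S0"
      unfolding S using \<rho>(2) by (auto simp: I_def grid_alg_def intro!: sigma_sets.Basic)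
    have LF_S0: "L r \<in> borel_measurable S0" if "0 \<le> r" "r \<le> a" for r
      using L_F[OF that] FS0 by (auto simp: measurable_def S F_space)
    have L_S0: "L (\<rho> k) \<in> borel_measurable S0" if "k \<le> n" for k
      using that
    proof (induction k)
      case 0 then show ?case using LF_S0[of a] a \<rho>(2) by simp
    next
      case (Suc k)
      then have "(\<lambda>\<omega>. L (\<rho> k) \<omega> + (L (\<rho> (Suc k)) \<omega> - L (\<rho> k) \<omega>)) \<in> borel_measurable S0"
        by (intro borel_measurable_add dL) auto
      then show ?case by simp
    qed
    have B_S1: "(\<lambda>\<omega>. B (\<rho> k) \<omega> - B a \<omega>) \<in> borel_measurable S1" if "k \<le> n" for k
      using that
    proof (induction k)
      case 0 then show ?case using \<rho>(2) by simp
    next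
      case (Suc k)
      then have "(\<lambda>\<omega>. (B (\<rho> k) \<omega> - B a \<omega>) + (B (\<rho> (Suc k)) \<omega> - B (\<rho> k) \<omega>)) \<in> borel_measurable S1"
        by (intro borel_measurable_add dB) auto
      then show ?case by simp
    qed
    have BR: "(\<lambda>\<omega>. B r \<omega> - B a \<omega>) \<in> borel_measurable S1" if "r \<in> R'" for r
    proof -
      have "r \<in> P" using that by (simp add: P_def)
      then show ?thesis using P B_S1 by auto
    qed
    have "(\<Union>r\<in>R'. {(\<lambda>\<omega>. B r \<omega> - B a \<omega>) -` T \<inter> space M |T. T \<in> sets borel}) \<subseteq> sets S1"
      using measurable_sets[OF BR] by (auto simp: S(2))
    then have US1: "U R' \<subseteq> sets S1"
      unfolding U_def using sets.sigma_sets_subset[of _ S1] by (simp add: S(2))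
    have LR: "L r \<in> borel_measurable S0" if "r \<in> R" for r
    proof (cases "a \<le> r")
      case True
      then have "r \<in> P" using that by (simp add: P_def)
      then show ?thesis using P L_S0 by auto
    next
      case False then show ?thesis using that R by (intro LF_S0) auto
    qed
    have "sets (F a) \<union> (\<Union>r\<in>R. {L r -` T \<inter> space M |T. T \<in> sets borel}) \<subseteq> sets S0"
      using FS0 measurable_sets[OF LR] by (auto simp: S(4))
    then have GS0: "G R \<subseteq> sets S0"
      unfolding G_def using sets.sigma_sets_subset[of _ S0] by (simp add: S(4))
    show ?thesis
    proof (rule indep_setI)
      show "U R' \<subseteq> events" "G R \<subseteq> events"
        using indep_setD_ev1[OF ind] indep_setD_ev2[OF ind] US1 GS0 unfolding S(1,3) by auto
      show "prob (x \<inter> y) = prob x * prob y" if "x \<in> U R'" "y \<in> G R" for x y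
        using indep_setD[OF ind, of x y] that US1 GS0 unfolding S(1,3) by blast
    qed
  qed
  define D where "D = (\<Union>R\<in>{R. finite R \<and> R \<subseteq> {0..}}. G R)"
  define E where "E = (\<Union>R\<in>{R. finite R \<and> R \<subseteq> {a..}}. U R)"
  have Gmono: "G R \<subseteq> G R'" if "R \<subseteq> R'" for R R'
    unfolding G_def using that by (intro sigma_sets_mono') auto
  have Umono: "U R \<subseteq> U R'" if "R \<subseteq> R'" for R R'
    unfolding U_def using that by (intro sigma_sets_mono') auto
  have Int: "x \<inter> y \<in> X" if "sigma_algebra (space M) X" "x \<in> X" "y \<in> X" for X x y
    using that by (meson sigma_algebra.axioms(1) algebra.axioms(1) ring_of_sets.axioms(1) semiring_of_sets.Int)
  have "indep_set E D"
  proof (rule indep_setI)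
    show "E \<subseteq> events" using indep_setD_ev1[OF G_ind[of "{}"]] unfolding E_def by blast
    show "D \<subseteq> events" using indep_setD_ev2[OF G_ind[of _ "{}"]] unfolding D_def by blast
    show "prob (x \<inter> y) = prob x * prob y" if "x \<in> E" "y \<in> D" for x y
      using indep_setD[OF G_ind] that by (auto simp: D_def E_def)
  qed
  moreover have "Int_stable E"
  proof (rule Int_stableI)
    fix x y assume "x \<in> E" "y \<in> E"
    then obtain R R' where R: "finite R" "R \<subseteq> {a..}" "finite R'" "R' \<subseteq> {a..}" "x \<in> U R" "y \<in> U R'" by (auto simp: E_def)
    then have "x \<in> U (R \<union> R')" "y \<in> U (R \<union> R')" using Umono[of R "R \<union> R'"] Umono[of R' "R \<union> R'"] by auto
    moreover have "sigma_algebra (space M) (U (R \<union> R'))" unfolding U_def by (rule sigma_algebra_sigma_sets[OF UP])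
    ultimately have "x \<inter> y \<in> U (R \<union> R')" by (intro Int)
    then show "x \<inter> y \<in> E" unfolding E_def using R by blast
  qed
  moreover have "Int_stable D"
  proof (rule Int_stableI)
    fix x y assume "x \<in> D" "y \<in> D"
    then obtain R R' where R: "finite R" "R \<subseteq> {0..}" "finite R'" "R' \<subseteq> {0..}" "x \<in> G R" "y \<in> G R'" by (auto simp: D_def)
    then have "x \<in> G (R \<union> R')" "y \<in> G (R \<union> R')" using Gmono[of R "R \<union> R'"] Gmono[of R' "R \<union> R'"] by auto
    moreover have "sigma_algebra (space M) (G (R \<union> R'))" unfolding G_def by (rule sigma_algebra_sigma_sets[OF GP])
    ultimately have "x \<inter> y \<in> G (R \<union> R')" by (intro Int)
    then show "x \<inter> y \<in> D" unfolding D_def using R by blast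
  qed
  ultimately have ind: "indep_set (sigma_sets (space M) E) (sigma_sets (space M) D)" by (rule indep_set_sigma_sets)
  have "sets (F a) \<union> (\<Union>r\<in>{0..}. {L r -` T \<inter> space M |T. T \<in> sets borel}) \<subseteq> D"
  proof -
    have "sets (F a) \<subseteq> G {}" unfolding G_def by auto
    moreover have "{L r -` T \<inter> space M |T. T \<in> sets borel} \<subseteq> G {r}" for r unfolding G_def by blast
    moreover have "G R \<subseteq> D" if "finite R" "R \<subseteq> {0..}" for R using that by (auto simp: D_def)
    from this[of "{}"] this[of "{r}" for r] have "G {} \<subseteq> D" "\<And>r. r \<in> {0..} \<Longrightarrow> G {r} \<subseteq> D" by simp_all
    ultimately show ?thesis by (intro Un_least UN_least) (rule order_trans, assumption+)+
  qed
  then have subD: "sigma_sets (space M) (sets (F a) \<union> (\<Union>r\<in>{0..}. {L r -` T \<inter> space M |T. T \<in> sets borel})) \<subseteq> sigma_sets (space M) D"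
    by (rule sigma_sets_mono')
  have "(\<Union>r\<in>{a..}. {(\<lambda>\<omega>. B r \<omega> - B a \<omega>) -` T \<inter> space M |T. T \<in> sets borel}) \<subseteq> E"
  proof (rule UN_least)
    fix r assume "r \<in> {a..}"
    then have "U {r} \<subseteq> E" unfolding E_def by blast
    moreover have "{(\<lambda>\<omega>. B r \<omega> - B a \<omega>) -` T \<inter> space M |T. T \<in> sets borel} \<subseteq> U {r}" unfolding U_def by blast
    ultimately show "{(\<lambda>\<omega>. B r \<omega> - B a \<omega>) -` T \<inter> space M |T. T \<in> sets borel} \<subseteq> E" by (rule order_trans[rotated])
  qed
  then have subE: "sigma_sets (space M) (\<Union>r\<in>{a..}. {(\<lambda>\<omega>. B r \<omega> - B a \<omega>) -` T \<inter> space M |T. T \<in> sets borel}) \<subseteq> sigma_sets (space M) E"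
    by (rule sigma_sets_mono')
  show ?thesis
  proof (rule indep_setI)
    show "sigma_sets (space M) (\<Union>r\<in>{a..}. {(\<lambda>\<omega>. B r \<omega> - B a \<omega>) -` T \<inter> space M |T. T \<in> sets borel}) \<subseteq> events"
      using subE indep_setD_ev1[OF ind] by (rule order_trans)
    show "sigma_sets (space M) (sets (F a) \<union> (\<Union>r\<in>{0..}. {L r -` T \<inter> space M |T. T \<in> sets borel})) \<subseteq> events"
      using subD indep_setD_ev2[OF ind] by (rule order_trans)
    fix x y assume "x \<in> sigma_sets (space M) (\<Union>r\<in>{a..}. {(\<lambda>\<omega>. B r \<omega> - B a \<omega>) -` T \<inter> space M |T. T \<in> sets borel})"
      "y \<in> sigma_sets (space M) (sets (F a) \<union> (\<Union>r\<in>{0..}. {L r -` T \<inter> space M |T. T \<in> sets borel}))"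
    then show "prob (x \<inter> y) = prob x * prob y" using subE subD by (intro indep_setD[OF ind]) auto
  qed
qed

end

section \<open>The Ito isometry for step processes\<close>

lemma (in prob_space) indep_increment_var:
  fixes X :: "'a \<Rightarrow> real" and \<phi> :: "'b \<Rightarrow> real"
  assumes N: "subalgebra M N" and U: "U \<in> M \<rightarrow>\<^sub>M K"
    and ind: "indep_set (sets (vimage_algebra (space M) U K)) (sets N)"
    and X: "X \<in> borel_measurable N" and \<phi>: "\<phi> \<in> borel_measurable K"
  shows "indep_var borel X borel (\<lambda>\<omega>. \<phi> (U \<omega>))"
proof -
  let ?Y = "\<lambda>\<omega>. \<phi> (U \<omega>)"
  have XM: "X \<in> borel_measurable M" by (rule measurable_from_subalg[OF N X])
  have YM: "?Y \<in> borel_measurable M" by (rule measurable_compose[OF U \<phi>])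
  have sp: "space N = space M" using N by (simp add: subalgebra_def)
  have sx: "sigma_sets (space M) {X -` A \<inter> space M |A. A \<in> sets borel} \<subseteq> sets N"
    using measurable_sets[OF X] by (intro sets.sigma_sets_subset[of _ N, unfolded sp]) (auto simp: sp)
  let ?V = "vimage_algebra (space M) U K"
  have UV: "U \<in> ?V \<rightarrow>\<^sub>M K" using measurable_space[OF U] by (intro measurable_vimage_algebra1) auto
  have YV: "?Y \<in> borel_measurable ?V" by (rule measurable_compose[OF UV \<phi>])
  have sy: "sigma_sets (space M) {?Y -` A \<inter> space M |A. A \<in> sets borel} \<subseteq> sets ?V"
    using measurable_sets[OF YV] by (intro sets.sigma_sets_subset[of _ ?V, simplified]) auto
  show ?thesis
    unfolding indep_var_eq
  proof (intro conjI XM YM indep_setI)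
    show "sigma_sets (space M) {X -` A \<inter> space M |A. A \<in> sets borel} \<subseteq> events"
      "sigma_sets (space M) {?Y -` A \<inter> space M |A. A \<in> sets borel} \<subseteq> events"
      using sx sy indep_setD_ev1[OF ind] indep_setD_ev2[OF ind] by auto
    fix a b assume "a \<in> sigma_sets (space M) {X -` A \<inter> space M |A. A \<in> sets borel}"
      "b \<in> sigma_sets (space M) {?Y -` A \<inter> space M |A. A \<in> sets borel}"
    then have "a \<in> sets N" "b \<in> sets ?V" using sx sy by auto
    from indep_setD[OF ind this(2,1)] show "prob (a \<inter> b) = prob a * prob b" by (simp add: Int_commute mult.commute)
  qed
qed

lemma (in prob_space) indep_increment_expectation:
  fixes X :: "'a \<Rightarrow> real" and \<phi> :: "'b \<Rightarrow> real"
  assumes N: "subalgebra M N" and U: "U \<in> M \<rightarrow>\<^sub>M K"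
    and ind: "indep_set (sets (vimage_algebra (space M) U K)) (sets N)"
    and X: "X \<in> borel_measurable N" "integrable M X"
    and \<phi>: "\<phi> \<in> borel_measurable K" "integrable M (\<lambda>\<omega>. \<phi> (U \<omega>))"
  shows "integrable M (\<lambda>\<omega>. X \<omega> * \<phi> (U \<omega>))" "(\<integral>\<omega>. X \<omega> * \<phi> (U \<omega>) \<partial>M) = (\<integral>\<omega>. X \<omega> \<partial>M) * (\<integral>\<omega>. \<phi> (U \<omega>) \<partial>M)"
  using indep_var_lebesgue_integral[OF indep_increment_var[OF N U ind X(1) \<phi>(1)] X(2) \<phi>(2)]
    indep_var_integrable[OF indep_increment_var[OF N U ind X(1) \<phi>(1)] X(2) \<phi>(2)] by auto

lemma integrable_mult_square:
  fixes X Y :: "'w \<Rightarrow> real"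
  assumes "X \<in> borel_measurable M" "Y \<in> borel_measurable M"
    and "integrable M (\<lambda>\<omega>. (X \<omega>)\<^sup>2)" "integrable M (\<lambda>\<omega>. (Y \<omega>)\<^sup>2)"
  shows "integrable M (\<lambda>\<omega>. X \<omega> * Y \<omega>)"
proof (rule Bochner_Integration.integrable_bound)
  show "integrable M (\<lambda>\<omega>. (X \<omega>)\<^sup>2 + (Y \<omega>)\<^sup>2)" using assms by simp
  have "\<bar>x * y\<bar> \<le> x\<^sup>2 + y\<^sup>2" for x y :: real
  proof -
    have "2 * \<bar>x * y\<bar> \<le> x\<^sup>2 + y\<^sup>2"
      using sum_squares_bound[of "\<bar>x\<bar>" "\<bar>y\<bar>"] by (simp add: abs_mult mult.assoc)
    then show ?thesis using abs_ge_zero[of "x * y"] by linarith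
  qed
  then show "AE \<omega> in M. norm (X \<omega> * Y \<omega>) \<le> norm ((X \<omega>)\<^sup>2 + (Y \<omega>)\<^sup>2)" by simp
qed (use assms in auto)

text \<open>An interval, a real random coefficient and a constant operator. Keeping the randomness
  scalar allows coefficients to be conditioned and frozen. Intervals may overlap, so sums of
  processes are just concatenated lists.\<close>

type_synonym ('w, 'a, 'b) atom = "real \<times> real \<times> ('w \<Rightarrow> real) \<times> ('a \<Rightarrow>\<^sub>L 'b)"

definition step_value :: "('w, 'a::real_normed_vector, 'b::real_normed_vector) atom list \<Rightarrow> real \<Rightarrow> 'w \<Rightarrow> 'a \<Rightarrow>\<^sub>L 'b" where
  "step_value xs s \<omega> = (\<Sum>(a, b, c, \<phi>)\<leftarrow>xs. (indicator {a<..b} s * c \<omega>) *\<^sub>R \<phi>)"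

text \<open>Coefficients and noise are evaluated at separate points. The diagonal
  \<open>v = \<omega>\<close> is the stochastic integral; for fixed \<open>\<omega>\<close> it is
  the integral with frozen coefficients.\<close>

definition step_integral :: "(real \<Rightarrow> 'v \<Rightarrow> 'a) \<Rightarrow> ('w, 'a::real_normed_vector, 'b::real_normed_vector) atom list \<Rightarrow> 'w \<Rightarrow> 'v \<Rightarrow> 'b" where
  "step_integral Z xs \<omega> v = (\<Sum>(a, b, c, \<phi>)\<leftarrow>xs. c \<omega> *\<^sub>R \<phi> (Z b v - Z a v))"

definition step_process :: "(real \<Rightarrow> 'w measure) \<Rightarrow> real \<Rightarrow> ('w, 'a::real_normed_vector, 'b::real_normed_vector) atom list \<Rightarrow> bool" where
  "step_process H T xs \<longleftrightarrow> (\<forall>(a, b, c, \<phi>)\<in>set xs. 0 \<le> a \<and> a \<le> b \<and> b \<le> T \<and> c \<in> borel_measurable (H a) \<and> (\<exists>K. \<forall>\<omega>. \<bar>c \<omega>\<bar> \<le> K))"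

definition step_map :: "('b::real_normed_vector \<Rightarrow>\<^sub>L 'c::real_normed_vector) \<Rightarrow> ('w, 'a::real_normed_vector, 'b) atom list \<Rightarrow> ('w, 'a, 'c) atom list" where
  "step_map S xs = map (\<lambda>(a, b, c, \<phi>). (a, b, c, S o\<^sub>L \<phi>)) xs"

lemma step_value_simps [simp]:
  "step_value [] s \<omega> = 0"
  "step_value ((a, b, c, \<phi>) # xs) s \<omega> = (indicator {a<..b} s * c \<omega>) *\<^sub>R \<phi> + step_value xs s \<omega>"
  "step_value (xs @ ys) s \<omega> = step_value xs s \<omega> + step_value ys s \<omega>"
  by (auto simp: step_value_def)

lemma step_integral_simps [simp]:
  "step_integral Z [] \<omega> v = 0"
  "step_integral Z ((a, b, c, \<phi>) # xs) \<omega> v = c \<omega> *\<^sub>R \<phi> (Z b v - Z a v) + step_integral Z xs \<omega> v"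
  "step_integral Z (xs @ ys) \<omega> v = step_integral Z xs \<omega> v + step_integral Z ys \<omega> v"
  by (auto simp: step_integral_def)

lemma step_process_simps [simp]:
  "step_process H T []"
  "step_process H T ((a, b, c, \<phi>) # xs) \<longleftrightarrow> 0 \<le> a \<and> a \<le> b \<and> b \<le> T \<and> c \<in> borel_measurable (H a) \<and> (\<exists>K. \<forall>\<omega>. \<bar>c \<omega>\<bar> \<le> K) \<and> step_process H T xs"
  "step_process H T (xs @ ys) \<longleftrightarrow> step_process H T xs \<and> step_process H T ys"
  by (simp_all add: step_process_def ball_Un)

lemma step_map_simps:
  "step_value (step_map S xs) s \<omega> = S o\<^sub>L step_value xs s \<omega>"
  "step_integral Z (step_map S xs) \<omega> v = S (step_integral Z xs \<omega> v)"
  "step_process H T xs \<Longrightarrow> step_process H T (step_map S xs)"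
proof -
  show "step_value (step_map S xs) s \<omega> = S o\<^sub>L step_value xs s \<omega>"
    by (induction xs) (auto simp: step_map_def intro!: blinfun_eqI simp: blinfun.bilinear_simps)
  show "step_integral Z (step_map S xs) \<omega> v = S (step_integral Z xs \<omega> v)"
    by (induction xs) (auto simp: step_map_def blinfun.bilinear_simps)
  show "step_process H T xs \<Longrightarrow> step_process H T (step_map S xs)"
    by (induction xs) (auto simp: step_map_def)
qed

definition step_neg :: "('w, 'a::real_normed_vector, 'b::real_normed_vector) atom list \<Rightarrow> ('w, 'a, 'b) atom list" where
  "step_neg xs = step_map (- id_blinfun) xs"

lemma step_neg_simps:
  "step_value (step_neg xs) s \<omega> = - step_value xs s \<omega>"
  "step_integral Z (step_neg xs) \<omega> v = - step_integral Z xs \<omega> v"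
  "step_process H T xs \<Longrightarrow> step_process H T (step_neg xs)"
  by (auto simp: step_neg_def step_map_simps blinfun.bilinear_simps intro!: blinfun_eqI)

lemma step_process_mono: "step_process H T xs \<Longrightarrow> T \<le> T' \<Longrightarrow> step_process H T' xs"
  by (induction xs) auto

lemma step_process_filtration:
  assumes "step_process H T xs"
    and le: "\<And>a f :: 'w \<Rightarrow> real. 0 \<le> a \<Longrightarrow> f \<in> borel_measurable (H a) \<Longrightarrow> f \<in> borel_measurable (H' a)"
  shows "step_process H' T xs"
  using assms(1)
proof (induction xs)
  case (Cons X xs)
  obtain a b c \<phi> where X: "X = (a, b, c, \<phi>)" by (cases X)
  have "c \<in> borel_measurable (H' a)" using Cons.prems le[of a c] by (simp add: X)
  then show ?case using Cons by (simp add: X)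
qed simp

lemma step_value_outside: "step_process H T xs \<Longrightarrow> T < s \<Longrightarrow> step_value xs s \<omega> = 0"
  by (induction xs) auto

text \<open>Lebesgue measure on \<open>[0, T]\<close> as a finite measure in its own right, so that
  \<open>ito_norm\<close> is one integral over a product space and Tonelli can be used in either
  order.\<close>

definition time_space :: "real \<Rightarrow> real measure" where
  "time_space T = restrict_space lborel {0..T}"

lemma finite_measure_time_space: "finite_measure (time_space T)"
  by (rule finite_measureI) (simp add: time_space_def emeasure_restrict_space space_restrict_space emeasure_lborel_Icc_eq)

lemma sets_time_space: "sets (time_space T) = sets (restrict_space borel {0..T})"
  unfolding time_space_def by (rule sets_restrict_space_cong) simp

lemma space_time_space: "space (time_space T) = {0..T}"
  by (simp add: time_space_def space_restrict_space)

definition jointly_measurable :: "'w measure \<Rightarrow> real \<Rightarrow> (real \<Rightarrow> 'w \<Rightarrow> 'a::real_normed_vector \<Rightarrow>\<^sub>L 'b::real_normed_vector) \<Rightarrow> bool" where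
  "jointly_measurable M T \<Psi> \<longleftrightarrow> (\<forall>x. (\<lambda>(s, \<omega>). \<Psi> s \<omega> x) \<in> borel_measurable (time_space T \<Otimes>\<^sub>M M))"

definition ito_norm :: "'w measure \<Rightarrow> ('a::{real_inner,banach,second_countable_topology} \<Rightarrow>\<^sub>L 'a) \<Rightarrow> real \<Rightarrow>
    (real \<Rightarrow> 'w \<Rightarrow> 'a \<Rightarrow>\<^sub>L 'b::{real_inner,banach,second_countable_topology}) \<Rightarrow> ennreal" where
  "ito_norm M Q T \<Psi> = (\<integral>\<^sup>+p. hs_norm_sq (\<Psi> (fst p) (snd p) o\<^sub>L sqrt_op Q) \<partial>(time_space T \<Otimes>\<^sub>M M))"

lemma jointly_measurable_add:
  fixes \<Psi> \<Psi>' :: "real \<Rightarrow> 'w \<Rightarrow> 'a::real_normed_vector \<Rightarrow>\<^sub>L 'b::{real_normed_vector,second_countable_topology}"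
  shows "jointly_measurable M T \<Psi> \<Longrightarrow> jointly_measurable M T \<Psi>' \<Longrightarrow> jointly_measurable M T (\<lambda>s \<omega>. \<Psi> s \<omega> + \<Psi>' s \<omega>)"
  unfolding jointly_measurable_def case_prod_beta by (auto simp: blinfun.bilinear_simps intro!: borel_measurable_add)

lemma jointly_measurable_diff:
  fixes \<Psi> \<Psi>' :: "real \<Rightarrow> 'w \<Rightarrow> 'a::real_normed_vector \<Rightarrow>\<^sub>L 'b::{real_normed_vector,second_countable_topology}"
  shows "jointly_measurable M T \<Psi> \<Longrightarrow> jointly_measurable M T \<Psi>' \<Longrightarrow> jointly_measurable M T (\<lambda>s \<omega>. \<Psi> s \<omega> - \<Psi>' s \<omega>)"
  unfolding jointly_measurable_def case_prod_beta by (auto simp: blinfun.bilinear_simps intro!: borel_measurable_diff)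

lemma measurable_ito_integrand:
  fixes \<Psi> :: "real \<Rightarrow> 'w \<Rightarrow> 'a::{real_inner,banach,second_countable_topology} \<Rightarrow>\<^sub>L 'b::{real_inner,banach,second_countable_topology}"
  assumes "jointly_measurable M T \<Psi>"
  shows "(\<lambda>p. hs_norm_sq (\<Psi> (fst p) (snd p) o\<^sub>L R)) \<in> borel_measurable (time_space T \<Otimes>\<^sub>M M)"
  using assms unfolding jointly_measurable_def case_prod_beta by (intro measurable_hs_norm_sq_compose) auto

text \<open>\<open>ito_norm\<close> is a squared seminorm, whence the factors 2.\<close>

lemma ito_norm_triangle:
  assumes "jointly_measurable M T A" "jointly_measurable M T B" "jointly_measurable M T C"
  shows "ito_norm M Q T (\<lambda>s \<omega>. A s \<omega> - C s \<omega>) \<le>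
    2 * ito_norm M Q T (\<lambda>s \<omega>. A s \<omega> - B s \<omega>) + 2 * ito_norm M Q T (\<lambda>s \<omega>. B s \<omega> - C s \<omega>)"
proof -
  let ?P = "time_space T \<Otimes>\<^sub>M M"
  let ?h = "\<lambda>X p. hs_norm_sq (X (fst p) (snd p) o\<^sub>L sqrt_op Q)"
  note m = measurable_ito_integrand[OF jointly_measurable_diff, where R = "sqrt_op Q"]
  have "ito_norm M Q T (\<lambda>s \<omega>. A s \<omega> - C s \<omega>) \<le>
      (\<integral>\<^sup>+p. 2 * ?h (\<lambda>s \<omega>. A s \<omega> - B s \<omega>) p + 2 * ?h (\<lambda>s \<omega>. B s \<omega> - C s \<omega>) p \<partial>?P)"
    unfolding ito_norm_def
  proof (rule nn_integral_mono)
    fix p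
    let ?A = "A (fst p) (snd p)" and ?B = "B (fst p) (snd p)" and ?C = "C (fst p) (snd p)"
    have "(?A - ?C) o\<^sub>L sqrt_op Q = ((?A - ?B) o\<^sub>L sqrt_op Q) + ((?B - ?C) o\<^sub>L sqrt_op Q)"
      by (rule blinfun_eqI) (simp add: blinfun.bilinear_simps)
    then show "hs_norm_sq ((?A - ?C) o\<^sub>L sqrt_op Q) \<le> 2 * hs_norm_sq ((?A - ?B) o\<^sub>L sqrt_op Q) + 2 * hs_norm_sq ((?B - ?C) o\<^sub>L sqrt_op Q)"
      using hs_norm_sq_add_le by metis
  qed
  also have "\<dots> = 2 * ito_norm M Q T (\<lambda>s \<omega>. A s \<omega> - B s \<omega>) + 2 * ito_norm M Q T (\<lambda>s \<omega>. B s \<omega> - C s \<omega>)"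
    unfolding ito_norm_def using m[OF assms(1,2)] m[OF assms(2,3)] by (simp add: nn_integral_add nn_integral_cmult)
  finally show ?thesis .
qed

lemma ito_norm_commute: "ito_norm M Q T (\<lambda>s \<omega>. A s \<omega> - B s \<omega>) = ito_norm M Q T (\<lambda>s \<omega>. B s \<omega> - A s \<omega>)"
  by (simp add: ito_norm_def hs_norm_sq_nn_integral blinfun.bilinear_simps norm_minus_commute)

lemma (in prob_space) ito_norm_iterated:
  assumes "jointly_measurable M T \<Psi>"
  shows "ito_norm M Q T \<Psi> = (\<integral>\<^sup>+\<omega>. (\<integral>\<^sup>+s\<in>{0..T}. hs_norm_sq (\<Psi> s \<omega> o\<^sub>L sqrt_op Q) \<partial>lborel) \<partial>M)"
proof -
  interpret T: finite_measure "time_space T" by (rule finite_measure_time_space)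
  interpret P: pair_sigma_finite "time_space T" M ..
  show ?thesis
    unfolding ito_norm_def P.nn_integral_snd[OF measurable_ito_integrand[OF assms], symmetric]
    by (simp add: time_space_def nn_integral_restrict_space)
qed

text \<open>Collects what the isometry needs of the integrator. It is used for the compensated Levy
  process in the given filtration and for \<open>B\<close> in the filtration enlarged by the paths
  of \<open>Y\<close>.\<close>

locale square_integrable_noise = prob_space M
  for M :: "'w measure" +
  fixes H :: "real \<Rightarrow> 'w measure" and Z :: "real \<Rightarrow> 'w \<Rightarrow> 'a::{real_inner,banach,second_countable_topology}"
    and Q :: "'a \<Rightarrow>\<^sub>L 'a"
  assumes H_subalg: "\<And>t. subalgebra M (H t)"
    and H_mono: "\<And>s t. 0 \<le> s \<Longrightarrow> s \<le> t \<Longrightarrow> sets (H s) \<subseteq> sets (H t)"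
    and Z_H: "\<And>t. 0 \<le> t \<Longrightarrow> Z t \<in> borel_measurable (H t)"
    and Z_ind: "\<And>s t. 0 \<le> s \<Longrightarrow> s \<le> t \<Longrightarrow>
      indep_set (sets (vimage_algebra (space M) (\<lambda>\<omega>. Z t \<omega> - Z s \<omega>) borel)) (sets (H s))"
    and Z_mean: "\<And>s t x. 0 \<le> s \<Longrightarrow> s \<le> t \<Longrightarrow> (\<integral>\<omega>. (Z t \<omega> - Z s \<omega>) \<bullet> x \<partial>M) = 0"
    and Z_int: "\<And>s t x. 0 \<le> s \<Longrightarrow> s \<le> t \<Longrightarrow> integrable M (\<lambda>\<omega>. ((Z t \<omega> - Z s \<omega>) \<bullet> x)\<^sup>2)"
    and Z_cov: "\<And>s t x y. 0 \<le> s \<Longrightarrow> s \<le> t \<Longrightarrow>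
      (\<integral>\<omega>. ((Z t \<omega> - Z s \<omega>) \<bullet> x) * ((Z t \<omega> - Z s \<omega>) \<bullet> y) \<partial>M) = (t - s) * (Q x \<bullet> y)"
    and Q_trace: "trace_class_nonneg Q"
begin

lemma H_space: "space (H t) = space M" using H_subalg by (simp add: subalgebra_def)

lemma H_lift: "0 \<le> s \<Longrightarrow> s \<le> t \<Longrightarrow> f \<in> borel_measurable (H s) \<Longrightarrow> f \<in> borel_measurable (H t)"
  using H_mono[of s t] H_space by (auto simp: measurable_def)

lemma H_M: "f \<in> borel_measurable (H s) \<Longrightarrow> f \<in> borel_measurable M"
  using measurable_from_subalg[OF H_subalg] .

lemma Z_M: "0 \<le> s \<Longrightarrow> Z s \<in> borel_measurable M" using Z_H H_M by blast

lemma incr_H: "0 \<le> s \<Longrightarrow> s \<le> t \<Longrightarrow> (\<lambda>\<omega>. (Z t \<omega> - Z s \<omega>) \<bullet> x) \<in> borel_measurable (H t)"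
  using H_lift[OF _ _ Z_H, of s t] Z_H[of t] by (intro borel_measurable_inner borel_measurable_diff) auto

lemma incr_M: "0 \<le> s \<Longrightarrow> s \<le> t \<Longrightarrow> (\<lambda>\<omega>. (Z t \<omega> - Z s \<omega>) \<bullet> x) \<in> borel_measurable M"
  using incr_H H_M by blast

lemma incr_integrable: "0 \<le> s \<Longrightarrow> s \<le> t \<Longrightarrow> integrable M (\<lambda>\<omega>. (Z t \<omega> - Z s \<omega>) \<bullet> x)"
  using integrable_mult_square[of "\<lambda>_. 1" M "\<lambda>\<omega>. (Z t \<omega> - Z s \<omega>) \<bullet> x"] incr_M[of s t x] Z_int[of s t x] by simp

lemma incr_mult_integrable:
  "0 \<le> s \<Longrightarrow> s \<le> t \<Longrightarrow> 0 \<le> s' \<Longrightarrow> s' \<le> t' \<Longrightarrow> integrable M (\<lambda>\<omega>. ((Z t \<omega> - Z s \<omega>) \<bullet> x) * ((Z t' \<omega> - Z s' \<omega>) \<bullet> y))"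
  by (rule integrable_mult_square) (auto intro: incr_M Z_int)

lemma expectation_past_times_increment:
  assumes st: "0 \<le> s" "s \<le> t" and W: "W \<in> borel_measurable (H s)" "integrable M W"
  shows "(\<integral>\<omega>. W \<omega> * ((Z t \<omega> - Z s \<omega>) \<bullet> y) \<partial>M) = 0"
proof -
  have "(\<lambda>\<omega>. Z t \<omega> - Z s \<omega>) \<in> borel_measurable M" using Z_M[of s] Z_M[of t] st by simp
  from indep_increment_expectation(2)[OF H_subalg this Z_ind[OF st] W, of "\<lambda>z. z \<bullet> y"] show ?thesis
    using incr_integrable[OF st] Z_mean[OF st] by simp
qed

text \<open>Splitting the longer increment at \<open>u\<close> leaves a term in which everything
  else is known at time \<open>u\<close>; it has mean 0, and only the covariance over the common
  interval survives.\<close>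

lemma expectation_same_start:
  assumes s: "0 \<le> s" "s \<le> u" "u \<le> v" and W: "W \<in> borel_measurable (H s)" "\<And>\<omega>. \<bar>W \<omega>\<bar> \<le> K"
  shows "(\<integral>\<omega>. W \<omega> * (((Z u \<omega> - Z s \<omega>) \<bullet> x) * ((Z v \<omega> - Z s \<omega>) \<bullet> y)) \<partial>M) = (u - s) * (\<integral>\<omega>. W \<omega> \<partial>M) * (Q x \<bullet> y)"
proof -
  have su: "s \<le> v" "0 \<le> u" using s by auto
  have WM: "W \<in> borel_measurable M" using W(1) by (rule H_M)
  have Wi: "integrable M W" by (rule integrable_const_bound[of _ K]) (use W WM in auto)
  have m: "(\<lambda>\<omega>. Z u \<omega> - Z s \<omega>) \<in> borel_measurable M" using Z_M[of s] Z_M[of u] s by simp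
  have i1: "integrable M (\<lambda>\<omega>. W \<omega> * (((Z u \<omega> - Z s \<omega>) \<bullet> x) * ((Z u \<omega> - Z s \<omega>) \<bullet> y)))"
    by (rule integrable_bounded_mult[OF incr_mult_integrable WM W(2)]) (use s in auto)
  have i2: "integrable M (\<lambda>\<omega>. W \<omega> * (((Z u \<omega> - Z s \<omega>) \<bullet> x) * ((Z v \<omega> - Z u \<omega>) \<bullet> y)))"
    by (rule integrable_bounded_mult[OF incr_mult_integrable WM W(2)]) (use s in auto)
  have "(\<integral>\<omega>. W \<omega> * (((Z u \<omega> - Z s \<omega>) \<bullet> x) * ((Z v \<omega> - Z s \<omega>) \<bullet> y)) \<partial>M) =
      (\<integral>\<omega>. W \<omega> * (((Z u \<omega> - Z s \<omega>) \<bullet> x) * ((Z u \<omega> - Z s \<omega>) \<bullet> y)) +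
          W \<omega> * (((Z u \<omega> - Z s \<omega>) \<bullet> x) * ((Z v \<omega> - Z u \<omega>) \<bullet> y)) \<partial>M)"
    by (rule Bochner_Integration.integral_cong) (auto simp: inner_diff_left algebra_simps)
  also have "\<dots> = (\<integral>\<omega>. W \<omega> * (((Z u \<omega> - Z s \<omega>) \<bullet> x) * ((Z u \<omega> - Z s \<omega>) \<bullet> y)) \<partial>M) +
      (\<integral>\<omega>. (W \<omega> * ((Z u \<omega> - Z s \<omega>) \<bullet> x)) * ((Z v \<omega> - Z u \<omega>) \<bullet> y) \<partial>M)"
    using i1 i2 by (simp add: mult.assoc)
  also have "(\<integral>\<omega>. (W \<omega> * ((Z u \<omega> - Z s \<omega>) \<bullet> x)) * ((Z v \<omega> - Z u \<omega>) \<bullet> y) \<partial>M) = 0"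
    using s by (intro expectation_past_times_increment borel_measurable_times incr_H H_lift[OF _ _ W(1)]
        integrable_bounded_mult[OF incr_integrable WM W(2)]) auto
  also have "(\<integral>\<omega>. W \<omega> * (((Z u \<omega> - Z s \<omega>) \<bullet> x) * ((Z u \<omega> - Z s \<omega>) \<bullet> y)) \<partial>M) = (\<integral>\<omega>. W \<omega> \<partial>M) * ((u - s) * (Q x \<bullet> y))"
    using indep_increment_expectation(2)[OF H_subalg m Z_ind[OF s(1,2)] W(1) Wi, of "\<lambda>z. (z \<bullet> x) * (z \<bullet> y)"]
      incr_mult_integrable[OF s(1,2) s(1,2)] Z_cov[OF s(1,2)] by simp
  finally show ?thesis by simp
qed

lemma Q_sym: "Q x \<bullet> y = Q y \<bullet> x"
  using trace_class_inner[OF Q_trace] by (simp add: inner_commute)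

text \<open>The earlier interval is cut at \<open>a'\<close>. Its part before \<open>a'\<close> is
  known when the second increment starts and contributes 0; the remaining increments have the same
  start. What survives is the length of the overlap, so atoms need not be disjoint.\<close>

lemma expectation_pair_le:
  assumes ab: "0 \<le> a" "a \<le> b" "0 \<le> a'" "a' \<le> b'" "a \<le> a'"
    and c: "c \<in> borel_measurable (H a)" "\<And>\<omega>. \<bar>c \<omega>\<bar> \<le> K"
    and c': "c' \<in> borel_measurable (H a')" "\<And>\<omega>. \<bar>c' \<omega>\<bar> \<le> K'"
  shows "(\<integral>\<omega>. (c \<omega> * c' \<omega>) * (((Z b \<omega> - Z a \<omega>) \<bullet> x) * ((Z b' \<omega> - Z a' \<omega>) \<bullet> y)) \<partial>M) =
    max 0 (min b b' - max a a') * (\<integral>\<omega>. c \<omega> * c' \<omega> \<partial>M) * (Q x \<bullet> y)"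
proof -
  have cH: "c \<in> borel_measurable (H a')" using H_lift[OF _ _ c(1)] ab by auto
  have WH: "(\<lambda>\<omega>. c \<omega> * c' \<omega>) \<in> borel_measurable (H a')" using cH c'(1) by simp
  have WM: "(\<lambda>\<omega>. c \<omega> * c' \<omega>) \<in> borel_measurable M" using WH by (rule H_M)
  have Wb: "\<bar>c \<omega> * c' \<omega>\<bar> \<le> K * K'" for \<omega>
    unfolding abs_mult using c(2) c'(2) by (intro mult_mono) (auto intro: order_trans[OF abs_ge_zero])
  have zero: "(\<integral>\<omega>. (c \<omega> * c' \<omega>) * (((Z r \<omega> - Z a \<omega>) \<bullet> x) * ((Z b' \<omega> - Z a' \<omega>) \<bullet> y)) \<partial>M) = 0" if r: "a \<le> r" "r \<le> a'" for r
  proof -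
    have "(\<integral>\<omega>. ((c \<omega> * c' \<omega>) * ((Z r \<omega> - Z a \<omega>) \<bullet> x)) * ((Z b' \<omega> - Z a' \<omega>) \<bullet> y) \<partial>M) = 0"
      using ab r by (intro expectation_past_times_increment borel_measurable_times[OF WH] H_lift[OF _ _ incr_H, of r]
          integrable_bounded_mult[OF incr_integrable WM Wb]) auto
    then show ?thesis by (simp add: mult.assoc)
  qed
  show ?thesis
  proof (cases "b \<le> a'")
    case True
    then show ?thesis using zero[of b] ab by simp
  next
    case False
    have i: "integrable M (\<lambda>\<omega>. (c \<omega> * c' \<omega>) * (((Z a' \<omega> - Z a \<omega>) \<bullet> x) * ((Z b' \<omega> - Z a' \<omega>) \<bullet> y)))"
      "integrable M (\<lambda>\<omega>. (c \<omega> * c' \<omega>) * (((Z b \<omega> - Z a' \<omega>) \<bullet> x) * ((Z b' \<omega> - Z a' \<omega>) \<bullet> y)))"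
      using ab False by (auto intro!: integrable_bounded_mult[OF incr_mult_integrable WM Wb])
    have "(\<integral>\<omega>. (c \<omega> * c' \<omega>) * (((Z b \<omega> - Z a \<omega>) \<bullet> x) * ((Z b' \<omega> - Z a' \<omega>) \<bullet> y)) \<partial>M) =
       (\<integral>\<omega>. (c \<omega> * c' \<omega>) * (((Z a' \<omega> - Z a \<omega>) \<bullet> x) * ((Z b' \<omega> - Z a' \<omega>) \<bullet> y)) +
          (c \<omega> * c' \<omega>) * (((Z b \<omega> - Z a' \<omega>) \<bullet> x) * ((Z b' \<omega> - Z a' \<omega>) \<bullet> y)) \<partial>M)"
      by (rule Bochner_Integration.integral_cong) (auto simp: inner_diff_left algebra_simps)
    also have "\<dots> = (\<integral>\<omega>. (c \<omega> * c' \<omega>) * (((Z b \<omega> - Z a' \<omega>) \<bullet> x) * ((Z b' \<omega> - Z a' \<omega>) \<bullet> y)) \<partial>M)"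
      using i zero[of a'] ab by simp
    also have "\<dots> = (min b b' - a') * (\<integral>\<omega>. c \<omega> * c' \<omega> \<partial>M) * (Q x \<bullet> y)"
    proof (cases "b \<le> b'")
      case True
      then show ?thesis using expectation_same_start[of a' b b' "\<lambda>\<omega>. c \<omega> * c' \<omega>" "K * K'" x y] ab False WH Wb by simp
    next
      case bb: False
      have "(\<integral>\<omega>. (c \<omega> * c' \<omega>) * (((Z b \<omega> - Z a' \<omega>) \<bullet> x) * ((Z b' \<omega> - Z a' \<omega>) \<bullet> y)) \<partial>M) =
          (\<integral>\<omega>. (c \<omega> * c' \<omega>) * (((Z b' \<omega> - Z a' \<omega>) \<bullet> y) * ((Z b \<omega> - Z a' \<omega>) \<bullet> x)) \<partial>M)" by (simp add: mult_ac)
      also have "\<dots> = (b' - a') * (\<integral>\<omega>. c \<omega> * c' \<omega> \<partial>M) * (Q y \<bullet> x)"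
        using bb ab WH Wb by (intro expectation_same_start) auto
      finally show ?thesis using bb by (simp add: Q_sym[of x y])
    qed
    finally show ?thesis using ab False by simp
  qed
qed

lemma expectation_pair:
  assumes ab: "0 \<le> a" "a \<le> b" "0 \<le> a'" "a' \<le> b'"
    and c: "c \<in> borel_measurable (H a)" "\<And>\<omega>. \<bar>c \<omega>\<bar> \<le> K"
    and c': "c' \<in> borel_measurable (H a')" "\<And>\<omega>. \<bar>c' \<omega>\<bar> \<le> K'"
  shows "integrable M (\<lambda>\<omega>. (c \<omega> * c' \<omega>) * (((Z b \<omega> - Z a \<omega>) \<bullet> x) * ((Z b' \<omega> - Z a' \<omega>) \<bullet> y)))"
    "(\<integral>\<omega>. (c \<omega> * c' \<omega>) * (((Z b \<omega> - Z a \<omega>) \<bullet> x) * ((Z b' \<omega> - Z a' \<omega>) \<bullet> y)) \<partial>M) =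
    max 0 (min b b' - max a a') * (\<integral>\<omega>. c \<omega> * c' \<omega> \<partial>M) * (Q x \<bullet> y)"
proof -
  have Wb: "\<bar>c \<omega> * c' \<omega>\<bar> \<le> K * K'" for \<omega>
    unfolding abs_mult using c(2) c'(2) by (intro mult_mono) (auto intro: order_trans[OF abs_ge_zero])
  show "integrable M (\<lambda>\<omega>. (c \<omega> * c' \<omega>) * (((Z b \<omega> - Z a \<omega>) \<bullet> x) * ((Z b' \<omega> - Z a' \<omega>) \<bullet> y)))"
    by (rule integrable_bounded_mult[OF incr_mult_integrable _ Wb])
      (use ab H_M[OF c(1)] H_M[OF c'(1)] in auto)
  show "(\<integral>\<omega>. (c \<omega> * c' \<omega>) * (((Z b \<omega> - Z a \<omega>) \<bullet> x) * ((Z b' \<omega> - Z a' \<omega>) \<bullet> y)) \<partial>M) =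
    max 0 (min b b' - max a a') * (\<integral>\<omega>. c \<omega> * c' \<omega> \<partial>M) * (Q x \<bullet> y)"
  proof (cases "a \<le> a'")
    case True then show ?thesis by (rule expectation_pair_le[OF ab _ c c'])
  next
    case False
    then have "(\<integral>\<omega>. (c' \<omega> * c \<omega>) * (((Z b' \<omega> - Z a' \<omega>) \<bullet> y) * ((Z b \<omega> - Z a \<omega>) \<bullet> x)) \<partial>M) =
      max 0 (min b' b - max a' a) * (\<integral>\<omega>. c' \<omega> * c \<omega> \<partial>M) * (Q y \<bullet> x)"
      using ab by (intro expectation_pair_le[OF ab(3,4,1,2) _ c' c]) auto
    then show ?thesis by (simp add: mult_ac min.commute max.commute Q_sym[of x y])
  qed
qed

lemma prob_pair: "pair_sigma_finite (time_space T) M"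
proof -
  interpret T: finite_measure "time_space T" by (rule finite_measure_time_space)
  show ?thesis ..
qed

lemma jointly_measurable_step:
  fixes xs :: "('w, 'a, 'b::{real_normed_vector,second_countable_topology}) atom list"
  assumes "step_process H T xs" shows "jointly_measurable M T' (step_value xs)"
  using assms
proof (induction xs)
  case Nil then show ?case by (simp add: jointly_measurable_def)
next
  case (Cons X xs)
  obtain a b c \<phi> where X: "X = (a, b, c, \<phi>)" by (cases X)
  have cM: "c \<in> borel_measurable M" using Cons.prems H_M by (auto simp: X)
  have im: "(\<lambda>s. indicator {a<..b} s :: real) \<in> borel_measurable (time_space T')"
    unfolding time_space_def by (rule measurable_restrict_space1) simp
  have "jointly_measurable M T' (\<lambda>s \<omega>. (indicator {a<..b} s * c \<omega>) *\<^sub>R \<phi>)"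
    unfolding jointly_measurable_def case_prod_beta
  proof
    fix x
    show "(\<lambda>p. ((indicator {a<..b} (fst p) * c (snd p)) *\<^sub>R \<phi>) x) \<in> borel_measurable (time_space T' \<Otimes>\<^sub>M M)"
      unfolding blinfun.scaleR_left
      by (intro borel_measurable_scaleR borel_measurable_times borel_measurable_const
          measurable_compose[OF measurable_fst im] measurable_compose[OF measurable_snd cM])
  qed
  moreover have "jointly_measurable M T' (step_value xs)" using Cons X by simp
  ultimately show ?case unfolding X by (auto dest: jointly_measurable_add)
qed

lemma step_integral_measurable:
  fixes xs :: "('w, 'a, 'b::{real_normed_vector,second_countable_topology}) atom list"
  assumes "step_process H T xs" shows "(\<lambda>\<omega>. step_integral Z xs \<omega> \<omega>) \<in> borel_measurable M"
  using assms
proof (induction xs)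
  case (Cons X xs)
  obtain a b c \<phi> where X: "X = (a, b, c, \<phi>)" by (cases X)
  have [measurable]: "c \<in> borel_measurable M" "Z a \<in> borel_measurable M" "Z b \<in> borel_measurable M"
    using Cons.prems H_M Z_M by (auto simp: X)
  have [measurable]: "blinfun_apply \<phi> \<in> borel_measurable borel"
    by (intro borel_measurable_continuous_onI linear_continuous_on blinfun.bounded_linear_right)
  have [measurable]: "(\<lambda>\<omega>. step_integral Z xs \<omega> \<omega>) \<in> borel_measurable M" using Cons X by simp
  show ?case unfolding X step_integral_simps by measurable
qed simp

text \<open>The isometry polarised in the processes and tested against \<open>f\<close> and
  \<open>g\<close>. Being additive in both lists, it reduces to pairs of atoms; integrability is
  part of the predicate so that sums can be split.\<close>

definition bilinear_isometry where
  "bilinear_isometry T f g xs ys \<longleftrightarrow>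
    integrable M (\<lambda>\<omega>. (step_integral Z xs \<omega> \<omega> \<bullet> f) * (step_integral Z ys \<omega> \<omega> \<bullet> g)) \<and>
    integrable (time_space T \<Otimes>\<^sub>M M) (\<lambda>p. Q (adj_op (step_value xs (fst p) (snd p)) f) \<bullet> adj_op (step_value ys (fst p) (snd p)) g) \<and>
    (\<integral>\<omega>. (step_integral Z xs \<omega> \<omega> \<bullet> f) * (step_integral Z ys \<omega> \<omega> \<bullet> g) \<partial>M) =
    (\<integral>p. Q (adj_op (step_value xs (fst p) (snd p)) f) \<bullet> adj_op (step_value ys (fst p) (snd p)) g \<partial>(time_space T \<Otimes>\<^sub>M M))"

lemma bilinear_isometry_append1:
  "bilinear_isometry T f g xs ys \<Longrightarrow> bilinear_isometry T f g xs' ys \<Longrightarrow> bilinear_isometry T f g (xs @ xs') ys"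
  unfolding bilinear_isometry_def
  by (simp add: inner_add_left distrib_right adj_op_add blinfun.bilinear_simps)

lemma bilinear_isometry_append2:
  "bilinear_isometry T f g xs ys \<Longrightarrow> bilinear_isometry T f g xs ys' \<Longrightarrow> bilinear_isometry T f g xs (ys @ ys')"
  unfolding bilinear_isometry_def
  by (simp add: inner_add_left inner_add_right distrib_left adj_op_add blinfun.bilinear_simps)

text \<open>With \<open>x\<close> and \<open>y\<close> the images of \<open>f\<close> and
  \<open>g\<close> under the adjoint operators, both sides equal the overlap length times the mean
  of \<open>c * c'\<close> times \<open>Q x \<bullet> y\<close>.\<close>

lemma bilinear_isometry_atom:
  fixes \<phi> \<phi>' :: "'a \<Rightarrow>\<^sub>L 'b::{real_inner,banach,second_countable_topology}"
  assumes "step_process H T [(a, b, c, \<phi>)]" "step_process H T [(a', b', c', \<phi>')]"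
  shows "bilinear_isometry T f g [(a, b, c, \<phi>)] [(a', b', c', \<phi>')]"
proof -
  obtain K K' where ab: "0 \<le> a" "a \<le> b" "b \<le> T" "0 \<le> a'" "a' \<le> b'" "b' \<le> T"
    and c: "c \<in> borel_measurable (H a)" "\<And>\<omega>. \<bar>c \<omega>\<bar> \<le> K" and c': "c' \<in> borel_measurable (H a')" "\<And>\<omega>. \<bar>c' \<omega>\<bar> \<le> K'"
    using assms by auto
  define x where "x = adj_op \<phi> f"
  define y where "y = adj_op \<phi>' g"
  interpret T: finite_measure "time_space T" by (rule finite_measure_time_space)
  interpret P: pair_sigma_finite "time_space T" M ..
  have cM [measurable]: "c \<in> borel_measurable M" "c' \<in> borel_measurable M" using c c' H_M by auto
  have im: "(\<lambda>s. indicator {a<..b} s :: real) \<in> borel_measurable (time_space T)" for a b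
    unfolding time_space_def by (rule measurable_restrict_space1) simp
  let ?i = "\<lambda>s. indicator {a<..b} s * indicator {a'<..b'} s :: real"
  let ?F = "\<lambda>p. ?i (fst p) * ((c (snd p) * c' (snd p)) * (Q x \<bullet> y))"
  have ceq: "(\<lambda>\<omega>. (step_integral Z [(a, b, c, \<phi>)] \<omega> \<omega> \<bullet> f) * (step_integral Z [(a', b', c', \<phi>')] \<omega> \<omega> \<bullet> g)) =
      (\<lambda>\<omega>. (c \<omega> * c' \<omega>) * (((Z b \<omega> - Z a \<omega>) \<bullet> x) * ((Z b' \<omega> - Z a' \<omega>) \<bullet> y)))"
    by (simp add: x_def y_def inner_adj_op[symmetric] mult_ac)
  have veq: "(\<lambda>p. Q (adj_op (step_value [(a, b, c, \<phi>)] (fst p) (snd p)) f) \<bullet> adj_op (step_value [(a', b', c', \<phi>')] (fst p) (snd p)) g) = ?F"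
    by (simp add: adj_op_scaleR blinfun.bilinear_simps x_def y_def mult_ac fun_eq_iff)
  have Wb: "\<bar>c \<omega> * c' \<omega>\<bar> \<le> K * K'" for \<omega>
    unfolding abs_mult using c(2) c'(2) by (intro mult_mono) (auto intro: order_trans[OF abs_ge_zero])
  have PF: "integrable (time_space T \<Otimes>\<^sub>M M) ?F"
  proof (rule finite_measure.integrable_const_bound[of _ _ "K * K' * \<bar>Q x \<bullet> y\<bar>"])
    interpret PT: pair_prob_space M M ..
    show "finite_measure (time_space T \<Otimes>\<^sub>M M)"
    proof
      have "emeasure (time_space T \<Otimes>\<^sub>M M) (space (time_space T) \<times> space M) = emeasure (time_space T) (space (time_space T)) * emeasure M (space M)"
        by (rule emeasure_pair_measure_Times) auto
      then show "emeasure (time_space T \<Otimes>\<^sub>M M) (space (time_space T \<Otimes>\<^sub>M M)) \<noteq> \<infinity>"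
        by (simp add: space_pair_measure emeasure_space_1 T.emeasure_eq_measure)
    qed
    have "\<bar>?F p\<bar> \<le> K * K' * \<bar>Q x \<bullet> y\<bar>" for p
    proof -
      have "\<bar>?F p\<bar> \<le> \<bar>c (snd p) * c' (snd p)\<bar> * \<bar>Q x \<bullet> y\<bar>" by (auto simp: abs_mult indicator_def)
      also have "\<dots> \<le> K * K' * \<bar>Q x \<bullet> y\<bar>" by (intro mult_right_mono Wb) auto
      finally show ?thesis .
    qed
    then show "AE p in time_space T \<Otimes>\<^sub>M M. norm (?F p) \<le> K * K' * \<bar>Q x \<bullet> y\<bar>" by simp
    show "?F \<in> borel_measurable (time_space T \<Otimes>\<^sub>M M)"
      by (intro borel_measurable_times borel_measurable_const measurable_compose[OF measurable_fst im]
          measurable_compose[OF measurable_snd cM(1)] measurable_compose[OF measurable_snd cM(2)])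
  qed
  have len: "(\<integral>s. ?i s \<partial>time_space T) = max 0 (min b b' - max a a')"
  proof -
    have "(\<integral>s. ?i s \<partial>time_space T) = (\<integral>s. indicator {max a a'<..min b b'} s \<partial>time_space T)"
      by (rule Bochner_Integration.integral_cong) (auto simp: indicator_def)
    also have "\<dots> = measure (time_space T) ({max a a'<..min b b'} \<inter> space (time_space T))" by simp
    also have "{max a a'<..min b b'} \<inter> space (time_space T) = {max a a'<..min b b'}"
      using ab by (auto simp: space_time_space)
    also have "measure (time_space T) {max a a'<..min b b'} = measure lborel {max a a'<..min b b'}"
      unfolding time_space_def using ab by (intro measure_restrict_space) auto
    also have "\<dots> = max 0 (min b b' - max a a')"
    proof (cases "max a a' \<le> min b b'")
      case False
      then have "{max a a'<..min b b'} = {}" by auto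
      with False show ?thesis by (simp only: measure_empty)
    qed simp
    finally show ?thesis .
  qed
  have "integral\<^sup>L (time_space T \<Otimes>\<^sub>M M) ?F = (\<integral>s. (\<integral>\<omega>. ?F (s, \<omega>) \<partial>M) \<partial>time_space T)"
    by (rule P.integral_fst'[OF PF, symmetric])
  also have "\<dots> = (\<integral>s. ?i s * ((\<integral>\<omega>. c \<omega> * c' \<omega> \<partial>M) * (Q x \<bullet> y)) \<partial>time_space T)" by simp
  also have "\<dots> = max 0 (min b b' - max a a') * (\<integral>\<omega>. c \<omega> * c' \<omega> \<partial>M) * (Q x \<bullet> y)"
    by (subst integral_mult_left_zero) (simp add: len mult.assoc)
  finally show ?thesis
    unfolding bilinear_isometry_def ceq veq using PF expectation_pair[OF ab(1,2,4,5) c c', of x y] by simp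
qed

lemma bilinear_isometry_steps:
  fixes xs ys :: "('w, 'a, 'b::{real_inner,banach,second_countable_topology}) atom list"
  assumes "step_process H T xs" "step_process H T ys"
  shows "bilinear_isometry T f g xs ys"
  using assms(1)
proof (induction xs)
  case Nil then show ?case by (simp add: bilinear_isometry_def adj_op_zero)
next
  case (Cons X xs)
  obtain a b c \<phi> where X: "X = (a, b, c, \<phi>)" by (cases X)
  have "bilinear_isometry T f g [X] ys" using assms(2)
  proof (induction ys)
    case Nil then show ?case by (simp add: bilinear_isometry_def adj_op_zero)
  next
    case (Cons Y ys)
    obtain a' b' c' \<phi>' where Y: "Y = (a', b', c', \<phi>')" by (cases Y)
    have "bilinear_isometry T f g [X] [Y]"
      using Cons.prems \<open>step_process H T (X # xs)\<close> unfolding X Y by (intro bilinear_isometry_atom) auto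
    moreover have "bilinear_isometry T f g [X] ys" using Cons by (simp add: Y)
    ultimately show ?case using bilinear_isometry_append2[of T f g "[X]" "[Y]" ys] by simp
  qed
  moreover have "bilinear_isometry T f g xs ys" using Cons by (simp add: X)
  ultimately show ?case using bilinear_isometry_append1[of T f g "[X]" ys xs] by simp
qed

text \<open>For \<open>f = g\<close>, summed over an orthonormal basis, Parseval on the left and the
  trace formula on the right produce the two norms; Tonelli exchanges the sums with the
  integrals.\<close>

theorem ito_isometry:
  fixes xs :: "('w, 'a, 'b::{real_inner,banach,second_countable_topology}) atom list"
  assumes xs: "step_process H T xs"
  shows "(\<integral>\<^sup>+\<omega>. ennreal ((norm (step_integral Z xs \<omega> \<omega>))\<^sup>2) \<partial>M) = ito_norm M Q T (step_value xs)"
proof -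
  let ?I = "\<lambda>\<omega>. step_integral Z xs \<omega> \<omega>" and ?v = "\<lambda>p. step_value xs (fst p) (snd p)" and ?P = "time_space T \<Otimes>\<^sub>M M"
  have [measurable]: "?I \<in> borel_measurable M" using xs by (rule step_integral_measurable)
  have b: "bilinear_isometry T f f xs xs" for f using xs xs by (rule bilinear_isometry_steps)
  have pos: "0 \<le> Q z \<bullet> z" for z using Q_trace by (auto simp: trace_class_nonneg_def nonneg_definite_def)
  have "(\<integral>\<^sup>+\<omega>. ennreal ((norm (?I \<omega>))\<^sup>2) \<partial>M) = (\<integral>\<^sup>+\<omega>. (\<integral>\<^sup>+f. ennreal ((?I \<omega> \<bullet> f)\<^sup>2) \<partial>basis_space) \<partial>M)"
    by (simp only: parseval_nn_integral)
  also have "\<dots> = (\<integral>\<^sup>+f. (\<integral>\<^sup>+\<omega>. ennreal ((?I \<omega> \<bullet> f)\<^sup>2) \<partial>M) \<partial>basis_space)"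
    by (rule nn_integral_basis_swap) measurable
  also have "\<dots> = (\<integral>\<^sup>+f. (\<integral>\<^sup>+p. ennreal (Q (adj_op (?v p) f) \<bullet> adj_op (?v p) f) \<partial>?P) \<partial>basis_space)"
  proof (rule nn_integral_cong)
    fix f :: 'b
    have i: "integrable M (\<lambda>\<omega>. (?I \<omega> \<bullet> f) * (?I \<omega> \<bullet> f))" "integrable ?P (\<lambda>p. Q (adj_op (?v p) f) \<bullet> adj_op (?v p) f)"
      and e: "(\<integral>\<omega>. (?I \<omega> \<bullet> f) * (?I \<omega> \<bullet> f) \<partial>M) = (\<integral>p. Q (adj_op (?v p) f) \<bullet> adj_op (?v p) f \<partial>?P)"
      using b[of f] by (auto simp: bilinear_isometry_def)
    have "(\<integral>\<^sup>+\<omega>. ennreal ((?I \<omega> \<bullet> f) * (?I \<omega> \<bullet> f)) \<partial>M) = ennreal (\<integral>\<omega>. (?I \<omega> \<bullet> f) * (?I \<omega> \<bullet> f) \<partial>M)"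
      by (rule nn_integral_eq_integral[OF i(1)]) simp
    also have "\<dots> = (\<integral>\<^sup>+p. ennreal (Q (adj_op (?v p) f) \<bullet> adj_op (?v p) f) \<partial>?P)"
      unfolding e by (rule nn_integral_eq_integral[OF i(2), symmetric]) (simp add: pos)
    finally show "(\<integral>\<^sup>+\<omega>. ennreal ((?I \<omega> \<bullet> f)\<^sup>2) \<partial>M) = (\<integral>\<^sup>+p. ennreal (Q (adj_op (?v p) f) \<bullet> adj_op (?v p) f) \<partial>?P)"
      by (simp add: power2_eq_square)
  qed
  also have "\<dots> = (\<integral>\<^sup>+p. (\<integral>\<^sup>+f. ennreal (Q (adj_op (?v p) f) \<bullet> adj_op (?v p) f) \<partial>basis_space) \<partial>?P)"
  proof (rule nn_integral_basis_swap[symmetric])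
    fix f :: 'b
    have "integrable ?P (\<lambda>p. Q (adj_op (?v p) f) \<bullet> adj_op (?v p) f)"
      using b[of f] by (auto simp: bilinear_isometry_def)
    then show "(\<lambda>p. ennreal (Q (adj_op (?v p) f) \<bullet> adj_op (?v p) f)) \<in> borel_measurable ?P" by simp
  qed
  also have "\<dots> = ito_norm M Q T (step_value xs)"
    by (simp add: ito_norm_def hs_norm_sq_compose_sqrt[OF Q_trace])
  finally show ?thesis .
qed

end

section \<open>From elementary processes to limits of step integrals\<close>

lemma simple_function_atoms:
  fixes f :: "'w \<Rightarrow> 'c::real_vector"
  assumes "simple_function N f"
  obtains cs :: "(('w \<Rightarrow> real) \<times> 'c) list"
  where "\<And>c \<phi>. (c, \<phi>) \<in> set cs \<Longrightarrow> c \<in> borel_measurable N \<and> (\<forall>\<omega>. \<bar>c \<omega>\<bar> \<le> 1)"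
    "\<And>\<omega>. \<omega> \<in> space N \<Longrightarrow> f \<omega> = (\<Sum>(c, \<phi>)\<leftarrow>cs. c \<omega> *\<^sub>R \<phi>)"
proof -
  have fin: "finite (f ` space N)" using assms by (rule simple_functionD)
  then obtain xs where xs: "set xs = f ` space N" "distinct xs" using finite_distinct_list by blast
  define cs where "cs = map (\<lambda>\<phi>. (indicator (f -` {\<phi>} \<inter> space N) :: 'w \<Rightarrow> real, \<phi>)) xs"
  show thesis
  proof
    fix c \<phi> assume "(c, \<phi>) \<in> set cs"
    then have "c = indicator (f -` {\<phi>} \<inter> space N)" by (auto simp: cs_def)
    then show "c \<in> borel_measurable N \<and> (\<forall>\<omega>. \<bar>c \<omega>\<bar> \<le> 1)"
      using simple_functionD(2)[OF assms, of "{\<phi>}"] by (auto simp: indicator_def)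
  next
    fix \<omega> assume w: "\<omega> \<in> space N"
    have "(\<Sum>(c, \<phi>)\<leftarrow>cs. c \<omega> *\<^sub>R \<phi>) = (\<Sum>\<phi>\<in>f ` space N. indicator (f -` {\<phi>} \<inter> space N) \<omega> *\<^sub>R \<phi>)"
      using xs by (simp add: cs_def sum_list_distinct_conv_sum_set o_def)
    also have "\<dots> = (\<Sum>\<phi>\<in>f ` space N. if \<phi> = f \<omega> then f \<omega> else 0)"
      using w by (intro sum.cong) (auto simp: indicator_def)
    also have "\<dots> = f \<omega>" using fin w by simp
    finally show "f \<omega> = (\<Sum>(c, \<phi>)\<leftarrow>cs. c \<omega> *\<^sub>R \<phi>)" by simp
  qed
qed

text \<open>The level sets of the simple coefficients become the atoms. Agreement is claimed on
  \<open>space M\<close> only, since a simple function is unconstrained off its space.\<close>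

lemma elementary_process_atoms:
  fixes \<Phi> :: "nat \<Rightarrow> 'w \<Rightarrow> 'a::real_normed_vector \<Rightarrow>\<^sub>L 'b::real_normed_vector"
  assumes el: "elementary_process F T n \<tau> \<Phi>" and sp: "\<And>t. space (F t) = space M"
  shows "\<exists>xs. step_process F T xs \<and> (\<forall>\<omega>\<in>space M. (\<forall>s. elementary_value n \<tau> \<Phi> s \<omega> = step_value xs s \<omega>) \<and>
    (\<forall>Z. elementary_integral Z n \<tau> \<Phi> \<omega> = step_integral Z xs \<omega> \<omega>))"
proof -
  have \<tau>: "\<tau> 0 = 0" "\<tau> n = T" "\<And>i. i < n \<Longrightarrow> \<tau> i \<le> \<tau> (Suc i)" "\<And>i. i < n \<Longrightarrow> simple_function (F (\<tau> i)) (\<Phi> i)"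
    using el by (auto simp: elementary_process_def)
  have mono: "\<tau> i \<le> \<tau> j" if "i \<le> j" "j \<le> n" for i j
    using that
  proof (induction j rule: dec_induct)
    case (step k) then show ?case using \<tau>(3)[of k] by simp
  qed simp
  have "\<exists>xs. step_process F T xs \<and> (\<forall>\<omega>\<in>space M. (\<forall>s. elementary_value m \<tau> \<Phi> s \<omega> = step_value xs s \<omega>) \<and>
    (\<forall>Z. elementary_integral Z m \<tau> \<Phi> \<omega> = step_integral Z xs \<omega> \<omega>))" if "m \<le> n" for m
    using that
  proof (induction m)
    case 0
    show ?case by (rule exI[of _ "[]"]) (simp add: elementary_value_def elementary_integral_def)
  next
    case (Suc m)
    then obtain xs where xs: "step_process F T xs" "\<And>\<omega> s. \<omega> \<in> space M \<Longrightarrow> elementary_value m \<tau> \<Phi> s \<omega> = step_value xs s \<omega>"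
      "\<And>\<omega> Z. \<omega> \<in> space M \<Longrightarrow> elementary_integral Z m \<tau> \<Phi> \<omega> = step_integral Z xs \<omega> \<omega>" by auto
    obtain cs where cs: "\<And>c \<phi>. (c, \<phi>) \<in> set cs \<Longrightarrow> c \<in> borel_measurable (F (\<tau> m)) \<and> (\<forall>\<omega>. \<bar>c \<omega>\<bar> \<le> 1)"
      and \<Phi>: "\<And>\<omega>. \<omega> \<in> space M \<Longrightarrow> \<Phi> m \<omega> = (\<Sum>(c, \<phi>)\<leftarrow>cs. c \<omega> *\<^sub>R \<phi>)"
      using simple_function_atoms[OF \<tau>(4)[of m]] Suc.prems sp by (metis Suc_le_lessD)
    define ys where "ys = map (\<lambda>(c, \<phi>). (\<tau> m, \<tau> (Suc m), c, \<phi>)) cs"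
    have v: "step_value ys s \<omega> = (indicator {\<tau> m<..\<tau> (Suc m)} s :: real) *\<^sub>R (\<Sum>(c, \<phi>)\<leftarrow>cs. c \<omega> *\<^sub>R \<phi>)" for s \<omega>
      unfolding ys_def by (induction cs) (auto simp: scaleR_add_right)
    have i: "step_integral Z ys \<omega> \<omega> = (\<Sum>(c, \<phi>)\<leftarrow>cs. c \<omega> *\<^sub>R \<phi>) (Z (\<tau> (Suc m)) \<omega> - Z (\<tau> m) \<omega>)" for Z :: "real \<Rightarrow> 'w \<Rightarrow> 'a" and \<omega>
      unfolding ys_def by (induction cs) (auto simp: blinfun.bilinear_simps scaleR_diff_right)
    have "step_process F T ys"
      using cs mono[of 0 m] \<tau> mono[of "Suc m" n] Suc.prems unfolding step_process_def ys_def by force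
    with xs(1) have "step_process F T (xs @ ys)" by simp
    moreover have "elementary_value (Suc m) \<tau> \<Phi> s \<omega> = step_value (xs @ ys) s \<omega>" if "\<omega> \<in> space M" for s \<omega>
      using xs(2)[OF that] \<Phi>[OF that] v by (simp add: elementary_value_def)
    moreover have "elementary_integral Z (Suc m) \<tau> \<Phi> \<omega> = step_integral Z (xs @ ys) \<omega> \<omega>" if "\<omega> \<in> space M" for Z \<omega>
      using xs(3)[OF that] \<Phi>[OF that] i by (simp add: elementary_integral_def)
    ultimately show ?case by blast
  qed
  from this[of n] show ?thesis by simp
qed

text \<open>Borel-Cantelli in integral form: along the subsequence the integrals are summable, so
  the sum of the functions is finite almost everywhere and its terms tend to 0.\<close>

lemma nn_integral_subseq_AE:
  fixes f :: "nat \<Rightarrow> 'w \<Rightarrow> ennreal"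
  assumes f: "\<And>k. f k \<in> borel_measurable M" and lim: "(\<lambda>k. \<integral>\<^sup>+x. f k x \<partial>M) \<longlonglongrightarrow> 0"
  obtains r :: "nat \<Rightarrow> nat" where "strict_mono r" "AE x in M. (\<lambda>k. f (r k) x) \<longlonglongrightarrow> 0"
proof -
  have ex: "\<exists>K. \<forall>k\<ge>K. (\<integral>\<^sup>+x. f k x \<partial>M) < ennreal ((1/2) ^ n)" for n
    using order_tendstoD(2)[OF lim, of "ennreal ((1/2) ^ n)"] by (simp add: eventually_sequentially)
  then obtain K where K: "\<And>n k. k \<ge> K n \<Longrightarrow> (\<integral>\<^sup>+x. f k x \<partial>M) < ennreal ((1/2) ^ n)" by metis
  \<comment> \<open>\<open>Suc\<close> makes the partial sums strictly increasing, and the last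
    summand alone exceeds \<open>K n\<close>.\<close>
  define r where "r n = (\<Sum>i\<le>n. Suc (K i))" for n
  have r: "strict_mono r" by (simp add: strict_mono_Suc_iff r_def)
  have rK: "K n \<le> r n" for n
    using member_le_sum[of n "{..n}" "\<lambda>i. Suc (K i)"] by (simp add: r_def)
  have "(\<integral>\<^sup>+x. (\<Sum>n. f (r n) x) \<partial>M) = (\<Sum>n. \<integral>\<^sup>+x. f (r n) x \<partial>M)"
    using f by (intro nn_integral_suminf) auto
  also have "\<dots> \<le> (\<Sum>n. ennreal ((1/2) ^ n))"
    using K[OF rK] by (intro suminf_le) (auto simp: less_imp_le)
  also have "\<dots> = ennreal (\<Sum>n. (1/2) ^ n)"
    by (rule suminf_ennreal2) (auto intro: summable_geometric)
  also have "\<dots> < \<infinity>" by simp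
  finally have "AE x in M. (\<Sum>n. f (r n) x) \<noteq> \<infinity>"
    using f by (intro nn_integral_PInf_AE) auto
  then have "AE x in M. (\<lambda>k. f (r k) x) \<longlonglongrightarrow> 0"
  proof eventually_elim
    fix x assume fin: "(\<Sum>n. f (r n) x) \<noteq> \<infinity>"
    have lt: "f (r n) x < \<top>" for n
    proof (rule ccontr)
      assume "\<not> f (r n) x < \<top>"
      then have "f (r n) x = \<top>" by (simp add: not_less top_unique)
      then have "\<top> \<le> (\<Sum>n. f (r n) x)" using sum_le_suminf[of "\<lambda>n. f (r n) x" "{n}"] by simp
      with fin show False by (simp add: top_unique)
    qed
    then have e: "f (r n) x = ennreal (enn2real (f (r n) x))" for n by simp
    have "(\<Sum>n. ennreal (enn2real (f (r n) x))) \<noteq> \<top>" using fin e by simp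
    then have "summable (\<lambda>n. enn2real (f (r n) x))" by (intro summable_suminf_not_top) auto
    then have "(\<lambda>n. enn2real (f (r n) x)) \<longlonglongrightarrow> 0" by (rule summable_LIMSEQ_zero)
    then have "(\<lambda>n. ennreal (enn2real (f (r n) x))) \<longlonglongrightarrow> ennreal 0" by (rule tendsto_ennrealI)
    then show "(\<lambda>k. f (r k) x) \<longlonglongrightarrow> 0" using e by simp
  qed
  with r show thesis by (rule that)
qed

lemma norm_sq_tendsto_zero:
  fixes X :: "nat \<Rightarrow> 'b::real_normed_vector"
  assumes "(\<lambda>k. ennreal ((norm (X k - x))\<^sup>2)) \<longlonglongrightarrow> 0"
  shows "X \<longlonglongrightarrow> x"
proof -
  have "(\<lambda>k. enn2real (ennreal ((norm (X k - x))\<^sup>2))) \<longlonglongrightarrow> 0"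
    using assms by (intro tendsto_enn2real) simp_all
  then have "(\<lambda>k. (norm (X k - x))\<^sup>2) \<longlonglongrightarrow> 0" by simp
  from tendsto_real_sqrt[OF this] have "(\<lambda>k. norm (X k - x)) \<longlonglongrightarrow> 0" by simp
  then show ?thesis by (simp add: tendsto_norm_zero_iff LIM_zero_iff)
qed

lemma L2_subseq_AE:
  fixes X :: "nat \<Rightarrow> 'w \<Rightarrow> 'b::{real_normed_vector,second_countable_topology}"
  assumes "\<And>k. X k \<in> borel_measurable M" "I \<in> borel_measurable M"
    and "(\<lambda>k. \<integral>\<^sup>+\<omega>. ennreal ((norm (X k \<omega> - I \<omega>))\<^sup>2) \<partial>M) \<longlonglongrightarrow> 0"
  obtains r :: "nat \<Rightarrow> nat" where "strict_mono r" "AE \<omega> in M. (\<lambda>k. X (r k) \<omega>) \<longlonglongrightarrow> I \<omega>"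
proof -
  obtain r :: "nat \<Rightarrow> nat" where r: "strict_mono r" "AE \<omega> in M. (\<lambda>k. ennreal ((norm (X (r k) \<omega> - I \<omega>))\<^sup>2)) \<longlonglongrightarrow> 0"
  proof (rule nn_integral_subseq_AE[OF _ assms(3)])
    show "(\<lambda>\<omega>. ennreal ((norm (X k \<omega> - I \<omega>))\<^sup>2)) \<in> borel_measurable M" for k
      using assms(1)[of k] assms(2) by simp
  qed
  from r(2) have "AE \<omega> in M. (\<lambda>k. X (r k) \<omega>) \<longlonglongrightarrow> I \<omega>"
    by eventually_elim (rule norm_sq_tendsto_zero)
  with r(1) show thesis by (rule that)
qed

lemma ennreal_tendsto_zero_bound:
  fixes f g h :: "nat \<Rightarrow> ennreal"
  assumes "\<And>k. f k \<le> 2 * g k + 2 * h k" "g \<longlonglongrightarrow> 0" "h \<longlonglongrightarrow> 0"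
  shows "f \<longlonglongrightarrow> 0"
proof (rule tendsto_sandwich[of "\<lambda>_. 0"])
  have "(\<lambda>k. 2 * g k + 2 * h k) \<longlonglongrightarrow> 2 * 0 + 2 * 0"
    using assms(2,3) by (intro tendsto_add ennreal_tendsto_cmult) auto
  then show "(\<lambda>k. 2 * g k + 2 * h k) \<longlonglongrightarrow> 0" by simp
qed (use assms(1) in auto)

context square_integrable_noise
begin

text \<open>Rewrites the defining approximation in terms of atoms and reads it in a larger
  filtration \<open>H\<close>; the approximating integrals, and so the limit \<open>I\<close>,
  remain the same.\<close>

lemma ito_integral_steps:
  fixes \<Psi> :: "real \<Rightarrow> 'w \<Rightarrow> 'a \<Rightarrow>\<^sub>L 'b::{real_inner,banach,second_countable_topology}"
  assumes ito: "has_ito_integral M F Z Q T \<Psi> I" and F: "\<And>t. subalgebra M (F t)" "\<And>t. 0 \<le> t \<Longrightarrow> sets (F t) \<subseteq> sets (H t)"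
  shows "jointly_measurable M T \<Psi>" "I \<in> borel_measurable M"
    "\<exists>xs. (\<forall>k. step_process H T (xs k)) \<and> (\<lambda>k. ito_norm M Q T (\<lambda>s \<omega>. step_value (xs k) s \<omega> - \<Psi> s \<omega>)) \<longlonglongrightarrow> 0 \<and>
      (\<lambda>k. \<integral>\<^sup>+\<omega>. ennreal ((norm (step_integral Z (xs k) \<omega> \<omega> - I \<omega>))\<^sup>2) \<partial>M) \<longlonglongrightarrow> 0"
proof -
  show I: "I \<in> borel_measurable M" using ito by (simp add: has_ito_integral_def)
  have "sets (time_space T \<Otimes>\<^sub>M M) = sets (restrict_space borel {0..T} \<Otimes>\<^sub>M M)"
    by (intro sets_pair_measure_cong sets_time_space) simp
  then show jm: "jointly_measurable M T \<Psi>"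
    using ito unfolding has_ito_integral_def jointly_measurable_def by (simp cong: measurable_cong_sets)
  have sp: "space (F t) = space M" for t using F(1) by (simp add: subalgebra_def)
  obtain n \<tau> \<Phi> where el: "\<And>k. elementary_process F T (n k) (\<tau> k) (\<Phi> k)"
    and l1: "(\<lambda>k. \<integral>\<^sup>+\<omega>. (\<integral>\<^sup>+s\<in>{0..T}.
            hs_norm_sq ((elementary_value (n k) (\<tau> k) (\<Phi> k) s \<omega> - \<Psi> s \<omega>) o\<^sub>L sqrt_op Q) \<partial>lborel) \<partial>M) \<longlonglongrightarrow> 0"
    and l2: "(\<lambda>k. \<integral>\<^sup>+\<omega>. ennreal ((norm (elementary_integral Z (n k) (\<tau> k) (\<Phi> k) \<omega> - I \<omega>))\<^sup>2) \<partial>M) \<longlonglongrightarrow> 0"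
    using ito unfolding has_ito_integral_def by blast
  have "\<exists>xs. step_process F T xs \<and> (\<forall>\<omega>\<in>space M. (\<forall>s. elementary_value (n k) (\<tau> k) (\<Phi> k) s \<omega> = step_value xs s \<omega>) \<and>
    (\<forall>Z. elementary_integral Z (n k) (\<tau> k) (\<Phi> k) \<omega> = step_integral Z xs \<omega> \<omega>))" for k
    using elementary_process_atoms[OF el sp] by blast
  then obtain xs where xs: "\<And>k. step_process F T (xs k)"
    "\<And>k \<omega> s. \<omega> \<in> space M \<Longrightarrow> elementary_value (n k) (\<tau> k) (\<Phi> k) s \<omega> = step_value (xs k) s \<omega>"
    "\<And>k \<omega> Z. \<omega> \<in> space M \<Longrightarrow> elementary_integral Z (n k) (\<tau> k) (\<Phi> k) \<omega> = step_integral Z (xs k) \<omega> \<omega>" by metis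
  have H: "step_process H T (xs k)" for k
  proof (rule step_process_filtration[OF xs(1)])
    fix a and f :: "'w \<Rightarrow> real" assume "0 \<le> a" "f \<in> borel_measurable (F a)"
    then show "f \<in> borel_measurable (H a)" using F(2)[of a] by (auto simp: measurable_def sp H_space)
  qed
  have "ito_norm M Q T (\<lambda>s \<omega>. step_value (xs k) s \<omega> - \<Psi> s \<omega>) = (\<integral>\<^sup>+\<omega>. (\<integral>\<^sup>+s\<in>{0..T}.
            hs_norm_sq ((elementary_value (n k) (\<tau> k) (\<Phi> k) s \<omega> - \<Psi> s \<omega>) o\<^sub>L sqrt_op Q) \<partial>lborel) \<partial>M)" for k
    using ito_norm_iterated[OF jointly_measurable_diff[OF jointly_measurable_step[OF H] jm], of Q k] xs(2)
    by (auto intro!: nn_integral_cong)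
  then have "(\<lambda>k. ito_norm M Q T (\<lambda>s \<omega>. step_value (xs k) s \<omega> - \<Psi> s \<omega>)) \<longlonglongrightarrow> 0" using l1 by simp
  moreover have "(\<integral>\<^sup>+\<omega>. ennreal ((norm (step_integral Z (xs k) \<omega> \<omega> - I \<omega>))\<^sup>2) \<partial>M) =
      (\<integral>\<^sup>+\<omega>. ennreal ((norm (elementary_integral Z (n k) (\<tau> k) (\<Phi> k) \<omega> - I \<omega>))\<^sup>2) \<partial>M)" for k
    using xs(3) by (intro nn_integral_cong) auto
  then have "(\<lambda>k. \<integral>\<^sup>+\<omega>. ennreal ((norm (step_integral Z (xs k) \<omega> \<omega> - I \<omega>))\<^sup>2) \<partial>M) \<longlonglongrightarrow> 0" using l2 by simp
  ultimately show "\<exists>xs. (\<forall>k. step_process H T (xs k)) \<and> (\<lambda>k. ito_norm M Q T (\<lambda>s \<omega>. step_value (xs k) s \<omega> - \<Psi> s \<omega>)) \<longlonglongrightarrow> 0 \<and>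
      (\<lambda>k. \<integral>\<^sup>+\<omega>. ennreal ((norm (step_integral Z (xs k) \<omega> \<omega> - I \<omega>))\<^sup>2) \<partial>M) \<longlonglongrightarrow> 0" using H by blast
qed

lemma step_integral_diff:
  fixes xs ys :: "('w, 'a, 'b::{real_inner,banach,second_countable_topology}) atom list"
  assumes "step_process H T xs" "step_process H T ys"
  shows "(\<integral>\<^sup>+\<omega>. ennreal ((norm (step_integral Z xs \<omega> \<omega> - step_integral Z ys \<omega> \<omega>))\<^sup>2) \<partial>M) =
    ito_norm M Q T (\<lambda>s \<omega>. step_value xs s \<omega> - step_value ys s \<omega>)"
  using ito_isometry[of T "xs @ step_neg ys"] assms
  by (simp add: step_neg_simps ito_norm_def)

text \<open>By the isometry, two approximations of the same integrand have step integrals at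
  vanishing distance. Approximations with better coefficients may therefore be substituted
  later.\<close>

lemma ito_limit_unique:
  fixes \<Psi> :: "real \<Rightarrow> 'w \<Rightarrow> 'a \<Rightarrow>\<^sub>L 'b::{real_inner,banach,second_countable_topology}"
  assumes jm: "jointly_measurable M T \<Psi>" and I: "I \<in> borel_measurable M"
    and xs: "\<And>k. step_process H T (xs k)" "(\<lambda>k. ito_norm M Q T (\<lambda>s \<omega>. step_value (xs k) s \<omega> - \<Psi> s \<omega>)) \<longlonglongrightarrow> 0"
    and lim: "(\<lambda>k. \<integral>\<^sup>+\<omega>. ennreal ((norm (step_integral Z (xs k) \<omega> \<omega> - I \<omega>))\<^sup>2) \<partial>M) \<longlonglongrightarrow> 0"
    and ys: "\<And>k. step_process H T (ys k)" "(\<lambda>k. ito_norm M Q T (\<lambda>s \<omega>. step_value (ys k) s \<omega> - \<Psi> s \<omega>)) \<longlonglongrightarrow> 0"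
  shows "(\<lambda>k. \<integral>\<^sup>+\<omega>. ennreal ((norm (step_integral Z (ys k) \<omega> \<omega> - I \<omega>))\<^sup>2) \<partial>M) \<longlonglongrightarrow> 0"
proof (rule ennreal_tendsto_zero_bound[OF _ _ lim])
  let ?X = "\<lambda>k \<omega>. step_integral Z (xs k) \<omega> \<omega>" and ?Y = "\<lambda>k \<omega>. step_integral Z (ys k) \<omega> \<omega>"
  note [measurable] = step_integral_measurable[OF xs(1)] step_integral_measurable[OF ys(1)] I
  show "(\<lambda>k. \<integral>\<^sup>+\<omega>. ennreal ((norm (?Y k \<omega> - ?X k \<omega>))\<^sup>2) \<partial>M) \<longlonglongrightarrow> 0"
  proof (rule ennreal_tendsto_zero_bound[OF _ ys(2) xs(2)])
    fix k
    show "(\<integral>\<^sup>+\<omega>. ennreal ((norm (?Y k \<omega> - ?X k \<omega>))\<^sup>2) \<partial>M) \<le>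
      2 * ito_norm M Q T (\<lambda>s \<omega>. step_value (ys k) s \<omega> - \<Psi> s \<omega>) + 2 * ito_norm M Q T (\<lambda>s \<omega>. step_value (xs k) s \<omega> - \<Psi> s \<omega>)"
      unfolding step_integral_diff[OF ys(1) xs(1)] ito_norm_commute[of M Q T "step_value (xs k)" \<Psi>]
      by (rule ito_norm_triangle[OF jointly_measurable_step[OF ys(1)] jm jointly_measurable_step[OF xs(1)]])
  qed
  fix k
  have "(\<integral>\<^sup>+\<omega>. ennreal ((norm (?Y k \<omega> - I \<omega>))\<^sup>2) \<partial>M) \<le>
      (\<integral>\<^sup>+\<omega>. 2 * ennreal ((norm (?Y k \<omega> - ?X k \<omega>))\<^sup>2) + 2 * ennreal ((norm (?X k \<omega> - I \<omega>))\<^sup>2) \<partial>M)"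
  proof (rule nn_integral_mono)
    fix \<omega>
    show "ennreal ((norm (?Y k \<omega> - I \<omega>))\<^sup>2) \<le> 2 * ennreal ((norm (?Y k \<omega> - ?X k \<omega>))\<^sup>2) + 2 * ennreal ((norm (?X k \<omega> - I \<omega>))\<^sup>2)"
      using ennreal_norm_sq_add_le[of "?Y k \<omega> - ?X k \<omega>" "?X k \<omega> - I \<omega>"] by simp
  qed
  also have "\<dots> = 2 * (\<integral>\<^sup>+\<omega>. ennreal ((norm (?Y k \<omega> - ?X k \<omega>))\<^sup>2) \<partial>M) + 2 * (\<integral>\<^sup>+\<omega>. ennreal ((norm (?X k \<omega> - I \<omega>))\<^sup>2) \<partial>M)"
    by (simp add: nn_integral_add nn_integral_cmult)
  finally show "(\<integral>\<^sup>+\<omega>. ennreal ((norm (?Y k \<omega> - I \<omega>))\<^sup>2) \<partial>M) \<le>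
      2 * (\<integral>\<^sup>+\<omega>. ennreal ((norm (?Y k \<omega> - ?X k \<omega>))\<^sup>2) \<partial>M) + 2 * (\<integral>\<^sup>+\<omega>. ennreal ((norm (?X k \<omega> - I \<omega>))\<^sup>2) \<partial>M)" .
qed

end

text \<open>Cauchy's functional equation. Non-negativity gives monotonicity, which takes the place
  of regularity in \<open>t\<close>; comparison with the integer part \<open>k\<close> of
  \<open>n t\<close> bounds the error by \<open>f 1 / n\<close>.\<close>

lemma additive_nonneg_linear:
  fixes f :: "real \<Rightarrow> real"
  assumes add: "\<And>s t. 0 \<le> s \<Longrightarrow> 0 \<le> t \<Longrightarrow> f (s + t) = f s + f t" and pos: "\<And>t. 0 \<le> t \<Longrightarrow> 0 \<le> f t"
    and t: "0 \<le> t"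
  shows "f t = t * f 1"
proof -
  have mono: "f s \<le> f t" if "0 \<le> s" "s \<le> t" for s t
    using add[of s "t - s"] pos[of "t - s"] that by simp
  have f0: "f 0 = 0" using add[of 0 0] by simp
  have nat: "f (real n * s) = real n * f s" if "0 \<le> s" for n s
  proof (induction n)
    case (Suc n) then show ?case using add[of "real n * s" s] that by (simp add: algebra_simps)
  qed (simp add: f0)
  have bound: "\<bar>f t - t * f 1\<bar> \<le> f 1 / real n" if "n > 0" for n
  proof -
    define k where "k = nat \<lfloor>real n * t\<rfloor>"
    have k: "real k \<le> real n * t" "real n * t \<le> real (Suc k)"
      using t by (auto simp: k_def) (linarith+)?
    have "real k * f 1 \<le> real n * f t"
      using mono[of "real k" "real n * t"] k t nat[of t n] nat[of 1 k] by simp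
    moreover have "real n * f t \<le> real (Suc k) * f 1"
      using mono[of "real n * t" "real (Suc k)"] k t nat[of t n] nat[of 1 "Suc k"] by simp
    moreover have "real k * f 1 \<le> real n * t * f 1" "real n * t * f 1 \<le> real (Suc k) * f 1"
      using k pos[of 1] by (auto intro!: mult_right_mono)
    ultimately have "\<bar>real n * f t - real n * t * f 1\<bar> \<le> f 1" by (simp add: abs_le_iff algebra_simps)
    then have "real n * \<bar>f t - t * f 1\<bar> \<le> f 1"
      by (metis abs_mult abs_of_nat mult.assoc right_diff_distrib)
    then show ?thesis using that by (simp add: field_simps)
  qed
  have "(\<lambda>n. f 1 / real n) \<longlonglongrightarrow> 0" by (rule lim_const_over_n)
  then have "\<bar>f t - t * f 1\<bar> \<le> 0"
    by (rule LIMSEQ_le_const) (auto intro!: exI[of _ 1] bound)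
  then show ?thesis by simp
qed

section \<open>Square integrable non-decreasing Levy processes\<close>

lemma (in prob_space) indep_set_vimage_compose:
  assumes ind: "indep_set (sets (vimage_algebra (space M) U K)) N" and U: "U \<in> M \<rightarrow>\<^sub>M K" and f: "f \<in> K \<rightarrow>\<^sub>M K'"
  shows "indep_set (sets (vimage_algebra (space M) (\<lambda>\<omega>. f (U \<omega>)) K')) N"
proof -
  have UV: "U \<in> vimage_algebra (space M) U K \<rightarrow>\<^sub>M K"
    using measurable_space[OF U] by (intro measurable_vimage_algebra1) auto
  have "(\<lambda>\<omega>. f (U \<omega>)) \<in> vimage_algebra (space M) U K \<rightarrow>\<^sub>M K'" by (rule measurable_compose[OF UV f])
  from measurable_sets[OF this] have sub: "sets (vimage_algebra (space M) (\<lambda>\<omega>. f (U \<omega>)) K') \<subseteq> sets (vimage_algebra (space M) U K)"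
    unfolding sets_vimage_algebra
    by (intro sets.sigma_sets_subset[of _ "vimage_algebra (space M) U K", simplified, unfolded sets_vimage_algebra])
      (auto simp: sets_vimage_algebra[symmetric])
  show ?thesis
  proof (rule indep_setI)
    show "sets (vimage_algebra (space M) (\<lambda>\<omega>. f (U \<omega>)) K') \<subseteq> events" "N \<subseteq> events"
      using sub indep_setD_ev1[OF ind] indep_setD_ev2[OF ind] by auto
  qed (use indep_setD[OF ind] sub in auto)
qed

lemma ennreal_tendsto_zeroI:
  fixes f :: "nat \<Rightarrow> ennreal"
  assumes c: "c < \<top>" and le: "\<And>\<epsilon>. 0 < \<epsilon> \<Longrightarrow> \<forall>\<^sub>F n in sequentially. f n \<le> ennreal \<epsilon> * c"
  shows "f \<longlonglongrightarrow> 0"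
proof (rule order_tendstoI)
  fix \<delta> :: ennreal assume "0 < \<delta>"
  then obtain d where d: "0 < d" "ennreal d < \<delta>"
    by (metis dense ennreal_0 ennreal_cases ennreal_less_zero_iff less_top_ennreal not_less_iff_gr_or_eq order_less_imp_not_less)
  obtain c' where c': "c = ennreal c'" "0 \<le> c'" using c by (cases c) auto
  define \<epsilon> where "\<epsilon> = d / (c' + 1)"
  have "0 < \<epsilon>" using d c' by (simp add: \<epsilon>_def)
  have "ennreal \<epsilon> * c = ennreal (\<epsilon> * c')" using c' \<open>0 < \<epsilon>\<close> by (simp add: ennreal_mult)
  also have "\<dots> \<le> ennreal d"
    using d c' by (intro ennreal_leI) (simp add: \<epsilon>_def field_simps)
  finally have "ennreal \<epsilon> * c < \<delta>" using d(2) by simp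
  then show "\<forall>\<^sub>F n in sequentially. f n < \<delta>"
    using le[OF \<open>0 < \<epsilon>\<close>] by (auto elim!: eventually_mono intro: le_less_trans)
qed simp

locale increasing_levy = prob_space M
  for M :: "'w measure" +
  fixes F :: "real \<Rightarrow> 'w measure" and L :: "real \<Rightarrow> 'w \<Rightarrow> 'h::{real_inner,banach,second_countable_topology} hs_op"
  assumes F_filtration: "filtration (space M) F" and F_subalg: "\<And>t. subalgebra M (F t)"
    and levy: "levy_process M F L" and square: "square_integrable_process M L" and nondecreasing: "nondecreasing_paths M L"
begin

lemma L_F: "0 \<le> t \<Longrightarrow> L t \<in> borel_measurable (F t)"
  using levy by (simp add: levy_process_def adapted_def)

lemma L_M: "0 \<le> t \<Longrightarrow> L t \<in> borel_measurable M"
  using measurable_from_subalg[OF F_subalg L_F] .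

lemma L_0: "AE \<omega> in M. L 0 \<omega> = 0" using levy by (simp add: levy_process_def)

lemma L_ind: "0 \<le> s \<Longrightarrow> s \<le> t \<Longrightarrow>
    indep_set (sets (vimage_algebra (space M) (\<lambda>\<omega>. L t \<omega> - L s \<omega>) borel)) (sets (F s))"
  using levy by (simp add: levy_process_def indep_increments_def)

lemma L_square: "0 \<le> t \<Longrightarrow> integrable M (\<lambda>\<omega>. (norm (L t \<omega>))\<^sup>2)"
  using square by (simp add: square_integrable_process_def)

lemma L_int: assumes "0 \<le> t" shows "integrable M (L t)"
proof (rule Bochner_Integration.integrable_bound)
  show "integrable M (\<lambda>\<omega>. 1 + (norm (L t \<omega>))\<^sup>2)" using L_square[OF assms] by simp
  have "norm (L t \<omega>) \<le> 1 + (norm (L t \<omega>))\<^sup>2" for \<omega>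
  proof -
    have "2 * norm (L t \<omega>) \<le> 1 + (norm (L t \<omega>))\<^sup>2" using sum_squares_bound[of 1 "norm (L t \<omega>)"] by simp
    then show ?thesis using norm_ge_zero[of "L t \<omega>"] by linarith
  qed
  then show "AE \<omega> in M. norm (L t \<omega>) \<le> norm (1 + (norm (L t \<omega>))\<^sup>2)" by simp
qed (rule L_M[OF assms])

lemma L_mono: "AE \<omega> in M. \<forall>s t. 0 \<le> s \<longrightarrow> s \<le> t \<longrightarrow> L t \<omega> - L s \<omega> \<in> pos_cone"
  using nondecreasing unfolding nondecreasing_paths_def
proof eventually_elim
  fix \<omega> assume a: "(\<forall>t\<ge>0. self_adjoint (op_of_hs (L t \<omega>))) \<and> (\<forall>f. mono_on {0..} (\<lambda>t. op_of_hs (L t \<omega>) f \<bullet> f))"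
  show "\<forall>s t. 0 \<le> s \<longrightarrow> s \<le> t \<longrightarrow> L t \<omega> - L s \<omega> \<in> pos_cone"
  proof (intro allI impI)
    fix s t :: real assume st: "0 \<le> s" "s \<le> t"
    have "op_of_hs (L s \<omega>) f \<bullet> f \<le> op_of_hs (L t \<omega>) f \<bullet> f" for f
      using a st by (auto simp: mono_on_def)
    moreover have "self_adjoint (op_of_hs (L s \<omega>))" "self_adjoint (op_of_hs (L t \<omega>))" using a st by auto
    ultimately show "L t \<omega> - L s \<omega> \<in> pos_cone"
      by (auto simp: pos_cone_def self_adjoint_def nonneg_definite_def minus_hs_op.rep_eq blinfun.bilinear_simps inner_diff_left inner_diff_right)
  qed
qed

lemma L_pos: assumes "0 \<le> t" shows "AE \<omega> in M. L t \<omega> \<in> pos_cone"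
  using L_mono L_0
proof eventually_elim
  fix \<omega> assume "\<forall>s t. 0 \<le> s \<longrightarrow> s \<le> t \<longrightarrow> L t \<omega> - L s \<omega> \<in> pos_cone" "L 0 \<omega> = 0"
  then have "L t \<omega> - L 0 \<omega> \<in> pos_cone" "L 0 \<omega> = 0" using assms by auto
  then show "L t \<omega> \<in> pos_cone" by simp
qed

lemma L_stationary:
  fixes \<phi> :: "'h hs_op \<Rightarrow> real"
  assumes "0 \<le> s" "s \<le> t" and \<phi>: "\<phi> \<in> borel_measurable borel"
  shows "(\<integral>\<omega>. \<phi> (L t \<omega> - L s \<omega>) \<partial>M) = (\<integral>\<omega>. \<phi> (L (t - s) \<omega>) \<partial>M)"
proof -
  have "distr M borel (\<lambda>\<omega>. L t \<omega> - L s \<omega>) = distr M borel (L (t - s))"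
    using levy assms by (simp add: levy_process_def)
  then have "integral\<^sup>L (distr M borel (\<lambda>\<omega>. L t \<omega> - L s \<omega>)) \<phi> = integral\<^sup>L (distr M borel (L (t - s))) \<phi>" by simp
  then show ?thesis
    using L_M[of s] L_M[of t] L_M[of "t - s"] assms by (simp add: integral_distr)
qed

definition m where "m = (\<integral>\<omega>. L 1 \<omega> \<partial>M)"
definition Z where "Z t \<omega> = L t \<omega> - t *\<^sub>R m"
definition Q where "Q = covariance_operator (distr M borel (L 1))"

lemma mean_inner: "0 \<le> t \<Longrightarrow> op_of_hs (\<integral>\<omega>. L t \<omega> \<partial>M) e \<bullet> f = (\<integral>\<omega>. op_of_hs (L t \<omega>) e \<bullet> f \<partial>M)"
  using integral_bounded_linear[OF bounded_linear_hs_inner L_int] by simp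

text \<open>The quadratic forms of the mean are additive and non-negative in \<open>t\<close>, hence
  linear; self-adjointness then recovers the operator from its form by polarisation.\<close>

lemma L_mean:
  assumes t: "0 \<le> t" shows "(\<integral>\<omega>. L t \<omega> \<partial>M) = t *\<^sub>R m"
proof -
  let ?E = "\<lambda>t. \<integral>\<omega>. L t \<omega> \<partial>M"
  have sa: "self_adjoint (op_of_hs (?E t))" if "0 \<le> t" for t
    unfolding self_adjoint_def
  proof (intro allI)
    fix x y
    have "op_of_hs (?E t) x \<bullet> y = (\<integral>\<omega>. op_of_hs (L t \<omega>) x \<bullet> y \<partial>M)" by (rule mean_inner[OF that])
    also have "\<dots> = (\<integral>\<omega>. op_of_hs (L t \<omega>) y \<bullet> x \<partial>M)"
    proof (rule integral_cong_AE)
      show "(\<lambda>\<omega>. op_of_hs (L t \<omega>) x \<bullet> y) \<in> borel_measurable M" "(\<lambda>\<omega>. op_of_hs (L t \<omega>) y \<bullet> x) \<in> borel_measurable M"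
        using borel_measurable_integrable[OF integrable_bounded_linear[OF bounded_linear_hs_inner L_int[OF that]]] by auto
      show "AE \<omega> in M. op_of_hs (L t \<omega>) x \<bullet> y = op_of_hs (L t \<omega>) y \<bullet> x"
        using L_pos[OF that] by eventually_elim (metis inner_commute mem_Collect_eq pos_cone_def self_adjoint_def)
    qed
    also have "\<dots> = op_of_hs (?E t) y \<bullet> x" by (rule mean_inner[OF that, symmetric])
    also have "\<dots> = x \<bullet> op_of_hs (?E t) y" by (rule inner_commute)
    finally show "op_of_hs (?E t) x \<bullet> y = x \<bullet> op_of_hs (?E t) y" .
  qed
  have lin: "op_of_hs (?E t) e \<bullet> e = t * (op_of_hs (?E 1) e \<bullet> e)" for e
  proof (rule additive_nonneg_linear[OF _ _ t])
    fix r :: real assume r: "0 \<le> r"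
    show "0 \<le> op_of_hs (?E r) e \<bullet> e"
      unfolding mean_inner[OF r]
    proof (rule integral_nonneg_AE)
      show "AE \<omega> in M. 0 \<le> op_of_hs (L r \<omega>) e \<bullet> e"
        using L_pos[OF r] by eventually_elim (simp add: pos_cone_def nonneg_definite_def)
    qed
    fix s :: real assume s: "0 \<le> s"
    have i: "integrable M (\<lambda>\<omega>. op_of_hs (L r \<omega>) e \<bullet> e)" if "0 \<le> r" for r
      by (rule integrable_bounded_linear[OF bounded_linear_hs_inner L_int[OF that]])
    have "(\<integral>\<omega>. op_of_hs (L (r + s) \<omega> - L r \<omega>) e \<bullet> e \<partial>M) = (\<integral>\<omega>. op_of_hs (L s \<omega>) e \<bullet> e \<partial>M)"
      using L_stationary[of r "r + s" "\<lambda>T. op_of_hs T e \<bullet> e"] r s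
      by (simp add: borel_measurable_continuous_onI[OF linear_continuous_on[OF bounded_linear_hs_inner]])
    then have "(\<integral>\<omega>. op_of_hs (L (r + s) \<omega>) e \<bullet> e \<partial>M) - (\<integral>\<omega>. op_of_hs (L r \<omega>) e \<bullet> e \<partial>M) = (\<integral>\<omega>. op_of_hs (L s \<omega>) e \<bullet> e \<partial>M)"
      using i[of "r + s"] i[of r] r s by (simp add: minus_hs_op.rep_eq blinfun.bilinear_simps inner_diff_left)
    then show "op_of_hs (?E (r + s)) e \<bullet> e = op_of_hs (?E r) e \<bullet> e + op_of_hs (?E s) e \<bullet> e"
      using r s by (simp add: mean_inner)
  qed
  let ?D = "op_of_hs (?E t - t *\<^sub>R m)"
  have diag: "?D x \<bullet> x = 0" for x
    using lin[of x] by (simp add: m_def minus_hs_op.rep_eq scaleR_hs_op.rep_eq blinfun.bilinear_simps inner_diff_left)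
  have sD: "?D x \<bullet> y = ?D y \<bullet> x" for x y
    using sa[OF t] sa[of 1] unfolding self_adjoint_def m_def
    by (simp add: minus_hs_op.rep_eq scaleR_hs_op.rep_eq blinfun.bilinear_simps inner_diff_left) (metis inner_commute)
  have "?D x \<bullet> y = 0" for x y
    using diag[of "x + y"] diag[of x] diag[of y] sD[of x y]
    by (simp add: blinfun.bilinear_simps inner_add_left inner_add_right)
  then have "?D x = 0" for x by (metis inner_eq_zero_iff)
  then have "?D = op_of_hs 0" by (intro blinfun_eqI) (simp add: zero_hs_op.rep_eq)
  then show ?thesis by (simp add: op_of_hs_inject)
qed

lemma Z_M: "0 \<le> t \<Longrightarrow> Z t \<in> borel_measurable M"
  unfolding Z_def[abs_def] using L_M by simp

lemma Z_square: assumes st: "0 \<le> s" "s \<le> t" shows "integrable M (\<lambda>\<omega>. (norm (Z t \<omega> - Z s \<omega>))\<^sup>2)"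
proof (rule Bochner_Integration.integrable_bound)
  let ?c = "(s - t) *\<^sub>R m"
  show "integrable M (\<lambda>\<omega>. 2 * (2 * (norm (L t \<omega>))\<^sup>2 + 2 * (norm (L s \<omega>))\<^sup>2) + 2 * (norm ?c)\<^sup>2)"
    using L_square[of s] L_square[of t] st by simp
  have "(norm (Z t \<omega> - Z s \<omega>))\<^sup>2 \<le> 2 * (2 * (norm (L t \<omega>))\<^sup>2 + 2 * (norm (L s \<omega>))\<^sup>2) + 2 * (norm ?c)\<^sup>2" for \<omega>
  proof -
    have "Z t \<omega> - Z s \<omega> = (L t \<omega> + (- L s \<omega>)) + ?c" by (simp add: Z_def scaleR_diff_left)
    then have "(norm (Z t \<omega> - Z s \<omega>))\<^sup>2 \<le> 2 * (norm (L t \<omega> + (- L s \<omega>)))\<^sup>2 + 2 * (norm ?c)\<^sup>2"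
      by (simp only: norm_sq_add_le)
    also have "\<dots> \<le> 2 * (2 * (norm (L t \<omega>))\<^sup>2 + 2 * (norm (L s \<omega>))\<^sup>2) + 2 * (norm ?c)\<^sup>2"
    proof (intro add_right_mono mult_left_mono)
      show "(norm (L t \<omega> + (- L s \<omega>)))\<^sup>2 \<le> 2 * (norm (L t \<omega>))\<^sup>2 + 2 * (norm (L s \<omega>))\<^sup>2"
        using norm_sq_add_le[of "L t \<omega>" "- L s \<omega>"] by (simp only: norm_minus_cancel)
    qed simp
    finally show ?thesis .
  qed
  then show "AE \<omega> in M. norm ((norm (Z t \<omega> - Z s \<omega>))\<^sup>2) \<le> norm (2 * (2 * (norm (L t \<omega>))\<^sup>2 + 2 * (norm (L s \<omega>))\<^sup>2) + 2 * (norm ?c)\<^sup>2)"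
    by (simp add: order_trans[OF _ abs_ge_self])
qed (use Z_M[of s] Z_M[of t] st in simp)

lemma Z_inner_square: assumes st: "0 \<le> s" "s \<le> t" shows "integrable M (\<lambda>\<omega>. ((Z t \<omega> - Z s \<omega>) \<bullet> x)\<^sup>2)"
proof (rule Bochner_Integration.integrable_bound)
  show "integrable M (\<lambda>\<omega>. (norm (Z t \<omega> - Z s \<omega>))\<^sup>2 * (norm x)\<^sup>2)" using Z_square[OF st] by simp
  have "((Z t \<omega> - Z s \<omega>) \<bullet> x)\<^sup>2 \<le> (norm (Z t \<omega> - Z s \<omega>))\<^sup>2 * (norm x)\<^sup>2" for \<omega>
    using Cauchy_Schwarz_ineq[of "Z t \<omega> - Z s \<omega>" x] by (simp add: dot_square_norm)
  then show "AE \<omega> in M. norm (((Z t \<omega> - Z s \<omega>) \<bullet> x)\<^sup>2) \<le> norm ((norm (Z t \<omega> - Z s \<omega>))\<^sup>2 * (norm x)\<^sup>2)" by simp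
qed (use Z_M[of s] Z_M[of t] st in simp)

lemma Z_mean: assumes st: "0 \<le> s" "s \<le> t" shows "(\<integral>\<omega>. (Z t \<omega> - Z s \<omega>) \<bullet> x \<partial>M) = 0"
proof -
  have i: "integrable M (\<lambda>\<omega>. Z t \<omega> - Z s \<omega>)"
    unfolding Z_def using L_int[of s] L_int[of t] st by simp
  have "(\<integral>\<omega>. Z t \<omega> - Z s \<omega> \<partial>M) = 0"
    unfolding Z_def using L_int[of s] L_int[of t] L_mean[of s] L_mean[of t] st by (simp add: prob_space)
  then show ?thesis using i by simp
qed

lemma Z_ind: assumes st: "0 \<le> s" "s \<le> t"
  shows "indep_set (sets (vimage_algebra (space M) (\<lambda>\<omega>. Z t \<omega> - Z s \<omega>) borel)) (sets (F s))"
proof -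
  have "Z t \<omega> - Z s \<omega> = (L t \<omega> - L s \<omega>) - (t - s) *\<^sub>R m" for \<omega> by (simp add: Z_def scaleR_diff_left)
  moreover have "(\<lambda>\<omega>. L t \<omega> - L s \<omega>) \<in> borel_measurable M" using L_M[of s] L_M[of t] st by simp
  ultimately show ?thesis
    using indep_set_vimage_compose[OF L_ind[OF st], of "\<lambda>z. z - (t - s) *\<^sub>R m" borel] by simp
qed

lemma Z_F: "0 \<le> t \<Longrightarrow> Z t \<in> borel_measurable (F t)"
  unfolding Z_def[abs_def] using L_F by simp

lemma Z_0: "AE \<omega> in M. Z 0 \<omega> = 0"
  using L_0 by eventually_elim (simp add: Z_def)

lemma Z_stationary:
  fixes \<phi> :: "'h hs_op \<Rightarrow> real"
  assumes st: "0 \<le> s" "s \<le> t" and \<phi>: "\<phi> \<in> borel_measurable borel"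
  shows "(\<integral>\<omega>. \<phi> (Z t \<omega> - Z s \<omega>) \<partial>M) = (\<integral>\<omega>. \<phi> (Z (t - s) \<omega>) \<partial>M)"
  using L_stationary[OF st, of "\<lambda>z. \<phi> (z - (t - s) *\<^sub>R m)"] \<phi>
  by (simp add: Z_def algebra_simps measurable_compose[OF _ \<phi>])

text \<open>Independent centred increments are orthogonal, so the variance is additive in time and
  the functional equation applies.\<close>

lemma Z_variance: assumes t: "0 \<le> t" shows "(\<integral>\<omega>. (Z t \<omega> \<bullet> x)\<^sup>2 \<partial>M) = t * (\<integral>\<omega>. (Z 1 \<omega> \<bullet> x)\<^sup>2 \<partial>M)"
proof (rule additive_nonneg_linear[OF _ _ t])
  fix s u :: real assume su: "0 \<le> s" "0 \<le> u"
  \<comment> \<open>\<open>Z 0\<close> vanishes only almost surely, so it is kept inside the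
    increment until the integrals are compared.\<close>
  let ?A = "\<lambda>\<omega>. (Z s \<omega> - Z 0 \<omega>) \<bullet> x" and ?B = "\<lambda>\<omega>. (Z (s + u) \<omega> - Z s \<omega>) \<bullet> x"
  have F0s: "sets (F 0) \<subseteq> sets (F s)" using F_filtration su by (simp add: filtration_def)
  have sp: "space (F r) = space M" for r using F_subalg[of r] by (simp add: subalgebra_def)
  have "Z 0 \<in> borel_measurable (F s)" using Z_F[of 0] F0s by (auto simp: measurable_def sp)
  then have AF: "?A \<in> borel_measurable (F s)" using Z_F[of s] su by simp
  have AM: "?A \<in> borel_measurable M" "?B \<in> borel_measurable M" using Z_M[of s] Z_M[of 0] Z_M[of "s + u"] su by auto
  have sq: "integrable M (\<lambda>\<omega>. (?A \<omega>)\<^sup>2)" "integrable M (\<lambda>\<omega>. (?B \<omega>)\<^sup>2)" using su by (auto intro!: Z_inner_square)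
  have i1: "integrable M ?A" "integrable M ?B"
    using integrable_mult_square[of "\<lambda>_. 1" M ?A] integrable_mult_square[of "\<lambda>_. 1" M ?B] AM sq by auto
  have "(\<integral>\<omega>. ?A \<omega> * ?B \<omega> \<partial>M) = (\<integral>\<omega>. ?A \<omega> \<partial>M) * (\<integral>\<omega>. ?B \<omega> \<partial>M)"
    using indep_increment_expectation(2)[OF F_subalg _ Z_ind AF i1(1), of "s + u" "\<lambda>z. z \<bullet> x"] i1(2) su Z_M[of s] Z_M[of "s + u"] by simp
  also have "(\<integral>\<omega>. ?B \<omega> \<partial>M) = 0" using su by (intro Z_mean) auto
  finally have AB: "(\<integral>\<omega>. ?A \<omega> * ?B \<omega> \<partial>M) = 0" by simp
  have "(\<integral>\<omega>. (Z (s + u) \<omega> \<bullet> x)\<^sup>2 \<partial>M) = (\<integral>\<omega>. (?A \<omega>)\<^sup>2 + 2 * (?A \<omega> * ?B \<omega>) + (?B \<omega>)\<^sup>2 \<partial>M)"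
  proof (rule integral_cong_AE)
    show "AE \<omega> in M. (Z (s + u) \<omega> \<bullet> x)\<^sup>2 = (?A \<omega>)\<^sup>2 + 2 * (?A \<omega> * ?B \<omega>) + (?B \<omega>)\<^sup>2"
      using Z_0 by eventually_elim (simp add: inner_diff_left power2_eq_square algebra_simps)
  qed (use AM Z_M[of "s + u"] su in auto)
  also have "\<dots> = (\<integral>\<omega>. (?A \<omega>)\<^sup>2 \<partial>M) + (\<integral>\<omega>. (?B \<omega>)\<^sup>2 \<partial>M)"
    using sq integrable_mult_square[OF AM sq] AB by simp
  also have "(\<integral>\<omega>. (?B \<omega>)\<^sup>2 \<partial>M) = (\<integral>\<omega>. (Z u \<omega> \<bullet> x)\<^sup>2 \<partial>M)"
    using Z_stationary[of s "s + u" "\<lambda>z. (z \<bullet> x)\<^sup>2"] su by simp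
  also have "(\<integral>\<omega>. (?A \<omega>)\<^sup>2 \<partial>M) = (\<integral>\<omega>. (Z s \<omega> \<bullet> x)\<^sup>2 \<partial>M)"
    using Z_stationary[of 0 s "\<lambda>z. (z \<bullet> x)\<^sup>2"] su by simp
  finally show "(\<integral>\<omega>. (Z (s + u) \<omega> \<bullet> x)\<^sup>2 \<partial>M) = (\<integral>\<omega>. (Z s \<omega> \<bullet> x)\<^sup>2 \<partial>M) + (\<integral>\<omega>. (Z u \<omega> \<bullet> x)\<^sup>2 \<partial>M)" .
qed simp

text \<open>An explicit candidate. \<open>Q\<close> is a definite description and acquires a meaning
  only when a covariance operator is shown to exist and to be unique.\<close>

definition Q0 :: "'h hs_op \<Rightarrow>\<^sub>L 'h hs_op" where
  "Q0 = Blinfun (\<lambda>x. \<integral>\<omega>. (Z 1 \<omega> \<bullet> x) *\<^sub>R Z 1 \<omega> \<partial>M)"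

lemma Z1_square: "integrable M (\<lambda>\<omega>. (norm (Z 1 \<omega>))\<^sup>2)"
proof (rule integrable_cong_AE_imp[OF Z_square[of 0 1]])
  show "(\<lambda>\<omega>. (norm (Z 1 \<omega>))\<^sup>2) \<in> borel_measurable M" using Z_M[of 1] by simp
  show "AE \<omega> in M. (norm (Z 1 \<omega> - Z 0 \<omega>))\<^sup>2 = (norm (Z 1 \<omega>))\<^sup>2"
    using Z_0 by eventually_elim simp
qed simp_all

lemma Z_inner_square': assumes t: "0 \<le> t" shows "integrable M (\<lambda>\<omega>. (Z t \<omega> \<bullet> x)\<^sup>2)"
proof (rule integrable_cong_AE_imp[OF Z_inner_square[of 0 t]])
  show "(\<lambda>\<omega>. (Z t \<omega> \<bullet> x)\<^sup>2) \<in> borel_measurable M" using Z_M[OF t] by simp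
  show "AE \<omega> in M. ((Z t \<omega> - Z 0 \<omega>) \<bullet> x)\<^sup>2 = (Z t \<omega> \<bullet> x)\<^sup>2"
    using Z_0 by eventually_elim simp
qed (use t in simp_all)

lemma Z_inner_mult: "0 \<le> t \<Longrightarrow> integrable M (\<lambda>\<omega>. (Z t \<omega> \<bullet> x) * (Z t \<omega> \<bullet> y))"
  using Z_M[of t] Z_inner_square'[of t x] Z_inner_square'[of t y] by (intro integrable_mult_square) auto

lemma Q0_integrable: "integrable M (\<lambda>\<omega>. (Z 1 \<omega> \<bullet> x) *\<^sub>R Z 1 \<omega>)"
proof (rule Bochner_Integration.integrable_bound)
  show "integrable M (\<lambda>\<omega>. norm x * (norm (Z 1 \<omega>))\<^sup>2)" using Z1_square by simp
  have "norm ((Z 1 \<omega> \<bullet> x) *\<^sub>R Z 1 \<omega>) \<le> norm x * (norm (Z 1 \<omega>))\<^sup>2" for \<omega>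
  proof -
    have "\<bar>Z 1 \<omega> \<bullet> x\<bar> * norm (Z 1 \<omega>) \<le> (norm (Z 1 \<omega>) * norm x) * norm (Z 1 \<omega>)"
      by (intro mult_right_mono Cauchy_Schwarz_ineq2) auto
    then show ?thesis by (simp add: power2_eq_square mult_ac)
  qed
  then show "AE \<omega> in M. norm ((Z 1 \<omega> \<bullet> x) *\<^sub>R Z 1 \<omega>) \<le> norm (norm x * (norm (Z 1 \<omega>))\<^sup>2)" by simp
qed (use Z_M[of 1] in simp)

lemma Q0_apply: "Q0 x = (\<integral>\<omega>. (Z 1 \<omega> \<bullet> x) *\<^sub>R Z 1 \<omega> \<partial>M)"
proof -
  have "bounded_linear (\<lambda>x. \<integral>\<omega>. (Z 1 \<omega> \<bullet> x) *\<^sub>R Z 1 \<omega> \<partial>M)"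
  proof (rule bounded_linear_intro[of _ "\<integral>\<omega>. (norm (Z 1 \<omega>))\<^sup>2 \<partial>M"])
    show "(\<integral>\<omega>. (Z 1 \<omega> \<bullet> (x + y)) *\<^sub>R Z 1 \<omega> \<partial>M) = (\<integral>\<omega>. (Z 1 \<omega> \<bullet> x) *\<^sub>R Z 1 \<omega> \<partial>M) + (\<integral>\<omega>. (Z 1 \<omega> \<bullet> y) *\<^sub>R Z 1 \<omega> \<partial>M)" for x y
      using Q0_integrable[of x] Q0_integrable[of y] by (simp add: inner_add_right scaleR_add_left)
    show "(\<integral>\<omega>. (Z 1 \<omega> \<bullet> (r *\<^sub>R x)) *\<^sub>R Z 1 \<omega> \<partial>M) = r *\<^sub>R (\<integral>\<omega>. (Z 1 \<omega> \<bullet> x) *\<^sub>R Z 1 \<omega> \<partial>M)" for r x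
      by (simp only: inner_scaleR_right scaleR_scaleR[symmetric] integral_scaleR_right)
    show "norm (\<integral>\<omega>. (Z 1 \<omega> \<bullet> x) *\<^sub>R Z 1 \<omega> \<partial>M) \<le> norm x * (\<integral>\<omega>. (norm (Z 1 \<omega>))\<^sup>2 \<partial>M)" for x
    proof -
      have "norm (\<integral>\<omega>. (Z 1 \<omega> \<bullet> x) *\<^sub>R Z 1 \<omega> \<partial>M) \<le> (\<integral>\<omega>. norm ((Z 1 \<omega> \<bullet> x) *\<^sub>R Z 1 \<omega>) \<partial>M)"
        by (rule integral_norm_bound)
      also have "\<dots> \<le> (\<integral>\<omega>. norm x * (norm (Z 1 \<omega>))\<^sup>2 \<partial>M)"
      proof (rule integral_mono)
        show "integrable M (\<lambda>\<omega>. norm ((Z 1 \<omega> \<bullet> x) *\<^sub>R Z 1 \<omega>))" using Q0_integrable by (rule integrable_norm)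
        show "integrable M (\<lambda>\<omega>. norm x * (norm (Z 1 \<omega>))\<^sup>2)" using Z1_square by simp
        fix \<omega>
        have "\<bar>Z 1 \<omega> \<bullet> x\<bar> * norm (Z 1 \<omega>) \<le> (norm (Z 1 \<omega>) * norm x) * norm (Z 1 \<omega>)"
          by (intro mult_right_mono Cauchy_Schwarz_ineq2) auto
        then show "norm ((Z 1 \<omega> \<bullet> x) *\<^sub>R Z 1 \<omega>) \<le> norm x * (norm (Z 1 \<omega>))\<^sup>2"
          by (simp add: power2_eq_square mult_ac)
      qed
      also have "\<dots> = norm x * (\<integral>\<omega>. (norm (Z 1 \<omega>))\<^sup>2 \<partial>M)" by simp
      finally show ?thesis .
    qed
  qed
  then show ?thesis by (simp add: Q0_def bounded_linear_Blinfun_apply)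
qed

lemma Q0_inner: "Q0 x \<bullet> y = (\<integral>\<omega>. (Z 1 \<omega> \<bullet> x) * (Z 1 \<omega> \<bullet> y) \<partial>M)"
  using integral_bounded_linear[OF bounded_linear_inner_left Q0_integrable, of x y] by (simp add: Q0_apply)

lemma Q_eq_Q0: "Q = Q0"
  unfolding Q_def covariance_operator_def
proof (rule the_equality)
  let ?D = "distr M borel (L 1)"
  have L1: "L 1 \<in> borel_measurable M" using L_M by simp
  have mean: "has_mean ?D m"
    unfolding has_mean_def
  proof (intro allI conjI)
    fix h
    show "integrable ?D (\<lambda>x. x \<bullet> h)" using L1 L_int[of 1] by (simp add: integrable_distr_eq)
    show "(\<integral>x. x \<bullet> h \<partial>?D) = m \<bullet> h" using L1 L_int[of 1] by (simp add: integral_distr m_def)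
  qed
  have Z1: "L 1 \<omega> - m = Z 1 \<omega>" for \<omega> by (simp add: Z_def)
  show "has_covariance ?D Q0"
    unfolding has_covariance_def
  proof (intro exI[of _ m] conjI mean allI)
    fix h k
    show "integrable ?D (\<lambda>x. ((x - m) \<bullet> h) * ((x - m) \<bullet> k))"
      using L1 Z_inner_mult[of 1 h k] by (simp add: integrable_distr_eq Z1)
    show "(\<integral>x. ((x - m) \<bullet> h) * ((x - m) \<bullet> k) \<partial>?D) = Q0 h \<bullet> k"
      using L1 by (simp add: integral_distr Z1 Q0_inner)
  qed
  fix Q' assume "has_covariance ?D Q'"
  then obtain m' where m': "has_mean ?D m'" and c: "\<And>h k. (\<integral>x. ((x - m') \<bullet> h) * ((x - m') \<bullet> k) \<partial>?D) = Q' h \<bullet> k"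
    unfolding has_covariance_def by blast
  have "m' \<bullet> h = m \<bullet> h" for h using m' mean by (simp add: has_mean_def)
  then have "m' = m" using vector_eq_rdot by blast
  have "Q' h \<bullet> k = Q0 h \<bullet> k" for h k
    using c[of h k] L1 unfolding \<open>m' = m\<close> by (simp add: integral_distr Z1 Q0_inner)
  then have "Q' h = Q0 h" for h using vector_eq_rdot by blast
  then show "Q' = Q0" by (rule blinfun_eqI)
qed

text \<open>Partial traces are expectations of Bessel sums, hence bounded by the second moment of
  \<open>Z 1\<close>.\<close>

lemma Q_trace_class: "trace_class_nonneg Q"
  unfolding trace_class_nonneg_def Q_eq_Q0
proof (intro conjI)
  show "self_adjoint Q0"
    unfolding self_adjoint_def
  proof (intro allI)
    fix x y show "Q0 x \<bullet> y = x \<bullet> Q0 y"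
      by (subst inner_commute[of x]) (simp add: Q0_inner mult.commute)
  qed
  show "nonneg_definite Q0" unfolding nonneg_definite_def by (simp add: Q0_inner)
  show "(\<lambda>e. Q0 e \<bullet> e) summable_on hilbert_basis"
  proof (rule nonneg_bdd_above_summable_on)
    show "bdd_above (sum (\<lambda>e. Q0 e \<bullet> e) ` {F. F \<subseteq> hilbert_basis \<and> finite F})"
    proof (rule bdd_aboveI2[of _ _ "\<integral>\<omega>. (norm (Z 1 \<omega>))\<^sup>2 \<partial>M"])
      fix E :: "'h hs_op set" assume E: "E \<in> {F. F \<subseteq> hilbert_basis \<and> finite F}"
      have "(\<Sum>e\<in>E. Q0 e \<bullet> e) = (\<integral>\<omega>. (\<Sum>e\<in>E. (Z 1 \<omega> \<bullet> e)\<^sup>2) \<partial>M)"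
        using Z_inner_square'[of 1] by (subst Bochner_Integration.integral_sum) (auto simp: Q0_inner power2_eq_square)
      also have "\<dots> \<le> (\<integral>\<omega>. (norm (Z 1 \<omega>))\<^sup>2 \<partial>M)"
      proof (rule integral_mono)
        show "integrable M (\<lambda>\<omega>. \<Sum>e\<in>E. (Z 1 \<omega> \<bullet> e)\<^sup>2)" using Z_inner_square'[of 1] by (intro Bochner_Integration.integrable_sum) auto
        fix \<omega> show "(\<Sum>e\<in>E. (Z 1 \<omega> \<bullet> e)\<^sup>2) \<le> (norm (Z 1 \<omega>))\<^sup>2"
          using finite_sum_le_has_sum[OF parseval_norm[of "Z 1 \<omega>"], of E] E by simp
      qed (rule Z1_square)
      finally show "(\<Sum>e\<in>E. Q0 e \<bullet> e) \<le> (\<integral>\<omega>. (norm (Z 1 \<omega>))\<^sup>2 \<partial>M)" .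
    qed
  qed (simp add: Q0_inner)
qed

lemma Z_covariance: assumes t: "0 \<le> t" shows "(\<integral>\<omega>. (Z t \<omega> \<bullet> x) * (Z t \<omega> \<bullet> y) \<partial>M) = t * (Q x \<bullet> y)"
proof -
  have p: "(\<integral>\<omega>. (Z t \<omega> \<bullet> (x + y))\<^sup>2 \<partial>M) = (\<integral>\<omega>. (Z t \<omega> \<bullet> x)\<^sup>2 \<partial>M) + 2 * (\<integral>\<omega>. (Z t \<omega> \<bullet> x) * (Z t \<omega> \<bullet> y) \<partial>M) + (\<integral>\<omega>. (Z t \<omega> \<bullet> y)\<^sup>2 \<partial>M)" if "0 \<le> t" for t
  proof -
    have "(\<integral>\<omega>. (Z t \<omega> \<bullet> (x + y))\<^sup>2 \<partial>M) = (\<integral>\<omega>. (Z t \<omega> \<bullet> x)\<^sup>2 + 2 * ((Z t \<omega> \<bullet> x) * (Z t \<omega> \<bullet> y)) + (Z t \<omega> \<bullet> y)\<^sup>2 \<partial>M)"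
      by (rule Bochner_Integration.integral_cong) (auto simp: inner_add_right power2_eq_square algebra_simps)
    then show ?thesis using that by (simp add: Z_inner_square' Z_inner_mult)
  qed
  have "2 * (\<integral>\<omega>. (Z t \<omega> \<bullet> x) * (Z t \<omega> \<bullet> y) \<partial>M) = t * (2 * (\<integral>\<omega>. (Z 1 \<omega> \<bullet> x) * (Z 1 \<omega> \<bullet> y) \<partial>M))"
    using p[OF t] p[of 1] Z_variance[OF t, of x] Z_variance[OF t, of y] Z_variance[OF t, of "x + y"]
    by (simp add: algebra_simps)
  then show ?thesis by (simp add: Q_eq_Q0 Q0_inner)
qed

lemma noise: "square_integrable_noise M F Z Q"
proof unfold_locales
  fix s t :: real and x y :: "'h hs_op" assume st: "0 \<le> s" "s \<le> t"
  show "sets (F s) \<subseteq> sets (F t)" using F_filtration st by (simp add: filtration_def)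
  show "(\<integral>\<omega>. ((Z t \<omega> - Z s \<omega>) \<bullet> x) * ((Z t \<omega> - Z s \<omega>) \<bullet> y) \<partial>M) = (t - s) * (Q x \<bullet> y)"
    using Z_stationary[OF st, of "\<lambda>z. (z \<bullet> x) * (z \<bullet> y)"] Z_covariance[of "t - s" x y] st by simp
qed (auto simp: F_subalg Z_F Z_ind Z_mean Z_inner_square Q_trace_class)

end

text \<open>Over one atom the drift \<open>t v\<close> contributes
  \<open>(b - a) c \<phi> v\<close>, which is also the time integral of that atom applied to
  \<open>v\<close>. This is the pathwise counterpart of the split in
  \<open>has_levy_integral\<close>.\<close>

lemma step_integral_drift:
  fixes v :: "'a::real_normed_vector" and xs :: "('w, 'a, 'b::{banach,second_countable_topology}) atom list"
  assumes "step_process H T xs"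
  shows "set_integrable lborel {0..T} (\<lambda>r. step_value xs r \<omega> v)"
    "step_integral Z xs \<omega> \<omega> = step_integral (\<lambda>t \<omega>. Z t \<omega> - t *\<^sub>R v) xs \<omega> \<omega> + (LINT r:{0..T}|lborel. step_value xs r \<omega> v)"
  using assms
proof (induction xs)
  case Nil
  { case 1 show ?case by (simp add: set_integrable_def) }
  { case 2 show ?case by (simp add: set_lebesgue_integral_def) }
next
  case (Cons X xs)
  obtain a b c \<phi> where X: "X = (a, b, c, \<phi>)" by (cases X)
  have eq: "(indicator {0..T} r :: real) *\<^sub>R ((indicator {a<..b} r * c \<omega>) *\<^sub>R \<phi> v) = indicator {a<..b} r *\<^sub>R (c \<omega> *\<^sub>R \<phi> v)"
    if "0 \<le> a" "b \<le> T" for r using that by (auto simp: indicator_def)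
  have i: "set_integrable lborel {0..T} (\<lambda>r. (indicator {a<..b} r * c \<omega>) *\<^sub>R \<phi> v)"
    "(LINT r:{0..T}|lborel. (indicator {a<..b} r * c \<omega>) *\<^sub>R \<phi> v) = (b - a) *\<^sub>R (c \<omega> *\<^sub>R \<phi> v)"
    if "step_process H T (X # xs)"
  proof -
    have ab: "0 \<le> a" "a \<le> b" "b \<le> T" using that by (auto simp: X)
    show "set_integrable lborel {0..T} (\<lambda>r. (indicator {a<..b} r * c \<omega>) *\<^sub>R \<phi> v)"
      unfolding set_integrable_def eq[OF ab(1,3)] using ab by simp
    show "(LINT r:{0..T}|lborel. (indicator {a<..b} r * c \<omega>) *\<^sub>R \<phi> v) = (b - a) *\<^sub>R (c \<omega> *\<^sub>R \<phi> v)"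
      unfolding set_lebesgue_integral_def eq[OF ab(1,3)] using ab by simp
  qed
  { case 1
    then show ?case using Cons.IH(1) i(1)[OF 1] by (simp add: X blinfun.bilinear_simps set_integral_add) }
  { case 2
    have "(LINT r:{0..T}|lborel. step_value (X # xs) r \<omega> v) =
        (LINT r:{0..T}|lborel. (indicator {a<..b} r * c \<omega>) *\<^sub>R \<phi> v) + (LINT r:{0..T}|lborel. step_value xs r \<omega> v)"
      using Cons.IH(1) i(1)[OF 2] 2 by (simp add: X blinfun.bilinear_simps set_integral_add)
    then show ?case using Cons.IH(2) i(2)[OF 2] 2 by (simp add: X blinfun.bilinear_simps algebra_simps) }
qed

section \<open>Riemann sums for the Levy integral defining the volatility\<close>

context increasing_levy
begin

definition path_sigma :: "'w measure" where
  "path_sigma = sigma (space M) (\<Union>r\<in>{0..}. {L r -` T \<inter> space M |T. T \<in> sets borel})"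

lemma space_path_sigma: "space path_sigma = space M"
  by (simp add: path_sigma_def space_measure_of_conv)

lemma sets_path_sigma: "sets path_sigma = sigma_sets (space M) (\<Union>r\<in>{0..}. {L r -` T \<inter> space M |T. T \<in> sets borel})"
  unfolding path_sigma_def by (rule sets_measure_of) auto

lemma L_path_sigma: "0 \<le> r \<Longrightarrow> L r \<in> borel_measurable path_sigma"
  by (rule measurableI) (auto simp: space_path_sigma sets_path_sigma intro!: sigma_sets.Basic)

context
  fixes C :: "'h hs_op \<Rightarrow>\<^sub>L 'h hs_op" and s :: real
  assumes s: "0 \<le> s" and C_pos: "\<And>u T. 0 \<le> u \<Longrightarrow> T \<in> pos_cone \<Longrightarrow> exp_op (u *\<^sub>R C) T \<in> pos_cone"
begin

definition grid :: "nat \<Rightarrow> nat \<Rightarrow> real" where "grid n i = s * (real i / real (Suc n))"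

text \<open>Left endpoints and constant coefficients: the integral against \<open>L\<close> is a
  finite sum of exponentials applied to increments of \<open>L\<close>, so its positivity and its
  dependence on the paths of \<open>L\<close> are visible.\<close>

definition riemann :: "nat \<Rightarrow> ('w, 'h hs_op, 'h hs_op) atom list" where
  "riemann n = map (\<lambda>i. (grid n i, grid n (Suc i), \<lambda>_. 1, exp_op ((s - grid n i) *\<^sub>R C))) [0..<Suc n]"

lemma grid_mono: "i \<le> j \<Longrightarrow> grid n i \<le> grid n j"
  using s by (auto simp: grid_def intro!: mult_left_mono divide_right_mono)

lemma grid_ends: "grid n 0 = 0" "grid n (Suc n) = s"
proof -
  have "real (Suc n) / real (Suc n) = 1" by simp
  then show "grid n (Suc n) = s" unfolding grid_def by (simp only: mult_1_right)
qed (simp add: grid_def)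

lemma grid_bounds: "i \<le> Suc n \<Longrightarrow> 0 \<le> grid n i" "i \<le> Suc n \<Longrightarrow> grid n i \<le> s"
  using grid_mono[of 0 i n] grid_mono[of i "Suc n" n] by (auto simp: grid_ends)

lemma grid_step: "grid n (Suc i) - grid n i = s / real (Suc n)"
proof -
  have "s * (real (Suc i) / real (Suc n)) - s * (real i / real (Suc n)) = s * ((real (Suc i) - real i) / real (Suc n))"
    by (simp only: right_diff_distrib diff_divide_distrib)
  then show ?thesis by (simp add: grid_def)
qed

lemma riemann_step: "step_process F s (riemann n)"
  unfolding riemann_def step_process_def
  using grid_bounds grid_mono by (auto intro!: exI[of _ 1])

text \<open>The intervals are left-open, so \<open>r = 0\<close> belongs to none of them and is
  excluded.\<close>

lemma riemann_value:
  assumes r: "0 < r" "r \<le> s"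
  obtains i where "i < Suc n" "r \<in> {grid n i<..grid n (Suc i)}" "\<And>\<omega>. step_value (riemann n) r \<omega> = exp_op ((s - grid n i) *\<^sub>R C)"
proof -
  define k where "k = (LEAST k. r \<le> grid n k)"
  have k: "r \<le> grid n k" unfolding k_def by (rule LeastI[of _ "Suc n"]) (use r in \<open>simp add: grid_ends\<close>)
  have k_le: "k \<le> Suc n" unfolding k_def by (rule Least_le) (use r in \<open>simp add: grid_ends\<close>)
  have "k \<noteq> 0" using k r by (intro notI) (simp add: grid_ends)
  then obtain i where i: "k = Suc i" by (cases k) auto
  have "\<not> r \<le> grid n i" unfolding k_def using i by (intro not_less_Least) (simp add: k_def)
  then have ri: "r \<in> {grid n i<..grid n (Suc i)}" using k i by auto
  have iN: "i < Suc n" using k_le i by simp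
  have other: "r \<notin> {grid n j<..grid n (Suc j)}" if "j \<noteq> i" for j
  proof (cases "j < i")
    case True
    then show ?thesis using grid_mono[of "Suc j" i n] ri by auto
  next
    case False
    then show ?thesis using grid_mono[of "Suc i" j n] ri that by auto
  qed
  have "step_value (riemann n) r \<omega> = exp_op ((s - grid n i) *\<^sub>R C)" for \<omega>
  proof -
    have "step_value (riemann n) r \<omega> =
        (\<Sum>j\<in>{0..<Suc n}. (indicator {grid n j<..grid n (Suc j)} r :: real) *\<^sub>R exp_op ((s - grid n j) *\<^sub>R C))"
      unfolding step_value_def riemann_def by (simp add: o_def interv_sum_list_conv_sum_set_nat del: upt_Suc)
    also have "\<dots> = (\<Sum>j\<in>{0..<Suc n}. if j = i then exp_op ((s - grid n i) *\<^sub>R C) else 0)"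
      using ri other by (intro sum.cong) (auto simp: indicator_def)
    finally show ?thesis using iN by simp
  qed
  with iN ri show thesis by (rule that)
qed

lemma riemann_close:
  assumes "0 < \<epsilon>"
  shows "\<forall>\<^sub>F n in sequentially. \<forall>r \<omega>. 0 < r \<longrightarrow> r \<le> s \<longrightarrow> norm (step_value (riemann n) r \<omega> - exp_op ((s - r) *\<^sub>R C)) \<le> \<epsilon>"
proof -
  have "uniformly_continuous_on {0..s} (\<lambda>u. exp_op (u *\<^sub>R C))"
    by (rule compact_uniformly_continuous[OF continuous_on_exp_op]) simp
  then obtain \<delta> where "0 < \<delta>" and \<delta>: "\<And>x y. x \<in> {0..s} \<Longrightarrow> y \<in> {0..s} \<Longrightarrow> dist y x < \<delta> \<Longrightarrow>
      dist (exp_op (y *\<^sub>R C)) (exp_op (x *\<^sub>R C)) < \<epsilon>"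
    using \<open>0 < \<epsilon>\<close> unfolding uniformly_continuous_on_def by metis
  obtain N where N: "s / \<delta> < real N" using reals_Archimedean2 by blast
  show ?thesis
    unfolding eventually_sequentially
  proof (intro exI[of _ N] allI impI)
    fix n r \<omega> assume n: "N \<le> n" and r: "0 < r" "r \<le> s"
    obtain i where i: "i < Suc n" "r \<in> {grid n i<..grid n (Suc i)}" "step_value (riemann n) r \<omega> = exp_op ((s - grid n i) *\<^sub>R C)"
      using riemann_value[OF r] by metis
    have "s < \<delta> * real N" using N \<open>0 < \<delta>\<close> by (simp add: field_simps)
    also have "\<dots> \<le> \<delta> * real (Suc n)" using n \<open>0 < \<delta>\<close> by (intro mult_left_mono) auto
    finally have "s / real (Suc n) < \<delta>" by (simp add: field_simps)
    moreover have "\<bar>(s - grid n i) - (s - r)\<bar> \<le> s / real (Suc n)" using i(2) grid_step[of n i] by auto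
    ultimately have "dist (s - grid n i) (s - r) < \<delta>" by (simp add: dist_real_def)
    then have "dist (exp_op ((s - grid n i) *\<^sub>R C)) (exp_op ((s - r) *\<^sub>R C)) < \<epsilon>"
      using r grid_bounds[of i n] i by (intro \<delta>) auto
    then show "norm (step_value (riemann n) r \<omega> - exp_op ((s - r) *\<^sub>R C)) \<le> \<epsilon>" by (simp add: i(3) dist_norm)
  qed
qed

lemma riemann_ito_norm:
  assumes jm: "jointly_measurable M s (\<lambda>r (\<omega> :: 'w). exp_op ((s - r) *\<^sub>R C))"
  shows "(\<lambda>n. ito_norm M Q s (\<lambda>r \<omega>. step_value (riemann n) r \<omega> - exp_op ((s - r) *\<^sub>R C))) \<longlonglongrightarrow> 0"
proof (rule ennreal_tendsto_zeroI)
  interpret N: square_integrable_noise M F Z Q by (rule noise)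
  let ?c = "hs_norm_sq (sqrt_op Q) * ennreal s"
  show "?c < \<top>" using hs_norm_sq_sqrt_finite[OF Q_trace_class] by (simp add: ennreal_mult_less_top)
  fix \<epsilon> :: real assume "0 < \<epsilon>"
  \<comment> \<open>Closeness in operator norm enters squared, so the tolerance is
    \<open>sqrt \<epsilon>\<close>.\<close>
  then have "0 < sqrt \<epsilon>" by simp
  from riemann_close[OF this]
  show "\<forall>\<^sub>F n in sequentially. ito_norm M Q s (\<lambda>r \<omega>. step_value (riemann n) r \<omega> - exp_op ((s - r) *\<^sub>R C)) \<le> ennreal \<epsilon> * ?c"
  proof eventually_elim
    fix n assume close: "\<forall>r \<omega>. 0 < r \<longrightarrow> r \<le> s \<longrightarrow> norm (step_value (riemann n) r \<omega> - exp_op ((s - r) *\<^sub>R C)) \<le> sqrt \<epsilon>"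
    have "ito_norm M Q s (\<lambda>r \<omega>. step_value (riemann n) r \<omega> - exp_op ((s - r) *\<^sub>R C)) =
        (\<integral>\<^sup>+\<omega>. (\<integral>\<^sup>+r\<in>{0..s}. hs_norm_sq ((step_value (riemann n) r \<omega> - exp_op ((s - r) *\<^sub>R C)) o\<^sub>L sqrt_op Q) \<partial>lborel) \<partial>M)"
      by (rule ito_norm_iterated[OF jointly_measurable_diff[OF N.jointly_measurable_step[OF riemann_step] jm]])
    also have "\<dots> \<le> (\<integral>\<^sup>+(\<omega> :: 'w). ennreal \<epsilon> * ?c \<partial>M)"
    proof (rule nn_integral_mono)
      fix \<omega>
      have "(\<integral>\<^sup>+r\<in>{0..s}. hs_norm_sq ((step_value (riemann n) r \<omega> - exp_op ((s - r) *\<^sub>R C)) o\<^sub>L sqrt_op Q) \<partial>lborel) \<le>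
          (\<integral>\<^sup>+r. (ennreal \<epsilon> * hs_norm_sq (sqrt_op Q)) * indicator {0..s} r \<partial>lborel)"
      proof (rule nn_integral_mono_AE)
        \<comment> \<open>At \<open>r = 0\<close> the Riemann step process is 0 and need not be
          close to the exponential; this is a null set of times.\<close>
        have "AE r in lborel. r \<noteq> (0::real)" by (rule AE_lborel_singleton)
        then show "AE r in lborel. hs_norm_sq ((step_value (riemann n) r \<omega> - exp_op ((s - r) *\<^sub>R C)) o\<^sub>L sqrt_op Q) * indicator {0..s} r \<le>
            (ennreal \<epsilon> * hs_norm_sq (sqrt_op Q)) * indicator {0..s} r"
        proof eventually_elim
          fix r :: real assume "r \<noteq> 0"
          let ?A = "step_value (riemann n) r \<omega> - exp_op ((s - r) *\<^sub>R C)"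
          show "hs_norm_sq (?A o\<^sub>L sqrt_op Q) * indicator {0..s} r \<le> (ennreal \<epsilon> * hs_norm_sq (sqrt_op Q)) * indicator {0..s} r"
          proof (cases "r \<in> {0..s}")
            case True
            then have "norm ?A \<le> sqrt \<epsilon>" using close \<open>r \<noteq> 0\<close> by auto
            then have "(norm ?A)\<^sup>2 \<le> (sqrt \<epsilon>)\<^sup>2" by (intro power_mono) auto
            then have "ennreal ((norm ?A)\<^sup>2) \<le> ennreal \<epsilon>" using \<open>0 < \<epsilon>\<close> by (intro ennreal_leI) simp
            then have "hs_norm_sq (?A o\<^sub>L sqrt_op Q) \<le> ennreal \<epsilon> * hs_norm_sq (sqrt_op Q)"
              by (rule order_trans[OF hs_norm_sq_compose_left mult_right_mono]) simp
            then show ?thesis using True by simp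
          qed simp
        qed
      qed
      also have "\<dots> = ennreal \<epsilon> * ?c" using s by (subst nn_integral_cmult_indicator) (simp_all add: mult.assoc)
      finally show "(\<integral>\<^sup>+r\<in>{0..s}. hs_norm_sq ((step_value (riemann n) r \<omega> - exp_op ((s - r) *\<^sub>R C)) o\<^sub>L sqrt_op Q) \<partial>lborel) \<le> ennreal \<epsilon> * ?c" .
    qed
    also have "\<dots> = ennreal \<epsilon> * ?c" by (simp add: emeasure_space_1)
    finally show "ito_norm M Q s (\<lambda>r \<omega>. step_value (riemann n) r \<omega> - exp_op ((s - r) *\<^sub>R C)) \<le> ennreal \<epsilon> * ?c" .
  qed
qed

lemma riemann_drift:
  "(\<lambda>n. LINT r:{0..s}|lborel. step_value (riemann n) r \<omega> v) \<longlonglongrightarrow> (LINT r:{0..s}|lborel. exp_op ((s - r) *\<^sub>R C) v)"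
proof (rule LIMSEQ_I)
  fix \<epsilon> :: real assume "0 < \<epsilon>"
  \<comment> \<open>The summand 1 keeps the divisor positive when \<open>v\<close> or
    \<open>s\<close> is 0.\<close>
  define D where "D = norm v * s + 1"
  define \<eta> where "\<eta> = \<epsilon> / (2 * D)"
  have pos: "0 < D" using s by (simp add: D_def add_nonneg_pos)
  have "0 < \<eta>" using \<open>0 < \<epsilon>\<close> pos by (simp add: \<eta>_def)
  have "continuous_on {0..s} (\<lambda>r. exp_op ((s - r) *\<^sub>R C))"
    by (rule continuous_on_compose2[OF continuous_on_exp_op[of s C], of "{0..s}" "\<lambda>r. s - r"]) (auto intro!: continuous_intros)
  then have ci: "set_integrable lborel {0..s} (\<lambda>r. exp_op ((s - r) *\<^sub>R C) v)"
    unfolding set_integrable_def by (intro borel_integrable_compact continuous_intros) auto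
  from riemann_close[OF \<open>0 < \<eta>\<close>] obtain N where N: "\<And>n r. n \<ge> N \<Longrightarrow> 0 < r \<Longrightarrow> r \<le> s \<Longrightarrow>
      norm (step_value (riemann n) r \<omega> - exp_op ((s - r) *\<^sub>R C)) \<le> \<eta>"
    unfolding eventually_sequentially by blast
  have "norm ((LINT r:{0..s}|lborel. step_value (riemann n) r \<omega> v) - (LINT r:{0..s}|lborel. exp_op ((s - r) *\<^sub>R C) v)) < \<epsilon>" if n: "n \<ge> N" for n
  proof -
    let ?d = "\<lambda>r. step_value (riemann n) r \<omega> v - exp_op ((s - r) *\<^sub>R C) v"
    note si = step_integral_drift(1)[OF riemann_step]
    have di: "set_integrable lborel {0..s} ?d" using si ci by (rule set_integral_diff)
    have "(LINT r:{0..s}|lborel. step_value (riemann n) r \<omega> v) - (LINT r:{0..s}|lborel. exp_op ((s - r) *\<^sub>R C) v) = (LINT r:{0..s}|lborel. ?d r)"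
      using si ci by (simp add: set_integral_diff)
    also have "norm \<dots> \<le> (\<integral>r. norm (indicator {0..s} r *\<^sub>R ?d r) \<partial>lborel)"
      unfolding set_lebesgue_integral_def by (rule integral_norm_bound)
    also have "\<dots> \<le> (\<integral>r. indicator {0..s} r * (\<eta> * norm v) \<partial>lborel)"
    proof (rule integral_mono_AE)
      show "integrable lborel (\<lambda>r. norm (indicator {0..s} r *\<^sub>R ?d r))"
        using di unfolding set_integrable_def by (rule integrable_norm)
      have "AE r in lborel. r \<noteq> (0::real)" by (rule AE_lborel_singleton)
      then show "AE r in lborel. norm (indicator {0..s} r *\<^sub>R ?d r) \<le> indicator {0..s} r * (\<eta> * norm v)"
      proof eventually_elim
        fix r :: real assume "r \<noteq> 0"
        show "norm (indicator {0..s} r *\<^sub>R ?d r) \<le> indicator {0..s} r * (\<eta> * norm v)"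
        proof (cases "r \<in> {0..s}")
          case True
          have "?d r = (step_value (riemann n) r \<omega> - exp_op ((s - r) *\<^sub>R C)) v" by (simp add: blinfun.bilinear_simps)
          also have "norm \<dots> \<le> norm (step_value (riemann n) r \<omega> - exp_op ((s - r) *\<^sub>R C)) * norm v" by (rule norm_blinfun)
          also have "\<dots> \<le> \<eta> * norm v" using True \<open>r \<noteq> 0\<close> by (intro mult_right_mono N n) auto
          finally show ?thesis using True by simp
        qed simp
      qed
    qed (use s in simp)
    also have "\<dots> = s * (\<eta> * norm v)" using s by simp
    also have "\<dots> \<le> \<eta> * D" using \<open>0 < \<eta>\<close> by (simp add: D_def algebra_simps)
    also have "\<dots> = \<epsilon> / 2" using pos by (simp add: \<eta>_def)
    also have "\<dots> < \<epsilon>" using \<open>0 < \<epsilon>\<close> by simp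
    finally show ?thesis .
  qed
  then show "\<exists>no. \<forall>n\<ge>no. norm ((LINT r:{0..s}|lborel. step_value (riemann n) r \<omega> v) - (LINT r:{0..s}|lborel. exp_op ((s - r) *\<^sub>R C) v)) < \<epsilon>"
    by blast
qed

lemma riemann_path_sigma: "(\<lambda>\<omega>. step_integral L (riemann n) \<omega> \<omega>) \<in> borel_measurable path_sigma"
proof -
  have "(\<lambda>\<omega>. step_integral L (riemann n) \<omega> \<omega>) =
      (\<lambda>\<omega>. \<Sum>i\<in>{0..<Suc n}. exp_op ((s - grid n i) *\<^sub>R C) (L (grid n (Suc i)) \<omega> - L (grid n i) \<omega>))"
    unfolding step_integral_def riemann_def by (simp add: o_def interv_sum_list_conv_sum_set_nat del: upt_Suc)
  also have "\<dots> \<in> borel_measurable path_sigma"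
  proof (rule borel_measurable_sum)
    fix i assume i: "i \<in> {0..<Suc n}"
    have "(\<lambda>\<omega>. L (grid n (Suc i)) \<omega> - L (grid n i) \<omega>) \<in> borel_measurable path_sigma"
      using i grid_bounds by (intro borel_measurable_diff L_path_sigma) auto
    then show "(\<lambda>\<omega>. exp_op ((s - grid n i) *\<^sub>R C) (L (grid n (Suc i)) \<omega> - L (grid n i) \<omega>)) \<in> borel_measurable path_sigma"
      by (rule measurable_compose) (intro borel_measurable_continuous_onI linear_continuous_on blinfun.bounded_linear_right)
  qed
  finally show ?thesis .
qed

lemma riemann_pos_cone:
  assumes "\<forall>r t. 0 \<le> r \<longrightarrow> r \<le> t \<longrightarrow> L t \<omega> - L r \<omega> \<in> pos_cone"
  shows "step_integral L (riemann n) \<omega> \<omega> \<in> pos_cone"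
proof -
  have "step_integral L (riemann n) \<omega> \<omega> =
      (\<Sum>i\<in>{0..<Suc n}. exp_op ((s - grid n i) *\<^sub>R C) (L (grid n (Suc i)) \<omega> - L (grid n i) \<omega>))"
    unfolding step_integral_def riemann_def by (simp add: o_def interv_sum_list_conv_sum_set_nat del: upt_Suc)
  also have "\<dots> \<in> pos_cone"
    using assms grid_bounds grid_mono by (intro pos_cone_sum C_pos) auto
  finally show ?thesis .
qed

text \<open>An almost surely convergent subsequence of Riemann sums hands two properties to the
  limit: membership in the closed cone, and dependence on the paths of \<open>L\<close>
  alone.\<close>

lemma levy_integral_properties:
  assumes I: "has_levy_integral M F L s (\<lambda>r \<omega>. exp_op ((s - r) *\<^sub>R C)) I"
  shows "AE \<omega> in M. I \<omega> \<in> pos_cone" "\<exists>I'\<in>borel_measurable path_sigma. AE \<omega> in M. I \<omega> = I' \<omega>"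
proof -
  interpret N: square_integrable_noise M F Z Q by (rule noise)
  have Ze: "(\<lambda>t \<omega>. L t \<omega> - t *\<^sub>R m) = Z" by (simp add: Z_def fun_eq_iff)
  from I obtain J where J: "has_ito_integral M F Z Q s (\<lambda>r \<omega>. exp_op ((s - r) *\<^sub>R C)) J"
    and IJ: "AE \<omega> in M. I \<omega> = J \<omega> + (LINT r:{0..s}|lborel. exp_op ((s - r) *\<^sub>R C) m)"
    unfolding has_levy_integral_def Let_def m_def[symmetric] Q_def[symmetric] Ze by blast
  note ito = N.ito_integral_steps[OF J F_subalg order_refl]
  from ito(3) obtain xs where xs: "\<And>k. step_process F s (xs k)"
    "(\<lambda>k. ito_norm M Q s (\<lambda>r \<omega>. step_value (xs k) r \<omega> - exp_op ((s - r) *\<^sub>R C))) \<longlonglongrightarrow> 0"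
    "(\<lambda>k. \<integral>\<^sup>+\<omega>. ennreal ((norm (step_integral Z (xs k) \<omega> \<omega> - J \<omega>))\<^sup>2) \<partial>M) \<longlonglongrightarrow> 0" by blast
  have conv: "(\<lambda>k. \<integral>\<^sup>+\<omega>. ennreal ((norm (step_integral Z (riemann k) \<omega> \<omega> - J \<omega>))\<^sup>2) \<partial>M) \<longlonglongrightarrow> 0"
    by (rule N.ito_limit_unique[OF ito(1,2) xs riemann_step riemann_ito_norm[OF ito(1)]])
  obtain \<rho> :: "nat \<Rightarrow> nat" where \<rho>: "strict_mono \<rho>" "AE \<omega> in M. (\<lambda>k. step_integral Z (riemann (\<rho> k)) \<omega> \<omega>) \<longlonglongrightarrow> J \<omega>"
    by (rule L2_subseq_AE[OF N.step_integral_measurable[OF riemann_step] ito(2) conv])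
  have lim: "AE \<omega> in M. (\<lambda>k. step_integral L (riemann (\<rho> k)) \<omega> \<omega>) \<longlonglongrightarrow> I \<omega>"
    using \<rho>(2) IJ
  proof eventually_elim
    fix \<omega> assume a: "(\<lambda>k. step_integral Z (riemann (\<rho> k)) \<omega> \<omega>) \<longlonglongrightarrow> J \<omega>"
      and b: "I \<omega> = J \<omega> + (LINT r:{0..s}|lborel. exp_op ((s - r) *\<^sub>R C) m)"
    have "(\<lambda>k. LINT r:{0..s}|lborel. step_value (riemann (\<rho> k)) r \<omega> m) \<longlonglongrightarrow> (LINT r:{0..s}|lborel. exp_op ((s - r) *\<^sub>R C) m)"
      using LIMSEQ_subseq_LIMSEQ[OF riemann_drift \<rho>(1)] by (simp add: o_def)
    from tendsto_add[OF a this]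
    show "(\<lambda>k. step_integral L (riemann (\<rho> k)) \<omega> \<omega>) \<longlonglongrightarrow> I \<omega>"
      using step_integral_drift(2)[OF riemann_step, of L _ \<omega> m] unfolding Ze b by simp
  qed
  show "AE \<omega> in M. I \<omega> \<in> pos_cone"
    using lim L_mono
  proof eventually_elim
    fix \<omega> assume l: "(\<lambda>k. step_integral L (riemann (\<rho> k)) \<omega> \<omega>) \<longlonglongrightarrow> I \<omega>"
      and p: "\<forall>s t. 0 \<le> s \<longrightarrow> s \<le> t \<longrightarrow> L t \<omega> - L s \<omega> \<in> pos_cone"
    show "I \<omega> \<in> pos_cone"
      by (rule closed_sequentially[OF closed_pos_cone riemann_pos_cone[OF p] l])
  qed
  show "\<exists>I'\<in>borel_measurable path_sigma. AE \<omega> in M. I \<omega> = I' \<omega>"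
  \<comment> \<open>\<open>lim\<close> gives a version that is measurable for the uncompleted path
    algebra; it agrees with \<open>I\<close> only almost surely.\<close>
  proof (intro bexI[of _ "\<lambda>\<omega>. lim (\<lambda>k. step_integral L (riemann (\<rho> k)) \<omega> \<omega>)"])
    show "AE \<omega> in M. I \<omega> = lim (\<lambda>k. step_integral L (riemann (\<rho> k)) \<omega> \<omega>)"
      using lim by eventually_elim (simp add: limI)
    show "(\<lambda>\<omega>. lim (\<lambda>k. step_integral L (riemann (\<rho> k)) \<omega> \<omega>)) \<in> borel_measurable path_sigma"
      by (rule borel_measurable_lim_metric) (rule riemann_path_sigma)
  qed
qed

end

end

section \<open>Centred normal laws\<close>

text \<open>Parametrised by the variance and including the point mass at \<open>v = 0\<close>, so
  degenerate directions fit the same formulas.\<close>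

definition centred_normal :: "real \<Rightarrow> real measure" where
  "centred_normal v = distr std_normal_distribution borel (\<lambda>x. sqrt v * x)"

lemma std_normal_prob_space: "prob_space std_normal_distribution"
  using real_dist_normal_dist by (simp add: real_distribution_def)

lemma real_distribution_centred_normal: "real_distribution (centred_normal v)"
  unfolding centred_normal_def by (rule prob_space.real_distribution_distr[OF std_normal_prob_space]) simp

lemma char_centred_normal:
  assumes "0 \<le> v" shows "char (centred_normal v) u = complex_of_real (exp (- (v * u\<^sup>2) / 2))"
proof -
  have "char (centred_normal v) u = char std_normal_distribution (u * sqrt v)"
    unfolding char_def centred_normal_def by (subst integral_distr) (auto simp: mult.assoc)
  also have "\<dots> = complex_of_real (exp (- (v * u\<^sup>2) / 2))"
    using assms by (simp add: char_std_normal_distribution power_mult_distrib mult.commute)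
  finally show ?thesis .
qed

lemma centred_normal_moments:
  assumes "0 \<le> v"
  shows "integrable (centred_normal v) (\<lambda>x. x)" "(\<integral>x. x \<partial>centred_normal v) = 0"
    "integrable (centred_normal v) (\<lambda>x. x\<^sup>2)" "(\<integral>x. x\<^sup>2 \<partial>centred_normal v) = v"
proof -
  have m: "(\<lambda>x. sqrt v * x) \<in> std_normal_distribution \<rightarrow>\<^sub>M borel" by simp
  have i1: "integrable std_normal_distribution (\<lambda>x. x)"
    using integrable_std_normal_distribution_moment[of 1] by (simp only: power_one_right)
  have e1: "(\<integral>x. x \<partial>std_normal_distribution) = 0"
    using integral_std_normal_distribution_moment_odd[of 1] by (simp only: power_one_right odd_one simp_thms)
  have e2: "(\<integral>x. x\<^sup>2 \<partial>std_normal_distribution) = 1"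
    using std_normal_distribution_even_moments(1)[of 1] by (simp only: mult_1_right) (simp add: fact_numeral)
  have sq: "(sqrt v * x)\<^sup>2 = v * x\<^sup>2" for x using assms by (simp add: power_mult_distrib)
  show "integrable (centred_normal v) (\<lambda>x. x)"
    unfolding centred_normal_def by (rule integrable_distr_eq[OF m, THEN iffD2]) (rule measurable_ident_sets[OF refl], rule integrable_mult_right[OF i1])
  show "(\<integral>x. x \<partial>centred_normal v) = 0"
    unfolding centred_normal_def integral_distr[OF m measurable_ident_sets[OF refl]] integral_mult_right_zero e1 by (rule mult_zero_right)
  have m2: "(\<lambda>x. x\<^sup>2) \<in> borel_measurable (borel :: real measure)" by simp
  show "integrable (centred_normal v) (\<lambda>x. x\<^sup>2)"
    unfolding centred_normal_def using integrable_std_normal_distribution_moment[of 2]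
    by (intro integrable_distr_eq[OF m m2, THEN iffD2]) (unfold sq, rule integrable_mult_right)
  show "(\<integral>x. x\<^sup>2 \<partial>centred_normal v) = v"
    unfolding centred_normal_def integral_distr[OF m m2] sq integral_mult_right_zero e2 by (rule mult_1_right)
qed

lemma normal_eq_distr_std:
  assumes "0 < \<sigma>"
  shows "density lborel (\<lambda>x. ennreal (normal_density \<mu> \<sigma> x)) = distr std_normal_distribution borel (\<lambda>x. \<mu> + \<sigma> * x)"
proof -
  interpret prob_space std_normal_distribution by (rule std_normal_prob_space)
  have "distr std_normal_distribution lborel (\<lambda>x. x) = std_normal_distribution"
    by (rule distr_id2) simp
  then have "distributed std_normal_distribution lborel (\<lambda>x. x) (normal_density 0 1)"
    unfolding distributed_def by simp
  from normal_density_affine[OF this, of \<sigma> \<mu>] assms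
  have "distr std_normal_distribution lborel (\<lambda>x. \<mu> + \<sigma> * x) = density lborel (\<lambda>x. ennreal (normal_density \<mu> \<sigma> x))"
    by (simp add: distributed_def)
  moreover have "distr std_normal_distribution lborel (\<lambda>x. \<mu> + \<sigma> * x) = distr std_normal_distribution borel (\<lambda>x. \<mu> + \<sigma> * x)"
    by (rule distr_cong) auto
  ultimately show ?thesis by simp
qed

lemma centred_normal_0: "centred_normal 0 = return borel 0"
  using prob_space.distr_const[OF std_normal_prob_space, of 0 borel] by (simp add: centred_normal_def)

lemma gaussian_centred_normal:
  assumes "0 \<le> v" shows "gaussian_real (centred_normal v)"
proof (cases "v = 0")
  case True then show ?thesis using centred_normal_0 by (auto simp: gaussian_real_def)
next
  case False
  then have "0 < sqrt v" using assms by simp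
  from normal_eq_distr_std[OF this, of 0] \<open>0 < sqrt v\<close> show ?thesis
    unfolding gaussian_real_def centred_normal_def by (intro disjI1 exI[of _ 0] exI[of _ "sqrt v"]) simp
qed

lemma centred_gaussianD:
  assumes g: "gaussian_real \<nu>" and m: "(\<integral>x. x \<partial>\<nu>) = 0"
  shows "\<exists>v\<ge>0. \<nu> = centred_normal v"
  using g unfolding gaussian_real_def
proof (elim disjE exE conjE)
  fix \<mu> \<sigma> :: real assume \<sigma>: "0 < \<sigma>" and \<nu>': "\<nu> = density lborel (\<lambda>x. ennreal (normal_density \<mu> \<sigma> x))"
  have \<nu>: "\<nu> = distr std_normal_distribution borel (\<lambda>x. \<mu> + \<sigma> * x)"
    unfolding \<nu>' by (rule normal_eq_distr_std[OF \<sigma>])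
  have i1: "integrable std_normal_distribution (\<lambda>x. x)"
    using integrable_std_normal_distribution_moment[of 1] by (simp only: power_one_right)
  have e1: "(\<integral>x. x \<partial>std_normal_distribution) = 0"
    using integral_std_normal_distribution_moment_odd[of 1] by (simp only: power_one_right odd_one simp_thms)
  have i0: "integrable std_normal_distribution (\<lambda>x. \<mu>)"
    by (rule finite_measure.integrable_const[OF prob_space.finite_measure[OF std_normal_prob_space]])
  have "(\<integral>x. x \<partial>\<nu>) = (\<integral>x. \<mu> + \<sigma> * x \<partial>std_normal_distribution)"
    unfolding \<nu> by (rule integral_distr) simp_all
  also have "\<dots> = (\<integral>x. \<mu> \<partial>std_normal_distribution) + (\<integral>x. \<sigma> * x \<partial>std_normal_distribution)"
    by (rule Bochner_Integration.integral_add[OF i0 integrable_mult_right[OF i1]])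
  also have "\<dots> = \<mu>"
    unfolding integral_mult_right_zero e1 using prob_space.prob_space[OF std_normal_prob_space]
    by (simp only: lebesgue_integral_const mult_zero_right add_0_right real_scaleR_def mult_1_left)
  finally have "\<mu> = 0" using m by simp
  then have "\<nu> = centred_normal (\<sigma>\<^sup>2)" using \<sigma> by (simp add: \<nu> centred_normal_def)
  then show ?thesis by (intro exI[of _ "\<sigma>\<^sup>2"]) simp
next
  fix \<mu> :: real assume \<nu>: "\<nu> = return borel \<mu>"
  have "(\<integral>x. x \<partial>\<nu>) = \<mu>" unfolding \<nu> by (rule integral_return) auto
  with m \<nu> show ?thesis by (intro exI[of _ 0]) (simp add: centred_normal_0)
qed

lemma centred_normal_eqI:
  assumes "real_distribution \<nu>" "0 \<le> v" "\<And>u. char \<nu> u = complex_of_real (exp (- (v * u\<^sup>2) / 2))"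
  shows "\<nu> = centred_normal v"
  using assms by (intro Levy_uniqueness real_distribution_centred_normal) (auto simp: char_centred_normal)

text \<open>Characteristic functions converge by dominated convergence, and Levy's uniqueness
  theorem identifies the limit, also when the limiting variance is 0.\<close>

lemma (in prob_space) centred_normal_limit:
  fixes X :: "nat \<Rightarrow> 'a \<Rightarrow> real"
  assumes X: "\<And>k. X k \<in> borel_measurable M" "Y \<in> borel_measurable M" "AE \<omega> in M. (\<lambda>k. X k \<omega>) \<longlonglongrightarrow> Y \<omega>"
    and v: "\<And>k. 0 \<le> v k" "v \<longlonglongrightarrow> w" and d: "\<And>k. distr M borel (X k) = centred_normal (v k)"
  shows "distr M borel Y = centred_normal w"
proof (rule centred_normal_eqI)
  show "real_distribution (distr M borel Y)" using X(2) by simp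
  show w: "0 \<le> w" using v by (intro LIMSEQ_le_const[OF v(2)]) auto
  fix u
  have c: "char (distr M borel V) u = (CLINT \<omega>|M. iexp (u * V \<omega>))" if "V \<in> borel_measurable M" for V
    unfolding char_def using that by (subst integral_distr) auto
  have "(\<lambda>k. CLINT \<omega>|M. iexp (u * X k \<omega>)) \<longlonglongrightarrow> (CLINT \<omega>|M. iexp (u * Y \<omega>))"
  proof (rule integral_dominated_convergence[where w = "\<lambda>_. 1"])
    show "AE \<omega> in M. (\<lambda>k. iexp (u * X k \<omega>)) \<longlonglongrightarrow> iexp (u * Y \<omega>)"
      using X(3) by eventually_elim (intro tendsto_intros)
  qed (use X in auto)
  moreover have "(CLINT \<omega>|M. iexp (u * X k \<omega>)) = complex_of_real (exp (- (v k * u\<^sup>2) / 2))" for k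
    using c[OF X(1)[of k]] d[of k] char_centred_normal[OF v(1), of k u] by simp
  moreover have "(\<lambda>k. complex_of_real (exp (- (v k * u\<^sup>2) / 2))) \<longlonglongrightarrow> complex_of_real (exp (- (w * u\<^sup>2) / 2))"
    by (intro tendsto_intros v(2)) auto
  ultimately show "char (distr M borel Y) u = complex_of_real (exp (- (w * u\<^sup>2) / 2))"
    unfolding c[OF X(2)] using LIMSEQ_unique by simp
qed

section \<open>Integrals with frozen coefficients are normal\<close>

locale gaussian_noise = square_integrable_noise M H Z Q
  for M :: "'w measure" and H and Z :: "real \<Rightarrow> 'w \<Rightarrow> 'a::{real_inner,banach,second_countable_topology}" and Q +
  assumes Z_gaussian: "\<And>s t x. 0 \<le> s \<Longrightarrow> s \<le> t \<Longrightarrow> gaussian_real (distr M borel (\<lambda>\<omega>. (Z t \<omega> - Z s \<omega>) \<bullet> x))"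
begin

lemma increment_normal:
  assumes st: "0 \<le> s" "s \<le> t"
  shows "\<exists>v\<ge>0. distr M borel (\<lambda>\<omega>. (Z t \<omega> - Z s \<omega>) \<bullet> x) = centred_normal v"
proof (rule centred_gaussianD[OF Z_gaussian[OF st]])
  show "(\<integral>z. z \<partial>distr M borel (\<lambda>\<omega>. (Z t \<omega> - Z s \<omega>) \<bullet> x)) = 0"
    using incr_M[OF st] Z_mean[OF st] by (subst integral_distr) auto
qed

text \<open>The weight at the last time \<open>b\<close> is split into the increment from
  \<open>p\<close> to \<open>b\<close> and the same weight at the previous time \<open>p\<close>.
  The former is independent of \<open>H p\<close>; the latter joins the induction hypothesis, which
  is why \<open>y\<close> is arbitrary there.\<close>

lemma finite_increments_normal:
  assumes "finite A" "A \<subseteq> {0..}"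
  shows "\<exists>v\<ge>0. distr M borel (\<lambda>\<omega>. \<Sum>t\<in>A. (Z t \<omega> - Z 0 \<omega>) \<bullet> y t) = centred_normal v"
  using assms
proof (induction A arbitrary: y rule: finite_linorder_max_induct)
  case empty
  show ?case by (intro exI[of _ 0]) (simp add: centred_normal_0 distr_const)
next
  case (insert b A)
  show ?case
  proof (cases "A = {}")
    case True
    then show ?thesis using increment_normal[of 0 b "y b"] insert.prems by simp
  next
    case False
    define p where "p = Max A"
    have pA: "p \<in> A" unfolding p_def using False insert.hyps by (intro Max_in)
    then have p: "p < b" "0 \<le> p" using insert by auto
    have pm: "\<And>a. a \<in> A \<Longrightarrow> a \<le> p" using insert.hyps by (simp add: p_def)
    define S where "S \<omega> = (\<Sum>t\<in>A. (Z t \<omega> - Z 0 \<omega>) \<bullet> (y(p := y p + y b)) t)" for \<omega>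
    obtain v where v: "0 \<le> v" "distr M borel S = centred_normal v"
      using insert.IH[of "y(p := y p + y b)"] insert.prems unfolding S_def by auto
    obtain v' where v': "0 \<le> v'" "distr M borel (\<lambda>\<omega>. (Z b \<omega> - Z p \<omega>) \<bullet> y b) = centred_normal v'"
      using increment_normal[of p b "y b"] p by auto
    have SH: "S \<in> borel_measurable (H p)"
      unfolding S_def[abs_def]
    proof (rule borel_measurable_sum)
      fix t assume t: "t \<in> A"
      then have "0 \<le> t" "t \<le> p" using insert.prems pm by auto
      then show "(\<lambda>\<omega>. (Z t \<omega> - Z 0 \<omega>) \<bullet> (y(p := y p + y b)) t) \<in> borel_measurable (H p)"
        using H_lift[OF _ _ incr_H, of t p 0] by simp
    qed
    have m: "(\<lambda>\<omega>. Z b \<omega> - Z p \<omega>) \<in> borel_measurable M" using Z_M[of b] Z_M[of p] p by simp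
    have iv: "indep_var borel S borel (\<lambda>\<omega>. (Z b \<omega> - Z p \<omega>) \<bullet> y b)"
      using indep_increment_var[OF H_subalg m Z_ind SH, of "\<lambda>z. z \<bullet> y b"] p by simp
    have eq: "(\<Sum>t\<in>insert b A. (Z t \<omega> - Z 0 \<omega>) \<bullet> y t) = S \<omega> + (Z b \<omega> - Z p \<omega>) \<bullet> y b" for \<omega>
    proof -
      have "S \<omega> = (\<Sum>t\<in>A. (Z t \<omega> - Z 0 \<omega>) \<bullet> y t + (if t = p then (Z p \<omega> - Z 0 \<omega>) \<bullet> y b else 0))"
        unfolding S_def by (intro sum.cong) (auto simp: inner_add_right)
      also have "\<dots> = (\<Sum>t\<in>A. (Z t \<omega> - Z 0 \<omega>) \<bullet> y t) + (Z p \<omega> - Z 0 \<omega>) \<bullet> y b"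
        using insert.hyps pA by (simp add: sum.distrib)
      finally have "S \<omega> = (\<Sum>t\<in>A. (Z t \<omega> - Z 0 \<omega>) \<bullet> y t) + (Z p \<omega> - Z 0 \<omega>) \<bullet> y b" .
      moreover have "b \<notin> A" using insert.hyps by auto
      ultimately show ?thesis using insert.hyps by (simp add: inner_diff_left)
    qed
    have "distr M borel (\<lambda>\<omega>. \<Sum>t\<in>insert b A. (Z t \<omega> - Z 0 \<omega>) \<bullet> y t) = centred_normal (v + v')"
      unfolding eq
    proof (rule centred_normal_eqI)
      have "(\<lambda>\<omega>. S \<omega> + (Z b \<omega> - Z p \<omega>) \<bullet> y b) \<in> borel_measurable M"
        using indep_var_rv1[OF iv] indep_var_rv2[OF iv] by simp
      then show "real_distribution (distr M borel (\<lambda>\<omega>. S \<omega> + (Z b \<omega> - Z p \<omega>) \<bullet> y b))" by simp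
      show "char (distr M borel (\<lambda>\<omega>. S \<omega> + (Z b \<omega> - Z p \<omega>) \<bullet> y b)) u = complex_of_real (exp (- ((v + v') * u\<^sup>2) / 2))" for u
        unfolding char_distr_add[OF iv] v(2) v'(2)
        using v(1) v'(1) by (simp add: char_centred_normal exp_add[symmetric] of_real_mult[symmetric] add_divide_distrib algebra_simps del: of_real_mult)
    qed (use v(1) v'(1) in simp)
    then show ?thesis using v(1) v'(1) by (intro exI[of _ "v + v'"]) simp
  qed
qed

text \<open>Summation by parts: each atom moves its weight to the values of \<open>Z\<close> at its
  two endpoints, so overlaps are harmless. \<open>Z 0\<close> is subtracted because only increments
  of \<open>Z\<close> are known to be normal.\<close>

lemma step_integral_as_values:
  fixes xs :: "('w, 'a, 'b::{real_inner,banach,second_countable_topology}) atom list"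
  assumes "step_process H T xs"
  shows "\<exists>A y. finite A \<and> A \<subseteq> {0..} \<and> (\<forall>t. t \<notin> A \<longrightarrow> y t = 0) \<and>
    (\<forall>\<omega>'. step_integral Z xs \<omega> \<omega>' \<bullet> h = (\<Sum>t\<in>A. (Z t \<omega>' - Z 0 \<omega>') \<bullet> y t))"
  using assms
proof (induction xs)
  case Nil
  show ?case by (intro exI[of _ "{}"] exI[of _ "\<lambda>_. 0"]) simp
next
  case (Cons X xs)
  obtain a b c \<phi> where X: "X = (a, b, c, \<phi>)" by (cases X)
  have ab: "0 \<le> a" "0 \<le> b" using Cons.prems by (auto simp: X)
  obtain A y where A: "finite A" "A \<subseteq> {0..}" "\<And>t. t \<notin> A \<Longrightarrow> y t = 0"
    "\<And>\<omega>'. step_integral Z xs \<omega> \<omega>' \<bullet> h = (\<Sum>t\<in>A. (Z t \<omega>' - Z 0 \<omega>') \<bullet> y t)"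
    using Cons by (auto simp: X)
  define x where "x = c \<omega> *\<^sub>R adj_op \<phi> h"
  define A' where "A' = insert a (insert b A)"
  define y' where "y' t = y t + (if t = b then x else 0) - (if t = a then x else 0)" for t
  have "step_integral Z (X # xs) \<omega> \<omega>' \<bullet> h = (\<Sum>t\<in>A'. (Z t \<omega>' - Z 0 \<omega>') \<bullet> y' t)" for \<omega>'
  proof -
    have fin: "finite A'" "A \<subseteq> A'" "a \<in> A'" "b \<in> A'" using A by (auto simp: A'_def)
    have "(\<Sum>t\<in>A'. (Z t \<omega>' - Z 0 \<omega>') \<bullet> y' t) =
        (\<Sum>t\<in>A'. (Z t \<omega>' - Z 0 \<omega>') \<bullet> y t + (if t = b then (Z b \<omega>' - Z 0 \<omega>') \<bullet> x else 0) - (if t = a then (Z a \<omega>' - Z 0 \<omega>') \<bullet> x else 0))"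
      by (intro sum.cong) (auto simp: y'_def inner_add_right inner_diff_right)
    also have "\<dots> = (\<Sum>t\<in>A'. (Z t \<omega>' - Z 0 \<omega>') \<bullet> y t) + (Z b \<omega>' - Z 0 \<omega>') \<bullet> x - (Z a \<omega>' - Z 0 \<omega>') \<bullet> x"
      using fin by (simp add: sum.distrib sum_subtractf)
    also have "(\<Sum>t\<in>A'. (Z t \<omega>' - Z 0 \<omega>') \<bullet> y t) = (\<Sum>t\<in>A. (Z t \<omega>' - Z 0 \<omega>') \<bullet> y t)"
      using fin A(3) by (intro sum.mono_neutral_right) auto
    finally show ?thesis
      using A(4)[of \<omega>'] by (simp add: X x_def inner_add_left inner_diff_left inner_adj_op[symmetric] blinfun.bilinear_simps right_diff_distrib)
  qed
  moreover have "finite A'" "A' \<subseteq> {0..}" "\<And>t. t \<notin> A' \<Longrightarrow> y' t = 0"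
    using A ab by (auto simp: A'_def y'_def)
  ultimately show ?case by blast
qed

definition freeze :: "'w \<Rightarrow> ('w, 'a, 'b::real_normed_vector) atom list \<Rightarrow> ('w, 'a, 'b) atom list" where
  "freeze \<omega> xs = map (\<lambda>(a, b, c, \<phi>). (a, b, \<lambda>_. c \<omega>, \<phi>)) xs"

lemma freeze_simps:
  "step_process H T xs \<Longrightarrow> step_process H T (freeze \<omega> xs)"
  "step_value (freeze \<omega> xs) s \<omega>' = step_value xs s \<omega>"
  "step_integral Z (freeze \<omega> xs) \<omega>' \<omega>'' = step_integral Z xs \<omega> \<omega>''"
proof -
  show "step_process H T xs \<Longrightarrow> step_process H T (freeze \<omega> xs)"
    by (induction xs) (auto simp: freeze_def)
  show "step_value (freeze \<omega> xs) s \<omega>' = step_value xs s \<omega>"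
    by (induction xs) (auto simp: freeze_def)
  show "step_integral Z (freeze \<omega> xs) \<omega>' \<omega>'' = step_integral Z xs \<omega> \<omega>''"
    by (induction xs) (auto simp: freeze_def)
qed

text \<open>A frozen process is again a step process, with constant coefficients. Normality comes
  from finitely many values of the noise, the variance from the isometry, so the induction for
  normality does not have to track it.\<close>

lemma frozen_step_normal:
  fixes xs :: "('w, 'a, 'b::{real_inner,banach,second_countable_topology}) atom list"
    and \<omega> :: 'w and h :: 'b
  assumes xs: "step_process H T xs"
  defines "q \<equiv> \<lambda>s. Q (adj_op (step_value xs s \<omega>) h) \<bullet> adj_op (step_value xs s \<omega>) h"
  shows "integrable (time_space T) q" "0 \<le> (\<integral>s. q s \<partial>time_space T)"
    "(\<lambda>\<omega>'. step_integral Z xs \<omega> \<omega>') \<in> borel_measurable M"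
    "distr M borel (\<lambda>\<omega>'. step_integral Z xs \<omega> \<omega>' \<bullet> h) = centred_normal (\<integral>s. q s \<partial>time_space T)"
proof -
  interpret P: pair_sigma_finite "time_space T" M by (rule prob_pair)
  let ?I = "\<lambda>\<omega>'. step_integral Z xs \<omega> \<omega>' \<bullet> h"
  note fr = freeze_simps(1)[OF xs, of \<omega>]
  have b: "bilinear_isometry T h h (freeze \<omega> xs) (freeze \<omega> xs)" using fr fr by (rule bilinear_isometry_steps)
  have i: "integrable (time_space T \<Otimes>\<^sub>M M) (\<lambda>p. q (fst p))"
    and e: "(\<integral>\<omega>'. (?I \<omega>')\<^sup>2 \<partial>M) = (\<integral>p. q (fst p) \<partial>(time_space T \<Otimes>\<^sub>M M))"
    using b by (simp_all add: bilinear_isometry_def freeze_simps(2,3) q_def power2_eq_square)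
  show "integrable (time_space T) q" using P.integrable_fst'[OF i] by (simp add: prob_space)
  have "(\<integral>s. q s \<partial>time_space T) = (\<integral>p. q (fst p) \<partial>(time_space T \<Otimes>\<^sub>M M))"
    using P.integral_fst'[OF i] by (simp add: prob_space)
  with e have sq: "(\<integral>\<omega>'. (?I \<omega>')\<^sup>2 \<partial>M) = (\<integral>s. q s \<partial>time_space T)" by simp
  show "0 \<le> (\<integral>s. q s \<partial>time_space T)" unfolding sq[symmetric] by simp
  show m: "(\<lambda>\<omega>'. step_integral Z xs \<omega> \<omega>') \<in> borel_measurable M"
    using step_integral_measurable[OF fr] by (simp add: freeze_simps(3))
  obtain A y where A: "finite A" "A \<subseteq> {0..}" and S: "\<And>\<omega>'. ?I \<omega>' = (\<Sum>t\<in>A. (Z t \<omega>' - Z 0 \<omega>') \<bullet> y t)"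
    using step_integral_as_values[OF xs, of \<omega> h] by blast
  obtain v where v: "0 \<le> v" "distr M borel ?I = centred_normal v"
    using finite_increments_normal[OF A, of y] unfolding S by blast
  have "v = (\<integral>x. x\<^sup>2 \<partial>distr M borel ?I)" using centred_normal_moments(4)[OF v(1)] v(2) by simp
  also have "\<dots> = (\<integral>\<omega>'. (?I \<omega>')\<^sup>2 \<partial>M)" using m by (intro integral_distr) auto
  finally show "distr M borel ?I = centred_normal (\<integral>s. q s \<partial>time_space T)" using v(2) sq by simp
qed

end

text \<open>A Young inequality with free \<open>\<epsilon>\<close> bounds the difference of squares
  by \<open>1 + 1/\<epsilon>\<close> times the squared distance plus \<open>\<epsilon>\<close> times
  the squared limit; it takes the place of Cauchy-Schwarz for the integrals.\<close>

lemma L2_norms_converge: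
  fixes \<alpha> :: "nat \<Rightarrow> 's \<Rightarrow> 'b::{real_inner,second_countable_topology}"
  assumes m: "\<And>k. \<alpha> k \<in> borel_measurable N" "\<beta> \<in> borel_measurable N"
    and i: "\<And>k. integrable N (\<lambda>s. (norm (\<alpha> k s))\<^sup>2)"
    and lim: "(\<lambda>k. \<integral>\<^sup>+s. ennreal ((norm (\<alpha> k s - \<beta> s))\<^sup>2) \<partial>N) \<longlonglongrightarrow> 0"
  shows "integrable N (\<lambda>s. (norm (\<beta> s))\<^sup>2)"
    "(\<lambda>k. \<integral>s. (norm (\<alpha> k s))\<^sup>2 \<partial>N) \<longlonglongrightarrow> (\<integral>s. (norm (\<beta> s))\<^sup>2 \<partial>N)"
proof -
  note [measurable] = m
  have "\<forall>\<^sub>F k in sequentially. (\<integral>\<^sup>+s. ennreal ((norm (\<alpha> k s - \<beta> s))\<^sup>2) \<partial>N) < 1"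
    using order_tendstoD(2)[OF lim, of 1] by simp
  then obtain K where K: "\<And>k. k \<ge> K \<Longrightarrow> (\<integral>\<^sup>+s. ennreal ((norm (\<alpha> k s - \<beta> s))\<^sup>2) \<partial>N) < 1"
    unfolding eventually_sequentially by blast
  have di: "integrable N (\<lambda>s. (norm (\<alpha> k s - \<beta> s))\<^sup>2)" if "k \<ge> K" for k
  proof (rule integrableI_nonneg)
    show "(\<integral>\<^sup>+s. ennreal ((norm (\<alpha> k s - \<beta> s))\<^sup>2) \<partial>N) < \<infinity>"
      using K[OF that] by (rule less_trans) simp
  qed auto
  show \<beta>i: "integrable N (\<lambda>s. (norm (\<beta> s))\<^sup>2)"
  proof (rule Bochner_Integration.integrable_bound)
    show "integrable N (\<lambda>s. 2 * (norm (\<alpha> K s))\<^sup>2 + 2 * (norm (\<alpha> K s - \<beta> s))\<^sup>2)" using i[of K] di[of K] by simp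
    have "(norm (\<beta> s))\<^sup>2 \<le> 2 * (norm (\<alpha> K s))\<^sup>2 + 2 * (norm (\<alpha> K s - \<beta> s))\<^sup>2" for s
      using norm_sq_add_le[of "\<alpha> K s" "\<beta> s - \<alpha> K s"] by (simp add: norm_minus_commute)
    then show "AE s in N. norm ((norm (\<beta> s))\<^sup>2) \<le> norm (2 * (norm (\<alpha> K s))\<^sup>2 + 2 * (norm (\<alpha> K s - \<beta> s))\<^sup>2)" by simp
  qed simp
  define d where "d k = (\<integral>s. (norm (\<alpha> k s - \<beta> s))\<^sup>2 \<partial>N)" for k
  have d0: "d \<longlonglongrightarrow> 0"
  proof -
    have "(\<lambda>k. enn2real (\<integral>\<^sup>+s. ennreal ((norm (\<alpha> k s - \<beta> s))\<^sup>2) \<partial>N)) \<longlonglongrightarrow> 0"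
      using lim by (intro tendsto_enn2real) simp_all
    moreover have "enn2real (\<integral>\<^sup>+s. ennreal ((norm (\<alpha> k s - \<beta> s))\<^sup>2) \<partial>N) = d k" for k
      unfolding d_def by (rule integral_eq_nn_integral[symmetric]) auto
    ultimately show ?thesis by simp
  qed
  let ?b = "\<integral>s. (norm (\<beta> s))\<^sup>2 \<partial>N"
  have est: "\<bar>(\<integral>s. (norm (\<alpha> k s))\<^sup>2 \<partial>N) - ?b\<bar> \<le> (1 + 1 / \<epsilon>) * d k + \<epsilon> * ?b" if k: "k \<ge> K" and \<epsilon>: "0 < \<epsilon>" for k \<epsilon>
  proof -
    have pt: "\<bar>(norm a)\<^sup>2 - (norm b)\<^sup>2\<bar> \<le> (1 + 1 / \<epsilon>) * (norm (a - b))\<^sup>2 + \<epsilon> * (norm b)\<^sup>2" for a b :: 'b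
    proof -
      define x where "x = norm (a - b)"
      define y where "y = norm b"
      have "\<bar>norm a - y\<bar> \<le> x" unfolding x_def y_def by (rule norm_triangle_ineq3)
      moreover have "\<bar>norm a + y\<bar> \<le> x + 2 * y" using norm_triangle_ineq2[of a b] by (simp add: x_def y_def)
      ultimately have "\<bar>norm a - y\<bar> * \<bar>norm a + y\<bar> \<le> x * (x + 2 * y)"
        by (intro mult_mono) (auto simp: x_def)
      moreover have "\<bar>(norm a)\<^sup>2 - y\<^sup>2\<bar> = \<bar>norm a - y\<bar> * \<bar>norm a + y\<bar>"
        by (simp add: abs_mult[symmetric] power2_eq_square algebra_simps)
      moreover have "2 * (x * y) \<le> x\<^sup>2 / \<epsilon> + \<epsilon> * y\<^sup>2"
      proof -
        have "0 \<le> (x - \<epsilon> * y)\<^sup>2 / \<epsilon>" using \<epsilon> by simp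
        also have "\<dots> = x\<^sup>2 / \<epsilon> - 2 * (x * y) + \<epsilon> * y\<^sup>2" using \<epsilon> by (simp add: power2_eq_square field_simps)
        finally show ?thesis by simp
      qed
      ultimately have "\<bar>(norm a)\<^sup>2 - y\<^sup>2\<bar> \<le> x\<^sup>2 + x\<^sup>2 / \<epsilon> + \<epsilon> * y\<^sup>2" by (simp add: power2_eq_square algebra_simps)
      then show ?thesis by (simp add: x_def y_def algebra_simps)
    qed
    have "\<bar>(\<integral>s. (norm (\<alpha> k s))\<^sup>2 \<partial>N) - ?b\<bar> = \<bar>\<integral>s. (norm (\<alpha> k s))\<^sup>2 - (norm (\<beta> s))\<^sup>2 \<partial>N\<bar>"
      using i[of k] \<beta>i by simp
    also have "\<dots> \<le> (\<integral>s. \<bar>(norm (\<alpha> k s))\<^sup>2 - (norm (\<beta> s))\<^sup>2\<bar> \<partial>N)" by (rule integral_abs_bound)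
    also have "\<dots> \<le> (\<integral>s. (1 + 1 / \<epsilon>) * (norm (\<alpha> k s - \<beta> s))\<^sup>2 + \<epsilon> * (norm (\<beta> s))\<^sup>2 \<partial>N)"
      using i[of k] \<beta>i di[OF k] by (intro integral_mono pt) auto
    also have "\<dots> = (1 + 1 / \<epsilon>) * d k + \<epsilon> * ?b" using \<beta>i di[OF k] by (simp add: d_def)
    finally show ?thesis .
  qed
  show "(\<lambda>k. \<integral>s. (norm (\<alpha> k s))\<^sup>2 \<partial>N) \<longlonglongrightarrow> ?b"
  proof (rule LIMSEQ_I)
    fix e :: real assume e: "0 < e"
    have b0: "0 \<le> ?b" by simp
    \<comment> \<open>Chosen so that the second error term is at most \<open>e / 2\<close>;
      \<open>?b + 1\<close> keeps the divisor positive when the limit norm is 0.\<close>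
    define \<epsilon> where "\<epsilon> = e / (2 * (?b + 1))"
    have "0 < 2 * (?b + 1)" by (rule mult_pos_pos[OF _ add_nonneg_pos[OF b0]]) simp_all
    with e have \<epsilon>: "0 < \<epsilon>" unfolding \<epsilon>_def by (rule divide_pos_pos)
    have "\<epsilon> * ?b \<le> \<epsilon> * (?b + 1)" using \<epsilon> by simp
    also have "\<dots> = e / 2" using b0 unfolding \<epsilon>_def by (simp add: add_nonneg_eq_0_iff field_simps)
    finally have eb: "\<epsilon> * ?b \<le> e / 2" .
    have "(\<lambda>k. (1 + 1 / \<epsilon>) * d k) \<longlonglongrightarrow> 0" using tendsto_mult_right_zero[OF d0] by blast
    then have "\<forall>\<^sub>F k in sequentially. (1 + 1 / \<epsilon>) * d k < e / 2" using e by (intro order_tendstoD(2)) auto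
    then obtain K' where K': "\<And>k. k \<ge> K' \<Longrightarrow> (1 + 1 / \<epsilon>) * d k < e / 2" unfolding eventually_sequentially by blast
    have "norm ((\<integral>s. (norm (\<alpha> k s))\<^sup>2 \<partial>N) - ?b) < e" if k: "k \<ge> max K K'" for k
    proof -
      have "(1 + 1 / \<epsilon>) * d k + \<epsilon> * ?b < e / 2 + e / 2" using K'[of k] k eb by (intro add_less_le_mono) auto
      then have "(1 + 1 / \<epsilon>) * d k + \<epsilon> * ?b < e" by (simp only: field_sum_of_halves)
      with est[OF _ \<epsilon>, of k] k show ?thesis unfolding real_norm_def by (intro le_less_trans[OF est[OF _ \<epsilon>]]) auto
    qed
    then show "\<exists>no. \<forall>k\<ge>no. norm ((\<integral>s. (norm (\<alpha> k s))\<^sup>2 \<partial>N) - ?b) < e" by blast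
  qed
qed

section \<open>Conditioning the coefficients of a step process\<close>

text \<open>Conditional Jensen for the square of \<open>u - y\<close>, where \<open>y\<close> is
  fixed by conditioning. A finite right side and boundedness of \<open>u\<close> make
  \<open>y\<close> integrable; an infinite right side leaves nothing to prove.\<close>

lemma (in finite_measure_subalgebra) cond_exp_L2_contraction:
  assumes u: "u \<in> borel_measurable M" "\<And>\<omega>. \<bar>u \<omega>\<bar> \<le> K" and y: "y \<in> borel_measurable F"
  shows "(\<integral>\<^sup>+\<omega>. ennreal ((real_cond_exp M F u \<omega> - y \<omega>)\<^sup>2) \<partial>M) \<le> (\<integral>\<^sup>+\<omega>. ennreal ((u \<omega> - y \<omega>)\<^sup>2) \<partial>M)"
proof (cases "(\<integral>\<^sup>+\<omega>. ennreal ((u \<omega> - y \<omega>)\<^sup>2) \<partial>M) = \<infinity>")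
  case False
  have yM: "y \<in> borel_measurable M" by (rule measurable_from_subalg[OF subalg y])
  have dM: "(\<lambda>\<omega>. u \<omega> - y \<omega>) \<in> borel_measurable M" using u(1) yM by simp
  have i2: "integrable M (\<lambda>\<omega>. (u \<omega> - y \<omega>)\<^sup>2)"
  proof (rule integrableI_nonneg)
    show "(\<integral>\<^sup>+\<omega>. ennreal ((u \<omega> - y \<omega>)\<^sup>2) \<partial>M) < \<infinity>" using False by (simp add: less_top)
  qed (use dM in auto)
  have i: "integrable M (\<lambda>\<omega>. u \<omega> - y \<omega>)" by (rule square_integrable_imp_integrable[OF dM i2])
  have ui: "integrable M u" using u by (intro integrable_const_bound[where B = K]) auto
  have yi: "integrable M y" using Bochner_Integration.integrable_diff[OF ui i] by simp
  have "AE \<omega> in M. (real_cond_exp M F (\<lambda>\<omega>. u \<omega> - y \<omega>) \<omega>)\<^sup>2 \<le> real_cond_exp M F (\<lambda>\<omega>. (u \<omega> - y \<omega>)\<^sup>2) \<omega>"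
    using i i2 convex_power2 by (intro real_cond_exp_jensens_inequality(2)[where I = UNIV and q = "\<lambda>x. x\<^sup>2"]) auto
  then have "AE \<omega> in M. (real_cond_exp M F u \<omega> - y \<omega>)\<^sup>2 \<le> real_cond_exp M F (\<lambda>\<omega>. (u \<omega> - y \<omega>)\<^sup>2) \<omega>"
    using real_cond_exp_diff[OF ui yi] real_cond_exp_F_meas[OF yi y] by eventually_elim simp
  then have "(\<integral>\<^sup>+\<omega>. ennreal ((real_cond_exp M F u \<omega> - y \<omega>)\<^sup>2) \<partial>M) \<le>
      (\<integral>\<^sup>+\<omega>. ennreal (real_cond_exp M F (\<lambda>\<omega>. (u \<omega> - y \<omega>)\<^sup>2) \<omega>) \<partial>M)"
    by (intro nn_integral_mono_AE) (auto intro: ennreal_leI elim: eventually_mono)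
  also have "\<dots> = ennreal (\<integral>\<omega>. real_cond_exp M F (\<lambda>\<omega>. (u \<omega> - y \<omega>)\<^sup>2) \<omega> \<partial>M)"
    using real_cond_exp_int(1)[OF i2] i2 by (intro nn_integral_eq_integral real_cond_exp_pos) auto
  also have "\<dots> = ennreal (\<integral>\<omega>. (u \<omega> - y \<omega>)\<^sup>2 \<partial>M)" using real_cond_exp_int(2)[OF i2] by simp
  also have "\<dots> = (\<integral>\<^sup>+\<omega>. ennreal ((u \<omega> - y \<omega>)\<^sup>2) \<partial>M)" using i2 by (intro nn_integral_eq_integral[symmetric]) auto
  finally show ?thesis .
qed simp

text \<open>Clipping keeps the coefficients bounded everywhere, not only almost surely.\<close>

definition clipped_cond_exp :: "'w measure \<Rightarrow> 'w measure \<Rightarrow> ('w \<Rightarrow> real) \<Rightarrow> 'w \<Rightarrow> real" where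
  "clipped_cond_exp M G c \<omega> = (let K = (SUP \<omega>'. \<bar>c \<omega>'\<bar>) in max (- K) (min K (real_cond_exp M G c \<omega>)))"

lemma (in finite_measure_subalgebra) clipped_cond_exp_props:
  assumes c: "c \<in> borel_measurable M" "\<And>\<omega>. \<bar>c \<omega>\<bar> \<le> K"
  shows "clipped_cond_exp M F c \<in> borel_measurable F" "\<exists>K. \<forall>\<omega>. \<bar>clipped_cond_exp M F c \<omega>\<bar> \<le> K"
    "AE \<omega> in M. clipped_cond_exp M F c \<omega> = real_cond_exp M F c \<omega>"
proof -
  define S where "S = (SUP \<omega>'. \<bar>c \<omega>'\<bar>)"
  have bdd: "bdd_above (range (\<lambda>\<omega>. \<bar>c \<omega>\<bar>))" by (rule bdd_aboveI2[where M = K]) (rule c(2))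
  have S: "\<bar>c \<omega>\<bar> \<le> S" for \<omega> unfolding S_def by (rule cSUP_upper[OF UNIV_I bdd])
  have S0: "0 \<le> S" using S[of undefined] by simp
  have eq: "clipped_cond_exp M F c = (\<lambda>\<omega>. max (- S) (min S (real_cond_exp M F c \<omega>)))"
    by (simp add: clipped_cond_exp_def[abs_def] S_def Let_def)
  show "clipped_cond_exp M F c \<in> borel_measurable F" unfolding eq by simp
  have "\<bar>clipped_cond_exp M F c \<omega>\<bar> \<le> S" for \<omega> using S0 by (simp add: eq abs_le_iff)
  then show "\<exists>K. \<forall>\<omega>. \<bar>clipped_cond_exp M F c \<omega>\<bar> \<le> K" by blast
  have i: "integrable M c" using c by (intro integrable_const_bound[where B = K]) auto
  have "AE \<omega> in M. - S \<le> real_cond_exp M F c \<omega>"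
  proof (rule real_cond_exp_ge_c[OF i], rule AE_I2)
    show "- S \<le> c \<omega>" for \<omega> using S[of \<omega>] by simp
  qed
  moreover have "AE \<omega> in M. real_cond_exp M F c \<omega> \<le> S"
  proof (rule real_cond_exp_le_c[OF i], rule AE_I2)
    show "c \<omega> \<le> S" for \<omega> using S[of \<omega>] by simp
  qed
  ultimately show "AE \<omega> in M. clipped_cond_exp M F c \<omega> = real_cond_exp M F c \<omega>"
    by eventually_elim (simp add: eq)
qed

definition cond_step :: "'w measure \<Rightarrow> 'w measure \<Rightarrow> ('w, 'a::real_normed_vector, 'b::real_normed_vector) atom list \<Rightarrow> ('w, 'a, 'b) atom list" where
  "cond_step M G xs = map (\<lambda>(a, b, c, \<phi>). (a, b, clipped_cond_exp M G c, \<phi>)) xs"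

lemma step_value_norm_bound: "norm (step_value xs s \<omega>) \<le> (\<Sum>(a, b, c, \<phi>)\<leftarrow>xs. \<bar>c \<omega>\<bar> * norm \<phi>)"
proof (induction xs)
  case (Cons X xs)
  obtain a b c \<phi> where X: "X = (a, b, c, \<phi>)" by (cases X)
  have "norm ((indicator {a<..b} s * c \<omega>) *\<^sub>R \<phi>) \<le> \<bar>c \<omega>\<bar> * norm \<phi>"
    by (auto simp: indicator_def)
  then have "norm ((indicator {a<..b} s * c \<omega>) *\<^sub>R \<phi>) + norm (step_value xs s \<omega>) \<le>
      \<bar>c \<omega>\<bar> * norm \<phi> + (\<Sum>(a, b, c, \<phi>)\<leftarrow>xs. \<bar>c \<omega>\<bar> * norm \<phi>)"
    using Cons.IH by (rule add_mono)
  from norm_triangle_le[OF this] show ?case by (simp add: X)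
qed simp

context square_integrable_noise begin

lemma cond_step_process:
  fixes xs :: "('w, 'a, 'b::{real_inner,banach,second_countable_topology}) atom list"
  assumes G: "subalgebra M G" and xs: "step_process H T xs"
  shows "step_process (\<lambda>_. G) T (cond_step M G xs)"
proof -
  interpret G: finite_measure_subalgebra M G using G by unfold_locales
  show ?thesis using xs
  proof (induction xs)
    case (Cons X xs)
    obtain a b c \<phi> where X: "X = (a, b, c, \<phi>)" by (cases X)
    have "step_process H T ((a, b, c, \<phi>) # xs)" using Cons.prems by (simp only: X)
    then have pr: "0 \<le> a" "c \<in> borel_measurable (H a)" "\<exists>K. \<forall>\<omega>. \<bar>c \<omega>\<bar> \<le> K" "step_process H T xs"
      unfolding step_process_simps(2) by blast+
    obtain K where K: "\<And>\<omega>. \<bar>c \<omega>\<bar> \<le> K" using pr(3) by blast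
    have cM: "c \<in> borel_measurable M" by (rule H_M[OF pr(2)])
    have "step_process H T ((a, b, c, \<phi>) # xs)" using Cons.prems by (simp only: X)
    then have "a \<le> b" "b \<le> T" unfolding step_process_simps(2) by blast+
    then show ?case using pr(1) Cons.IH[OF pr(4)] G.clipped_cond_exp_props(1,2)[OF cM K] by (simp add: X cond_step_def)
  qed (simp add: cond_step_def)
qed

text \<open>Matrix coefficients of the process are linear in the scalar coefficients of its atoms,
  so conditioning commutes with evaluation. Boundedness is carried along for integrability.\<close>

lemma cond_step_value:
  fixes xs :: "('w, 'a, 'b::{real_inner,banach,second_countable_topology}) atom list"
  assumes G: "subalgebra M G" and xs: "step_process H T xs"
  shows "(\<lambda>\<omega>. step_value xs s \<omega> x \<bullet> y) \<in> borel_measurable M"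
    "\<exists>K. \<forall>\<omega>. \<bar>step_value xs s \<omega> x \<bullet> y\<bar> \<le> K"
    "AE \<omega> in M. real_cond_exp M G (\<lambda>\<omega>. step_value xs s \<omega> x \<bullet> y) \<omega> = step_value (cond_step M G xs) s \<omega> x \<bullet> y"
proof -
  interpret G: finite_measure_subalgebra M G using G by unfold_locales
  have "(\<lambda>\<omega>. step_value xs s \<omega> x \<bullet> y) \<in> borel_measurable M \<and> (\<exists>K. \<forall>\<omega>. \<bar>step_value xs s \<omega> x \<bullet> y\<bar> \<le> K) \<and>
    (AE \<omega> in M. real_cond_exp M G (\<lambda>\<omega>. step_value xs s \<omega> x \<bullet> y) \<omega> = step_value (cond_step M G xs) s \<omega> x \<bullet> y)"
    using xs
  proof (induction xs)
    case Nil
    have "AE \<omega> in M. real_cond_exp M G (\<lambda>\<omega>. 0) \<omega> = 0" by (rule G.real_cond_exp_F_meas) auto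
    then show ?case by (auto simp: cond_step_def)
  next
    case (Cons X xs)
    obtain a b c \<phi> where X: "X = (a, b, c, \<phi>)" by (cases X)
    define r where "r = indicator {a<..b} s * (\<phi> x \<bullet> y)"
    define u where "u \<omega> = step_value xs s \<omega> x \<bullet> y" for \<omega>
    have "step_process H T ((a, b, c, \<phi>) # xs)" using Cons.prems by (simp only: X)
    then have pr: "0 \<le> a" "c \<in> borel_measurable (H a)" "\<exists>K. \<forall>\<omega>. \<bar>c \<omega>\<bar> \<le> K" "step_process H T xs"
      unfolding step_process_simps(2) by blast+
    obtain K where K: "\<And>\<omega>. \<bar>c \<omega>\<bar> \<le> K" using pr(3) by blast
    have cM: "c \<in> borel_measurable M" by (rule H_M[OF pr(2)])
    have IH: "u \<in> borel_measurable M" "\<exists>K. \<forall>\<omega>. \<bar>u \<omega>\<bar> \<le> K"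
      "AE \<omega> in M. real_cond_exp M G u \<omega> = step_value (cond_step M G xs) s \<omega> x \<bullet> y"
      using Cons.IH[OF pr(4)] unfolding u_def[abs_def] by blast+
    obtain K' where K': "\<And>\<omega>. \<bar>u \<omega>\<bar> \<le> K'" using IH(2) by blast
    have ci: "integrable M c" using cM K by (intro integrable_const_bound[where B = K]) auto
    have ui: "integrable M u" using IH(1) K' by (intro integrable_const_bound[where B = K']) auto
    have eq: "step_value (X # xs) s \<omega> x \<bullet> y = r * c \<omega> + u \<omega>" for \<omega>
      by (simp add: X r_def u_def blinfun.bilinear_simps inner_add_left)
    have "\<bar>r * c \<omega> + u \<omega>\<bar> \<le> \<bar>r\<bar> * K + K'" for \<omega>
    proof -
      have "\<bar>r * c \<omega>\<bar> \<le> \<bar>r\<bar> * K" using K[of \<omega>] by (simp add: abs_mult mult_left_mono)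
      then show ?thesis using K'[of \<omega>] by linarith
    qed
    then have b: "\<exists>K. \<forall>\<omega>. \<bar>r * c \<omega> + u \<omega>\<bar> \<le> K" by blast
    have rc: "integrable M (\<lambda>\<omega>. r * c \<omega>)" using ci by simp
    have "AE \<omega> in M. real_cond_exp M G (\<lambda>\<omega>. r * c \<omega> + u \<omega>) \<omega> = step_value (cond_step M G (X # xs)) s \<omega> x \<bullet> y"
      using G.real_cond_exp_add[OF rc ui] G.real_cond_exp_cmult[OF ci, of r] IH(3) G.clipped_cond_exp_props(3)[OF cM K]
      by eventually_elim (simp add: X cond_step_def r_def blinfun.bilinear_simps inner_add_left)
    then show ?case unfolding eq using cM IH(1) b by simp
  qed
  then show "(\<lambda>\<omega>. step_value xs s \<omega> x \<bullet> y) \<in> borel_measurable M" "\<exists>K. \<forall>\<omega>. \<bar>step_value xs s \<omega> x \<bullet> y\<bar> \<le> K"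
    "AE \<omega> in M. real_cond_exp M G (\<lambda>\<omega>. step_value xs s \<omega> x \<bullet> y) \<omega> = step_value (cond_step M G xs) s \<omega> x \<bullet> y"
    by blast+
qed

text \<open>Moves the expectation innermost, for fixed \<open>s\<close>, \<open>e\<close> and
  \<open>f\<close>; a contraction of scalar conditional expectations then yields one of
  \<open>ito_norm\<close>.\<close>

lemma ito_norm_coordinates:
  fixes \<Theta> :: "real \<Rightarrow> 'w \<Rightarrow> 'a \<Rightarrow>\<^sub>L 'b::{real_inner,banach,second_countable_topology}"
  assumes jm: "jointly_measurable M T \<Theta>"
  shows "ito_norm M Q T \<Theta> =
    (\<integral>\<^sup>+s. \<integral>\<^sup>+e. \<integral>\<^sup>+f. \<integral>\<^sup>+\<omega>. ennreal ((\<Theta> s \<omega> (sqrt_op Q e) \<bullet> f)\<^sup>2) \<partial>M \<partial>basis_space \<partial>basis_space \<partial>time_space T)"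
proof -
  have "ito_norm M Q T \<Theta> = (\<integral>\<^sup>+s. \<integral>\<^sup>+\<omega>. hs_norm_sq (\<Theta> s \<omega> o\<^sub>L sqrt_op Q) \<partial>M \<partial>time_space T)"
    unfolding ito_norm_def using measurable_ito_integrand[OF jm] by (subst nn_integral_fst[symmetric]) auto
  also have "\<dots> = (\<integral>\<^sup>+s. \<integral>\<^sup>+e. \<integral>\<^sup>+f. \<integral>\<^sup>+\<omega>. ennreal ((\<Theta> s \<omega> (sqrt_op Q e) \<bullet> f)\<^sup>2) \<partial>M \<partial>basis_space \<partial>basis_space \<partial>time_space T)"
  proof (rule nn_integral_cong)
    fix s assume s: "s \<in> space (time_space T)"
    have m: "(\<lambda>\<omega>. \<Theta> s \<omega> x) \<in> borel_measurable M" for x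
      using measurable_compose[OF measurable_Pair1'[OF s], of "\<lambda>(s, \<omega>). \<Theta> s \<omega> x" M borel] jm unfolding jointly_measurable_def by auto
    have "(\<integral>\<^sup>+\<omega>. hs_norm_sq (\<Theta> s \<omega> o\<^sub>L sqrt_op Q) \<partial>M) =
        (\<integral>\<^sup>+\<omega>. \<integral>\<^sup>+e. \<integral>\<^sup>+f. ennreal ((\<Theta> s \<omega> (sqrt_op Q e) \<bullet> f)\<^sup>2) \<partial>basis_space \<partial>basis_space \<partial>M)"
      by (simp add: hs_norm_sq_double)
    also have "\<dots> = (\<integral>\<^sup>+e. \<integral>\<^sup>+\<omega>. \<integral>\<^sup>+f. ennreal ((\<Theta> s \<omega> (sqrt_op Q e) \<bullet> f)\<^sup>2) \<partial>basis_space \<partial>M \<partial>basis_space)"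
      using m by (intro nn_integral_basis_swap borel_measurable_nn_integral_basis) auto
    also have "\<dots> = (\<integral>\<^sup>+e. \<integral>\<^sup>+f. \<integral>\<^sup>+\<omega>. ennreal ((\<Theta> s \<omega> (sqrt_op Q e) \<bullet> f)\<^sup>2) \<partial>M \<partial>basis_space \<partial>basis_space)"
      using m by (intro nn_integral_cong nn_integral_basis_swap) auto
    finally show "(\<integral>\<^sup>+\<omega>. hs_norm_sq (\<Theta> s \<omega> o\<^sub>L sqrt_op Q) \<partial>M) = \<dots>" .
  qed
  finally show ?thesis .
qed

text \<open>\<open>G\<close> lies in every \<open>H a\<close>, so the conditioned coefficients stay
  adapted on the same intervals. Coordinates of \<open>\<Psi>\<close> are
  \<open>G\<close>-measurable, so projecting onto \<open>G\<close> cannot increase the distance to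
  \<open>\<Psi>\<close>.\<close>

lemma cond_step_contraction:
  fixes xs :: "('w, 'a, 'b::{real_inner,banach,second_countable_topology}) atom list"
  assumes G: "subalgebra M G" "\<And>a::real. 0 \<le> a \<Longrightarrow> sets G \<subseteq> sets (H a)" and xs: "step_process H T xs"
    and \<Psi>: "jointly_measurable M T \<Psi>" "\<And>s x. s \<in> {0..T} \<Longrightarrow> (\<lambda>\<omega>. \<Psi> s \<omega> x) \<in> borel_measurable G"
  shows "step_process H T (cond_step M G xs)"
    "ito_norm M Q T (\<lambda>s \<omega>. step_value (cond_step M G xs) s \<omega> - \<Psi> s \<omega>) \<le> ito_norm M Q T (\<lambda>s \<omega>. step_value xs s \<omega> - \<Psi> s \<omega>)"
proof -
  interpret G: finite_measure_subalgebra M G using G(1) by unfold_locales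
  show ys: "step_process H T (cond_step M G xs)"
  proof (rule step_process_filtration[OF cond_step_process[OF G(1) xs]])
    fix a :: real and f :: "'w \<Rightarrow> real" assume "0 \<le> a" "f \<in> borel_measurable G"
    moreover have "subalgebra (H a) G"
      using G(1) G(2)[OF \<open>0 \<le> a\<close>] H_space[of a] by (simp add: subalgebra_def)
    ultimately show "f \<in> borel_measurable (H a)" by (auto intro: measurable_from_subalg)
  qed
  note jm = jointly_measurable_diff[OF jointly_measurable_step \<Psi>(1)]
  show "ito_norm M Q T (\<lambda>s \<omega>. step_value (cond_step M G xs) s \<omega> - \<Psi> s \<omega>) \<le> ito_norm M Q T (\<lambda>s \<omega>. step_value xs s \<omega> - \<Psi> s \<omega>)"
    unfolding ito_norm_coordinates[OF jm[OF ys]] ito_norm_coordinates[OF jm[OF xs]]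
  proof (rule nn_integral_mono, rule nn_integral_mono, rule nn_integral_mono)
    fix s e and f :: 'b assume s: "s \<in> space (time_space T)"
    let ?u = "\<lambda>\<omega>. step_value xs s \<omega> (sqrt_op Q e) \<bullet> f" and ?y = "\<lambda>\<omega>. \<Psi> s \<omega> (sqrt_op Q e) \<bullet> f"
    let ?v = "\<lambda>\<omega>. step_value (cond_step M G xs) s \<omega> (sqrt_op Q e) \<bullet> f"
    note u = cond_step_value[OF G(1) xs, of s "sqrt_op Q e" f]
    obtain K where K: "\<And>\<omega>. \<bar>?u \<omega>\<bar> \<le> K" using u(2) by blast
    have y: "?y \<in> borel_measurable G" using \<Psi>(2)[of s "sqrt_op Q e"] s by (simp add: space_time_space)
    have "(\<integral>\<^sup>+\<omega>. ennreal ((?v \<omega> - ?y \<omega>)\<^sup>2) \<partial>M) = (\<integral>\<^sup>+\<omega>. ennreal ((real_cond_exp M G ?u \<omega> - ?y \<omega>)\<^sup>2) \<partial>M)"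
      using u(3) by (intro nn_integral_cong_AE) (auto elim: eventually_mono)
    also have "\<dots> \<le> (\<integral>\<^sup>+\<omega>. ennreal ((?u \<omega> - ?y \<omega>)\<^sup>2) \<partial>M)"
      by (rule G.cond_exp_L2_contraction[OF u(1) K y])
    finally show "(\<integral>\<^sup>+\<omega>. ennreal (((step_value (cond_step M G xs) s \<omega> - \<Psi> s \<omega>) (sqrt_op Q e) \<bullet> f)\<^sup>2) \<partial>M) \<le>
        (\<integral>\<^sup>+\<omega>. ennreal (((step_value xs s \<omega> - \<Psi> s \<omega>) (sqrt_op Q e) \<bullet> f)\<^sup>2) \<partial>M)"
      by (simp add: blinfun.bilinear_simps inner_diff_left)
  qed
qed

end

section \<open>Conditional laws of stochastic integrals\<close>

lemma measurable_adj_op_apply: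
  fixes A :: "'w \<Rightarrow> 'a::{real_inner,banach,second_countable_topology} \<Rightarrow>\<^sub>L 'b::{real_inner,banach,second_countable_topology}"
  assumes "\<And>x. (\<lambda>w. A w x) \<in> borel_measurable N"
  shows "(\<lambda>w. adj_op (A w) h) \<in> borel_measurable N"
proof (rule measurable_basis_coordinates)
  show "(\<lambda>w. adj_op (A w) h \<bullet> e) \<in> borel_measurable N" for e
    unfolding inner_adj_op' by (rule borel_measurable_inner[OF borel_measurable_const assms])
qed

lemma measurable_blinfun_apply:
  fixes A :: "'a::real_normed_vector \<Rightarrow>\<^sub>L 'b::real_normed_vector"
  assumes "f \<in> borel_measurable N" shows "(\<lambda>w. A (f w)) \<in> borel_measurable N"
  by (rule measurable_compose[OF assms borel_measurable_continuous_onI]) (intro continuous_intros)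

lemma measurable_step_integral:
  fixes xs :: "('w, 'a::{real_normed_vector,second_countable_topology}, 'b::{real_normed_vector,second_countable_topology}) atom list"
  assumes xs: "step_process (\<lambda>_. G) T xs" and N: "\<And>r. 0 \<le> r \<Longrightarrow> (\<lambda>\<omega>. Z r \<omega> - Z 0 \<omega>) \<in> borel_measurable N"
  shows "(\<lambda>p. step_integral Z xs (fst p) (snd p)) \<in> borel_measurable (G \<Otimes>\<^sub>M N)"
  using xs
proof (induction xs)
  case (Cons X xs)
  obtain a b c \<phi> where X: "X = (a, b, c, \<phi>)" by (cases X)
  have ab: "0 \<le> a" "0 \<le> b" and c: "c \<in> borel_measurable G" using Cons.prems by (auto simp: X)
  \<comment> \<open>Only increments from time 0 are known to be measurable for \<open>N\<close>; the
    increment of the atom is a difference of two of them.\<close>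
  have "(\<lambda>\<omega>. (Z b \<omega> - Z 0 \<omega>) - (Z a \<omega> - Z 0 \<omega>)) \<in> borel_measurable N"
    by (rule borel_measurable_diff[OF N[OF ab(2)] N[OF ab(1)]])
  then have "(\<lambda>\<omega>. Z b \<omega> - Z a \<omega>) \<in> borel_measurable N" by simp
  from measurable_compose[OF measurable_snd measurable_blinfun_apply[OF this]]
  have "(\<lambda>p. \<phi> (Z b (snd p) - Z a (snd p))) \<in> borel_measurable (G \<Otimes>\<^sub>M N)" .
  moreover have "(\<lambda>p. c (fst p)) \<in> borel_measurable (G \<Otimes>\<^sub>M N)" by (rule measurable_compose[OF measurable_fst c])
  ultimately show ?case using Cons by (simp add: X)
qed simp

text \<open>Independence says that the diagonal map has the law of two independent points, one seen
  through \<open>G\<close> and the other through \<open>N\<close>.\<close>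

lemma (in prob_space) independent_pair_diagonal:
  assumes G: "subalgebra M G" and N: "subalgebra M N" and ind: "indep_set (sets N) (sets G)"
  shows "distr M (G \<Otimes>\<^sub>M N) (\<lambda>\<omega>. (\<omega>, \<omega>)) = distr M G (\<lambda>\<omega>. \<omega>) \<Otimes>\<^sub>M distr M N (\<lambda>\<omega>. \<omega>)"
proof (rule indep_pair_distr[OF G])
  show "(\<lambda>\<omega>. \<omega>) \<in> M \<rightarrow>\<^sub>M N" by (rule measurable_from_subalg[OF N]) simp
  have "sets (vimage_algebra (space M) (\<lambda>\<omega>. \<omega>) N) = (\<lambda>A. A \<inter> space M) ` sets N"
    using N by (subst sets_vimage_algebra2) (auto simp: subalgebra_def)
  also have "\<dots> = (\<lambda>A. A) ` sets N"
    using N sets.sets_into_space[of _ N] by (intro image_cong) (auto simp: subalgebra_def)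
  finally show "indep_set (sets (vimage_algebra (space M) (\<lambda>\<omega>. \<omega>) N)) (sets G)" using ind by simp
qed

text \<open>On the diagonal \<open>R\<close> is \<open>J\<close>, and the diagonal carries the
  product law. By Fubini, averages of the laws of the sections of \<open>J\<close> over sets of
  \<open>G\<close> satisfy the characterisation of the conditional probability of
  \<open>R\<close>.\<close>

lemma (in prob_space) diagonal_kernel:
  fixes J :: "'a \<times> 'a \<Rightarrow> 'b::{banach,second_countable_topology}"
  assumes G: "subalgebra M G" and N: "subalgebra M N" and ind: "indep_set (sets N) (sets G)"
    and J: "J \<in> borel_measurable (G \<Otimes>\<^sub>M N)" and R: "R \<in> borel_measurable M" "AE \<omega> in M. J (\<omega>, \<omega>) = R \<omega>"
  shows "regular_cond_distr M G R (\<lambda>\<omega>. distr (distr M N (\<lambda>\<omega>. \<omega>)) borel (\<lambda>\<omega>'. J (\<omega>, \<omega>')))"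
proof -
  interpret G: finite_measure_subalgebra M G using G by unfold_locales
  define PG where "PG = distr M G (\<lambda>\<omega>. \<omega>)"
  define PN where "PN = distr M N (\<lambda>\<omega>. \<omega>)"
  define \<kappa> where "\<kappa> \<omega> = distr PN borel (\<lambda>\<omega>'. J (\<omega>, \<omega>'))" for \<omega>
  have idG: "(\<lambda>\<omega>. \<omega>) \<in> M \<rightarrow>\<^sub>M G" and idN: "(\<lambda>\<omega>. \<omega>) \<in> M \<rightarrow>\<^sub>M N"
    by (rule measurable_from_subalg[OF G], simp) (rule measurable_from_subalg[OF N], simp)
  interpret PG: prob_space PG unfolding PG_def by (rule prob_space_distr[OF idG])
  interpret PN: prob_space PN unfolding PN_def by (rule prob_space_distr[OF idN])
  interpret P: pair_prob_space PG PN ..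
  have diag: "distr M (G \<Otimes>\<^sub>M N) (\<lambda>\<omega>. (\<omega>, \<omega>)) = PG \<Otimes>\<^sub>M PN"
    unfolding PG_def PN_def by (rule independent_pair_diagonal[OF G N ind])
  have dm: "(\<lambda>\<omega>. (\<omega>, \<omega>)) \<in> M \<rightarrow>\<^sub>M G \<Otimes>\<^sub>M N" using idG idN by (rule measurable_Pair)
  have Js: "(\<lambda>\<omega>'. J (\<omega>, \<omega>')) \<in> borel_measurable N" if "\<omega> \<in> space G" for \<omega>
    by (rule measurable_compose[OF measurable_Pair1'[OF that] J])
  have \<kappa>: "\<kappa> \<in> G \<rightarrow>\<^sub>M prob_algebra borel"
    unfolding \<kappa>_def[abs_def]
  proof (rule measurable_distr_prob_space2)
    show "(\<lambda>_. PN) \<in> G \<rightarrow>\<^sub>M prob_algebra N"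
      using PN.prob_space_axioms by (intro measurable_const) (simp add: space_prob_algebra PN_def)
    show "(\<lambda>(\<omega>, \<omega>'). J (\<omega>, \<omega>')) \<in> borel_measurable (G \<Otimes>\<^sub>M N)" using J by simp
  qed
  have "AE \<omega> in M. real_cond_exp M G (\<lambda>\<omega>. indicator C (R \<omega>)) \<omega> = measure (\<kappa> \<omega>) C" if C: "C \<in> sets borel" for C
  proof (rule G.real_cond_exp_charact)
    show mG: "(\<lambda>\<omega>. measure (\<kappa> \<omega>) C) \<in> borel_measurable G"
      by (rule measurable_compose[OF measurable_prob_algebraD[OF \<kappa>] measurable_measure_subprob_algebra[OF C]])
    have p: "prob_space (\<kappa> \<omega>)" if "\<omega> \<in> space M" for \<omega>
      using measurable_space[OF \<kappa>, of \<omega>] that G by (simp add: subalgebra_def space_prob_algebra)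
    show "integrable M (\<lambda>\<omega>. measure (\<kappa> \<omega>) C)"
      using measurable_from_subalg[OF G mG] by (intro integrable_const_bound[where B = 1] AE_I2) (auto intro: prob_space.prob_le_1[OF p])
    show "integrable M (\<lambda>\<omega>. indicator C (R \<omega>) :: real)"
      using R(1) C by (intro integrable_const_bound[where B = 1] AE_I2) (auto simp: indicator_def)
    fix A assume A: "A \<in> sets G"
    let ?f = "\<lambda>p. indicator A (fst p) * indicator C (J p) :: real"
    have fm: "?f \<in> borel_measurable (G \<Otimes>\<^sub>M N)" using A C J by simp
    have "(\<integral>\<omega>\<in>A. indicator C (R \<omega>) \<partial>M) = (\<integral>\<omega>. ?f (\<omega>, \<omega>) \<partial>M)"
      unfolding set_lebesgue_integral_def
    proof (rule integral_cong_AE)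
      show "(\<lambda>\<omega>. indicator A \<omega> *\<^sub>R indicator C (R \<omega>) :: real) \<in> borel_measurable M"
        using R(1) C A G by (auto simp: subalgebra_def)
      show "(\<lambda>\<omega>. ?f (\<omega>, \<omega>)) \<in> borel_measurable M" by (rule measurable_compose[OF dm fm])
      show "AE \<omega> in M. indicator A \<omega> *\<^sub>R indicator C (R \<omega>) = ?f (\<omega>, \<omega>)"
        using R(2) by eventually_elim simp
    qed
    also have "\<dots> = (\<integral>p. ?f p \<partial>(PG \<Otimes>\<^sub>M PN))" unfolding diag[symmetric] by (rule integral_distr[OF dm fm, symmetric])
    also have "\<dots> = (\<integral>\<omega>. \<integral>\<omega>'. ?f (\<omega>, \<omega>') \<partial>PN \<partial>PG)"
    proof (rule P.integral_fst'[symmetric], rule P.P.integrable_const_bound[where B = 1])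
      have "sets (PG \<Otimes>\<^sub>M PN) = sets (G \<Otimes>\<^sub>M N)" by (simp add: PG_def PN_def cong: sets_pair_measure_cong)
      then show "?f \<in> borel_measurable (PG \<Otimes>\<^sub>M PN)" using fm by (simp cong: measurable_cong_sets)
    qed (auto simp: indicator_def)
    also have "\<dots> = (\<integral>\<omega>. indicator A \<omega> * measure (\<kappa> \<omega>) C \<partial>PG)"
    proof (rule Bochner_Integration.integral_cong[OF refl])
      fix \<omega> assume "\<omega> \<in> space PG"
      then have m: "(\<lambda>\<omega>'. J (\<omega>, \<omega>')) \<in> borel_measurable PN" using Js by (simp add: PG_def PN_def)
      have "(\<integral>\<omega>'. indicator C (J (\<omega>, \<omega>')) \<partial>PN) = (\<integral>x. indicator C x \<partial>\<kappa> \<omega> :: real)"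
        unfolding \<kappa>_def using C by (subst integral_distr[OF m]) auto
      also have "\<dots> = measure (\<kappa> \<omega>) C" using C by (simp add: \<kappa>_def)
      finally show "(\<integral>\<omega>'. ?f (\<omega>, \<omega>') \<partial>PN) = indicator A \<omega> * measure (\<kappa> \<omega>) C" by simp
    qed
    also have "\<dots> = (\<integral>\<omega>. indicator A \<omega> * measure (\<kappa> \<omega>) C \<partial>M)"
      unfolding PG_def using A mG by (subst integral_distr[OF idG]) auto
    also have "\<dots> = (\<integral>\<omega>\<in>A. measure (\<kappa> \<omega>) C \<partial>M)" by (simp add: set_lebesgue_integral_def)
    finally show "(\<integral>\<omega>\<in>A. indicator C (R \<omega>) \<partial>M) = (\<integral>\<omega>\<in>A. measure (\<kappa> \<omega>) C \<partial>M)" .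
  qed
  then show ?thesis using G R(1) \<kappa> unfolding regular_cond_distr_def \<kappa>_def[abs_def] PN_def by blast
qed

context gaussian_noise begin

text \<open>One limit \<open>Jl\<close> on the product space defines the kernel for all test vectors
  \<open>h\<close> together; normality is then checked section by section. The finiteness statement
  is recorded because it makes the integrated covariance converge.\<close>

theorem conditional_law:
  fixes \<Psi> :: "real \<Rightarrow> 'w \<Rightarrow> 'a \<Rightarrow>\<^sub>L 'b::{real_inner,banach,second_countable_topology}"
  assumes G: "subalgebra M G" "\<And>a::real. 0 \<le> a \<Longrightarrow> sets G \<subseteq> sets (H a)"
    and N: "subalgebra M N" "\<And>r. 0 \<le> r \<Longrightarrow> (\<lambda>\<omega>. Z r \<omega> - Z 0 \<omega>) \<in> borel_measurable N" "indep_set (sets N) (sets G)"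
    and \<Psi>: "jointly_measurable M T \<Psi>" "\<And>s x. s \<in> {0..T} \<Longrightarrow> (\<lambda>\<omega>. \<Psi> s \<omega> x) \<in> borel_measurable G"
    and zs: "\<And>k. step_process H T (zs k)" "(\<lambda>k. ito_norm M Q T (\<lambda>s \<omega>. step_value (zs k) s \<omega> - \<Psi> s \<omega>)) \<longlonglongrightarrow> 0"
    and R: "R \<in> borel_measurable M" "(\<lambda>k. \<integral>\<^sup>+\<omega>. ennreal ((norm (step_integral Z (zs k) \<omega> \<omega> - R \<omega>))\<^sup>2) \<partial>M) \<longlonglongrightarrow> 0"
  shows "\<exists>\<kappa>. regular_cond_distr M G R \<kappa> \<and>
    (AE \<omega> in M. (\<integral>\<^sup>+s. hs_norm_sq (\<Psi> s \<omega> o\<^sub>L sqrt_op Q) \<partial>time_space T) < \<top> \<and>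
      (\<forall>h. distr (\<kappa> \<omega>) borel (\<lambda>x. x \<bullet> h) = centred_normal (\<integral>s. (norm (sqrt_op Q (adj_op (\<Psi> s \<omega>) h)))\<^sup>2 \<partial>time_space T)))"
proof -
  interpret P: pair_sigma_finite "time_space T" M by (rule prob_pair)
  define xs where "xs k = cond_step M G (zs k)" for k
  have xsG: "step_process (\<lambda>_. G) T (xs k)" for k unfolding xs_def by (rule cond_step_process[OF G(1) zs(1)])
  have xsH: "step_process H T (xs k)" for k unfolding xs_def by (rule cond_step_contraction(1)[OF G zs(1) \<Psi>])
  have xlim: "(\<lambda>k. ito_norm M Q T (\<lambda>s \<omega>. step_value (xs k) s \<omega> - \<Psi> s \<omega>)) \<longlonglongrightarrow> 0"
  proof (rule tendsto_sandwich[OF _ _ tendsto_const zs(2)])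
    show "\<forall>\<^sub>F k in sequentially. ito_norm M Q T (\<lambda>s \<omega>. step_value (xs k) s \<omega> - \<Psi> s \<omega>) \<le> ito_norm M Q T (\<lambda>s \<omega>. step_value (zs k) s \<omega> - \<Psi> s \<omega>)"
      unfolding xs_def by (intro always_eventually allI cond_step_contraction(2)[OF G zs(1) \<Psi>])
  qed simp
  have Rlim: "(\<lambda>k. \<integral>\<^sup>+\<omega>. ennreal ((norm (step_integral Z (xs k) \<omega> \<omega> - R \<omega>))\<^sup>2) \<partial>M) \<longlonglongrightarrow> 0"
    by (rule ito_limit_unique[OF \<Psi>(1) R(1) zs R(2) xsH xlim])
  obtain r1 :: "nat \<Rightarrow> nat" where r1: "strict_mono r1"
    "AE \<omega> in M. (\<lambda>k. step_integral Z (xs (r1 k)) \<omega> \<omega>) \<longlonglongrightarrow> R \<omega>"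
    using L2_subseq_AE[OF step_integral_measurable[OF xsH] R(1) Rlim] by blast
  define d where "d k \<omega> = (\<integral>\<^sup>+s. hs_norm_sq ((step_value (xs k) s \<omega> - \<Psi> s \<omega>) o\<^sub>L sqrt_op Q) \<partial>time_space T)" for k \<omega>
  have jm: "jointly_measurable M T (\<lambda>s \<omega>. step_value (xs k) s \<omega> - \<Psi> s \<omega>)" for k
    by (rule jointly_measurable_diff[OF jointly_measurable_step[OF xsH] \<Psi>(1)])
  have dm: "d k \<in> borel_measurable M" for k
    using P.M1.borel_measurable_nn_integral_fst[OF measurable_pair_swap[OF measurable_ito_integrand[OF jm[of k]]]]
    unfolding d_def[abs_def] by simp
  have "(\<integral>\<^sup>+\<omega>. d k \<omega> \<partial>M) = ito_norm M Q T (\<lambda>s \<omega>. step_value (xs k) s \<omega> - \<Psi> s \<omega>)" for k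
    unfolding d_def ito_norm_def using P.nn_integral_snd[OF measurable_ito_integrand[OF jm[of k]]] by simp
  then have "(\<lambda>k. \<integral>\<^sup>+\<omega>. d (r1 k) \<omega> \<partial>M) \<longlonglongrightarrow> 0"
    using LIMSEQ_subseq_LIMSEQ[OF xlim r1(1)] by (simp add: o_def)
  then obtain r2 :: "nat \<Rightarrow> nat" where r2: "strict_mono r2" "AE \<omega> in M. (\<lambda>k. d (r1 (r2 k)) \<omega>) \<longlonglongrightarrow> 0"
    using nn_integral_subseq_AE[of "\<lambda>k. d (r1 k)", OF dm] by blast
  define r where "r k = r1 (r2 k)" for k
  define J where "J k p = step_integral Z (xs (r k)) (fst p) (snd p)" for k and p :: "'w \<times> 'w"
  define Jl where "Jl p = lim (\<lambda>k. J k p)" for p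
  have Jm: "J k \<in> borel_measurable (G \<Otimes>\<^sub>M N)" for k
    unfolding J_def[abs_def] by (rule measurable_step_integral[where Z = Z, OF xsG]) (rule N(2))
  have Jlm: "Jl \<in> borel_measurable (G \<Otimes>\<^sub>M N)" unfolding Jl_def[abs_def] using Jm by (rule borel_measurable_lim_metric)
  have conv: "AE \<omega> in M. (\<lambda>k. J k (\<omega>, \<omega>)) \<longlonglongrightarrow> R \<omega>"
    using r1(2)
  proof eventually_elim
    case (elim \<omega>)
    from LIMSEQ_subseq_LIMSEQ[OF this r2(1)] show ?case by (simp add: J_def r_def o_def)
  qed
  then have JR: "AE \<omega> in M. Jl (\<omega>, \<omega>) = R \<omega>" by eventually_elim (simp add: Jl_def limI)
  define \<kappa> where "\<kappa> \<omega> = distr (distr M N (\<lambda>\<omega>. \<omega>)) borel (\<lambda>\<omega>'. Jl (\<omega>, \<omega>'))" for \<omega>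
  have reg: "regular_cond_distr M G R \<kappa>"
    unfolding \<kappa>_def[abs_def] by (rule diagonal_kernel[OF G(1) N(1,3) Jlm R(1) JR])
  have idG: "(\<lambda>\<omega>. \<omega>) \<in> M \<rightarrow>\<^sub>M G" and idN: "(\<lambda>\<omega>. \<omega>) \<in> M \<rightarrow>\<^sub>M N"
    by (rule measurable_from_subalg[OF G(1)], simp) (rule measurable_from_subalg[OF N(1)], simp)
  \<comment> \<open>Convergence is known on the diagonal only, where the limit is \<open>R\<close>.
    The Cauchy property mentions no limit, so it passes to the product law and from there to almost
    all sections.\<close>
  have cauchy: "AE \<omega> in M. AE \<omega>' in M. Cauchy (\<lambda>k. J k (\<omega>, \<omega>'))"
  proof -
    define PG where "PG = distr M G (\<lambda>\<omega>. \<omega>)"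
    define PN where "PN = distr M N (\<lambda>\<omega>. \<omega>)"
    interpret PG: prob_space PG unfolding PG_def by (rule prob_space_distr[OF idG])
    interpret PN: prob_space PN unfolding PN_def by (rule prob_space_distr[OF idN])
    interpret PP: pair_prob_space PG PN ..
    have "AE \<omega> in M. Cauchy (\<lambda>k. J k (\<omega>, \<omega>))" using conv by eventually_elim (rule LIMSEQ_imp_Cauchy)
    then have "AE p in distr M (G \<Otimes>\<^sub>M N) (\<lambda>\<omega>. (\<omega>, \<omega>)). Cauchy (\<lambda>k. J k p)"
      using Jm idG idN by (subst AE_distr_iff) (auto intro!: measurable_Pair)
    then have "AE p in PG \<Otimes>\<^sub>M PN. Cauchy (\<lambda>k. J k p)"
      unfolding independent_pair_diagonal[OF G(1) N(1,3)] PG_def PN_def .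
    then have "AE \<omega> in PG. AE \<omega>' in PN. Cauchy (\<lambda>k. J k (\<omega>, \<omega>'))" by (rule PP.AE_pair)
    then have "AE \<omega> in M. AE \<omega>' in PN. Cauchy (\<lambda>k. J k (\<omega>, \<omega>'))" unfolding PG_def by (rule AE_distrD[OF idG])
    then show ?thesis by eventually_elim (unfold PN_def, erule AE_distrD[OF idN])
  qed
  have law: "(\<integral>\<^sup>+s. hs_norm_sq (\<Psi> s \<omega> o\<^sub>L sqrt_op Q) \<partial>time_space T) < \<top> \<and>
      (\<forall>h. distr (\<kappa> \<omega>) borel (\<lambda>x. x \<bullet> h) = centred_normal (\<integral>s. (norm (sqrt_op Q (adj_op (\<Psi> s \<omega>) h)))\<^sup>2 \<partial>time_space T))"
    if \<omega>: "\<omega> \<in> space M" and c: "AE \<omega>' in M. Cauchy (\<lambda>k. J k (\<omega>, \<omega>'))" and d0: "(\<lambda>k. d (r1 (r2 k)) \<omega>) \<longlonglongrightarrow> 0" for \<omega>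
  proof (intro conjI allI)
    have slice: "(\<lambda>s. \<Theta> s \<omega> x) \<in> borel_measurable (time_space T)"
      if "jointly_measurable M T \<Theta>" for \<Theta> :: "real \<Rightarrow> 'w \<Rightarrow> 'a \<Rightarrow>\<^sub>L 'b" and x
      using measurable_compose[OF measurable_Pair2'[OF \<omega>], of "\<lambda>(s, \<omega>). \<Theta> s \<omega> x" "time_space T" borel] that unfolding jointly_measurable_def by auto
    note \<Psi>s = slice[OF \<Psi>(1)] and vs = slice[OF jointly_measurable_step[OF xsH]]
    let ?v = "\<lambda>k s. step_value (xs (r k)) s \<omega>"
    have hm: "(\<lambda>s. hs_norm_sq ((?v k s - \<Psi> s \<omega>) o\<^sub>L sqrt_op Q)) \<in> borel_measurable (time_space T)" for k
      using vs \<Psi>s by (intro measurable_hs_norm_sq_compose) (auto simp: blinfun.bilinear_simps)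
    show "(\<integral>\<^sup>+s. hs_norm_sq (\<Psi> s \<omega> o\<^sub>L sqrt_op Q) \<partial>time_space T) < \<top>"
    proof -
      interpret TS: finite_measure "time_space T" by (rule finite_measure_time_space)
      have "\<forall>\<^sub>F k in sequentially. d (r1 (r2 k)) \<omega> < 1" using order_tendstoD(2)[OF d0, of 1] by simp
      then obtain k where k: "d (r k) \<omega> < 1" unfolding r_def by (auto dest: eventually_happens)
      \<comment> \<open>A bound for the step process at this \<open>\<omega>\<close>, uniform in
        time; a single index \<open>k\<close> with finite distance to the integrand gives
        finiteness.\<close>
      define K where "K = (\<Sum>(a, b, c, \<phi>)\<leftarrow>xs (r k). \<bar>c \<omega>\<bar> * norm \<phi>)"
      have le: "hs_norm_sq (\<Psi> s \<omega> o\<^sub>L sqrt_op Q) \<le>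
          2 * hs_norm_sq ((?v k s - \<Psi> s \<omega>) o\<^sub>L sqrt_op Q) + 2 * (ennreal (K\<^sup>2) * hs_norm_sq (sqrt_op Q))" for s
      proof -
        have "\<Psi> s \<omega> o\<^sub>L sqrt_op Q = (- ((?v k s - \<Psi> s \<omega>) o\<^sub>L sqrt_op Q)) + (?v k s o\<^sub>L sqrt_op Q)"
          by (rule blinfun_eqI) (simp add: blinfun.bilinear_simps)
        then have "hs_norm_sq (\<Psi> s \<omega> o\<^sub>L sqrt_op Q) \<le>
            2 * hs_norm_sq (- ((?v k s - \<Psi> s \<omega>) o\<^sub>L sqrt_op Q)) + 2 * hs_norm_sq (?v k s o\<^sub>L sqrt_op Q)"
          using hs_norm_sq_add_le by metis
        moreover have "hs_norm_sq (?v k s o\<^sub>L sqrt_op Q) \<le> ennreal (K\<^sup>2) * hs_norm_sq (sqrt_op Q)"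
          by (rule order_trans[OF hs_norm_sq_compose_left])
            (auto intro!: mult_right_mono ennreal_leI power_mono step_value_norm_bound simp: K_def)
        ultimately show ?thesis
          unfolding hs_norm_sq_uminus by (meson add_left_mono mult_left_mono order_trans zero_le)
      qed
      have "(\<integral>\<^sup>+s. hs_norm_sq (\<Psi> s \<omega> o\<^sub>L sqrt_op Q) \<partial>time_space T) \<le>
          (\<integral>\<^sup>+s. 2 * hs_norm_sq ((?v k s - \<Psi> s \<omega>) o\<^sub>L sqrt_op Q) + 2 * (ennreal (K\<^sup>2) * hs_norm_sq (sqrt_op Q)) \<partial>time_space T)"
        by (rule nn_integral_mono) (rule le)
      also have "\<dots> = 2 * d (r k) \<omega> + 2 * (ennreal (K\<^sup>2) * hs_norm_sq (sqrt_op Q)) * emeasure (time_space T) (space (time_space T))"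
        unfolding d_def using hm[of k] by (simp add: nn_integral_add nn_integral_cmult)
      also have "\<dots> < \<top>"
        using k hs_norm_sq_sqrt_finite[OF Q_trace] TS.emeasure_finite[of "space (time_space T)"]
        by (auto simp: ennreal_mult_less_top less_top[symmetric] ennreal_add_eq_top ennreal_mult_eq_top_iff)
      finally show ?thesis .
    qed
    fix h
    define \<alpha> where "\<alpha> k s = sqrt_op Q (adj_op (?v k s) h)" for k s
    define \<beta> where "\<beta> s = sqrt_op Q (adj_op (\<Psi> s \<omega>) h)" for s
    have m: "\<alpha> k \<in> borel_measurable (time_space T)" "\<beta> \<in> borel_measurable (time_space T)" for k
      unfolding \<alpha>_def[abs_def] \<beta>_def[abs_def]
      by (intro measurable_blinfun_apply measurable_adj_op_apply vs \<Psi>s)+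
    have sq: "Q x \<bullet> x = (norm (sqrt_op Q x))\<^sup>2" for x
      using trace_class_inner[OF Q_trace, of x x] by (simp add: dot_square_norm)
    note fr1 = frozen_step_normal(1)[OF xsH, where \<omega> = \<omega> and h = h, unfolded sq]
      and fr3 = frozen_step_normal(3)[OF xsH, where \<omega> = \<omega>]
      and fr4 = frozen_step_normal(4)[OF xsH, where \<omega> = \<omega> and h = h, unfolded sq]
    have ai: "integrable (time_space T) (\<lambda>s. (norm (\<alpha> k s))\<^sup>2)" for k unfolding \<alpha>_def by (rule fr1)
    have al: "(\<lambda>k. \<integral>\<^sup>+s. ennreal ((norm (\<alpha> k s - \<beta> s))\<^sup>2) \<partial>time_space T) \<longlonglongrightarrow> 0"
    proof (rule tendsto_sandwich[OF _ _ tendsto_const])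
      have "(\<lambda>k. ennreal ((norm h)\<^sup>2) * d (r1 (r2 k)) \<omega>) \<longlonglongrightarrow> ennreal ((norm h)\<^sup>2) * 0"
        by (rule ennreal_tendsto_cmult[OF _ d0]) simp
      then show "(\<lambda>k. ennreal ((norm h)\<^sup>2) * d (r k) \<omega>) \<longlonglongrightarrow> 0" by (simp add: r_def)
      have "(\<integral>\<^sup>+s. ennreal ((norm (\<alpha> k s - \<beta> s))\<^sup>2) \<partial>time_space T) \<le> ennreal ((norm h)\<^sup>2) * d (r k) \<omega>" for k
      proof -
        have "ennreal ((norm (\<alpha> k s - \<beta> s))\<^sup>2) \<le> ennreal ((norm h)\<^sup>2) * hs_norm_sq ((?v k s - \<Psi> s \<omega>) o\<^sub>L sqrt_op Q)" for s
        proof -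
          have "\<alpha> k s - \<beta> s = adj_op ((?v k s - \<Psi> s \<omega>) o\<^sub>L sqrt_op Q) h"
            by (simp add: \<alpha>_def \<beta>_def adj_op_compose adj_op_sqrt_trace_class[OF Q_trace] adj_op_diff blinfun.bilinear_simps)
          then show ?thesis using norm_adj_op_apply_le_hs by metis
        qed
        then have "(\<integral>\<^sup>+s. ennreal ((norm (\<alpha> k s - \<beta> s))\<^sup>2) \<partial>time_space T) \<le>
            (\<integral>\<^sup>+s. ennreal ((norm h)\<^sup>2) * hs_norm_sq ((?v k s - \<Psi> s \<omega>) o\<^sub>L sqrt_op Q) \<partial>time_space T)"
          by (intro nn_integral_mono)
        also have "\<dots> = ennreal ((norm h)\<^sup>2) * d (r k) \<omega>" unfolding d_def using hm by (rule nn_integral_cmult)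
        finally show ?thesis .
      qed
      then show "\<forall>\<^sub>F k in sequentially. (\<integral>\<^sup>+s. ennreal ((norm (\<alpha> k s - \<beta> s))\<^sup>2) \<partial>time_space T) \<le> ennreal ((norm h)\<^sup>2) * d (r k) \<omega>"
        by (intro always_eventually allI)
    qed simp
    note L2 = L2_norms_converge[OF m ai al]
    have \<omega>G: "\<omega> \<in> space G" using \<omega> G(1) by (simp add: subalgebra_def)
    have JN: "(\<lambda>\<omega>'. Jl (\<omega>, \<omega>')) \<in> borel_measurable N" by (rule measurable_compose[OF measurable_Pair1'[OF \<omega>G] Jlm])
    have JM: "(\<lambda>\<omega>'. Jl (\<omega>, \<omega>')) \<in> borel_measurable M" by (rule measurable_from_subalg[OF N(1) JN])
    have JNP: "(\<lambda>\<omega>'. Jl (\<omega>, \<omega>')) \<in> borel_measurable (distr M N (\<lambda>\<omega>. \<omega>))" using JN by simp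
    have "distr (\<kappa> \<omega>) borel (\<lambda>x. x \<bullet> h) = distr M borel (\<lambda>\<omega>'. Jl (\<omega>, \<omega>') \<bullet> h)"
      unfolding \<kappa>_def using JN idN by (simp add: distr_distr o_def)
    also have "\<dots> = centred_normal (\<integral>s. (norm (\<beta> s))\<^sup>2 \<partial>time_space T)"
    proof (rule centred_normal_limit)
      show "(\<lambda>\<omega>'. J k (\<omega>, \<omega>') \<bullet> h) \<in> borel_measurable M" for k
        using fr3[of "r k"] by (simp add: J_def)
      show "(\<lambda>\<omega>'. Jl (\<omega>, \<omega>') \<bullet> h) \<in> borel_measurable M" using JM by simp
      show "AE \<omega>' in M. (\<lambda>k. J k (\<omega>, \<omega>') \<bullet> h) \<longlonglongrightarrow> Jl (\<omega>, \<omega>') \<bullet> h"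
        using c
      proof eventually_elim
        case (elim \<omega>')
        then have "(\<lambda>k. J k (\<omega>, \<omega>')) \<longlonglongrightarrow> Jl (\<omega>, \<omega>')"
          unfolding Jl_def by (simp add: Cauchy_convergent_iff convergent_LIMSEQ_iff)
        then show ?case by (intro tendsto_intros)
      qed
      show "0 \<le> (\<integral>s. (norm (\<alpha> k s))\<^sup>2 \<partial>time_space T)" for k by simp
      show "(\<lambda>k. \<integral>s. (norm (\<alpha> k s))\<^sup>2 \<partial>time_space T) \<longlonglongrightarrow> (\<integral>s. (norm (\<beta> s))\<^sup>2 \<partial>time_space T)" by (rule L2(2))
      show "distr M borel (\<lambda>\<omega>'. J k (\<omega>, \<omega>') \<bullet> h) = centred_normal (\<integral>s. (norm (\<alpha> k s))\<^sup>2 \<partial>time_space T)" for k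
        using fr4[of "r k"] by (simp add: J_def \<alpha>_def)
    qed
    finally show "distr (\<kappa> \<omega>) borel (\<lambda>x. x \<bullet> h) = centred_normal (\<integral>s. (norm (sqrt_op Q (adj_op (\<Psi> s \<omega>) h)))\<^sup>2 \<partial>time_space T)"
      unfolding \<beta>_def .
  qed
  have "AE \<omega> in M. (\<integral>\<^sup>+s. hs_norm_sq (\<Psi> s \<omega> o\<^sub>L sqrt_op Q) \<partial>time_space T) < \<top> \<and>
      (\<forall>h. distr (\<kappa> \<omega>) borel (\<lambda>x. x \<bullet> h) = centred_normal (\<integral>s. (norm (sqrt_op Q (adj_op (\<Psi> s \<omega>) h)))\<^sup>2 \<partial>time_space T))"
    using cauchy r2(2) AE_space by eventually_elim (rule law)
  with reg show ?thesis by blast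
qed

end

text \<open>The law in every direction gives Gaussianity and the second moments; mixed moments
  follow by polarisation, where self-adjointness of \<open>\<Gamma>\<close> is used.\<close>

lemma gaussian_from_marginals:
  fixes \<kappa> :: "'b::{real_inner,second_countable_topology} measure"
  assumes \<kappa>: "prob_space \<kappa>" "sets \<kappa> = sets borel" and \<Gamma>: "self_adjoint \<Gamma>" "nonneg_definite \<Gamma>"
    and law: "\<And>h. distr \<kappa> borel (\<lambda>x. x \<bullet> h) = centred_normal (\<Gamma> h \<bullet> h)"
  shows "gaussian_measure \<kappa>" "has_mean \<kappa> 0" "has_covariance \<kappa> \<Gamma>"
proof -
  have v: "0 \<le> \<Gamma> h \<bullet> h" for h using \<Gamma>(2) by (simp add: nonneg_definite_def)
  have m: "(\<lambda>x. x \<bullet> h) \<in> borel_measurable \<kappa>" for h using \<kappa>(2) by (simp cong: measurable_cong_sets)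
  show "gaussian_measure \<kappa>"
    unfolding gaussian_measure_def law using \<kappa> gaussian_centred_normal[OF v] by blast
  note mo = centred_normal_moments[OF v, unfolded law[symmetric]]
  have i: "integrable \<kappa> (\<lambda>x. x \<bullet> h)" "(\<integral>x. x \<bullet> h \<partial>\<kappa>) = 0"
    "integrable \<kappa> (\<lambda>x. (x \<bullet> h)\<^sup>2)" "(\<integral>x. (x \<bullet> h)\<^sup>2 \<partial>\<kappa>) = \<Gamma> h \<bullet> h" for h
    using mo[of h] m[of h] by (auto simp: integrable_distr_eq integral_distr)
  show mean: "has_mean \<kappa> 0" unfolding has_mean_def using i by simp
  have pol: "(x \<bullet> h) * (x \<bullet> k) = ((x \<bullet> (h + k))\<^sup>2 - (x \<bullet> (h - k))\<^sup>2) / 4" for x h k :: 'b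
    by (simp add: inner_add_right inner_diff_right power2_eq_square algebra_simps)
  have "\<Gamma> k \<bullet> h = \<Gamma> h \<bullet> k" for h k using \<Gamma>(1) by (simp add: self_adjoint_def inner_commute)
  then have "(\<Gamma> (h + k) \<bullet> (h + k) - \<Gamma> (h - k) \<bullet> (h - k)) / 4 = \<Gamma> h \<bullet> k" for h k
    by (simp add: blinfun.bilinear_simps inner_add_left inner_add_right inner_diff_left inner_diff_right)
  then show "has_covariance \<kappa> \<Gamma>"
    unfolding has_covariance_def using mean i(3,4) by (intro exI[of _ 0]) (simp add: pol)
qed

section \<open>Null closures and the enlarged filtration\<close>

text \<open>The paths of \<open>Y\<close> are measurable with respect to those of \<open>L\<close> only up to null sets, and the
  filtration is not assumed to be complete.\<close>

definition null_closure :: "'w measure \<Rightarrow> 'w measure \<Rightarrow> 'w measure" where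
  "null_closure M S = sigma (space M) {A \<in> sets M. \<exists>A'\<in>sets S. AE \<omega> in M. \<omega> \<in> A \<longleftrightarrow> \<omega> \<in> A'}"

text \<open>The listed sets are already closed under complements and countable unions, so generating
  adds nothing.\<close>

lemma sets_null_closure:
  assumes S: "subalgebra M S"
  shows "sets (null_closure M S) = {A \<in> sets M. \<exists>A'\<in>sets S. AE \<omega> in M. \<omega> \<in> A \<longleftrightarrow> \<omega> \<in> A'}" (is "_ = ?\<Sigma>")
proof -
  have "sigma_algebra (space M) ?\<Sigma>"
    unfolding sigma_algebra_iff2
  proof (intro conjI ballI allI impI)
    show "?\<Sigma> \<subseteq> Pow (space M)" using sets.sets_into_space by auto
    show "{} \<in> ?\<Sigma>" by (auto intro!: bexI[of _ "{}"])
    fix A assume "A \<in> ?\<Sigma>"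
    then obtain A' where A: "A \<in> sets M" "A' \<in> sets S" "AE \<omega> in M. \<omega> \<in> A \<longleftrightarrow> \<omega> \<in> A'" by auto
    have "AE \<omega> in M. \<omega> \<in> space M - A \<longleftrightarrow> \<omega> \<in> space S - A'"
      using A(3) by eventually_elim (use S in \<open>auto simp: subalgebra_def\<close>)
    then show "space M - A \<in> ?\<Sigma>" using A by blast
  next
    fix A :: "nat \<Rightarrow> 'a set" assume A: "range A \<subseteq> ?\<Sigma>"
    then have "\<forall>i. \<exists>A'. A' \<in> sets S \<and> (AE \<omega> in M. \<omega> \<in> A i \<longleftrightarrow> \<omega> \<in> A')" by blast
    then obtain A' where A': "\<And>i. A' i \<in> sets S" "\<And>i. AE \<omega> in M. \<omega> \<in> A i \<longleftrightarrow> \<omega> \<in> A' i" by metis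
    have "AE \<omega> in M. \<forall>i. \<omega> \<in> A i \<longleftrightarrow> \<omega> \<in> A' i" using A'(2) by (simp add: AE_all_countable)
    then have "AE \<omega> in M. \<omega> \<in> (\<Union>i. A i) \<longleftrightarrow> \<omega> \<in> (\<Union>i. A' i)" by eventually_elim auto
    moreover have "(\<Union>i. A i) \<in> sets M" using A by auto
    moreover have "(\<Union>i. A' i) \<in> sets S" using A'(1) by auto
    ultimately show "(\<Union>i. A i) \<in> ?\<Sigma>" by blast
  qed
  then show ?thesis unfolding null_closure_def by (rule sigma_algebra.sets_measure_of_eq)
qed

lemma space_null_closure [simp]: "space (null_closure M S) = space M"
  unfolding null_closure_def by (rule space_measure_of) (use sets.sets_into_space in auto)

lemma measurable_null_closure:
  fixes f :: "'w \<Rightarrow> 'c::topological_space"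
  assumes S: "subalgebra M S" and f: "f \<in> borel_measurable M" "f' \<in> borel_measurable S" "AE \<omega> in M. f \<omega> = f' \<omega>"
  shows "f \<in> borel_measurable (null_closure M S)"
proof (rule measurableI)
  fix T :: "'c set" assume T: "T \<in> sets borel"
  have "AE \<omega> in M. \<omega> \<in> f -` T \<inter> space M \<longleftrightarrow> \<omega> \<in> f' -` T \<inter> space S"
    using f(3) by eventually_elim (use S in \<open>auto simp: subalgebra_def\<close>)
  then show "f -` T \<inter> space (null_closure M S) \<in> sets (null_closure M S)"
    unfolding sets_null_closure[OF S] space_null_closure using measurable_sets[OF f(1) T] measurable_sets[OF f(2) T] by blast
qed simp

lemma subset_null_closure:
  assumes "subalgebra M S" shows "sets S \<subseteq> sets (null_closure M S)"
  unfolding sets_null_closure[OF assms] using assms by (auto simp: subalgebra_def intro!: bexI)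

lemma (in prob_space) indep_null_closure:
  assumes S: "subalgebra M S" and ind: "indep_set \<N> (sets S)"
  shows "indep_set \<N> (sets (null_closure M S))"
proof (rule indep_setI)
  show N: "\<N> \<subseteq> events" by (rule indep_setD_ev1[OF ind])
  show "sets (null_closure M S) \<subseteq> events" unfolding sets_null_closure[OF S] by auto
  fix a b assume a: "a \<in> \<N>" and "b \<in> sets (null_closure M S)"
  then obtain b' where b: "b \<in> events" "b' \<in> sets S" "AE \<omega> in M. \<omega> \<in> b \<longleftrightarrow> \<omega> \<in> b'"
    unfolding sets_null_closure[OF S] by auto
  have b': "b' \<in> events" using b(2) S by (auto simp: subalgebra_def)
  have aM: "a \<in> events" using a N by auto
  have "prob (a \<inter> b) = prob (a \<inter> b')" using b b' aM by (intro finite_measure_eq_AE) auto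
  also have "\<dots> = prob a * prob b'" by (rule indep_setD[OF ind a b(2)])
  also have "prob b' = prob b" using b b' by (intro finite_measure_eq_AE) auto
  finally show "prob (a \<inter> b) = prob a * prob b" .
qed

lemma (in prob_space) indep_set_mono:
  assumes "indep_set A B" "A' \<subseteq> A" "B' \<subseteq> B" shows "indep_set A' B'"
proof (rule indep_setI)
  show "A' \<subseteq> events" "B' \<subseteq> events" using indep_setD_ev1[OF assms(1)] indep_setD_ev2[OF assms(1)] assms(2,3) by auto
  show "prob (a \<inter> b) = prob a * prob b" if "a \<in> A'" "b \<in> B'" for a b
    using indep_setD[OF assms(1)] assms(2,3) that by blast
qed

lemma space_path_algebra [simp]: "space (path_algebra M Y) = space M"
  by (simp add: path_algebra_def)

lemma path_algebra_least:
  assumes "space N = space M" "\<And>t. 0 \<le> t \<Longrightarrow> Y t \<in> borel_measurable N"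
  shows "sets (path_algebra M Y) \<subseteq> sets N"
proof -
  have m: "(\<lambda>\<omega>. \<lambda>t\<in>{0..}. Y t \<omega>) \<in> N \<rightarrow>\<^sub>M (\<Pi>\<^sub>M t\<in>{0..}. borel)"
    using assms(2) by (intro measurable_restrict) auto
  have "sets (path_algebra M Y) = {(\<lambda>\<omega>. \<lambda>t\<in>{0..}. Y t \<omega>) -` A \<inter> space M |A. A \<in> sets (\<Pi>\<^sub>M t\<in>{0..}. borel)}"
    unfolding path_algebra_def by (rule sets_vimage_algebra2) (auto simp: space_PiM)
  then show ?thesis using measurable_sets[OF m] assms(1) by auto
qed

lemma measurable_path_algebra:
  assumes "0 \<le> t" shows "Y t \<in> borel_measurable (path_algebra M Y)"
proof -
  have "(\<lambda>\<omega>. \<lambda>t\<in>{0..}. Y t \<omega>) \<in> path_algebra M Y \<rightarrow>\<^sub>M (\<Pi>\<^sub>M t\<in>{0..}. borel)"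
    unfolding path_algebra_def by (rule measurable_vimage_algebra1) (auto simp: space_PiM)
  from measurable_compose[OF this measurable_component_singleton[of t]] assms show ?thesis by simp
qed

text \<open>All of \<open>G\<close> is available at every time, so \<open>G\<close>-measurable
  variables act as constants for the integral.\<close>

definition enlargement :: "(real \<Rightarrow> 'w measure) \<Rightarrow> 'w measure \<Rightarrow> 'w measure \<Rightarrow> real \<Rightarrow> 'w measure" where
  "enlargement F M G a = sigma (space M) (sets (F a) \<union> sets G)"

lemma enlargement_props:
  assumes F: "\<And>t. subalgebra M (F t)" and G: "subalgebra M G"
  shows "space (enlargement F M G a) = space M"
    "sets (enlargement F M G a) = sigma_sets (space M) (sets (F a) \<union> sets G)"
    "subalgebra M (enlargement F M G a)" "sets (F a) \<subseteq> sets (enlargement F M G a)" "sets G \<subseteq> sets (enlargement F M G a)"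
proof -
  have sub: "sets (F a) \<union> sets G \<subseteq> sets M" using F[of a] G by (auto simp: subalgebra_def)
  then have P: "sets (F a) \<union> sets G \<subseteq> Pow (space M)" using sets.sets_into_space by blast
  show s: "space (enlargement F M G a) = space M" unfolding enlargement_def by (rule space_measure_of[OF P])
  show e: "sets (enlargement F M G a) = sigma_sets (space M) (sets (F a) \<union> sets G)"
    unfolding enlargement_def by (rule sets_measure_of[OF P])
  show "subalgebra M (enlargement F M G a)"
    unfolding subalgebra_def s e using sets.sigma_sets_subset[OF sub] by simp
  show "sets (F a) \<subseteq> sets (enlargement F M G a)" "sets G \<subseteq> sets (enlargement F M G a)" unfolding e by auto
qed

context wiener_increasing begin

text \<open>For \<open>a = 0\<close> this is the algebra that carries the noise variable
  \<open>\<omega>'\<close> of the product space; for general \<open>a\<close> it yields independence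
  of the future of \<open>B\<close> from the enlarged past.\<close>

definition increment_sigma :: "real \<Rightarrow> 'w measure" where
  "increment_sigma a = sigma (space M) (\<Union>r\<in>{a..}. {(\<lambda>\<omega>. B r \<omega> - B a \<omega>) -` T \<inter> space M |T. T \<in> sets borel})"

lemma increment_sigma_props:
  shows "sets (increment_sigma a) = sigma_sets (space M) (\<Union>r\<in>{a..}. {(\<lambda>\<omega>. B r \<omega> - B a \<omega>) -` T \<inter> space M |T. T \<in> sets borel})"
    "0 \<le> a \<Longrightarrow> subalgebra M (increment_sigma a)"
    "a \<le> r \<Longrightarrow> (\<lambda>\<omega>. B r \<omega> - B a \<omega>) \<in> borel_measurable (increment_sigma a)"
proof -
  let ?C = "\<Union>r\<in>{a..}. {(\<lambda>\<omega>. B r \<omega> - B a \<omega>) -` T \<inter> space M |T. T \<in> sets borel}"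
  have P: "?C \<subseteq> Pow (space M)" by auto
  show e: "sets (increment_sigma a) = sigma_sets (space M) ?C" unfolding increment_sigma_def by (rule sets_measure_of[OF P])
  have s: "space (increment_sigma a) = space M" unfolding increment_sigma_def by (rule space_measure_of[OF P])
  show "subalgebra M (increment_sigma a)" if a: "0 \<le> a"
  proof -
    have "?C \<subseteq> sets M"
    proof
      fix A assume "A \<in> ?C"
      then obtain r T where r: "a \<le> r" "T \<in> sets borel" and A: "A = (\<lambda>\<omega>. B r \<omega> - B a \<omega>) -` T \<inter> space M" by auto
      show "A \<in> sets M"
        unfolding A using r a by (intro measurable_sets[OF borel_measurable_diff[OF B_M B_M]]) auto
    qed
    from sets.sigma_sets_subset[OF this] show ?thesis by (simp add: subalgebra_def s e)
  qed
  show "(\<lambda>\<omega>. B r \<omega> - B a \<omega>) \<in> borel_measurable (increment_sigma a)" if "a \<le> r"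
    by (rule measurableI) (use that in \<open>auto simp: s e intro!: sigma_sets.Basic\<close>)
qed

text \<open>Each \<open>Y t\<close> is almost surely a functional of \<open>L\<close>, so the paths
  of \<open>Y\<close> generate sets in the null closure of \<open>F a\<close> joined with the paths
  of \<open>L\<close>. Independence survives null closures and passes to smaller algebras.\<close>

lemma enlargement_indep:
  fixes Y :: "real \<Rightarrow> 'w \<Rightarrow> 'c::topological_space"
  assumes YM: "\<And>t. 0 \<le> t \<Longrightarrow> Y t \<in> borel_measurable M"
    and Y: "\<And>t. 0 \<le> t \<Longrightarrow> \<exists>Y'\<in>borel_measurable (sigma (space M) (\<Union>r\<in>{0..}. {L r -` T \<inter> space M |T. T \<in> sets borel})).
      AE \<omega> in M. Y t \<omega> = Y' \<omega>"
    and a: "0 \<le> a"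
  shows "indep_set (sets (increment_sigma a)) (sets (enlargement F M (path_algebra M Y) a))"
proof -
  let ?L = "\<Union>r\<in>{0..}. {L r -` T \<inter> space M |T. T \<in> sets borel}"
  define S where "S = sigma (space M) (sets (F a) \<union> ?L)"
  have LM: "?L \<subseteq> sets M" using measurable_sets[OF L_M] by auto
  have FM: "sets (F a) \<subseteq> sets M" using F_subalg by (simp add: subalgebra_def)
  have PL: "?L \<subseteq> Pow (space M)" by auto
  have P: "sets (F a) \<union> ?L \<subseteq> Pow (space M)" using FM sets.sets_into_space PL by blast
  have sS: "sets S = sigma_sets (space M) (sets (F a) \<union> ?L)" unfolding S_def by (rule sets_measure_of[OF P])
  have spS: "space S = space M" unfolding S_def by (rule space_measure_of[OF P])
  have sub: "subalgebra M S"
    unfolding subalgebra_def sS spS using sets.sigma_sets_subset[of "sets (F a) \<union> ?L" M] FM LM by simp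
  have "indep_set (sets (increment_sigma a)) (sets S)"
    unfolding sS increment_sigma_props(1) by (rule increments_indep_enlarged[OF a])
  then have ind: "indep_set (sets (increment_sigma a)) (sets (null_closure M S))" by (rule indep_null_closure[OF sub])
  have subS: "subalgebra S (sigma (space M) ?L)"
    unfolding subalgebra_def spS sS sets_measure_of[OF PL] space_measure_of[OF PL]
    by (intro conjI refl sigma_sets_mono') (rule Un_upper2)
  have "sets (path_algebra M Y) \<subseteq> sets (null_closure M S)"
  proof (rule path_algebra_least)
    fix t :: real assume t: "0 \<le> t"
    obtain Y' where Y': "Y' \<in> borel_measurable (sigma (space M) ?L)" "AE \<omega> in M. Y t \<omega> = Y' \<omega>" using Y[OF t] by blast
    show "Y t \<in> borel_measurable (null_closure M S)"
      by (rule measurable_null_closure[OF sub YM[OF t] measurable_from_subalg[OF subS Y'(1)] Y'(2)])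
  qed simp
  moreover have "sets (F a) \<subseteq> sets (null_closure M S)"
    using subset_null_closure[OF sub] sS by auto
  ultimately have sub2: "sets (F a) \<union> sets (path_algebra M Y) \<subseteq> sets (null_closure M S)" by blast
  have G: "subalgebra M (path_algebra M Y)"
    using path_algebra_least[of M M Y] YM by (simp add: subalgebra_def)
  have "sets (enlargement F M (path_algebra M Y) a) \<subseteq> sets (null_closure M S)"
    using sets.sigma_sets_subset[OF sub2] unfolding enlargement_props(2)[OF F_subalg G] by simp
  with ind show ?thesis by (intro indep_set_mono[OF ind]) auto
qed

end

text \<open>Moments and Gaussian laws of the increments do not refer to the filtration, and
  adaptedness survives enlargement; independence from the larger past is the new point.\<close>

lemma wiener_gaussian_noise:
  fixes Y :: "real \<Rightarrow> 'w \<Rightarrow> 'c::topological_space" and B :: "real \<Rightarrow> 'w \<Rightarrow> 'a::{real_inner,banach,second_countable_topology}"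
  assumes "wiener_increasing M F B L" and W: "wiener_process M F Q B" and Q: "trace_class_nonneg Q"
    and YM: "\<And>t. 0 \<le> t \<Longrightarrow> Y t \<in> borel_measurable M"
    and Y: "\<And>t. 0 \<le> t \<Longrightarrow> \<exists>Y'\<in>borel_measurable (sigma (space M) (\<Union>r\<in>{0..}. {L r -` T \<inter> space M |T. T \<in> sets borel})).
      AE \<omega> in M. Y t \<omega> = Y' \<omega>"
  shows "gaussian_noise M (enlargement F M (path_algebra M Y)) B Q"
proof -
  interpret wiener_increasing M F B L by fact
  have G: "subalgebra M (path_algebra M Y)"
    using path_algebra_least[of M M Y] YM by (simp add: subalgebra_def)
  note H = enlargement_props[OF F_subalg G]
  have W': "gaussian_measure (distr M borel (\<lambda>\<omega>. B t \<omega> - B s \<omega>))"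
    "has_mean (distr M borel (\<lambda>\<omega>. B t \<omega> - B s \<omega>)) 0"
    "has_covariance (distr M borel (\<lambda>\<omega>. B t \<omega> - B s \<omega>)) ((t - s) *\<^sub>R Q)" if "0 \<le> s" "s \<le> t" for s t
    using W that unfolding wiener_process_def by blast+
  have BM: "(\<lambda>\<omega>. B t \<omega> - B s \<omega>) \<in> borel_measurable M" if "0 \<le> s" "s \<le> t" for s t
    using that by (intro borel_measurable_diff B_M) auto
  \<comment> \<open>\<open>has_covariance\<close> contains an existential mean, which this
    identifies with 0.\<close>
  have mean: "m = 0" if "has_mean (\<mu> :: 'a measure) m" "has_mean \<mu> 0" for \<mu> m
  proof -
    have "m \<bullet> m = 0 \<bullet> m" using that unfolding has_mean_def by metis
    then show ?thesis by simp
  qed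
  have cov: "integrable M (\<lambda>\<omega>. ((B t \<omega> - B s \<omega>) \<bullet> x) * ((B t \<omega> - B s \<omega>) \<bullet> y))"
    "(\<integral>\<omega>. ((B t \<omega> - B s \<omega>) \<bullet> x) * ((B t \<omega> - B s \<omega>) \<bullet> y) \<partial>M) = (t - s) * (Q x \<bullet> y)" if st: "0 \<le> s" "s \<le> t" for s t x y
  proof -
    note BM[OF st, measurable]
    let ?\<mu> = "distr M borel (\<lambda>\<omega>. B t \<omega> - B s \<omega>)"
    obtain m where m: "has_mean ?\<mu> m"
      "integrable ?\<mu> (\<lambda>z. ((z - m) \<bullet> x) * ((z - m) \<bullet> y))" "(\<integral>z. ((z - m) \<bullet> x) * ((z - m) \<bullet> y) \<partial>?\<mu>) = ((t - s) *\<^sub>R Q) x \<bullet> y"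
      using W'(3)[OF st] unfolding has_covariance_def by blast
    have "m = 0" by (rule mean[OF m(1) W'(2)[OF st]])
    with m(2,3) have "integrable ?\<mu> (\<lambda>z. (z \<bullet> x) * (z \<bullet> y))" "(\<integral>z. (z \<bullet> x) * (z \<bullet> y) \<partial>?\<mu>) = (t - s) * (Q x \<bullet> y)"
      by (simp_all add: blinfun.bilinear_simps)
    then show "integrable M (\<lambda>\<omega>. ((B t \<omega> - B s \<omega>) \<bullet> x) * ((B t \<omega> - B s \<omega>) \<bullet> y))"
      "(\<integral>\<omega>. ((B t \<omega> - B s \<omega>) \<bullet> x) * ((B t \<omega> - B s \<omega>) \<bullet> y) \<partial>M) = (t - s) * (Q x \<bullet> y)"
      by (simp_all add: integrable_distr_eq integral_distr)
  qed
  have sub: "subalgebra (enlargement F M (path_algebra M Y) t) (F t)" for t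
    using H(1,4) F_subalg[of t] by (simp add: subalgebra_def)
  show ?thesis
  proof unfold_locales
    show "subalgebra M (enlargement F M (path_algebra M Y) t)" for t by (rule H(3))
    show "sets (enlargement F M (path_algebra M Y) s) \<subseteq> sets (enlargement F M (path_algebra M Y) t)" if "0 \<le> s" "s \<le> t" for s t
    proof -
      have "sets (F s) \<subseteq> sets (F t)" using F_filtration that by (simp add: filtration_def)
      then show ?thesis unfolding H(2) by (intro sigma_sets_mono') auto
    qed
    show "B t \<in> borel_measurable (enlargement F M (path_algebra M Y) t)" if "0 \<le> t" for t
      using B_adapted that unfolding adapted_def by (intro measurable_from_subalg[OF sub]) blast
    show "indep_set (sets (vimage_algebra (space M) (\<lambda>\<omega>. B t \<omega> - B s \<omega>) borel)) (sets (enlargement F M (path_algebra M Y) s))"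
      if st: "0 \<le> s" "s \<le> t" for s t
    proof (rule indep_set_mono[OF enlargement_indep[OF YM Y st(1)]])
      have "sets (vimage_algebra (space M) (\<lambda>\<omega>. B t \<omega> - B s \<omega>) borel) = {(\<lambda>\<omega>. B t \<omega> - B s \<omega>) -` T \<inter> space M |T. T \<in> sets borel}"
        by (rule sets_vimage_algebra2) simp
      then show "sets (vimage_algebra (space M) (\<lambda>\<omega>. B t \<omega> - B s \<omega>) borel) \<subseteq> sets (increment_sigma s)"
        unfolding increment_sigma_props(1) using st by (auto intro!: sigma_sets.Basic)
    qed auto
    show "(\<integral>\<omega>. (B t \<omega> - B s \<omega>) \<bullet> x \<partial>M) = 0" if st: "0 \<le> s" "s \<le> t" for s t x
    proof -
      have "(\<integral>z. z \<bullet> x \<partial>distr M borel (\<lambda>\<omega>. B t \<omega> - B s \<omega>)) = 0"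
        using W'(2)[OF st] unfolding has_mean_def by simp
      then show ?thesis using BM[OF st] by (simp add: integral_distr)
    qed
    show "integrable M (\<lambda>\<omega>. ((B t \<omega> - B s \<omega>) \<bullet> x)\<^sup>2)" if "0 \<le> s" "s \<le> t" for s t x
      using cov(1)[OF that, of x x] by (simp add: power2_eq_square)
    show "gaussian_real (distr M borel (\<lambda>\<omega>. (B t \<omega> - B s \<omega>) \<bullet> x))" if st: "0 \<le> s" "s \<le> t" for s t x
    proof -
      have "gaussian_real (distr (distr M borel (\<lambda>\<omega>. B t \<omega> - B s \<omega>)) borel (\<lambda>z. z \<bullet> x))"
        using W'(1)[OF st] unfolding gaussian_measure_def by blast
      then show ?thesis using BM[OF st] by (simp add: distr_distr o_def)
    qed
  qed (fact cov(2) Q)+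
qed

section \<open>The adjusted return as a stochastic integral\<close>

text \<open>The approximation of \<open>J\<close>, mapped by \<open>S (T - t)\<close>, is subtracted
  from that of \<open>I\<close>. Up to time \<open>t\<close> the semigroup law makes the two limits
  cancel; beyond \<open>t\<close> the subtracted process is 0. What remains is the integrand cut off
  to the times after \<open>t\<close>.\<close>

lemma (in square_integrable_noise) ito_integral_difference:
  fixes S :: "real \<Rightarrow> 'b \<Rightarrow>\<^sub>L 'b::{real_inner,banach,second_countable_topology}" and V :: "real \<Rightarrow> 'w \<Rightarrow> 'a \<Rightarrow>\<^sub>L 'b"
  assumes F: "\<And>t. subalgebra M (F t)" "\<And>t. 0 \<le> t \<Longrightarrow> sets (F t) \<subseteq> sets (H t)" and tT: "0 \<le> t" "t \<le> T"
    and I: "has_ito_integral M F Z Q T (\<lambda>r \<omega>. S (T - r) o\<^sub>L V r \<omega>) I"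
    and J: "has_ito_integral M F Z Q t (\<lambda>r \<omega>. S (t - r) o\<^sub>L V r \<omega>) J"
    and S: "\<And>r. 0 \<le> r \<Longrightarrow> r \<le> t \<Longrightarrow> S (T - r) = S (T - t) o\<^sub>L S (t - r)"
  defines "\<Psi> \<equiv> \<lambda>r \<omega>. indicator {t<..T} r *\<^sub>R (S (T - r) o\<^sub>L V r \<omega>)"
  shows "jointly_measurable M T \<Psi>"
    "\<exists>zs. (\<forall>k. step_process H T (zs k)) \<and> (\<lambda>k. ito_norm M Q T (\<lambda>s \<omega>. step_value (zs k) s \<omega> - \<Psi> s \<omega>)) \<longlonglongrightarrow> 0 \<and>
      (\<lambda>k. \<integral>\<^sup>+\<omega>. ennreal ((norm (step_integral Z (zs k) \<omega> \<omega> - (I \<omega> - S (T - t) (J \<omega>))))\<^sup>2) \<partial>M) \<longlonglongrightarrow> 0"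
proof -
  let ?S = "S (T - t)"
  define U where "U s \<omega> = S (T - s) o\<^sub>L V s \<omega>" for s \<omega>
  define U' where "U' s \<omega> = S (t - s) o\<^sub>L V s \<omega>" for s \<omega>
  note iI = ito_integral_steps[OF I[folded U_def] F] and iJ = ito_integral_steps[OF J[folded U'_def] F]
  obtain xs where xs: "\<And>k. step_process H T (xs k)" "(\<lambda>k. ito_norm M Q T (\<lambda>s \<omega>. step_value (xs k) s \<omega> - U s \<omega>)) \<longlonglongrightarrow> 0"
    "(\<lambda>k. \<integral>\<^sup>+\<omega>. ennreal ((norm (step_integral Z (xs k) \<omega> \<omega> - I \<omega>))\<^sup>2) \<partial>M) \<longlonglongrightarrow> 0"
    using iI(3) by blast
  obtain ys where ys: "\<And>k. step_process H t (ys k)" "(\<lambda>k. ito_norm M Q t (\<lambda>s \<omega>. step_value (ys k) s \<omega> - U' s \<omega>)) \<longlonglongrightarrow> 0"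
    "(\<lambda>k. \<integral>\<^sup>+\<omega>. ennreal ((norm (step_integral Z (ys k) \<omega> \<omega> - J \<omega>))\<^sup>2) \<partial>M) \<longlonglongrightarrow> 0"
    using iJ(3) by blast
  have \<Psi>U: "\<Psi> s \<omega> = indicator {t<..T} s *\<^sub>R U s \<omega>" for s \<omega> by (simp add: \<Psi>_def U_def)
  have ind: "(\<lambda>p. indicator {t<..T} (fst p) :: real) \<in> borel_measurable (time_space T \<Otimes>\<^sub>M M)"
  proof (rule measurable_compose[OF measurable_fst])
    show "indicator {t<..T} \<in> borel_measurable (time_space T)"
      unfolding time_space_def by (rule measurable_restrict_space1) simp
  qed
  show jm: "jointly_measurable M T \<Psi>"
    using iI(1) ind unfolding jointly_measurable_def \<Psi>U case_prod_beta
    by (auto simp: blinfun.bilinear_simps intro!: borel_measurable_scaleR)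
  define zs where "zs k = xs k @ step_neg (step_map ?S (ys k))" for k
  have ysT: "step_process H T (ys k)" for k by (rule step_process_mono[OF ys(1) tT(2)])
  have zsT: "step_process H T (zs k)" for k
    unfolding zs_def using xs(1) step_neg_simps(3)[OF step_map_simps(3)[OF ysT]] by simp
  have val: "step_value (zs k) s \<omega> = step_value (xs k) s \<omega> - (?S o\<^sub>L step_value (ys k) s \<omega>)" for k s \<omega>
    by (simp add: zs_def step_neg_simps step_map_simps)
  have int: "step_integral Z (zs k) \<omega> \<omega> = step_integral Z (xs k) \<omega> \<omega> - ?S (step_integral Z (ys k) \<omega> \<omega>)" for k \<omega>
    by (simp add: zs_def step_neg_simps step_map_simps)
  \<comment> \<open>A half-way process for the triangle inequality: \<open>xs\<close> is replaced by
    its limit, \<open>ys\<close> is not yet.\<close>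
  define W where "W k s \<omega> = U s \<omega> - (?S o\<^sub>L step_value (ys k) s \<omega>)" for k s \<omega>
  have jy: "jointly_measurable M T (\<lambda>s \<omega>. ?S o\<^sub>L step_value (ys k) s \<omega>)" for k
    unfolding step_map_simps(1)[symmetric] by (rule jointly_measurable_step[OF step_map_simps(3)[OF ysT]])
  have jW: "jointly_measurable M T (W k)" for k
    unfolding W_def[abs_def] by (rule jointly_measurable_diff[OF iI(1) jy])
  have jd: "jointly_measurable M t (\<lambda>s \<omega>. step_value (ys k) s \<omega> - U' s \<omega>)" for k
    by (rule jointly_measurable_diff[OF jointly_measurable_step[OF ys(1)] iJ(1)])
  have jS: "jointly_measurable M t (\<lambda>s \<omega>. ?S o\<^sub>L (U' s \<omega> - step_value (ys k) s \<omega>))" for k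
    unfolding jointly_measurable_def
  proof
    fix x
    have "jointly_measurable M t (\<lambda>s \<omega>. U' s \<omega> - step_value (ys k) s \<omega>)"
      by (rule jointly_measurable_diff[OF iJ(1) jointly_measurable_step[OF ys(1)]])
    then show "(\<lambda>(s, \<omega>). (?S o\<^sub>L (U' s \<omega> - step_value (ys k) s \<omega>)) x) \<in> borel_measurable (time_space t \<Otimes>\<^sub>M M)"
      unfolding jointly_measurable_def case_prod_beta by (auto intro!: measurable_blinfun_apply)
  qed
  let ?c = "ennreal ((norm ?S)\<^sup>2)"
  have WS: "ito_norm M Q T (\<lambda>s \<omega>. W k s \<omega> - \<Psi> s \<omega>) \<le> ?c * ito_norm M Q t (\<lambda>s \<omega>. step_value (ys k) s \<omega> - U' s \<omega>)" for k
  proof -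
    \<comment> \<open>Turns an integral up to \<open>T\<close> into one up to \<open>t\<close>:
      after \<open>t\<close> the step process \<open>ys k\<close> is 0, so \<open>W k\<close> and
      \<open>\<Psi>\<close> coincide there.\<close>
    have pt: "hs_norm_sq ((W k s \<omega> - \<Psi> s \<omega>) o\<^sub>L sqrt_op Q) * indicator {0..T} s =
        hs_norm_sq ((?S o\<^sub>L (U' s \<omega> - step_value (ys k) s \<omega>)) o\<^sub>L sqrt_op Q) * indicator {0..t} s" for s \<omega>
    proof (cases "s \<in> {0..T}")
      case True
      show ?thesis
      proof (cases "s \<le> t")
        case le: True
        have "U s \<omega> = ?S o\<^sub>L U' s \<omega>" unfolding U_def U'_def using S[of s] le True by (intro blinfun_eqI) simp
        then have "W k s \<omega> - \<Psi> s \<omega> = ?S o\<^sub>L (U' s \<omega> - step_value (ys k) s \<omega>)"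
          using le by (intro blinfun_eqI) (simp add: W_def \<Psi>U blinfun.bilinear_simps)
        then show ?thesis using le True by simp
      next
        case False
        then have "W k s \<omega> - \<Psi> s \<omega> = 0"
          using step_value_outside[OF ys(1)[of k], of s \<omega>] True by (intro blinfun_eqI) (simp add: W_def \<Psi>U blinfun.bilinear_simps)
        then show ?thesis using False by (simp add: hs_norm_sq_nn_integral)
      qed
    qed (use tT in auto)
    have "ito_norm M Q T (\<lambda>s \<omega>. W k s \<omega> - \<Psi> s \<omega>) = ito_norm M Q t (\<lambda>s \<omega>. ?S o\<^sub>L (U' s \<omega> - step_value (ys k) s \<omega>))"
      unfolding ito_norm_iterated[OF jointly_measurable_diff[OF jW jm]] ito_norm_iterated[OF jS] pt ..
    also have "\<dots> \<le> (\<integral>\<^sup>+p. ?c * hs_norm_sq ((step_value (ys k) (fst p) (snd p) - U' (fst p) (snd p)) o\<^sub>L sqrt_op Q) \<partial>(time_space t \<Otimes>\<^sub>M M))"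
      unfolding ito_norm_def
    proof (rule nn_integral_mono)
      fix p
      let ?X = "U' (fst p) (snd p)" and ?Y = "step_value (ys k) (fst p) (snd p)"
      have "(?S o\<^sub>L (?X - ?Y)) o\<^sub>L sqrt_op Q = ?S o\<^sub>L ((?X - ?Y) o\<^sub>L sqrt_op Q)" by (rule blinfun_eqI) simp
      moreover have "hs_norm_sq ((?X - ?Y) o\<^sub>L sqrt_op Q) = hs_norm_sq ((?Y - ?X) o\<^sub>L sqrt_op Q)"
        by (simp add: hs_norm_sq_nn_integral blinfun.bilinear_simps norm_minus_commute)
      ultimately show "hs_norm_sq ((?S o\<^sub>L (?X - ?Y)) o\<^sub>L sqrt_op Q) \<le> ?c * hs_norm_sq ((?Y - ?X) o\<^sub>L sqrt_op Q)"
        using hs_norm_sq_compose_left by metis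
    qed
    also have "\<dots> = ?c * ito_norm M Q t (\<lambda>s \<omega>. step_value (ys k) s \<omega> - U' s \<omega>)"
      unfolding ito_norm_def using measurable_ito_integrand[OF jd] by (rule nn_integral_cmult)
    finally show ?thesis .
  qed
  have lim1: "(\<lambda>k. ito_norm M Q T (\<lambda>s \<omega>. step_value (zs k) s \<omega> - \<Psi> s \<omega>)) \<longlonglongrightarrow> 0"
  proof (rule ennreal_tendsto_zero_bound[OF _ xs(2)])
    show "(\<lambda>k. ?c * ito_norm M Q t (\<lambda>s \<omega>. step_value (ys k) s \<omega> - U' s \<omega>)) \<longlonglongrightarrow> 0"
      using ennreal_tendsto_cmult[OF _ ys(2), of ?c] by simp
    fix k
    have eq: "step_value (zs k) s \<omega> - W k s \<omega> = step_value (xs k) s \<omega> - U s \<omega>" for s \<omega>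
      unfolding val W_def by simp
    have "ito_norm M Q T (\<lambda>s \<omega>. step_value (zs k) s \<omega> - \<Psi> s \<omega>) \<le>
        2 * ito_norm M Q T (\<lambda>s \<omega>. step_value (zs k) s \<omega> - W k s \<omega>) + 2 * ito_norm M Q T (\<lambda>s \<omega>. W k s \<omega> - \<Psi> s \<omega>)"
      by (rule ito_norm_triangle[OF jointly_measurable_step[OF zsT] jW jm])
    also have "\<dots> \<le> 2 * ito_norm M Q T (\<lambda>s \<omega>. step_value (xs k) s \<omega> - U s \<omega>) +
        2 * (?c * ito_norm M Q t (\<lambda>s \<omega>. step_value (ys k) s \<omega> - U' s \<omega>))"
      unfolding eq by (intro add_left_mono mult_left_mono WS) simp
    finally show "ito_norm M Q T (\<lambda>s \<omega>. step_value (zs k) s \<omega> - \<Psi> s \<omega>) \<le> \<dots>" .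
  qed
  have lim2: "(\<lambda>k. \<integral>\<^sup>+\<omega>. ennreal ((norm (step_integral Z (zs k) \<omega> \<omega> - (I \<omega> - ?S (J \<omega>))))\<^sup>2) \<partial>M) \<longlonglongrightarrow> 0"
  proof (rule ennreal_tendsto_zero_bound[OF _ xs(3)])
    show "(\<lambda>k. ?c * (\<integral>\<^sup>+\<omega>. ennreal ((norm (step_integral Z (ys k) \<omega> \<omega> - J \<omega>))\<^sup>2) \<partial>M)) \<longlonglongrightarrow> 0"
      using ennreal_tendsto_cmult[OF _ ys(3), of ?c] by simp
    fix k
    let ?x = "\<lambda>\<omega>. step_integral Z (xs k) \<omega> \<omega> - I \<omega>" and ?y = "\<lambda>\<omega>. step_integral Z (ys k) \<omega> \<omega> - J \<omega>"
    have m: "?x \<in> borel_measurable M" "?y \<in> borel_measurable M"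
      using borel_measurable_diff[OF step_integral_measurable[OF xs(1)[of k]] iI(2)]
        borel_measurable_diff[OF step_integral_measurable[OF ys(1)[of k]] iJ(2)] by simp_all
    have "(\<integral>\<^sup>+\<omega>. ennreal ((norm (step_integral Z (zs k) \<omega> \<omega> - (I \<omega> - ?S (J \<omega>))))\<^sup>2) \<partial>M) \<le>
        (\<integral>\<^sup>+\<omega>. 2 * ennreal ((norm (?x \<omega>))\<^sup>2) + 2 * (?c * ennreal ((norm (?y \<omega>))\<^sup>2)) \<partial>M)"
    proof (rule nn_integral_mono)
      fix \<omega>
      have "step_integral Z (zs k) \<omega> \<omega> - (I \<omega> - ?S (J \<omega>)) = ?x \<omega> + (- ?S (?y \<omega>))"
        by (simp add: int blinfun.bilinear_simps)
      then have "ennreal ((norm (step_integral Z (zs k) \<omega> \<omega> - (I \<omega> - ?S (J \<omega>))))\<^sup>2) \<le>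
          2 * ennreal ((norm (?x \<omega>))\<^sup>2) + 2 * ennreal ((norm (- ?S (?y \<omega>)))\<^sup>2)"
        using ennreal_norm_sq_add_le by metis
      also have "ennreal ((norm (- ?S (?y \<omega>)))\<^sup>2) \<le> ?c * ennreal ((norm (?y \<omega>))\<^sup>2)"
        using norm_blinfun[of ?S "?y \<omega>"]
        by (simp add: ennreal_mult'[symmetric] power_mult_distrib[symmetric] power_mono ennreal_leI)
      finally show "ennreal ((norm (step_integral Z (zs k) \<omega> \<omega> - (I \<omega> - ?S (J \<omega>))))\<^sup>2) \<le>
          2 * ennreal ((norm (?x \<omega>))\<^sup>2) + 2 * (?c * ennreal ((norm (?y \<omega>))\<^sup>2))"
        by (simp add: mult_left_mono add_left_mono)
    qed
    also have "\<dots> = 2 * (\<integral>\<^sup>+\<omega>. ennreal ((norm (?x \<omega>))\<^sup>2) \<partial>M) + 2 * (?c * (\<integral>\<^sup>+\<omega>. ennreal ((norm (?y \<omega>))\<^sup>2) \<partial>M))"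
      using m by (simp add: nn_integral_add nn_integral_cmult)
    finally show "(\<integral>\<^sup>+\<omega>. ennreal ((norm (step_integral Z (zs k) \<omega> \<omega> - (I \<omega> - ?S (J \<omega>))))\<^sup>2) \<partial>M) \<le> \<dots>" .
  qed
  show "\<exists>zs. (\<forall>k. step_process H T (zs k)) \<and> (\<lambda>k. ito_norm M Q T (\<lambda>s \<omega>. step_value (zs k) s \<omega> - \<Psi> s \<omega>)) \<longlonglongrightarrow> 0 \<and>
      (\<lambda>k. \<integral>\<^sup>+\<omega>. ennreal ((norm (step_integral Z (zs k) \<omega> \<omega> - (I \<omega> - ?S (J \<omega>))))\<^sup>2) \<partial>M) \<longlonglongrightarrow> 0"
    using zsT lim1 lim2 by blast
qed

section \<open>The integrated covariance operator\<close>

text \<open>As operator norms are bounded by Hilbert-Schmidt norms,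
  \<open>X o\<^sub>L adj_op X\<close> has Hilbert-Schmidt norm at most \<open>hs_norm_sq X\<close>.
  This makes \<open>f\<close> Bochner integrable, and the bounded functionals
  \<open>op_of_hs T h \<bullet> k\<close> then pass under the integral.\<close>

lemma integrated_covariance:
  fixes f :: "'s \<Rightarrow> 'b::{real_inner,banach,second_countable_topology} hs_op" and A :: "'s \<Rightarrow> 'b \<Rightarrow>\<^sub>L 'b"
  assumes f: "f \<in> borel_measurable N" "AE s in N. op_of_hs (f s) = A s o\<^sub>L adj_op (A s)"
    and A: "\<And>x. (\<lambda>s. A s x) \<in> borel_measurable N" and fin: "(\<integral>\<^sup>+s. hs_norm_sq (A s) \<partial>N) < \<top>"
  shows "integrable N f" "self_adjoint (op_of_hs (\<integral>s. f s \<partial>N))" "nonneg_definite (op_of_hs (\<integral>s. f s \<partial>N))"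
    "op_of_hs (\<integral>s. f s \<partial>N) h \<bullet> h = (\<integral>s. (norm (adj_op (A s) h))\<^sup>2 \<partial>N)"
proof -
  have bound: "ennreal (norm T) \<le> hs_norm_sq X" if T: "op_of_hs T = X o\<^sub>L adj_op X" for T :: "'b hs_op" and X :: "'b \<Rightarrow>\<^sub>L 'b"
  proof (cases "hs_norm_sq X")
    case (real h)
    have h0: "0 \<le> h" and Xh: "hs_norm_sq X = ennreal h" using real by simp_all
    have "norm (adj_op X) \<le> sqrt h"
    proof (rule norm_blinfun_bound)
      fix y
      have "ennreal ((norm (adj_op X y))\<^sup>2) \<le> ennreal ((norm y)\<^sup>2) * hs_norm_sq X" by (rule norm_adj_op_apply_le_hs)
      also have "\<dots> = ennreal (h * (norm y)\<^sup>2)" unfolding Xh using h0 by (simp add: ennreal_mult' mult.commute)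
      finally have "ennreal ((norm (adj_op X y))\<^sup>2) \<le> ennreal (h * (norm y)\<^sup>2)" .
      then have "(norm (adj_op X y))\<^sup>2 \<le> h * (norm y)\<^sup>2"
        by (rule iffD1[OF ennreal_le_iff, rotated]) (use h0 in simp)
      then have "sqrt ((norm (adj_op X y))\<^sup>2) \<le> sqrt (h * (norm y)\<^sup>2)" by (rule real_sqrt_le_mono)
      then show "norm (adj_op X y) \<le> sqrt h * norm y" by (simp add: real_sqrt_mult)
    qed (use h0 in simp)
    then have "(norm (adj_op X))\<^sup>2 \<le> (sqrt h)\<^sup>2" by (rule power_mono) simp
    then have n: "(norm (adj_op X))\<^sup>2 \<le> h" using h0 by simp
    have "ennreal ((norm T)\<^sup>2) \<le> ennreal ((norm (adj_op X))\<^sup>2) * hs_norm_sq X"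
      unfolding norm_hs_op_eq_hs_norm_sq T by (rule hs_norm_sq_compose_right)
    also have "\<dots> \<le> ennreal h * ennreal h" unfolding Xh by (rule mult_right_mono[OF ennreal_leI[OF n]]) simp
    also have "\<dots> = ennreal (h\<^sup>2)" using h0 by (simp add: ennreal_mult' power2_eq_square)
    finally have "ennreal ((norm T)\<^sup>2) \<le> ennreal (h\<^sup>2)" .
    then have "(norm T)\<^sup>2 \<le> h\<^sup>2" by (rule iffD1[OF ennreal_le_iff, rotated]) simp
    from power2_le_imp_le[OF this h0] show ?thesis unfolding Xh by (rule ennreal_leI)
  qed simp
  show i: "integrable N f"
  proof (rule integrableI_bounded[OF f(1)])
    have "(\<integral>\<^sup>+s. ennreal (norm (f s)) \<partial>N) \<le> (\<integral>\<^sup>+s. hs_norm_sq (A s) \<partial>N)"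
      using f(2) by (intro nn_integral_mono_AE) (auto elim!: eventually_mono intro: bound)
    then show "(\<integral>\<^sup>+s. ennreal (norm (f s)) \<partial>N) < \<infinity>" using fin by simp
  qed
  have v: "op_of_hs (\<integral>s. f s \<partial>N) h \<bullet> k = (\<integral>s. adj_op (A s) h \<bullet> adj_op (A s) k \<partial>N)" for h k
  proof -
    have "op_of_hs (\<integral>s. f s \<partial>N) h \<bullet> k = (\<integral>s. op_of_hs (f s) h \<bullet> k \<partial>N)"
      by (rule integral_bounded_linear[OF bounded_linear_hs_inner i, symmetric])
    also have "\<dots> = (\<integral>s. adj_op (A s) h \<bullet> adj_op (A s) k \<partial>N)"
    proof (rule integral_cong_AE)
      show "(\<lambda>s. op_of_hs (f s) h \<bullet> k) \<in> borel_measurable N"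
        by (rule borel_measurable_integrable[OF integrable_bounded_linear[OF bounded_linear_hs_inner i]])
      show "(\<lambda>s. adj_op (A s) h \<bullet> adj_op (A s) k) \<in> borel_measurable N"
        using A by (intro borel_measurable_inner measurable_adj_op_apply)
      show "AE s in N. op_of_hs (f s) h \<bullet> k = adj_op (A s) h \<bullet> adj_op (A s) k"
        using f(2) by eventually_elim (simp add: inner_adj_op)
    qed
    finally show ?thesis .
  qed
  show "self_adjoint (op_of_hs (\<integral>s. f s \<partial>N))"
    unfolding self_adjoint_def inner_commute[of _ "blinfun_apply (op_of_hs (\<integral>s. f s \<partial>N)) _"] v by (simp add: inner_commute)
  show w: "op_of_hs (\<integral>s. f s \<partial>N) h \<bullet> h = (\<integral>s. (norm (adj_op (A s) h))\<^sup>2 \<partial>N)" for h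
    unfolding v by (simp add: dot_square_norm)
  show "nonneg_definite (op_of_hs (\<integral>s. f s \<partial>N))" unfolding nonneg_definite_def w by simp
qed

text \<open>Continuity is given only from the right at 0. Each \<open>r\<close> is therefore
  approached from the right by grid points \<open>u n r\<close>, where
  \<open>S (u n r) x = S r (S (h n) x)\<close> tends to \<open>S r x\<close>.\<close>

lemma c0_semigroup_measurable:
  fixes S :: "real \<Rightarrow> 'a::{real_normed_vector,second_countable_topology} \<Rightarrow>\<^sub>L 'a"
  assumes S: "c0_semigroup S"
  shows "(\<lambda>r. S r x) \<in> borel_measurable (restrict_space borel {0..})"
proof (rule borel_measurable_LIMSEQ_metric)
  \<comment> \<open>The summand 1 keeps \<open>u n r\<close> strictly above \<open>r\<close>, as
    \<open>at_right 0\<close> demands.\<close>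
  define u where "u n r = (real_of_int \<lfloor>real (Suc n) * r\<rfloor> + 1) / real (Suc n)" for n :: nat and r :: real
  show "(\<lambda>r. S (u n r) x) \<in> borel_measurable (restrict_space borel {0..})" for n
  proof -
    have "(\<lambda>r. \<lfloor>real (Suc n) * r\<rfloor>) \<in> restrict_space borel {0..} \<rightarrow>\<^sub>M count_space UNIV"
      by (rule measurable_restrict_space1) (rule measurable_compose[OF _ measurable_real_floor], simp)
    from measurable_compose[OF this, of "\<lambda>k. S ((real_of_int k + 1) / real (Suc n)) x" borel] show ?thesis
      by (simp add: u_def)
  qed
  fix r :: real assume "r \<in> space (restrict_space borel {0..})"
  then have r: "0 \<le> r" by (simp add: space_restrict_space)
  define h where "h n = u n r - r" for n
  have h: "0 < h n" "h n \<le> inverse (real (Suc n))" for n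
  proof -
    let ?m = "real (Suc n)"
    have m: "0 < ?m" by simp
    have "?m * r < real_of_int \<lfloor>?m * r\<rfloor> + 1" "real_of_int \<lfloor>?m * r\<rfloor> \<le> ?m * r" by linarith+
    then show "0 < h n" "h n \<le> inverse ?m" using m by (simp_all add: h_def u_def field_simps del: of_nat_Suc)
  qed
  have "h \<longlonglongrightarrow> 0"
    using h by (intro tendsto_sandwich[OF _ _ tendsto_const LIMSEQ_inverse_real_of_nat]) (auto intro!: always_eventually less_imp_le)
  then have "filterlim h (at_right 0) sequentially"
    unfolding filterlim_at using h(1) by (auto intro!: always_eventually simp: less_imp_neq[symmetric])
  moreover have "((\<lambda>t. S t x) \<longlongrightarrow> x) (at_right 0)" using S by (simp add: c0_semigroup_def)
  ultimately have "(\<lambda>n. S (h n) x) \<longlonglongrightarrow> x" by (rule filterlim_compose[rotated])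
  then have "(\<lambda>n. S r (S (h n) x)) \<longlonglongrightarrow> S r x" by (rule bounded_linear.tendsto[OF blinfun.bounded_linear_right])
  moreover have "S r (S (h n) x) = S (u n r) x" for n
  proof -
    have "S (r + h n) = S r o\<^sub>L S (h n)" using S r less_imp_le[OF h(1)] unfolding c0_semigroup_def by blast
    then show ?thesis by (simp add: h_def)
  qed
  ultimately show "(\<lambda>n. S (u n r) x) \<longlonglongrightarrow> S r x" by simp
qed

text \<open>\<open>V\<close> is measurable only vector by vector while its argument varies as well,
  so \<open>w s\<close> is expanded in the countable basis.\<close>

lemma measurable_blinfun_family_apply:
  fixes V :: "'s \<Rightarrow> 'a::{real_inner,second_countable_topology} \<Rightarrow>\<^sub>L 'b::{real_normed_vector,second_countable_topology}"
  assumes V: "\<And>x. (\<lambda>s. V s x) \<in> borel_measurable N" and w: "w \<in> borel_measurable N"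
  shows "(\<lambda>s. V s (w s)) \<in> borel_measurable N"
proof (rule measurable_has_sum_basis)
  show "(\<lambda>s. (w s \<bullet> e) *\<^sub>R V s e) \<in> borel_measurable N" for e
    by (rule borel_measurable_scaleR[OF borel_measurable_inner[OF w borel_measurable_const] V])
  show "((\<lambda>e. (w s \<bullet> e) *\<^sub>R V s e) has_sum V s (w s)) hilbert_basis" for s
    using has_sum_bounded_linear[OF blinfun.bounded_linear_right hilbert_basis_expansion, of "V s" "w s"]
    by (simp add: blinfun.scaleR_right)
qed

lemma measurable_sqrt_hs:
  fixes f :: "'s \<Rightarrow> 'a::{real_inner,banach,second_countable_topology} hs_op"
  assumes "f \<in> borel_measurable N" shows "(\<lambda>w. sqrt_op (op_of_hs (f w)) x) \<in> borel_measurable N"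
proof -
  have "op_of_hs \<in> borel_measurable (borel :: 'a hs_op measure)"
    by (intro borel_measurable_continuous_onI linear_continuous_on bounded_linear_op_of_hs)
  from measurable_compose[OF measurable_compose[OF assms this] measurable_sqrt_op]
  have "(\<lambda>w. sqrt_op (op_of_hs (f w))) \<in> borel_measurable N" .
  then show ?thesis
    by (rule measurable_compose) (intro borel_measurable_continuous_onI continuous_intros)
qed

text \<open>\<open>hs_of_op\<close> is meaningful on Hilbert-Schmidt operators only.
  \<open>Q\<close> is one, being its root composed with itself, and bounded factors preserve the
  property.\<close>

lemma op_of_hs_covariance:
  fixes Q :: "'a::{real_inner,banach,second_countable_topology} \<Rightarrow>\<^sub>L 'a"
    and X :: "'a \<Rightarrow>\<^sub>L 'a" and Y :: "'a \<Rightarrow>\<^sub>L 'a"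
  assumes Q: "trace_class_nonneg Q"
  shows "op_of_hs (hs_of_op (X o\<^sub>L Q o\<^sub>L Y)) = X o\<^sub>L Q o\<^sub>L Y"
proof -
  have "hs_norm_sq Q < \<top>"
    using hs_norm_sq_compose_sqrt_finite[OF Q, of "sqrt_op Q"] trace_class_sqrt(2)[OF Q] by simp
  then have "ennreal ((norm Y)\<^sup>2) * (ennreal ((norm X)\<^sup>2) * hs_norm_sq Q) < \<top>"
    by (simp add: ennreal_mult_less_top)
  moreover have "hs_norm_sq (X o\<^sub>L Q o\<^sub>L Y) \<le> ennreal ((norm Y)\<^sup>2) * (ennreal ((norm X)\<^sup>2) * hs_norm_sq Q)"
    by (rule order_trans[OF hs_norm_sq_compose_right]) (intro mult_left_mono hs_norm_sq_compose_left, simp)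
  ultimately have "hilbert_schmidt (X o\<^sub>L Q o\<^sub>L Y)" unfolding hilbert_schmidt_iff by (rule le_less_trans[rotated])
  then show ?thesis by (simp add: hs_of_op_inverse)
qed

lemma measurable_covariance:
  fixes A V :: "'s \<Rightarrow> 'a::{real_inner,banach,second_countable_topology} \<Rightarrow>\<^sub>L 'a"
  assumes Q: "trace_class_nonneg Q" and A: "\<And>x. (\<lambda>s. A s x) \<in> borel_measurable N" and V: "\<And>x. (\<lambda>s. V s x) \<in> borel_measurable N"
  shows "(\<lambda>s. hs_of_op (A s o\<^sub>L V s o\<^sub>L Q o\<^sub>L V s o\<^sub>L adj_op (A s))) \<in> borel_measurable N"
proof (rule measurable_hs_coordinates)
  fix e f :: 'a
  have assoc: "A s o\<^sub>L V s o\<^sub>L Q o\<^sub>L V s o\<^sub>L adj_op (A s) = (A s o\<^sub>L V s) o\<^sub>L Q o\<^sub>L (V s o\<^sub>L adj_op (A s))" for s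
    by (rule blinfun_eqI) simp
  have eq: "op_of_hs (hs_of_op (A s o\<^sub>L V s o\<^sub>L Q o\<^sub>L V s o\<^sub>L adj_op (A s))) e \<bullet> f =
      Q (V s (adj_op (A s) e)) \<bullet> adj_op (A s o\<^sub>L V s) f" for s
    unfolding assoc op_of_hs_covariance[OF Q] by (simp add: inner_adj_op[symmetric])
  show "(\<lambda>s. op_of_hs (hs_of_op (A s o\<^sub>L V s o\<^sub>L Q o\<^sub>L V s o\<^sub>L adj_op (A s))) e \<bullet> f) \<in> borel_measurable N"
    unfolding eq
  proof (rule borel_measurable_inner)
    show "(\<lambda>s. Q (V s (adj_op (A s) e))) \<in> borel_measurable N"
      by (rule measurable_blinfun_apply[OF measurable_blinfun_family_apply[where V = V, OF V measurable_adj_op_apply[OF A]]])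
    have "(\<lambda>s. (A s o\<^sub>L V s) x) \<in> borel_measurable N" for x
      using measurable_blinfun_family_apply[where V = A, OF A V, of x] by simp
    then show "(\<lambda>s. adj_op (A s o\<^sub>L V s) f) \<in> borel_measurable N" by (rule measurable_adj_op_apply)
  qed
qed

theorem lemma3p3:
  fixes M :: "'w measure" and F :: "real \<Rightarrow> 'w measure"
    and L Y :: "real \<Rightarrow> 'w \<Rightarrow> 'h::{real_inner,banach,second_countable_topology} hs_op"
    and C :: "'h hs_op \<Rightarrow>\<^sub>L 'h hs_op" and Y0 :: "'h hs_op"
    and B X :: "real \<Rightarrow> 'w \<Rightarrow> 'h" and X0 :: 'h
    and Q :: "'h \<Rightarrow>\<^sub>L 'h" and S :: "real \<Rightarrow> 'h \<Rightarrow>\<^sub>L 'h"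
    and D :: "'h set" and A :: "'h \<Rightarrow> 'h" and t \<Delta> :: real
  assumes space: "filtered_prob_space M F"
    and C_adjoint: "\<And>T. hs_adjoint (C T) = C (hs_adjoint T)"
    and C_cone: "(\<forall>T\<in>hs_cone. C T \<in> hs_cone) \<or>
      (\<forall>s\<ge>0. \<forall>T\<in>hs_cone. exp_op (s *\<^sub>R C) T \<in> hs_cone)"
    and L: "levy_process M F L" "square_integrable_process M L" "nondecreasing_paths M L"
    and Y0: "self_adjoint (op_of_hs Y0)" "nonneg_definite (op_of_hs Y0)"
    and Y_measurable: "(\<lambda>(s, \<omega>). Y s \<omega>) \<in> borel_measurable (restrict_space borel {0..} \<Otimes>\<^sub>M M)"
    and Y: "\<And>s. s \<ge> 0 \<Longrightarrow> has_levy_integral M F L s (\<lambda>r \<omega>. exp_op ((s - r) *\<^sub>R C))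
      (\<lambda>\<omega>. Y s \<omega> - exp_op (s *\<^sub>R C) Y0)"
    and Q: "trace_class_nonneg Q"
    and B: "wiener_process M F Q B"
    and S: "c0_semigroup S" "densely_defined_operator D A" "generates D A S"
    and X: "\<And>s. s \<ge> 0 \<Longrightarrow> has_ito_integral M F B Q s
      (\<lambda>r \<omega>. S (s - r) o\<^sub>L sqrt_op (op_of_hs (Y r \<omega>))) (\<lambda>\<omega>. X s \<omega> - S s X0)"
    and t: "t \<ge> 0" and \<Delta>: "\<Delta> > 0"
  defines "R \<equiv> \<lambda>\<omega>. X (t + \<Delta>) \<omega> - S \<Delta> (X t \<omega>)"
    and "q \<equiv> \<lambda>s \<omega>. hs_of_op (S (t + \<Delta> - s) o\<^sub>L sqrt_op (op_of_hs (Y s \<omega>)) o\<^sub>L Q o\<^sub>L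
      sqrt_op (op_of_hs (Y s \<omega>)) o\<^sub>L adj_op (S (t + \<Delta> - s)))"
  shows "\<exists>\<kappa>. regular_cond_distr M (path_algebra M Y) R \<kappa> \<and>
    (AE \<omega> in M. gaussian_measure (\<kappa> \<omega>) \<and> has_mean (\<kappa> \<omega>) 0 \<and>
      set_integrable lborel {t..t + \<Delta>} (\<lambda>s. q s \<omega>) \<and>
      has_covariance (\<kappa> \<omega>) (op_of_hs (LINT s:{t..t + \<Delta>}|lborel. q s \<omega>)))"
proof -
  have P: "prob_space M" and filt: "filtration (space M) F" and F: "\<And>t. subalgebra M (F t)"
    using space by (auto simp: filtered_prob_space_def)
  interpret prob_space M by (rule P)
  interpret levy: increasing_levy M F L
    by (intro increasing_levy.intro increasing_levy_axioms.intro P filt F L)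
  interpret wiener: wiener_increasing M F B L
  proof (intro wiener_increasing.intro wiener_increasing_axioms.intro P filt F levy.L_mono levy.L_int)
    show "adapted F B" "indep_increments M F B" "AE \<omega> in M. continuous_on {0..} (\<lambda>t. B t \<omega>)"
      using B by (simp_all add: wiener_process_def)
    show "adapted F L" "indep_increments M F L" using L(1) by (simp_all add: levy_process_def)
  qed
  have S_add: "S (r + s) = S r o\<^sub>L S s" if "0 \<le> r" "0 \<le> s" for r s
    using S(1) that unfolding c0_semigroup_def by blast
  have C_pos: "exp_op (u *\<^sub>R C) Z \<in> pos_cone" if "0 \<le> u" "Z \<in> pos_cone" for u Z
    using exp_op_pos_cone[OF C_adjoint C_cone that] .
  have Y0_pos: "Y0 \<in> pos_cone" using Y0 by (simp add: pos_cone_def)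
  \<comment> \<open>For each fixed time; the exceptional null set may depend on
    \<open>s\<close>.\<close>
  have Y_pos: "AE \<omega> in M. Y s \<omega> \<in> pos_cone" if s: "0 \<le> s" for s
  proof -
    have "AE \<omega> in M. Y s \<omega> - exp_op (s *\<^sub>R C) Y0 \<in> pos_cone"
      by (rule levy.levy_integral_properties(1)[OF s _ Y[OF s]]) (rule C_pos)
    then show ?thesis
    proof eventually_elim
    case (elim \<omega>)
    from pos_cone_add[OF this C_pos[OF s Y0_pos]] show ?case by simp
    qed
  qed
  have Y_L: "\<exists>Y'\<in>borel_measurable (sigma (space M) (\<Union>r\<in>{0..}. {L r -` T \<inter> space M |T. T \<in> sets borel})). AE \<omega> in M. Y s \<omega> = Y' \<omega>"
    if s: "0 \<le> s" for s
  proof -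
    obtain I' where I': "I' \<in> borel_measurable levy.path_sigma" "AE \<omega> in M. Y s \<omega> - exp_op (s *\<^sub>R C) Y0 = I' \<omega>"
      using levy.levy_integral_properties(2)[OF s _ Y[OF s]] C_pos by blast
    show ?thesis
    proof (rule bexI)
      show "AE \<omega> in M. Y s \<omega> = I' \<omega> + exp_op (s *\<^sub>R C) Y0" using I'(2) by eventually_elim (simp add: algebra_simps)
      show "(\<lambda>\<omega>. I' \<omega> + exp_op (s *\<^sub>R C) Y0) \<in> borel_measurable (sigma (space M) (\<Union>r\<in>{0..}. {L r -` T \<inter> space M |T. T \<in> sets borel}))"
        using I'(1) unfolding levy.path_sigma_def by (rule borel_measurable_add[OF _ borel_measurable_const])
    qed
  qed
  have Y_M: "Y s \<in> borel_measurable M" if "0 \<le> s" for s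
    using measurable_compose[OF measurable_Pair1' Y_measurable, of s] that by (simp add: space_restrict_space)
  define G where "G = path_algebra M Y"
  interpret N: gaussian_noise M "enlargement F M G" B Q
    unfolding G_def by (rule wiener_gaussian_noise[OF wiener.wiener_increasing_axioms B Q Y_M Y_L])
  have G: "subalgebra M G"
    using path_algebra_least[of M M Y] Y_M by (simp add: subalgebra_def G_def)
  note enl = enlargement_props[where F = F, OF F G]
  let ?T = "t + \<Delta>"
  define V where "V s \<omega> = sqrt_op (op_of_hs (Y s \<omega>))" for s \<omega>
  \<comment> \<open>The left-open cut-off is the one delivered by
    \<open>ito_integral_difference\<close>; it differs from the closed interval of the claim only at
    the time \<open>t\<close>.\<close>
  define \<Psi> where "\<Psi> s \<omega> = indicator {t<..?T} s *\<^sub>R (S (?T - s) o\<^sub>L V s \<omega>)" for s \<omega>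
  have T: "0 \<le> ?T" "t \<le> ?T" using t \<Delta> by auto
  have ST: "S (?T - r) = S (?T - t) o\<^sub>L S (t - r)" if "0 \<le> r" "r \<le> t" for r
  proof -
    have "?T - r = (?T - t) + (t - r)" by simp
    then have "S (?T - r) = S ((?T - t) + (t - r))" by (rule arg_cong)
    also have "\<dots> = S (?T - t) o\<^sub>L S (t - r)" using that \<Delta> by (intro S_add) auto
    finally show ?thesis .
  qed
  note diff = N.ito_integral_difference[OF F enl(4) t T(2) X[OF T(1), folded V_def] X[OF t, folded V_def] ST, folded \<Psi>_def]
  \<comment> \<open>The initial terms cancel, since
    \<open>S ?T X0 = S \<Delta> (S t X0)\<close>.\<close>
  have R_eq: "X ?T \<omega> - S ?T X0 - S (?T - t) (X t \<omega> - S t X0) = R \<omega>" for \<omega>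
    using S_add[of \<Delta> t] t \<Delta> by (simp add: R_def blinfun.bilinear_simps add.commute)
  obtain zs where zs: "\<And>k. step_process (enlargement F M G) ?T (zs k)"
    "(\<lambda>k. ito_norm M Q ?T (\<lambda>s \<omega>. step_value (zs k) s \<omega> - \<Psi> s \<omega>)) \<longlonglongrightarrow> 0"
    "(\<lambda>k. \<integral>\<^sup>+\<omega>. ennreal ((norm (step_integral B (zs k) \<omega> \<omega> - R \<omega>))\<^sup>2) \<partial>M) \<longlonglongrightarrow> 0"
    using diff(2) unfolding R_eq by blast
  have X_M: "X s \<in> borel_measurable M" if "0 \<le> s" for s
  proof -
    have "(\<lambda>\<omega>. X s \<omega> - S s X0) \<in> borel_measurable M" using X[OF that] unfolding has_ito_integral_def by blast
    from borel_measurable_add[OF this borel_measurable_const[of "S s X0"]] show ?thesis by simp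
  qed
  have R_M: "R \<in> borel_measurable M"
    unfolding R_def using X_M[OF T(1)] measurable_blinfun_apply[OF X_M[OF t]] by (rule borel_measurable_diff)
  have \<Psi>_G: "(\<lambda>\<omega>. \<Psi> s \<omega> x) \<in> borel_measurable G" if "s \<in> {0..?T}" for s x
  proof -
    have "Y s \<in> borel_measurable G" unfolding G_def using that by (intro measurable_path_algebra) simp
    from measurable_blinfun_apply[OF measurable_sqrt_hs[OF this]]
    have "(\<lambda>\<omega>. S (?T - s) (V s \<omega> x)) \<in> borel_measurable G" unfolding V_def .
    then show ?thesis unfolding \<Psi>_def by (simp add: blinfun.bilinear_simps)
  qed
  have ind: "indep_set (sets (wiener.increment_sigma 0)) (sets G)"
    unfolding G_def
    by (rule indep_set_mono[OF wiener.enlargement_indep[OF Y_M Y_L order_refl] subset_refl enl(5)[unfolded G_def]])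
  obtain \<kappa> where \<kappa>: "regular_cond_distr M G R \<kappa>"
    "AE \<omega> in M. (\<integral>\<^sup>+s. hs_norm_sq (\<Psi> s \<omega> o\<^sub>L sqrt_op Q) \<partial>time_space ?T) < \<top> \<and>
      (\<forall>h. distr (\<kappa> \<omega>) borel (\<lambda>x. x \<bullet> h) = centred_normal (\<integral>s. (norm (sqrt_op Q (adj_op (\<Psi> s \<omega>) h)))\<^sup>2 \<partial>time_space ?T))"
    using N.conditional_law[OF G enl(5) wiener.increment_sigma_props(2,3) ind diff(1) \<Psi>_G zs(1,2) R_M zs(3)] by blast
  interpret TS: pair_sigma_finite "time_space ?T" M by (rule N.prob_pair)
  have idT: "(\<lambda>s. s) \<in> time_space ?T \<rightarrow>\<^sub>M restrict_space borel {0..}"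
    unfolding time_space_def
    by (intro measurable_restrict_space2 measurable_restrict_space1) (auto simp: space_restrict_space)
  have Y_TM: "(\<lambda>p. Y (fst p) (snd p)) \<in> borel_measurable (time_space ?T \<Otimes>\<^sub>M M)"
    using measurable_compose[OF measurable_Pair[OF measurable_compose[OF measurable_fst idT] measurable_snd] Y_measurable]
    by (simp add: case_prod_beta)
  \<comment> \<open>Joint measurability of \<open>Y\<close> lets Fubini exchange the null sets:
    almost every path is positive at almost every time, which is enough under the time
    integral.\<close>
  have pos: "AE \<omega> in M. AE s in time_space ?T. Y s \<omega> \<in> pos_cone"
  proof (rule TS.AE_commute[THEN iffD1])
    have "{p \<in> space (time_space ?T \<Otimes>\<^sub>M M). Y (fst p) (snd p) \<in> pos_cone} = (\<lambda>p. Y (fst p) (snd p)) -` pos_cone \<inter> space (time_space ?T \<Otimes>\<^sub>M M)"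
      by auto
    also have "\<dots> \<in> sets (time_space ?T \<Otimes>\<^sub>M M)"
      by (rule measurable_sets[OF Y_TM borel_closed[OF closed_pos_cone]])
    finally show "{p \<in> space (time_space ?T \<Otimes>\<^sub>M M). Y (fst p) (snd p) \<in> pos_cone} \<in> sets (time_space ?T \<Otimes>\<^sub>M M)" .
    show "AE s in time_space ?T. AE \<omega> in M. Y s \<omega> \<in> pos_cone"
      by (rule AE_I2) (simp add: space_time_space Y_pos)
  qed
  have not_t: "AE s in time_space ?T. s \<noteq> t"
    unfolding time_space_def by (subst AE_restrict_space_iff) (auto intro: eventually_mono[OF AE_lborel_singleton[of t]])
  have main: "gaussian_measure (\<kappa> \<omega>) \<and> has_mean (\<kappa> \<omega>) 0 \<and> set_integrable lborel {t..?T} (\<lambda>s. q s \<omega>) \<and>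
      has_covariance (\<kappa> \<omega>) (op_of_hs (LINT s:{t..?T}|lborel. q s \<omega>))"
    if \<omega>: "\<omega> \<in> space M" and fin: "(\<integral>\<^sup>+s. hs_norm_sq (\<Psi> s \<omega> o\<^sub>L sqrt_op Q) \<partial>time_space ?T) < \<top>"
      and law: "\<And>h. distr (\<kappa> \<omega>) borel (\<lambda>x. x \<bullet> h) = centred_normal (\<integral>s. (norm (sqrt_op Q (adj_op (\<Psi> s \<omega>) h)))\<^sup>2 \<partial>time_space ?T)"
      and pos: "AE s in time_space ?T. Y s \<omega> \<in> pos_cone" for \<omega>
  proof -
    define f where "f s = indicat_real {t..?T} s *\<^sub>R q s \<omega>" for s
    define A' where "A' s = \<Psi> s \<omega> o\<^sub>L sqrt_op Q" for s
    have Y_s: "(\<lambda>s. Y s \<omega>) \<in> borel_measurable (time_space ?T)"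
      using measurable_compose[OF measurable_Pair2'[OF \<omega>] Y_TM] by simp
    have V_s: "(\<lambda>s. V s \<omega> x) \<in> borel_measurable (time_space ?T)" for x
      unfolding V_def by (rule measurable_sqrt_hs[OF Y_s])
    have revT: "(\<lambda>s. ?T - s) \<in> time_space ?T \<rightarrow>\<^sub>M restrict_space borel {0..}"
      unfolding time_space_def
      by (intro measurable_restrict_space2 measurable_restrict_space1) (auto simp: space_restrict_space)
    have S_s: "(\<lambda>s. S (?T - s) x) \<in> borel_measurable (time_space ?T)" for x
      by (rule measurable_compose[OF revT c0_semigroup_measurable[OF S(1)]])
    have q_s: "(\<lambda>s. q s \<omega>) \<in> borel_measurable (time_space ?T)"
      using measurable_covariance[OF Q S_s V_s] unfolding q_def V_def .
    have ind_s: "indicat_real {t..?T} \<in> borel_measurable (time_space ?T)"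
      unfolding time_space_def by (rule measurable_restrict_space1) simp
    have f_meas: "f \<in> borel_measurable (time_space ?T)"
      unfolding f_def[abs_def] by (rule borel_measurable_scaleR[OF ind_s q_s])
    \<comment> \<open>Positivity makes the root of \<open>Y\<close> self-adjoint, so the adjoint of
      \<open>A' s\<close> contains the same root and the product is the integrand of the claim.
      Before \<open>t\<close> both sides are 0.\<close>
    have f_cov: "AE s in time_space ?T. op_of_hs (f s) = A' s o\<^sub>L adj_op (A' s)"
      using pos not_t AE_space
    proof eventually_elim
      case (elim s)
      then have s: "s \<le> ?T" by (simp add: space_time_space)
      have sa: "adj_op (V s \<omega>) = V s \<omega>"
        using sqrt_op_props(1)[of "op_of_hs (Y s \<omega>)"] elim(1) by (simp add: V_def pos_cone_def self_adjoint_adj_op)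
      have sq: "sqrt_op Q (sqrt_op Q x) = Q x" for x
        using trace_class_sqrt(2)[OF Q] by (metis blinfun_apply_blinfun_compose)
      show ?case
      proof (cases "t < s")
        case True
        have "f s = hs_of_op ((S (?T - s) o\<^sub>L V s \<omega>) o\<^sub>L Q o\<^sub>L (V s \<omega> o\<^sub>L adj_op (S (?T - s))))"
          using True s by (simp add: f_def q_def V_def) (rule arg_cong[of _ _ hs_of_op], rule blinfun_eqI, simp)
        then have "op_of_hs (f s) = (S (?T - s) o\<^sub>L V s \<omega>) o\<^sub>L Q o\<^sub>L (V s \<omega> o\<^sub>L adj_op (S (?T - s)))"
          by (simp only: op_of_hs_covariance[OF Q])
        moreover have "A' s = (S (?T - s) o\<^sub>L V s \<omega>) o\<^sub>L sqrt_op Q" using True s by (simp add: A'_def \<Psi>_def)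
        ultimately show ?thesis
          by (intro blinfun_eqI) (simp add: adj_op_compose adj_op_sqrt_trace_class[OF Q] sa sq)
      next
        case False
        then have "f s = 0" "A' s = 0" using elim(2) by (auto simp: f_def A'_def \<Psi>_def intro: blinfun_eqI)
        then show ?thesis by (simp add: zero_hs_op.rep_eq)
      qed
    qed
    have A'_meas: "(\<lambda>s. A' s x) \<in> borel_measurable (time_space ?T)" for x
    proof -
      have "(\<lambda>(s, \<omega>). \<Psi> s \<omega> (sqrt_op Q x)) \<in> borel_measurable (time_space ?T \<Otimes>\<^sub>M M)"
        using diff(1) unfolding jointly_measurable_def by blast
      from measurable_compose[OF measurable_Pair2'[OF \<omega>] this] show ?thesis by (simp add: A'_def)
    qed
    note cov = integrated_covariance[OF f_meas f_cov A'_meas fin[folded A'_def]]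
    have ind_eq: "indicat_real {0..?T} s *\<^sub>R f s = indicat_real {t..?T} s *\<^sub>R q s \<omega>" for s
      using t by (auto simp: f_def indicator_def)
    have int: "set_integrable lborel {t..?T} (\<lambda>s. q s \<omega>)"
      using cov(1) unfolding time_space_def set_integrable_def by (subst (asm) integrable_restrict_space) (simp_all add: ind_eq)
    have eq: "(\<integral>s. f s \<partial>time_space ?T) = (LINT s:{t..?T}|lborel. q s \<omega>)"
      unfolding time_space_def set_lebesgue_integral_def by (subst integral_restrict_space) (simp_all add: ind_eq)
    have "\<kappa> \<omega> \<in> space (prob_algebra borel)"
      using \<kappa>(1) \<omega> G unfolding regular_cond_distr_def by (auto simp: subalgebra_def dest: measurable_space)
    then have \<kappa>p: "prob_space (\<kappa> \<omega>)" "sets (\<kappa> \<omega>) = sets borel" by (simp_all add: space_prob_algebra)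
    have adj: "adj_op (A' s) h = sqrt_op Q (adj_op (\<Psi> s \<omega>) h)" for s h
      by (simp add: A'_def adj_op_compose adj_op_sqrt_trace_class[OF Q])
    have "distr (\<kappa> \<omega>) borel (\<lambda>x. x \<bullet> h) = centred_normal (op_of_hs (\<integral>s. f s \<partial>time_space ?T) h \<bullet> h)" for h
      unfolding cov(4) adj by (rule law)
    from gaussian_from_marginals[OF \<kappa>p cov(2,3) this] int show ?thesis unfolding eq by blast
  qed
  have "AE \<omega> in M. gaussian_measure (\<kappa> \<omega>) \<and> has_mean (\<kappa> \<omega>) 0 \<and> set_integrable lborel {t..?T} (\<lambda>s. q s \<omega>) \<and>
      has_covariance (\<kappa> \<omega>) (op_of_hs (LINT s:{t..?T}|lborel. q s \<omega>))"
    using \<kappa>(2) pos AE_space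
  proof eventually_elim
    case (elim \<omega>)
    show ?case
      by (rule main[OF elim(3) conjunct1[OF elim(1)] spec[OF conjunct2[OF elim(1)]] elim(2)])
  qed
  with \<kappa>(1) show ?thesis unfolding G_def by blast
qed

end
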